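(* Let $\Omega$ be a bounded Lipschitz domain in $\mathbb{R}^n$, $n\ge2$, and let $Q>0$ be a constant such that $$Q\,P_\Omega(E)\ \ge\ \min\big(|E|,|\Omega\setminus E|\big)^{1-1/n}\qquad\text{for every measurable } E\subseteq\Omega .$$ Let $u\in H^{1,2}(\Omega)$, $u\ge 0$ in $\Omega$, and suppose that $|\text{support of }u|=|\Omega|-\epsilon$ for some $\epsilon>0$. Then $\tilde u\in H^{1,2}_0(\tilde\Omega)$ and $$\int_{\tilde\Omega}|D\tilde u|^2\,dx\ \le\ L^2\int_\Omega|Du|^2\,dx,\qquad L=\frac{Q\,n\,c_n^{1/n}}{\alpha^{1-1/n}},$$ where $\alpha=\dfrac{\epsilon}{|\Omega|-\epsilon}$ if $\epsilon\le \dfrac{|\Omega|}{2}$, and $\alpha=1$ otherwise.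
   Context: $|\cdot|$ denotes Lebesgue measure of sets, $c_n$ is the measure of the unit ball of $\mathbb{R}^n$, and $D$ denotes the gradient. $P_\Omega(E)$ is the De Giorgi perimeter of $E$ relative to $\Omega$; a constant $Q$ as in the claim exists for every bounded Lipschitz domain. The support of a Sobolev function is understood in the usual a.e. sense. For a real measurable function $u$ on $\Omega$: the distribution function is $\mu(t)=|\{x\in\Omega:u(x)>t\}|$, $t\in\mathbb{R}$; the decreasing rearrangement is $u^*(s)=\inf\{t\in\mathbb{R}:\mu(t)\le s\}$, $s\in[0,|\Omega|]$; the Schwarz symmetrization is $\tilde u(x)=u^*(c_n|x|^n)$, $x\in\tilde\Omega$, where $\tilde\Omega$ is the (open) ball centred at the origin with the same measure as $\Omega$. $H^{1,2}(\Omega)$ is the usual Sobolev space and $H^{1,2}_0$ the closure of $C_c^\infty$ in it. *)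

theory Defs
  imports "HOL-Analysis.Analysis"
begin

section \<open>Bounded Lipschitz domains\<close>

text \<open>
  Near each boundary point \<open>\<Omega>\<close> is the open epigraph of a Lipschitz function. Instead of
  rotating the coordinate axes, we let \<open>\<nu>\<close> be the direction of the last axis in the new
  coordinates; \<open>x - (x \<bullet> \<nu>) *\<^sub>R \<nu>\<close> are then the remaining \<open>n - 1\<close> coordinates.
\<close>

definition bounded_lipschitz_domain :: "'a::euclidean_space set \<Rightarrow> bool" where
  "bounded_lipschitz_domain \<Omega> \<longleftrightarrow>
     \<Omega> \<noteq> {} \<and> open \<Omega> \<and> connected \<Omega> \<and> bounded \<Omega> \<and>
     (\<forall>p\<in>frontier \<Omega>. \<exists>r>0. \<exists>\<nu> C \<gamma>. norm \<nu> = 1 \<and> C-lipschitz_on {y. y \<bullet> \<nu> = 0} \<gamma> \<and>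
        \<Omega> \<inter> ball p r = {x \<in> ball p r. x \<bullet> \<nu> > \<gamma> (x - (x \<bullet> \<nu>) *\<^sub>R \<nu>)})"


section \<open>Test functions\<close>

primrec Ck_fun :: "nat \<Rightarrow> ('a::euclidean_space \<Rightarrow> 'b::real_normed_vector) \<Rightarrow> bool" where
  "Ck_fun 0 f \<longleftrightarrow> continuous_on UNIV f"
| "Ck_fun (Suc k) f \<longleftrightarrow> f differentiable_on UNIV \<and>
     (\<forall>i\<in>Basis. Ck_fun k (\<lambda>x. frechet_derivative f (at x) i))"

definition compactly_supported_in ::
    "'a::euclidean_space set \<Rightarrow> ('a \<Rightarrow> 'b::real_normed_vector) \<Rightarrow> bool" where
  "compactly_supported_in \<Omega> f \<longleftrightarrow> compact (closure {x. f x \<noteq> 0}) \<and> closure {x. f x \<noteq> 0} \<subseteq> \<Omega>"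

text \<open>\<open>C\<^sub>c\<^sup>\<infinity>(\<Omega>)\<close>; its elements are identified with their extensions by zero.\<close>

definition test_function :: "'a::euclidean_space set \<Rightarrow> ('a \<Rightarrow> real) \<Rightarrow> bool" where
  "test_function \<Omega> \<phi> \<longleftrightarrow> (\<forall>k. Ck_fun k \<phi>) \<and> compactly_supported_in \<Omega> \<phi>"


section \<open>De Giorgi perimeter\<close>

definition divergence :: "('a::euclidean_space \<Rightarrow> 'a) \<Rightarrow> 'a \<Rightarrow> real" where
  "divergence \<phi> x = (\<Sum>i\<in>Basis. frechet_derivative \<phi> (at x) i \<bullet> i)"

definition perimeter :: "'a::euclidean_space set \<Rightarrow> 'a set \<Rightarrow> ereal" where
  "perimeter \<Omega> E =
     (SUP \<phi> \<in> {\<phi>. Ck_fun 1 \<phi> \<and> compactly_supported_in \<Omega> \<phi> \<and> (\<forall>x. norm (\<phi> x) \<le> 1)}.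
        ereal (integral\<^sup>L (lebesgue_on E) (divergence \<phi>)))"


section \<open>Sobolev spaces\<close>

definition locally_integrable_on ::
    "('a::euclidean_space \<Rightarrow> 'b::euclidean_space) \<Rightarrow> 'a set \<Rightarrow> bool" where
  "locally_integrable_on f \<Omega> \<longleftrightarrow> (\<forall>K. compact K \<and> K \<subseteq> \<Omega> \<longrightarrow> set_integrable lebesgue K f)"

definition has_weak_gradient ::
    "'a::euclidean_space set \<Rightarrow> ('a \<Rightarrow> real) \<Rightarrow> ('a \<Rightarrow> 'a) \<Rightarrow> bool" where
  "has_weak_gradient \<Omega> u g \<longleftrightarrow> locally_integrable_on u \<Omega> \<and> locally_integrable_on g \<Omega> \<and>
     (\<forall>\<phi>. test_function \<Omega> \<phi> \<longrightarrow> (\<forall>i\<in>Basis.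
        integral\<^sup>L (lebesgue_on \<Omega>) (\<lambda>x. u x * frechet_derivative \<phi> (at x) i) =
        - integral\<^sup>L (lebesgue_on \<Omega>) (\<lambda>x. (g x \<bullet> i) * \<phi> x)))"

text \<open>The weak gradient is unique up to null sets, so the choice does not affect integrals.\<close>

definition weak_gradient :: "'a::euclidean_space set \<Rightarrow> ('a \<Rightarrow> real) \<Rightarrow> 'a \<Rightarrow> 'a" where
  "weak_gradient \<Omega> u = (SOME g. has_weak_gradient \<Omega> u g)"

definition L2_on :: "'a::euclidean_space set \<Rightarrow> ('a \<Rightarrow> 'b::euclidean_space) set" where
  "L2_on \<Omega> = {f. f \<in> borel_measurable (lebesgue_on \<Omega>) \<and>
                 integrable (lebesgue_on \<Omega>) (\<lambda>x. (norm (f x))\<^sup>2)}"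

definition H12 :: "'a::euclidean_space set \<Rightarrow> ('a \<Rightarrow> real) set" where
  "H12 \<Omega> = {u. u \<in> L2_on \<Omega> \<and> (\<exists>g. g \<in> L2_on \<Omega> \<and> has_weak_gradient \<Omega> u g)}"

definition dirichlet_integral :: "'a::euclidean_space set \<Rightarrow> ('a \<Rightarrow> real) \<Rightarrow> real" where
  "dirichlet_integral \<Omega> u = integral\<^sup>L (lebesgue_on \<Omega>) (\<lambda>x. (norm (weak_gradient \<Omega> u x))\<^sup>2)"

definition H12_norm :: "'a::euclidean_space set \<Rightarrow> ('a \<Rightarrow> real) \<Rightarrow> real" where
  "H12_norm \<Omega> u = sqrt (integral\<^sup>L (lebesgue_on \<Omega>) (\<lambda>x. (u x)\<^sup>2) + dirichlet_integral \<Omega> u)"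

definition H12_0 :: "'a::euclidean_space set \<Rightarrow> ('a \<Rightarrow> real) set" where
  "H12_0 \<Omega> = {u \<in> H12 \<Omega>. \<forall>e>0. \<exists>\<phi>. test_function \<Omega> \<phi> \<and> H12_norm \<Omega> (\<lambda>x. u x - \<phi> x) < e}"

text \<open>
  The support of a function defined only up to null sets: the complement in \<open>\<Omega>\<close> of the largest
  open subset of \<open>\<Omega>\<close> on which the function vanishes almost everywhere.
\<close>

definition ae_support :: "'a::euclidean_space set \<Rightarrow> ('a \<Rightarrow> real) \<Rightarrow> 'a set" where
  "ae_support \<Omega> u = \<Omega> - \<Union>{U. open U \<and> U \<subseteq> \<Omega> \<and> (AE x in lebesgue_on U. u x = 0)}"


section \<open>Rearrangements\<close>

definition distribution_function :: "'a::euclidean_space set \<Rightarrow> ('a \<Rightarrow> real) \<Rightarrow> real \<Rightarrow> real" where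
  "distribution_function \<Omega> u t = measure lebesgue {x \<in> \<Omega>. u x > t}"

text \<open>
  The infimum is taken in the extended reals, as it is \<open>\<infinity>\<close> at \<open>s = 0\<close> for \<open>u\<close> essentially
  unbounded above, and \<open>-\<infinity>\<close> at \<open>s = |\<Omega>|\<close>.
\<close>

definition decreasing_rearrangement ::
    "'a::euclidean_space set \<Rightarrow> ('a \<Rightarrow> real) \<Rightarrow> real \<Rightarrow> ereal" where
  "decreasing_rearrangement \<Omega> u s = Inf {ereal t | t. distribution_function \<Omega> u t \<le> s}"

definition symmetrized_domain :: "'a::euclidean_space set \<Rightarrow> 'a set" where
  "symmetrized_domain \<Omega> =
     ball 0 ((measure lebesgue \<Omega> / unit_ball_vol DIM('a)) powr (1 / DIM('a)))"

lemma measure_symmetrized_domain: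
  "measure lebesgue (symmetrized_domain (\<Omega> :: 'a::euclidean_space set)) = measure lebesgue \<Omega>"
proof -
  let ?n = "DIM('a)" and ?c = "unit_ball_vol (real DIM('a))"
  have n: "?n > 0" and c: "?c > 0" by (auto intro: unit_ball_vol_pos)
  let ?r = "(measure lebesgue \<Omega> / ?c) powr (1 / ?n)"
  have q: "measure lebesgue \<Omega> / ?c \<ge> 0" using c by simp
  have "?r ^ ?n = measure lebesgue \<Omega> / ?c"
  proof (cases "measure lebesgue \<Omega> / ?c = 0")
    case False
    with q show ?thesis using n by (simp add: powr_realpow[symmetric] powr_powr)
  qed (use n in auto)
  moreover have "measure lborel (ball (0::'a) ?r) = ?c * ?r ^ ?n"
    by (rule content_ball) simp
  ultimately show ?thesis
    using c by (simp add: symmetrized_domain_def)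
qed

text \<open>
  For \<open>x\<close> in the symmetrized domain the value of the rearrangement is finite, except possibly at
  the single point \<open>x = 0\<close>, where \<open>real_of_ereal\<close> replaces \<open>\<infinity>\<close> by \<open>0\<close>.
\<close>

definition schwarz_symmetrization ::
    "'a::euclidean_space set \<Rightarrow> ('a \<Rightarrow> real) \<Rightarrow> 'a \<Rightarrow> real" where
  "schwarz_symmetrization \<Omega> u x =
     real_of_ereal (decreasing_rearrangement \<Omega> u (unit_ball_vol DIM('a) * norm x ^ DIM('a)))"

end

theory Submission
  imports Defs
begin

text \<open>
  The argument is the one of Polya and Szego with the isoperimetric inequality of the whole space
  replaced by the relative one. For \<open>t \<ge> 0\<close> the set \<open>{u > t}\<close> has measure \<open>\<mu>(t) \<le> |\<Omega>| - \<epsilon>\<close>, hence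
  the smaller of \<open>|{u > t}|\<close> and \<open>|\<Omega> - {u > t}|\<close> is at least \<open>\<alpha> \<mu>(t)\<close>, and the hypothesis on \<open>Q\<close>
  becomes \<open>P(u > t) \<ge> c \<mu>(t) powr (1 - 1/n)\<close> with \<open>c = \<alpha> powr (1 - 1/n) / Q\<close>. The constant \<open>L\<close> is
  the quotient of the isoperimetric constant \<open>n c\<^sub>n powr (1/n)\<close> of the whole space and \<open>c\<close>.

  \<^emph>\<open>Coarea.\<close> Testing the weak gradient of \<open>F(u)\<close> with vector fields, where \<open>F\<close> increases from \<open>0\<close> to
  about \<open>h\<close> on the interval \<open>[t, t + h]\<close>, shows that the integral of \<open>|Du|\<close> over \<open>{t < u \<le> t + h}\<close>
  is at least \<open>h\<close> times any number below the perimeter of \<open>{u > t}\<close>, for small \<open>h\<close>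
  (\<open>slab_ge_perimeter\<close>). A comparison of Dini derivatives adds these local estimates up
  (\<open>dini_comparison\<close>), and the result is \<open>\<integral> \<theta>(t) c \<mu>(t) powr (1 - 1/n) dt \<le> \<integral> \<theta>(u) |Du| dx\<close> for all
  Borel functions \<open>\<theta> \<ge> 0\<close> (\<open>coarea_inequality\<close>). This half of the coarea formula is enough, and it
  spares the theory of functions of bounded variation.

  \<^emph>\<open>Duality.\<close> Let \<open>\<rho>(t)\<close> be the radius of the ball of measure \<open>\<mu>(t)\<close>. Apart from countably many
  levels, \<open>\<rho>(u(x))\<close> is distributed at most like \<open>|x|\<close> on a ball \<open>B\<close> of measure \<open>|\<Omega>| - \<epsilon>\<close>
  (\<open>radial_law\<close>). The coarea inequality for \<open>\<theta> \<circ> \<rho>\<close> and the Cauchy-Schwarz inequality therefore give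
  \<open>(\<integral> \<theta>(\<rho>(t)) c \<mu>(t) powr (1 - 1/n) dt)\<^sup>2 \<le> \<integral>\<^sub>B \<theta>(|x|)\<^sup>2 dx \<cdot> \<integral> |Du|\<^sup>2 dx\<close>. This is a bound for a
  linear functional on a weighted \<open>L\<^sup>2\<close> space of functions of the radius, so the image under \<open>\<rho>\<close> of
  the measure \<open>c \<mu>(t) powr (1 - 1/n) dt\<close> has a density with square integral at most \<open>\<integral> |Du|\<^sup>2 dx\<close>
  (\<open>density_of_square_bound\<close>). As \<open>c \<mu>(t) powr (1 - 1/n)\<close> is a multiple of \<open>\<rho>(t)\<close> to the power
  \<open>n - 1\<close>, this says in polar coordinates that \<open>|{t > 0. \<rho>(t) > s}|\<close> is the integral of a function
  \<open>e\<close> over \<open>(s, \<infinity>)\<close>, where \<open>\<integral> e(|x|)\<^sup>2 dx \<le> L\<^sup>2 \<integral> |Du|\<^sup>2 dx\<close> (\<open>profile_exists\<close>). But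
  \<open>|{t > 0. \<rho>(t) > s}|\<close> is the value of the Schwarz symmetrization at distance \<open>s\<close> from the origin
  (\<open>rearrangement_value\<close>). In this way the absolute continuity of the decreasing rearrangement,
  usually the delicate point, comes from the Radon-Nikodym theorem.

  \<^emph>\<open>Zero boundary values.\<close> The function \<open>e\<close> vanishes outside an interval \<open>(0, R\<^sub>0]\<close> with \<open>R\<^sub>0\<close>
  smaller than the radius of the symmetrized domain, because \<open>\<epsilon> > 0\<close>. Cutting \<open>e\<close> off near \<open>0\<close> and
  mollifying it yields smooth functions of the radius whose integrals are test functions converging
  to the symmetrization (\<open>radial_function_in_H12_0\<close>).

  Throughout, \<open>u\<close> and its gradient are represented by Borel functions on the whole space that vanish
  outside \<open>\<Omega>\<close>.
\<close>

section \<open>Smooth functions\<close>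

lemma Ck_fun_SucI:
  fixes f :: "'a::euclidean_space \<Rightarrow> 'b::real_normed_vector"
  assumes "\<And>x. (f has_derivative D x) (at x)"
    and "\<And>i. i \<in> Basis \<Longrightarrow> Ck_fun k (\<lambda>x. D x i)"
  shows "Ck_fun (Suc k) f"
proof -
  have "frechet_derivative f (at x) = D x" for x
    using frechet_derivative_at[OF assms(1)[of x]] by simp
  then show ?thesis
    using assms by (auto simp: differentiable_on_def differentiable_def)
qed

lemma Ck_fun_SucD:
  assumes "Ck_fun (Suc k) f"
  shows "(f has_derivative frechet_derivative f (at x)) (at x)"
    and "i \<in> Basis \<Longrightarrow> Ck_fun k (\<lambda>x. frechet_derivative f (at x) i)"
  using assms by (auto simp: differentiable_on_def frechet_derivative_works)

lemma Ck_fun_continuous: "Ck_fun k f \<Longrightarrow> continuous_on UNIV f"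
  by (cases k) (auto intro: differentiable_imp_continuous_on)

lemma Ck_fun_Suc_imp: "Ck_fun (Suc k) f \<Longrightarrow> Ck_fun k f"
proof (induction k arbitrary: f)
  case 0
  then show ?case by (auto intro: differentiable_imp_continuous_on)
next
  case (Suc k)
  then show ?case by (metis Ck_fun.simps(2))
qed

lemma Ck_fun_const: "Ck_fun k (\<lambda>x. c)"
proof (induction k arbitrary: c)
  case (Suc k)
  show ?case
    by (rule Ck_fun_SucI[where D="\<lambda>x i. 0"]) (auto intro: Suc)
qed auto

lemma Ck_fun_add:
  "Ck_fun k f \<Longrightarrow> Ck_fun k g \<Longrightarrow> Ck_fun k (\<lambda>x. f x + g x)"
proof (induction k arbitrary: f g)
  case (Suc k)
  show ?case
    by (rule Ck_fun_SucI[OF has_derivative_add[OF Ck_fun_SucD(1)[OF Suc.prems(1)] Ck_fun_SucD(1)[OF Suc.prems(2)]]])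
       (intro Suc.IH Ck_fun_SucD(2) Suc.prems)
qed (auto intro: continuous_intros)

lemma Ck_fun_mult:
  fixes f g :: "'a::euclidean_space \<Rightarrow> real"
  shows "Ck_fun k f \<Longrightarrow> Ck_fun k g \<Longrightarrow> Ck_fun k (\<lambda>x. f x * g x)"
proof (induction k arbitrary: f g)
  case (Suc k)
  show ?case
    by (rule Ck_fun_SucI[OF has_derivative_mult[OF Ck_fun_SucD(1)[OF Suc.prems(1)] Ck_fun_SucD(1)[OF Suc.prems(2)]]])
       (intro Ck_fun_add Suc.IH Ck_fun_SucD(2) Suc.prems Ck_fun_Suc_imp[OF Suc.prems(1)] Ck_fun_Suc_imp[OF Suc.prems(2)])
qed (auto intro: continuous_intros)

lemma Ck_fun_prod:
  fixes f :: "'b \<Rightarrow> 'a::euclidean_space \<Rightarrow> real"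
  assumes "\<And>i. i \<in> I \<Longrightarrow> Ck_fun k (f i)"
  shows "Ck_fun k (\<lambda>x. \<Prod>i\<in>I. f i x)"
  using assms by (induction I rule: infinite_finite_induct) (auto intro: Ck_fun_mult Ck_fun_const)

lemma Ck_fun_inner_left: "Ck_fun k (\<lambda>x::'a::euclidean_space. x \<bullet> v)"
proof (cases k)
  case (Suc j)
  show ?thesis
    unfolding Suc by (rule Ck_fun_SucI[where D="\<lambda>x i. i \<bullet> v"]) (auto intro!: derivative_eq_intros Ck_fun_const)
qed (auto intro: continuous_intros)

lemma Ck_fun_comp_scaleR:
  fixes f :: "'a::euclidean_space \<Rightarrow> 'b::real_normed_vector"
  assumes "Ck_fun k f"
  shows "Ck_fun k (\<lambda>x. f (c *\<^sub>R x + d))"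
  using assms
proof (induction k arbitrary: f)
  case 0
  then show ?case
    by (auto intro!: continuous_on_compose2[of UNIV f] continuous_intros)
next
  case (Suc k)
  let ?D = "\<lambda>x i. c *\<^sub>R frechet_derivative f (at (c *\<^sub>R x + d)) i"
  show ?case
  proof (rule Ck_fun_SucI[where D = ?D])
    fix x
    have "((\<lambda>x. f (c *\<^sub>R x + d)) has_derivative
        (\<lambda>i. frechet_derivative f (at (c *\<^sub>R x + d)) (c *\<^sub>R i))) (at x)"
      by (rule has_derivative_compose[OF _ Ck_fun_SucD(1)[OF Suc.prems], where f="\<lambda>x. c *\<^sub>R x + d"])
         (auto intro!: derivative_eq_intros)
    then show "((\<lambda>x. f (c *\<^sub>R x + d)) has_derivative ?D x) (at x)"
      using linear_frechet_derivative[of f "at (c *\<^sub>R x + d)"] Suc.prems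
      by (simp add: linear_scale differentiable_on_def)
  next
    fix i :: 'a assume i: "i \<in> Basis"
    have "Ck_fun k (\<lambda>x. frechet_derivative f (at (c *\<^sub>R x + d)) i)"
      using Suc.IH[OF Ck_fun_SucD(2)[OF Suc.prems i]] .
    moreover have "Ck_fun k f \<Longrightarrow> Ck_fun k (\<lambda>x. c *\<^sub>R f x)" for f :: "'a \<Rightarrow> 'b"
    proof (induction k arbitrary: f)
      case (Suc k)
      show ?case
        by (rule Ck_fun_SucI[OF has_derivative_scaleR_right[OF Ck_fun_SucD(1)[OF Suc.prems]]])
           (intro Suc.IH Ck_fun_SucD(2) Suc.prems)
    qed (auto intro: continuous_intros)
    ultimately show "Ck_fun k (\<lambda>x. ?D x i)" by blast
  qed
qed

lemma Ck_fun_real_SucI: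
  fixes f :: "real \<Rightarrow> real"
  assumes "\<And>x. (f has_real_derivative f' x) (at x)" and "Ck_fun k f'"
  shows "Ck_fun (Suc k) f"
  by (rule Ck_fun_SucI[where D="\<lambda>x t. f' x * t"])
     (use assms in \<open>auto simp: has_field_derivative_def\<close>)

lemma Ck_fun_real_SucD:
  fixes f :: "real \<Rightarrow> real"
  assumes "Ck_fun (Suc k) f"
  shows "(f has_real_derivative deriv f x) (at x)" "Ck_fun k (deriv f)"
proof -
  have *: "frechet_derivative f (at x) = (\<lambda>t. deriv f x * t)" for x
  proof -
    have "f differentiable at x" using assms by (simp add: differentiable_on_def)
    then obtain D where D: "(f has_real_derivative D) (at x)" using real_differentiable_def by blast
    show ?thesis
      using frechet_derivative_at[of f "\<lambda>t. D * t" x] D DERIV_imp_deriv[OF D]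
      by (simp add: has_field_derivative_def)
  qed
  show "(f has_real_derivative deriv f x) (at x)"
    using Ck_fun_SucD(1)[OF assms, of x] unfolding * has_field_derivative_def .
  show "Ck_fun k (deriv f)"
    using Ck_fun_SucD(2)[OF assms, of 1] unfolding * by simp
qed

lemma Ck_fun_comp_inner:
  fixes f :: "real \<Rightarrow> real"
  assumes "Ck_fun k f"
  shows "Ck_fun k (\<lambda>x::'a::euclidean_space. f (x \<bullet> v))"
  using assms
proof (induction k arbitrary: f)
  case 0
  then show ?case by (auto intro!: continuous_on_compose2[of UNIV f] continuous_intros)
next
  case (Suc k)
  show ?case
  proof (rule Ck_fun_SucI[where D="\<lambda>x i. deriv f (x \<bullet> v) * (i \<bullet> v)"])
    show "((\<lambda>x. f (x \<bullet> v)) has_derivative (\<lambda>i. deriv f (x \<bullet> v) * (i \<bullet> v))) (at x)" for x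
      by (rule has_derivative_compose[OF _ Ck_fun_real_SucD(1)[OF Suc.prems, unfolded has_field_derivative_def],
          of "\<lambda>x. x \<bullet> v" "\<lambda>x. x \<bullet> v" x UNIV])
        (auto intro!: derivative_eq_intros)
    show "Ck_fun k (\<lambda>x. deriv f (x \<bullet> v) * (i \<bullet> v))" for i
      by (intro Ck_fun_mult Suc.IH Ck_fun_real_SucD(2) Suc.prems Ck_fun_const)
  qed
qed

text \<open>
  The factor \<open>inverse t ^ j\<close> makes the family closed under differentiation, up to linear
  combinations, so that smoothness of all members follows by one induction.
\<close>

definition flat_exp :: "nat \<Rightarrow> real \<Rightarrow> real" where
  "flat_exp j t = (if t > 0 then exp (- inverse t) * inverse t ^ j else 0)"

text \<open>
  Exponential decay beats every power: substitute \<open>1 / t\<close> for the variable of \<open>x ^ j / exp x\<close>.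
\<close>

lemma flat_exp_tendsto: "(flat_exp j \<longlongrightarrow> 0) (at_right 0)"
proof -
  have "((\<lambda>x::real. x ^ j / exp x) \<longlongrightarrow> 0) at_top"
    by (rule tendsto_power_div_exp_0)
  then have "((\<lambda>t::real. inverse t ^ j / exp (inverse t)) \<longlongrightarrow> 0) (at_right 0)"
    by (rule filterlim_compose[OF _ filterlim_inverse_at_top_right])
  moreover have "\<forall>\<^sub>F t in at_right 0. inverse t ^ j / exp (inverse t) = flat_exp j t"
    by (auto simp: eventually_at_right_field flat_exp_def exp_minus field_simps intro!: exI[of _ 1])
  ultimately show ?thesis by (rule Lim_transform_eventually)
qed

lemma flat_exp_deriv:
  "(flat_exp j has_real_derivative (flat_exp (j + 2) t - real j * flat_exp (j + 1) t)) (at t)"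
proof (cases "t = 0")
  case False
  show ?thesis
  proof (cases "t > 0")
    case True
    have d1: "((\<lambda>t. exp (- inverse t)) has_real_derivative exp (- inverse t) * inverse t ^ 2) (at t)"
      using True by (auto intro!: derivative_eq_intros simp: power2_eq_square)
    have d2: "((\<lambda>t. inverse t ^ j) has_real_derivative - real j * inverse t ^ (j + 1)) (at t)"
      using DERIV_power[OF DERIV_inverse[of t UNIV], of j] True by (cases j) (simp_all add: algebra_simps)
    have "((\<lambda>t. exp (- inverse t) * inverse t ^ j) has_real_derivative
        exp (- inverse t) * inverse t ^ (j + 2) - real j * (exp (- inverse t) * inverse t ^ (j + 1))) (at t)"
      by (rule DERIV_cong[OF DERIV_mult[OF d1 d2]]) (simp add: algebra_simps power2_eq_square)
    then have *: "((\<lambda>t. exp (- inverse t) * inverse t ^ j) has_real_derivative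
        flat_exp (j + 2) t - real j * flat_exp (j + 1) t) (at t)"
      using True by (simp add: flat_exp_def)
    show ?thesis
      by (rule has_field_derivative_transform_within_open[OF *, of "{0<..}"])
         (use True in \<open>auto simp: flat_exp_def\<close>)
  next
    case f: False
    then have "t < 0" using False by simp
    have *: "((\<lambda>t. 0) has_real_derivative
        flat_exp (j + 2) t - real j * flat_exp (j + 1) t) (at t)"
      using f by (simp add: flat_exp_def)
    show ?thesis
      by (rule has_field_derivative_transform_within_open[OF *, of "{..<0}"])
         (use \<open>t < 0\<close> in \<open>auto simp: flat_exp_def\<close>)
  qed
next
  case [simp]: True
  have r: "((\<lambda>h. (flat_exp j (0 + h) - flat_exp j 0) / h) \<longlongrightarrow> 0) (at_right 0)"
    by (rule Lim_transform_eventually[OF flat_exp_tendsto[of "Suc j"]])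
       (auto simp: flat_exp_def eventually_at_right_field divide_inverse mult_ac intro!: exI[of _ 1])
  have l: "((\<lambda>h. (flat_exp j (0 + h) - flat_exp j 0) / h) \<longlongrightarrow> 0) (at_left 0)"
    by (rule Lim_transform_eventually[OF tendsto_const])
       (auto simp: flat_exp_def eventually_at_left_field intro!: exI[of _ "-1"])
  have "((\<lambda>h. (flat_exp j (0 + h) - flat_exp j 0) / h) \<longlongrightarrow> 0) (at 0)"
    using l r filterlim_split_at by blast
  then have "(flat_exp j has_real_derivative 0) (at 0)"
    unfolding has_field_derivative_iff by simp
  then show ?thesis by (simp add: flat_exp_def)
qed

lemma Ck_fun_flat_exp: "Ck_fun k (flat_exp j)"
proof (induction k arbitrary: j)
  case 0
  show ?case
    using flat_exp_deriv by (auto intro!: DERIV_continuous continuous_at_imp_continuous_on)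
next
  case (Suc k)
  have "Ck_fun k (\<lambda>t. flat_exp (j + 2) t + (- real j) * flat_exp (j + 1) t)"
    by (intro Ck_fun_add Ck_fun_mult Ck_fun_const Suc)
  then show ?case
    by (intro Ck_fun_real_SucI[OF flat_exp_deriv]) (simp add: algebra_simps)
qed

text \<open>
  These functions serve as kernels for mollification and, with \<open>k \<rightarrow> \<infinity>\<close>, as test functions that
  approximate the indicator of a box.
\<close>

definition box_bump :: "'a::euclidean_space \<Rightarrow> 'a \<Rightarrow> nat \<Rightarrow> 'a \<Rightarrow> real" where
  "box_bump a b k x =
     (\<Prod>i\<in>Basis. flat_exp 0 (real k * (x \<bullet> i - a \<bullet> i)) * flat_exp 0 (real k * (b \<bullet> i - x \<bullet> i)))"

lemma flat_exp_0: "0 \<le> flat_exp 0 t" "flat_exp 0 t \<le> 1" "flat_exp 0 t > 0 \<longleftrightarrow> t > 0" "flat_exp 0 t = 0 \<longleftrightarrow> t \<le> 0"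
  by (auto simp: flat_exp_def)

lemma Ck_fun_box_bump: "Ck_fun m (box_bump a b k)"
proof -
  have *: "Ck_fun m (\<lambda>x. flat_exp 0 (c * (x \<bullet> v) + d))" for c d and v :: 'a
    using Ck_fun_comp_inner[OF Ck_fun_comp_scaleR[OF Ck_fun_flat_exp, of m 0 c d]] by simp
  have "Ck_fun m (\<lambda>x. \<Prod>i\<in>Basis. flat_exp 0 (real k * (x \<bullet> i) + (- real k * (a \<bullet> i))) * 
      flat_exp 0 ((- real k) * (x \<bullet> i) + real k * (b \<bullet> i)))"
    by (intro Ck_fun_prod Ck_fun_mult *)
  then show ?thesis by (simp add: box_bump_def[abs_def] algebra_simps)
qed

lemma box_bump_nonneg: "box_bump a b k x \<ge> 0"
  by (auto simp: box_bump_def intro!: prod_nonneg mult_nonneg_nonneg flat_exp_0)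

lemma box_bump_le_1: "box_bump a b k x \<le> 1"
  unfolding box_bump_def by (intro prod_le_1 conjI mult_nonneg_nonneg mult_le_one flat_exp_0)

lemma box_bump_zero:
  assumes "x \<notin> box a b"
  shows "box_bump a b k x = 0"
proof -
  from assms obtain i where i: "i \<in> Basis" "x \<bullet> i \<le> a \<bullet> i \<or> b \<bullet> i \<le> x \<bullet> i"
    by (auto simp: mem_box not_less)
  then have "flat_exp 0 (real k * (x \<bullet> i - a \<bullet> i)) * flat_exp 0 (real k * (b \<bullet> i - x \<bullet> i)) = 0"
    unfolding mult_eq_0_iff flat_exp_0(4) by (auto simp: mult_le_0_iff)
  then show ?thesis
    unfolding box_bump_def using i(1) by (intro prod_zero) auto
qed

lemma box_bump_pos:
  assumes "x \<in> box a b" "k > 0"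
  shows "box_bump a b k x > 0"
  unfolding box_bump_def
  by (intro prod_pos ballI mult_pos_pos) (use assms in \<open>simp_all add: flat_exp_0(3) mem_box\<close>)

lemma box_bump_tendsto:
  "(\<lambda>k. box_bump a b k x) \<longlonglongrightarrow> indicator (box a b) x"
proof (cases "x \<in> box a b")
  case False
  then show ?thesis by (simp add: box_bump_zero)
next
  case True
  have 1: "(\<lambda>k. flat_exp 0 (real k * t)) \<longlonglongrightarrow> 1" if "t > 0" for t
  proof -
    have "(\<lambda>k. exp (- (inverse (real k) * inverse t))) \<longlonglongrightarrow> exp (- (0 * inverse t))"
      by (intro tendsto_intros lim_inverse_n)
    moreover have "\<forall>\<^sub>F k in sequentially. exp (- (inverse (real k) * inverse t)) = flat_exp 0 (real k * t)"
      using eventually_gt_at_top[of 0] by eventually_elim (use that in \<open>auto simp: flat_exp_def field_simps\<close>)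
    ultimately show ?thesis by (simp add: tendsto_cong)
  qed
  have "(\<lambda>k. box_bump a b k x) \<longlonglongrightarrow> (\<Prod>i\<in>(Basis::'a set). 1 * 1)"
    unfolding box_bump_def
    by (intro tendsto_prod tendsto_mult 1) (use True in \<open>auto simp: mem_box\<close>)
  then show ?thesis using True by simp
qed

lemma compactly_supported_in_I:
  assumes "{x. f x \<noteq> 0} \<subseteq> K" "compact K" "K \<subseteq> \<Omega>"
  shows "compactly_supported_in \<Omega> f"
proof -
  have "closure {x. f x \<noteq> 0} \<subseteq> K"
    using assms by (intro closure_minimal compact_imp_closed)
  moreover have "compact (closure {x. f x \<noteq> 0})"
    using assms(1,2) by (metis bounded_subset compact_closure compact_imp_bounded)
  ultimately show ?thesis using assms by (auto simp: compactly_supported_in_def)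
qed

lemma test_function_box_bump:
  assumes "cbox a b \<subseteq> \<Omega>"
  shows "test_function \<Omega> (box_bump a b k)"
  unfolding test_function_def
proof (intro conjI allI Ck_fun_box_bump)
  have "{x. box_bump a b k x \<noteq> 0} \<subseteq> cbox a b"
    using box_bump_zero box_subset_cbox by blast
  then show "compactly_supported_in \<Omega> (box_bump a b k)"
    by (rule compactly_supported_in_I) (use assms in auto)
qed

section \<open>Square integrable functions\<close>

definition sqint :: "'b measure \<Rightarrow> ('b \<Rightarrow> real) \<Rightarrow> bool" where
  "sqint M f \<longleftrightarrow> f \<in> borel_measurable M \<and> integrable M (\<lambda>x. (f x)\<^sup>2)"

lemma sqintD: "sqint M f \<Longrightarrow> f \<in> borel_measurable M" "sqint M f \<Longrightarrow> integrable M (\<lambda>x. (f x)\<^sup>2)"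
  by (auto simp: sqint_def)

lemma sqint_mult_integrable:
  assumes "sqint M f" "sqint M g"
  shows "integrable M (\<lambda>x. f x * g x)"
proof (rule Bochner_Integration.integrable_bound)
  show "integrable M (\<lambda>x. (f x)\<^sup>2 + (g x)\<^sup>2)"
    using assms by (auto simp: sqint_def)
  have "\<bar>a * b\<bar> \<le> a\<^sup>2 + b\<^sup>2" for a b :: real
  proof -
    have "2 * (\<bar>a\<bar> * \<bar>b\<bar>) \<le> a\<^sup>2 + b\<^sup>2" "0 \<le> \<bar>a\<bar> * \<bar>b\<bar>"
      using sum_squares_bound[of "\<bar>a\<bar>" "\<bar>b\<bar>"] by simp_all
    then show ?thesis unfolding abs_mult by linarith
  qed
  then show "AE x in M. norm (f x * g x) \<le> norm ((f x)\<^sup>2 + (g x)\<^sup>2)"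
    by simp
qed (use assms in \<open>auto simp: sqint_def\<close>)

lemma sqint_add:
  assumes "sqint M f" "sqint M g"
  shows "sqint M (\<lambda>x. f x + g x)"
proof -
  have "integrable M (\<lambda>x. (f x)\<^sup>2 + (g x)\<^sup>2 + 2 * (f x * g x))"
    using sqintD(2)[OF assms(1)] sqintD(2)[OF assms(2)] sqint_mult_integrable[OF assms] by simp
  then show ?thesis
    using assms by (auto simp: sqint_def power2_sum mult.assoc)
qed

lemma sqint_cmult: "sqint M f \<Longrightarrow> sqint M (\<lambda>x. c * f x)"
  by (auto simp: sqint_def power_mult_distrib)

lemma sqint_minus: "sqint M f \<Longrightarrow> sqint M (\<lambda>x. - f x)"
  by (auto simp: sqint_def)

lemma sqint_diff: "sqint M f \<Longrightarrow> sqint M g \<Longrightarrow> sqint M (\<lambda>x. f x - g x)"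
  using sqint_add[OF _ sqint_minus, of M f g] by simp

lemma sqint_abs: "sqint M f \<Longrightarrow> sqint M (\<lambda>x. \<bar>f x\<bar>)"
  by (auto simp: sqint_def)

lemma sqint_le:
  assumes "sqint M f" "g \<in> borel_measurable M" "\<And>x. \<bar>g x\<bar> \<le> \<bar>f x\<bar>"
  shows "sqint M g" "(\<integral>x. (g x)\<^sup>2 \<partial>M) \<le> (\<integral>x. (f x)\<^sup>2 \<partial>M)"
proof -
  have le: "(g x)\<^sup>2 \<le> (f x)\<^sup>2" for x using assms(3) abs_le_square_iff by blast
  show 1: "sqint M g"
    unfolding sqint_def
  proof (intro conjI)
    show "integrable M (\<lambda>x. (g x)\<^sup>2)"
      by (rule Bochner_Integration.integrable_bound[OF sqintD(2)[OF assms(1)]]) (use assms le in auto)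
  qed fact
  show "(\<integral>x. (g x)\<^sup>2 \<partial>M) \<le> (\<integral>x. (f x)\<^sup>2 \<partial>M)"
    by (intro integral_mono sqintD(2) 1 assms le)
qed

lemma Cauchy_Schwarz_integral:
  assumes f: "sqint M f" and g: "sqint M g"
  shows "\<bar>\<integral>x. f x * g x \<partial>M\<bar> \<le> sqrt (\<integral>x. (f x)\<^sup>2 \<partial>M) * sqrt (\<integral>x. (g x)\<^sup>2 \<partial>M)"
proof -
  define A B C where "A = (\<integral>x. (f x)\<^sup>2 \<partial>M)" and "B = (\<integral>x. (g x)\<^sup>2 \<partial>M)" and "C = (\<integral>x. f x * g x \<partial>M)"
  \<comment> \<open>The discriminant of this quadratic polynomial in \<open>s\<close> is not positive.\<close>
  have q: "0 \<le> A - 2 * s * C + s\<^sup>2 * B" for s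
  proof -
    have "0 \<le> (\<integral>x. (f x - s * g x)\<^sup>2 \<partial>M)" by simp
    also have "\<dots> = (\<integral>x. (f x)\<^sup>2 - 2 * s * (f x * g x) + s\<^sup>2 * (g x)\<^sup>2 \<partial>M)"
      by (simp add: power2_diff power_mult_distrib algebra_simps)
    also have "\<dots> = A - 2 * s * C + s\<^sup>2 * B"
      unfolding A_def B_def C_def
      using sqintD(2)[OF f] sqintD(2)[OF g] sqint_mult_integrable[OF f g] by simp
    finally show ?thesis .
  qed
  have A: "A \<ge> 0" and B: "B \<ge> 0" by (auto simp: A_def B_def)
  have "C\<^sup>2 \<le> A * B"
  proof (cases "B = 0")
    case True
    have "C = 0"
    proof (rule ccontr)
      assume "C \<noteq> 0"
      with q[of "(A + 1) / (2 * C)"] True show False by (simp add: field_simps)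
    qed
    then show ?thesis using A B by simp
  next
    case False
    then have "B > 0" using B by simp
    with q[of "C / B"] show ?thesis by (simp add: field_simps power2_eq_square)
  qed
  then have "sqrt (C\<^sup>2) \<le> sqrt (A * B)" by (rule real_sqrt_le_mono)
  then show ?thesis by (simp add: real_sqrt_mult A_def B_def C_def)
qed

lemma compactly_supported_inD:
  assumes "compactly_supported_in \<Omega> f"
  obtains K where "compact K" "K \<subseteq> \<Omega>" "\<And>x. x \<notin> K \<Longrightarrow> f x = 0"
  using assms closure_subset[of "{x. f x \<noteq> 0}"] unfolding compactly_supported_in_def by blast

lemma continuous_compact_support_bounded:
  fixes f :: "'a::euclidean_space \<Rightarrow> 'b::real_normed_vector"
  assumes "continuous_on UNIV f" "compact K" "\<And>x. x \<notin> K \<Longrightarrow> f x = 0"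
  obtains B where "B > 0" "\<And>x. norm (f x) \<le> B"
proof -
  have "bounded (f ` K)"
    using assms by (intro compact_imp_bounded compact_continuous_image continuous_on_subset[OF assms(1)]) auto
  then obtain B where B: "B > 0" "\<And>x. x \<in> K \<Longrightarrow> norm (f x) \<le> B" by (auto simp: bounded_pos)
  show ?thesis
  proof (rule that[OF B(1)])
    show "norm (f x) \<le> B" for x using B assms(3)[of x] by (cases "x \<in> K") auto
  qed
qed

lemma frechet_derivative_zero_outside:
  fixes f :: "'a::euclidean_space \<Rightarrow> 'b::real_normed_vector"
  assumes "compact K" "\<And>x. x \<notin> K \<Longrightarrow> f x = 0" "x \<notin> K"
  shows "frechet_derivative f (at x) i = 0"
proof -
  have "(f has_derivative (\<lambda>_. 0)) (at x)"
    by (rule has_derivative_transform_within_open[OF has_derivative_const, of "- K"])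
       (use assms in \<open>auto simp: compact_imp_closed open_Compl\<close>)
  then show ?thesis using frechet_derivative_at by metis
qed

text \<open>This makes the integrals in the definition of a weak gradient genuine.\<close>

lemma integrable_lebesgue_on_mult:
  fixes f \<phi> :: "'a::euclidean_space \<Rightarrow> real"
  assumes f: "locally_integrable_on f \<Omega>" and \<Omega>: "\<Omega> \<in> sets lebesgue"
    and \<phi>: "continuous_on UNIV \<phi>" and K: "compact K" "K \<subseteq> \<Omega>" "\<And>x. x \<notin> K \<Longrightarrow> \<phi> x = 0"
  shows "integrable (lebesgue_on \<Omega>) (\<lambda>x. f x * \<phi> x)"
proof -
  obtain B where B: "B > 0" "\<And>x. norm (\<phi> x) \<le> B"
    using continuous_compact_support_bounded[OF \<phi> K(1,3)] by blast
  have i: "integrable lebesgue (\<lambda>x. indicator K x * f x)"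
    using f K unfolding locally_integrable_on_def set_integrable_def by simp
  have m: "\<phi> \<in> borel_measurable lebesgue"
    using borel_measurable_continuous_onI[OF \<phi>] by (simp add: measurable_completion)
  have "integrable lebesgue (\<lambda>x. (indicator K x * f x) * \<phi> x)"
  proof (rule Bochner_Integration.integrable_bound[OF integrable_mult_right[OF i, of B]])
    show "(\<lambda>x. (indicator K x * f x) * \<phi> x) \<in> borel_measurable lebesgue"
      using borel_measurable_integrable[OF i] m by simp
    show "AE x in lebesgue. norm (indicator K x * f x * \<phi> x) \<le> norm (B * (indicator K x * f x))"
    proof (rule AE_I2)
      fix x
      have "\<bar>\<phi> x\<bar> * \<bar>indicator K x * f x\<bar> \<le> B * \<bar>indicator K x * f x\<bar>"
        using B(2)[of x] by (intro mult_right_mono) auto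
      then show "norm (indicator K x * f x * \<phi> x) \<le> norm (B * (indicator K x * f x))"
        using B(1) by (simp add: abs_mult mult.commute)
    qed
  qed
  also have "(\<lambda>x. (indicator K x * f x) * \<phi> x) = (\<lambda>x. indicator \<Omega> x *\<^sub>R (f x * \<phi> x))"
    using K(2,3) by (force simp: indicator_def)
  finally show ?thesis
    using \<Omega> by (subst integrable_restrict_space) auto
qed

section \<open>Uniqueness of weak gradients\<close>

lemma enn2real_inj: "enn2real a = enn2real b \<Longrightarrow> a \<noteq> \<infinity> \<Longrightarrow> b \<noteq> \<infinity> \<Longrightarrow> a = b"
  by (cases a rule: ennreal_cases; cases b rule: ennreal_cases) auto

text \<open>
  The positive and the negative part of \<open>F\<close> are densities of two measures that agree on boxes, hence
  everywhere.
\<close>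

lemma AE_zero_if_box_integrals_zero:
  fixes F :: "'a::euclidean_space \<Rightarrow> real"
  assumes F: "integrable lborel F"
    and box0: "\<And>c d. (\<integral>x. indicator (box c d) x * F x \<partial>lborel) = 0"
  shows "AE x in lborel. F x = 0"
proof -
  have [measurable]: "F \<in> borel_measurable borel" using F by auto
  let ?p = "\<lambda>x. ennreal (F x)" and ?m = "\<lambda>x. ennreal (- F x)"
  have fin: "(\<integral>\<^sup>+x. ennreal (F x) \<partial>lborel) < \<infinity>" "(\<integral>\<^sup>+x. ennreal (- F x) \<partial>lborel) < \<infinity>"
    using F by (auto simp: real_integrable_def less_top)
  have "density lborel ?p = density lborel ?m"
  proof (rule measure_eqI_generator_eq[where A="\<lambda>n. box (- (real n *\<^sub>R One)) (real n *\<^sub>R One)" and E="range (\<lambda>(a, b). box a b)" and \<Omega>=UNIV])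
    show "Int_stable (range (\<lambda>(a, b). box a b :: 'a set))"
      by (auto simp: Int_stable_def box_Int_box)
    show "sets (density lborel ?p) = sigma_sets UNIV (range (\<lambda>(a, b). box a b))"
      "sets (density lborel ?m) = sigma_sets UNIV (range (\<lambda>(a, b). box a b))"
      by (simp_all add: borel_eq_box)
    show "(\<Union>n. box (- (real n *\<^sub>R One)) (real n *\<^sub>R One)) = (UNIV :: 'a set)"
      by (rule UN_box_eq_UNIV)
    show "emeasure (density lborel ?p) (box (- (real n *\<^sub>R One)) (real n *\<^sub>R One)) \<noteq> \<infinity>" for n
    proof -
      have "emeasure (density lborel ?p) (box (- (real n *\<^sub>R One)) (real n *\<^sub>R One)) \<le> (\<integral>\<^sup>+x. ?p x \<partial>lborel)"
        by (subst emeasure_density) (auto intro!: nn_integral_mono simp: indicator_def)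
      then show ?thesis using fin by (auto simp: top_unique)
    qed
    fix X :: "'a set" assume "X \<in> range (\<lambda>(a, b). box a b)"
    then obtain c d where X: "X = box c d" by auto
    have "integrable lborel (\<lambda>x. indicator X x * F x)"
      using integrable_mult_indicator[OF _ F, of X] X by simp
    from real_lebesgue_integral_def[OF this] box0[of c d] this
    have "enn2real (\<integral>\<^sup>+x. ennreal (indicator X x * F x) \<partial>lborel) =
        enn2real (\<integral>\<^sup>+x. ennreal (- (indicator X x * F x)) \<partial>lborel)"
      "(\<integral>\<^sup>+x. ennreal (indicator X x * F x) \<partial>lborel) \<noteq> \<infinity>" "(\<integral>\<^sup>+x. ennreal (- (indicator X x * F x)) \<partial>lborel) \<noteq> \<infinity>"
      using X by (auto simp: real_integrable_def)
    then have "(\<integral>\<^sup>+x. ennreal (indicator X x * F x) \<partial>lborel) = (\<integral>\<^sup>+x. ennreal (- (indicator X x * F x)) \<partial>lborel)"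
      by (rule enn2real_inj)
    moreover have "ennreal (indicator X x * F x) = ?p x * indicator X x"
        "ennreal (- (indicator X x * F x)) = ?m x * indicator X x" for x
      by (auto simp: indicator_def)
    ultimately show "emeasure (density lborel ?p) X = emeasure (density lborel ?m) X"
      using X by (simp add: emeasure_density)
  qed auto
  then have "AE x in lborel. ?p x = ?m x"
    by (subst (asm) sigma_finite_measure.density_unique_iff[OF sigma_finite_lborel]) auto
  then show ?thesis
  proof eventually_elim
    case (elim x)
    show ?case
    proof (cases "F x \<ge> 0")
      case True
      then have "ennreal (F x) = 0" using elim by (simp add: ennreal_neg)
      then show ?thesis using True by (simp add: ennreal_eq_0_iff)
    next
      case False
      then have "ennreal (- F x) = 0" using elim by (simp add: ennreal_neg)
      then show ?thesis using False by (simp add: ennreal_eq_0_iff)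
    qed
  qed
qed

lemma locally_integrable_on_inner:
  assumes "locally_integrable_on g \<Omega>"
  shows "locally_integrable_on (\<lambda>x. g x \<bullet> i) \<Omega>"
  unfolding locally_integrable_on_def set_integrable_def
proof (intro allI impI)
  fix K assume "compact K \<and> K \<subseteq> \<Omega>"
  then have "integrable lebesgue (\<lambda>x. (indicator K x *\<^sub>R g x) \<bullet> i)"
    using assms unfolding locally_integrable_on_def set_integrable_def by (intro integrable_inner_left) auto
  then show "integrable lebesgue (\<lambda>x. indicator K x *\<^sub>R (g x \<bullet> i))"
    by simp
qed

lemma locally_integrable_on_diff:
  "locally_integrable_on f \<Omega> \<Longrightarrow> locally_integrable_on g \<Omega> \<Longrightarrow> locally_integrable_on (\<lambda>x. f x - g x) \<Omega>"
  unfolding locally_integrable_on_def by (auto intro: set_integral_diff)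

text \<open>
  Bump functions tend boundedly to the indicator of a box, so the integral of \<open>f\<close> over every box
  inside \<open>cbox a b\<close> vanishes.
\<close>

lemma fundamental_lemma_cbox:
  fixes f :: "'a::euclidean_space \<Rightarrow> real"
  assumes \<Omega>: "open \<Omega>" and f: "locally_integrable_on f \<Omega>"
    and zero: "\<And>\<phi>. test_function \<Omega> \<phi> \<Longrightarrow> (\<integral>x. f x * \<phi> x \<partial>(lebesgue_on \<Omega>)) = 0"
    and ab: "cbox a b \<subseteq> \<Omega>"
  shows "AE x in lebesgue. x \<in> cbox a b \<longrightarrow> f x = 0"
proof -
  let ?f = "\<lambda>x. indicator (cbox a b) x * f x"
  have i: "integrable lebesgue ?f"
    using f ab unfolding locally_integrable_on_def set_integrable_def by simp
  then obtain F where F[measurable]: "F \<in> borel_measurable lborel" and AE: "AE x in lebesgue. ?f x = F x"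
    using completion_ex_borel_measurable_real[of ?f lborel] by (auto dest: AE_completion)
  have "integrable lebesgue F"
    using i AE by (subst integrable_cong_AE[where g="?f"]) (auto simp: measurable_completion)
  then have iF: "integrable lborel F" by (simp add: integrable_completion)
  have ib: "(indicator (box c d) :: 'a \<Rightarrow> real) \<in> borel_measurable lebesgue" for c d :: 'a
    by (intro borel_measurable_indicator) auto
  have box0: "(\<integral>x. indicator (box c d) x * F x \<partial>lborel) = 0" if cd: "cbox c d \<subseteq> cbox a b" for c d
  proof -
    have "(\<lambda>k. \<integral>x. ?f x * box_bump c d k x \<partial>lebesgue) \<longlonglongrightarrow> (\<integral>x. ?f x * indicator (box c d) x \<partial>lebesgue)"
    proof (rule integral_dominated_convergence[where w="\<lambda>x. norm (?f x)"])
      have bm: "box_bump c d k \<in> borel_measurable lebesgue" for k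
        using borel_measurable_continuous_onI[OF Ck_fun_continuous[OF Ck_fun_box_bump[of 0 c d k]]]
            by (simp add: measurable_completion)
      show "(\<lambda>x. ?f x * box_bump c d k x) \<in> borel_measurable lebesgue" for k
        using borel_measurable_integrable[OF i] bm by simp
      show "(\<lambda>x. ?f x * indicator (box c d) x) \<in> borel_measurable lebesgue"
        by (intro borel_measurable_times borel_measurable_integrable[OF i] ib)
      show "AE x in lebesgue. (\<lambda>k. ?f x * box_bump c d k x) \<longlonglongrightarrow> ?f x * indicator (box c d) x"
        by (intro AE_I2 tendsto_intros box_bump_tendsto)
      show "AE x in lebesgue. norm (?f x * box_bump c d k x) \<le> norm (?f x)" for k
      proof (intro AE_I2)
        fix x
        have "\<bar>?f x\<bar> * box_bump c d k x \<le> \<bar>?f x\<bar> * 1"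
          by (intro mult_left_mono box_bump_le_1) auto
        then show "norm (?f x * box_bump c d k x) \<le> norm (?f x)"
          by (simp only: real_norm_def abs_mult[of "?f x"] abs_of_nonneg[OF box_bump_nonneg] mult_1_right)
      qed
    qed (use i in simp)
    moreover have "(\<integral>x. ?f x * box_bump c d k x \<partial>lebesgue) = 0" for k
    proof -
      have "(\<integral>x. f x * box_bump c d k x \<partial>(lebesgue_on \<Omega>)) = 0"
        by (intro zero test_function_box_bump) (use cd ab in auto)
      then have "(\<integral>x. indicator \<Omega> x *\<^sub>R (f x * box_bump c d k x) \<partial>lebesgue) = 0"
        using \<Omega> by (subst (asm) integral_restrict_space) auto
      moreover have "indicator \<Omega> x *\<^sub>R (f x * box_bump c d k x) = ?f x * box_bump c d k x" for x
      proof (cases "x \<in> box c d")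
        case True
        then have "x \<in> cbox a b" using cd box_subset_cbox by blast
        then show ?thesis using ab by (auto simp: indicator_def)
      qed (simp add: box_bump_zero)
      ultimately show ?thesis by (simp only:)
    qed
    ultimately have "(\<lambda>k::nat. 0) \<longlonglongrightarrow> (\<integral>x. ?f x * indicator (box c d) x \<partial>lebesgue)"
      by simp
    then have "(\<integral>x. ?f x * indicator (box c d) x \<partial>lebesgue) = 0"
      using LIMSEQ_const_iff by metis
    moreover have "(\<integral>x. ?f x * indicator (box c d) x \<partial>lebesgue) = (\<integral>x. indicator (box c d) x * F x \<partial>lebesgue)"
    proof (rule integral_cong_AE)
      show "(\<lambda>x. ?f x * indicator (box c d) x) \<in> borel_measurable lebesgue"
        by (intro borel_measurable_times borel_measurable_integrable[OF i] ib)
      show "(\<lambda>x. indicator (box c d) x * F x) \<in> borel_measurable lebesgue"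
        by (intro borel_measurable_times ib measurable_completion[OF F])
      show "AE x in lebesgue. ?f x * indicator (box c d) x = indicator (box c d) x * F x"
        using AE by eventually_elim simp
    qed
    ultimately show ?thesis
      by (simp add: integral_completion)
  qed
  let ?F = "\<lambda>x. indicator (box a b) x * F x"
  have "AE x in lborel. ?F x = 0"
  proof (rule AE_zero_if_box_integrals_zero)
    show "integrable lborel ?F" using integrable_mult_indicator[OF _ iF, of "box a b"] by simp
    fix c d :: 'a
    obtain c' d' where cd: "box c d \<inter> box a b = box c' d'" using box_Int_box by blast
    have "(\<integral>x. indicator (box c' d') x * F x \<partial>lborel) = 0"
    proof (cases "box c' d' = {}")
      case False
      have "box c' d' \<subseteq> cbox a b" using cd box_subset_cbox[of a b] by blast
      from closure_minimal[OF this closed_cbox] False have "cbox c' d' \<subseteq> cbox a b"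
        by (simp add: closure_box)
      then show ?thesis by (rule box0)
    qed simp
    then show "(\<integral>x. indicator (box c d) x * ?F x \<partial>lborel) = 0"
      unfolding cd[symmetric] indicator_inter_arith mult.assoc .
  qed
  then have 1: "AE x in lebesgue. ?F x = 0" by (rule AE_completion)
  have 2: "AE x in lebesgue. x \<notin> cbox a b - box a b"
    by (rule AE_not_in) (use negligible_frontier_interval[of a b] in \<open>simp add: negligible_iff_null_sets\<close>)
  show ?thesis using AE 1 2 by eventually_elim (auto simp: indicator_def split: if_splits)
qed

text \<open>An open set is a countable union of closed boxes.\<close>

lemma fundamental_lemma:
  fixes f :: "'a::euclidean_space \<Rightarrow> real"
  assumes \<Omega>: "open \<Omega>" and f: "locally_integrable_on f \<Omega>"
    and zero: "\<And>\<phi>. test_function \<Omega> \<phi> \<Longrightarrow> (\<integral>x. f x * \<phi> x \<partial>(lebesgue_on \<Omega>)) = 0"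
  shows "AE x in lebesgue_on \<Omega>. f x = 0"
proof -
  obtain D where D: "countable D" "D \<subseteq> Pow \<Omega>" "\<And>X. X \<in> D \<Longrightarrow> \<exists>a b. X = cbox a b" "\<Union>D = \<Omega>"
    using open_countable_Union_open_cbox[OF \<Omega>] by metis
  have "AE x in lebesgue. \<forall>X\<in>D. x \<in> X \<longrightarrow> f x = 0"
  proof (subst AE_ball_countable[OF D(1)], intro ballI)
    fix X assume "X \<in> D"
    then obtain a b where "X = cbox a b" "cbox a b \<subseteq> \<Omega>" using D(2,3) by blast
    then show "AE x in lebesgue. x \<in> X \<longrightarrow> f x = 0"
      using fundamental_lemma_cbox[OF assms] by simp
  qed
  then have "AE x in lebesgue. x \<in> \<Omega> \<longrightarrow> f x = 0"
    by eventually_elim (use D(4) in blast)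
  then show ?thesis using \<Omega> by (subst AE_restrict_space_iff) auto
qed

lemma test_functionD:
  assumes "test_function \<Omega> \<phi>"
  obtains K B where "compact K" "K \<subseteq> \<Omega>" "\<And>x. x \<notin> K \<Longrightarrow> \<phi> x = 0"
    "\<And>x i. i \<in> Basis \<Longrightarrow> x \<notin> K \<Longrightarrow> frechet_derivative \<phi> (at x) i = 0"
    "B > 0" "\<And>x. \<bar>\<phi> x\<bar> \<le> B" "\<And>x i. i \<in> Basis \<Longrightarrow> \<bar>frechet_derivative \<phi> (at x) i\<bar> \<le> B"
proof -
  have C: "Ck_fun 1 \<phi>" using assms by (auto simp: test_function_def simp del: Ck_fun.simps)
  obtain K where K: "compact K" "K \<subseteq> \<Omega>" "\<And>x. x \<notin> K \<Longrightarrow> \<phi> x = 0"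
    using assms compactly_supported_inD unfolding test_function_def by metis
  have K': "frechet_derivative \<phi> (at x) i = 0" if "x \<notin> K" for x i
    by (rule frechet_derivative_zero_outside[OF K(1,3) that])
  obtain B where B: "B > 0" "\<And>x. norm (\<phi> x) \<le> B"
    using continuous_compact_support_bounded[OF Ck_fun_continuous[OF C] K(1,3)] by blast
  have "\<exists>b>0. \<forall>x. norm (frechet_derivative \<phi> (at x) i) \<le> b" if "i \<in> Basis" for i
  proof -
    have "continuous_on UNIV (\<lambda>x. frechet_derivative \<phi> (at x) i)" using C that by simp
    from continuous_compact_support_bounded[OF this K(1) K'] show ?thesis by blast
  qed
  then obtain b where b: "\<And>i. i \<in> Basis \<Longrightarrow> b i > 0 \<and> (\<forall>x. norm (frechet_derivative \<phi> (at x) i) \<le> b i)"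
    by metis
  have le: "b i \<le> (\<Sum>i\<in>Basis. b i)" if "i \<in> Basis" for i
    using that b by (intro member_le_sum) (auto intro: less_imp_le)
  have pos: "0 \<le> (\<Sum>i\<in>Basis. b i)" using b by (intro sum_nonneg) (auto intro: less_imp_le)
  show ?thesis
  proof (rule that[OF K K'])
    show "0 < B + (\<Sum>i\<in>Basis. b i)" using B pos by simp
    show "\<bar>\<phi> x\<bar> \<le> B + (\<Sum>i\<in>Basis. b i)" for x using B(2)[of x] pos by simp
    show "\<bar>frechet_derivative \<phi> (at x) i\<bar> \<le> B + (\<Sum>i\<in>Basis. b i)" if "i \<in> Basis" for x i
    proof -
      have "\<bar>frechet_derivative \<phi> (at x) i\<bar> \<le> b i" using b[OF that] by simp
      then show ?thesis using le[OF that] B(1) by linarith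
    qed
  qed
qed

lemma has_weak_gradient_unique:
  fixes \<Omega> :: "'a::euclidean_space set"
  assumes \<Omega>: "open \<Omega>" and g: "has_weak_gradient \<Omega> u g" and h: "has_weak_gradient \<Omega> u h"
  shows "AE x in lebesgue_on \<Omega>. g x = h x"
proof -
  have li: "locally_integrable_on g \<Omega>" "locally_integrable_on h \<Omega>"
    using g h by (auto simp: has_weak_gradient_def)
  have "AE x in lebesgue_on \<Omega>. g x \<bullet> i - h x \<bullet> i = 0" if i: "i \<in> Basis" for i
  proof (rule fundamental_lemma[OF \<Omega>])
    show "locally_integrable_on (\<lambda>x. g x \<bullet> i - h x \<bullet> i) \<Omega>"
      by (intro locally_integrable_on_diff locally_integrable_on_inner li)
    fix \<phi> assume t: "test_function \<Omega> \<phi>"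
    then obtain K where K: "compact K" "K \<subseteq> \<Omega>" "\<And>x. x \<notin> K \<Longrightarrow> \<phi> x = 0"
      using compactly_supported_inD unfolding test_function_def by metis
    have c: "continuous_on UNIV \<phi>" using t Ck_fun_continuous unfolding test_function_def by blast
    have ig: "integrable (lebesgue_on \<Omega>) (\<lambda>x. (g x \<bullet> i) * \<phi> x)" "integrable (lebesgue_on \<Omega>) (\<lambda>x. (h x \<bullet> i) * \<phi> x)"
      using \<Omega> li by (auto intro!: integrable_lebesgue_on_mult[OF _ _ c K] locally_integrable_on_inner)
    have "(\<integral>x. u x * frechet_derivative \<phi> (at x) i \<partial>lebesgue_on \<Omega>) = - (\<integral>x. (g x \<bullet> i) * \<phi> x \<partial>lebesgue_on \<Omega>)"
      using g t i unfolding has_weak_gradient_def by blast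
    moreover have "(\<integral>x. u x * frechet_derivative \<phi> (at x) i \<partial>lebesgue_on \<Omega>) = - (\<integral>x. (h x \<bullet> i) * \<phi> x \<partial>lebesgue_on \<Omega>)"
      using h t i unfolding has_weak_gradient_def by blast
    ultimately have "(\<integral>x. (g x \<bullet> i) * \<phi> x \<partial>lebesgue_on \<Omega>) = (\<integral>x. (h x \<bullet> i) * \<phi> x \<partial>lebesgue_on \<Omega>)"
      by linarith
    then show "(\<integral>x. (g x \<bullet> i - h x \<bullet> i) * \<phi> x \<partial>lebesgue_on \<Omega>) = 0"
      using ig by (simp add: left_diff_distrib)
  qed
  then have "AE x in lebesgue_on \<Omega>. \<forall>i\<in>Basis. g x \<bullet> i - h x \<bullet> i = 0"
    by (intro AE_finite_allI) auto
  then show ?thesis by eventually_elim (auto intro: euclidean_eqI)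
qed

text \<open>Integrals of the chosen weak gradient can therefore be computed from any weak gradient.\<close>

lemma weak_gradient_AE:
  assumes "open \<Omega>" "has_weak_gradient \<Omega> u g"
  shows "AE x in lebesgue_on \<Omega>. weak_gradient \<Omega> u x = g x"
proof (rule has_weak_gradient_unique[OF assms(1) _ assms(2)])
  show "has_weak_gradient \<Omega> u (weak_gradient \<Omega> u)"
    unfolding weak_gradient_def by (rule someI[of "has_weak_gradient \<Omega> u"]) fact
qed

section \<open>Continuity of translations in the mean square\<close>

lemma lborel_translate:
  fixes f :: "'a::euclidean_space \<Rightarrow> real"
  assumes [measurable]: "f \<in> borel_measurable borel"
  shows "integrable lborel (\<lambda>x. f (x + z)) \<longleftrightarrow> integrable lborel f"
    and "(\<integral>x. f (x + z) \<partial>lborel) = (\<integral>x. f x \<partial>lborel)"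
proof -
  have "distr lborel borel ((+) z) = lborel" by (rule lborel_distr_plus)
  moreover have "integrable (distr lborel borel ((+) z)) f \<longleftrightarrow> integrable lborel (\<lambda>x. f (z + x))"
    by (subst integrable_distr_eq) auto
  moreover have "(\<integral>x. f x \<partial>(distr lborel borel ((+) z))) = (\<integral>x. f (z + x) \<partial>lborel)"
    by (subst integral_distr) auto
  ultimately show "integrable lborel (\<lambda>x. f (x + z)) \<longleftrightarrow> integrable lborel f"
    "(\<integral>x. f (x + z) \<partial>lborel) = (\<integral>x. f x \<partial>lborel)"
    by (simp_all add: add.commute)
qed

lemma sqint_translate:
  fixes f :: "'a::euclidean_space \<Rightarrow> real"
  assumes f: "sqint lborel f"
  shows "sqint lborel (\<lambda>x. f (x - z))" "(\<integral>x. (f (x - z))\<^sup>2 \<partial>lborel) = (\<integral>x. (f x)\<^sup>2 \<partial>lborel)"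
proof -
  have [measurable]: "f \<in> borel_measurable borel" using sqintD(1)[OF f] by simp
  show "sqint lborel (\<lambda>x. f (x - z))" "(\<integral>x. (f (x - z))\<^sup>2 \<partial>lborel) = (\<integral>x. (f x)\<^sup>2 \<partial>lborel)"
    using lborel_translate[of "\<lambda>x. (f x)\<^sup>2" "- z"] sqintD(2)[OF f] by (auto simp: sqint_def)
qed

definition transl_dist :: "('a::euclidean_space \<Rightarrow> real) \<Rightarrow> 'a \<Rightarrow> real" where
  "transl_dist f z = (\<integral>x. (f (x - z) - f x)\<^sup>2 \<partial>lborel)"

lemma square_add_le: "(a + b)\<^sup>2 \<le> 2 * a\<^sup>2 + 2 * (b::real)\<^sup>2"
  using sum_squares_bound[of a b] by (simp add: power2_sum)

lemma integral_square_add_le: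
  assumes "sqint M f" "sqint M g"
  shows "(\<integral>x. (f x + g x)\<^sup>2 \<partial>M) \<le> 2 * (\<integral>x. (f x)\<^sup>2 \<partial>M) + 2 * (\<integral>x. (g x)\<^sup>2 \<partial>M)"
proof -
  have "(\<integral>x. (f x + g x)\<^sup>2 \<partial>M) \<le> (\<integral>x. 2 * (f x)\<^sup>2 + 2 * (g x)\<^sup>2 \<partial>M)"
    using assms sqint_add[OF assms] by (intro integral_mono square_add_le) (auto simp: sqint_def)
  also have "\<dots> = 2 * (\<integral>x. (f x)\<^sup>2 \<partial>M) + 2 * (\<integral>x. (g x)\<^sup>2 \<partial>M)"
    using assms by (simp add: sqint_def)
  finally show ?thesis .
qed

lemma transl_dist_le:
  assumes "sqint lborel f"
  shows "transl_dist f z \<le> 4 * (\<integral>x. (f x)\<^sup>2 \<partial>lborel)"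
  using integral_square_add_le[OF sqint_translate(1)[OF assms] sqint_minus[OF assms], of z] sqint_translate(2)[OF assms, of z]
  by (simp add: transl_dist_def)

lemma transl_dist_add:
  assumes f: "sqint lborel f" and g: "sqint lborel g"
  shows "transl_dist (\<lambda>x. f x + g x) z \<le> 2 * transl_dist f z + 2 * transl_dist g z"
proof -
  have "sqint lborel (\<lambda>x. f (x - z) - f x)" "sqint lborel (\<lambda>x. g (x - z) - g x)"
    using f g by (auto intro: sqint_diff sqint_translate)
  from integral_square_add_le[OF this] show ?thesis
    by (simp add: transl_dist_def algebra_simps)
qed

lemma transl_dist_nonneg: "transl_dist f z \<ge> 0"
  by (simp add: transl_dist_def)

lemma transl_dist_tendsto_add:
  assumes "sqint lborel f" "sqint lborel g" "(transl_dist f \<longlongrightarrow> 0) (at 0)" "(transl_dist g \<longlongrightarrow> 0) (at 0)"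
  shows "(transl_dist (\<lambda>x. f x + g x) \<longlongrightarrow> 0) (at 0)"
proof (rule tendsto_sandwich[of "\<lambda>_. 0" _ _ "\<lambda>z. 2 * transl_dist f z + 2 * transl_dist g z"])
  show "((\<lambda>z. 2 * transl_dist f z + 2 * transl_dist g z) \<longlongrightarrow> 0) (at 0)"
    using tendsto_add[OF tendsto_mult_left[OF assms(3), of 2] tendsto_mult_left[OF assms(4), of 2]] by simp
qed (auto intro!: always_eventually transl_dist_add assms transl_dist_nonneg)

lemma transl_dist_tendsto_cmult:
  assumes "(transl_dist f \<longlongrightarrow> 0) (at 0)"
  shows "(transl_dist (\<lambda>x. c * f x) \<longlongrightarrow> 0) (at 0)"
proof -
  have "transl_dist (\<lambda>x. c * f x) = (\<lambda>z. c\<^sup>2 * transl_dist f z)"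
    by (simp add: transl_dist_def right_diff_distrib[symmetric] power_mult_distrib fun_eq_iff)
  then show ?thesis using tendsto_mult_left[OF assms, of "c\<^sup>2"] by simp
qed

text \<open>
  Translations are isometries of \<open>L\<^sup>2\<close>, so the functions on which they act continuously form a
  closed set. Starting with indicators of open sets, this extends continuity by outer regularity to
  Borel sets and by density of simple functions to all of \<open>L\<^sup>2\<close>.
\<close>

lemma transl_dist_tendsto_approx:
  assumes f: "sqint lborel f"
    and approx: "\<And>e. e > 0 \<Longrightarrow> \<exists>h. sqint lborel h \<and> (transl_dist h \<longlongrightarrow> 0) (at 0) \<and> (\<integral>x. (f x - h x)\<^sup>2 \<partial>lborel) \<le> e"
  shows "(transl_dist f \<longlongrightarrow> 0) (at 0)"
proof (rule tendstoI)
  fix e :: real assume e: "e > 0"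
  then obtain h where h: "sqint lborel h" "(transl_dist h \<longlongrightarrow> 0) (at 0)" "(\<integral>x. (f x - h x)\<^sup>2 \<partial>lborel) \<le> e / 32"
    using approx[of "e / 32"] by auto
  have "\<forall>\<^sub>F z in at 0. dist (transl_dist h z) 0 < e / 8"
    using h(2) e by (intro tendstoD) auto
  then show "\<forall>\<^sub>F z in at 0. dist (transl_dist f z) 0 < e"
  proof eventually_elim
    case (elim z)
    have "transl_dist f z \<le> 2 * transl_dist h z + 2 * transl_dist (\<lambda>x. f x - h x) z"
      using transl_dist_add[OF h(1) sqint_diff[OF f h(1)], of z] by simp
    also have "\<dots> \<le> 2 * transl_dist h z + 2 * (4 * (e / 32))"
      using transl_dist_le[OF sqint_diff[OF f h(1)], of z] h(3) by simp
    also have "\<dots> < e" using elim e by simp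
    finally show ?case by (simp add: transl_dist_nonneg)
  qed
qed

lemma sqint_indicator:
  assumes "A \<in> sets M" "emeasure M A < \<infinity>"
  shows "sqint M (\<lambda>x. c * indicator A x)"
proof -
  have "(c * indicator A x)\<^sup>2 = c\<^sup>2 * (indicator A x :: real)" for x
    by (simp add: indicator_def)
  then show ?thesis using assms by (simp add: sqint_def)
qed

text \<open>
  By translation invariance both parts of the symmetric difference of \<open>U\<close> and its translate have the
  same measure, and a point of the open set \<open>U\<close> stays in \<open>U\<close> under small translations.
\<close>

lemma transl_dist_indicator_open:
  fixes U :: "'a::euclidean_space set"
  assumes U: "open U" and fin: "emeasure lborel U < \<infinity>"
  shows "(transl_dist (indicator U) \<longlongrightarrow> 0) (at 0)"
  unfolding tendsto_at_iff_sequentially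
proof (intro allI impI)
  fix X :: "nat \<Rightarrow> 'a" assume X: "X \<longlonglongrightarrow> 0"
  let ?I = "indicator U :: 'a \<Rightarrow> real"
  have sq: "sqint lborel ?I" using sqint_indicator[of U lborel 1] U fin by simp
  have iI: "integrable lborel ?I" using U fin by simp
  have iT: "integrable lborel (\<lambda>x. ?I (x - z))" "(\<integral>x. ?I (x - z) \<partial>lborel) = (\<integral>x. ?I x \<partial>lborel)" for z
    using lborel_translate[of ?I "- z"] iI U by auto
  have iP: "integrable lborel (\<lambda>x. ?I x * ?I (x - z))" for z
    using sqint_mult_integrable[OF sq sqint_translate(1)[OF sq]] .
  have eq: "transl_dist ?I z = 2 * (\<integral>x. ?I x - ?I x * ?I (x - z) \<partial>lborel)" for z
  proof -
    have "transl_dist ?I z = (\<integral>x. ?I x + ?I (x - z) - 2 * (?I x * ?I (x - z)) \<partial>lborel)"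
      unfolding transl_dist_def by (intro Bochner_Integration.integral_cong) (auto simp: indicator_def)
    also have "\<dots> = 2 * (\<integral>x. ?I x - ?I x * ?I (x - z) \<partial>lborel)"
      using iI iT iP by simp
    finally show ?thesis .
  qed
  have "(\<lambda>k. \<integral>x. ?I x - ?I x * ?I (x - X k) \<partial>lborel) \<longlonglongrightarrow> (\<integral>x. (0::real) \<partial>(lborel :: 'a measure))"
  proof (rule integral_dominated_convergence[where w="?I"])
    show "AE x in lborel. (\<lambda>k. ?I x - ?I x * ?I (x - X k)) \<longlonglongrightarrow> 0"
    proof (rule AE_I2)
      fix x
      show "(\<lambda>k. ?I x - ?I x * ?I (x - X k)) \<longlonglongrightarrow> 0"
      proof (cases "x \<in> U")
        case True
        have "(\<lambda>k. x - X k) \<longlonglongrightarrow> x - 0" by (intro tendsto_intros X)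
        then have "\<forall>\<^sub>F k in sequentially. x - X k \<in> U"
          using U True by (intro topological_tendstoD) auto
        then have "\<forall>\<^sub>F k in sequentially. ?I x - ?I x * ?I (x - X k) = 0"
          by eventually_elim (use True in simp)
        then show ?thesis by (rule tendsto_eventually)
      qed simp
    qed
    show "AE x in lborel. norm (?I x - ?I x * ?I (x - X k)) \<le> ?I x" for k
      by (auto simp: indicator_def)
  qed (use iI iP U in \<open>auto intro!: borel_measurable_integrable\<close>)
  then show "(transl_dist ?I \<circ> X) \<longlonglongrightarrow> 0"
    unfolding comp_def eq using tendsto_mult_left[of _ 0 sequentially 2] by fastforce
qed

lemma transl_dist_indicator:
  fixes A :: "'a::euclidean_space set"
  assumes A[measurable]: "A \<in> sets borel" and fin: "emeasure lborel A < \<infinity>"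
  shows "(transl_dist (indicator A) \<longlongrightarrow> 0) (at 0)"
proof (rule transl_dist_tendsto_approx)
  show "sqint lborel (indicator A)" using sqint_indicator[of A lborel 1] A fin by simp
  fix e :: real assume e: "e > 0"
  obtain U where U: "open U" "A \<subseteq> U" "emeasure lborel (U - A) < e"
    using outer_regular_lborel[OF A e] by blast
  have [measurable]: "U \<in> sets borel" using U by simp
  have "emeasure lborel U \<le> emeasure lborel A + emeasure lborel (U - A)"
    using U(2) by (intro order_trans[OF _ emeasure_subadditive]) (auto intro!: emeasure_mono)
  also have "\<dots> < \<infinity>" using fin U(3) by (auto simp: less_top[symmetric] intro: le_less_trans)
  finally have finU: "emeasure lborel U < \<infinity>" .
  have "(\<integral>x. (indicator A x - indicator U x :: real)\<^sup>2 \<partial>lborel) = (\<integral>x. indicator (U - A) x \<partial>lborel)"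
    using U(2) by (intro Bochner_Integration.integral_cong) (auto simp: indicator_def)
  also have "\<dots> = measure lborel (U - A)" by simp
  also have "\<dots> \<le> e" using U(3) e by (simp add: measure_def enn2real_leI less_imp_le)
  finally show "\<exists>h. sqint lborel h \<and> (transl_dist h \<longlongrightarrow> 0) (at 0) \<and> (\<integral>x. (indicator A x - h x)\<^sup>2 \<partial>lborel) \<le> e"
    using transl_dist_indicator_open[OF U(1) finU] sqint_indicator[of U lborel 1] finU
        by (intro exI[of _ "indicator U"]) auto
qed

lemma transl_dist_simple:
  fixes s :: "'a::euclidean_space \<Rightarrow> real"
  assumes s: "simple_function lborel s" and q: "sqint lborel s"
  shows "(transl_dist s \<longlongrightarrow> 0) (at 0)"
proof -
  let ?V = "s ` space lborel - {0}"
  have finV: "finite ?V" using simple_functionD(1)[OF s] by simp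
  have [measurable]: "s \<in> borel_measurable borel" using sqintD(1)[OF q] by simp
  have m: "s -` {c} \<in> sets borel" for c using measurable_sets_borel[of s borel "{c}"] by simp
  have fin: "emeasure lborel (s -` {c}) < \<infinity>" if "c \<noteq> 0" for c
  proof -
    have "integrable lborel (\<lambda>x. indicator (s -` {c}) x *\<^sub>R (s x)\<^sup>2)"
      by (intro integrable_mult_indicator sqintD(2) q) (simp add: m)
    then have "integrable lborel (\<lambda>x. (1 / c\<^sup>2) * (indicator (s -` {c}) x *\<^sub>R (s x)\<^sup>2))"
      by (rule integrable_mult_right)
    also have "(\<lambda>x. (1 / c\<^sup>2) * (indicator (s -` {c}) x *\<^sub>R (s x)\<^sup>2)) = (indicator (s -` {c}) :: 'a \<Rightarrow> real)"
      using that by (auto simp: indicator_def fun_eq_iff)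
    finally show ?thesis using m by (simp add: integrable_indicator_iff)
  qed
  have "(transl_dist (\<lambda>x. \<Sum>c\<in>F. c * indicator (s -` {c}) x) \<longlongrightarrow> 0) (at 0) \<and>
      sqint lborel (\<lambda>x. \<Sum>c\<in>F. c * indicator (s -` {c}) x)"
    if "finite F" "F \<subseteq> ?V" for F
    using that
  proof (induction F rule: finite_induct)
    case empty
    show ?case by (simp add: transl_dist_def sqint_def)
  next
    case (insert c F)
    have c: "sqint lborel (\<lambda>x. c * indicator (s -` {c}) x)"
      using insert fin[of c] m[of c] by (intro sqint_indicator) auto
    show ?case
      unfolding sum.insert[OF insert.hyps] using insert.prems insert.IH fin[of c]
      by (intro conjI transl_dist_tendsto_add sqint_add transl_dist_tendsto_cmult transl_dist_indicator m c) auto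
  qed
  from this[OF finV order_refl]
  have "(transl_dist (\<lambda>x. \<Sum>c\<in>?V. c * indicator (s -` {c}) x) \<longlongrightarrow> 0) (at 0)" by blast
  moreover have "(\<Sum>c\<in>?V. c * indicator (s -` {c}) x) = s x" for x
  proof (cases "s x = 0")
    case True
    then show ?thesis by (auto intro!: sum.neutral simp: indicator_def)
  next
    case False
    have "(\<Sum>c\<in>?V. c * indicator (s -` {c}) x) = (\<Sum>c\<in>{s x}. c * indicator (s -` {c}) x)"
      using finV False by (intro sum.mono_neutral_right) (auto simp: indicator_def)
    then show ?thesis by simp
  qed
  ultimately show ?thesis by simp
qed

lemma transl_dist_tendsto:
  fixes f :: "'a::euclidean_space \<Rightarrow> real"
  assumes f: "sqint lborel f"
  shows "(transl_dist f \<longlongrightarrow> 0) (at 0)"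
proof (rule transl_dist_tendsto_approx[OF f])
  fix e :: real assume e: "e > 0"
  have [measurable]: "f \<in> borel_measurable borel" using sqintD(1)[OF f] by simp
  obtain s where s: "\<And>i. simple_function lborel (s i)" "\<And>x. (\<lambda>i. s i x) \<longlonglongrightarrow> f x" "\<And>i x. norm (s i x) \<le> 2 * norm (f x)"
    using borel_measurable_implies_sequence_metric[of f lborel 0] by (auto simp: space_lborel)
  have sq: "sqint lborel (s i)" for i
    using s(1,3)[of i] by (intro sqint_le(1)[OF sqint_cmult[OF f, of 2]]) (auto dest: borel_measurable_simple_function simp: abs_mult)
  have "(\<lambda>i. \<integral>x. (f x - s i x)\<^sup>2 \<partial>lborel) \<longlonglongrightarrow> (\<integral>x. (f x - f x)\<^sup>2 \<partial>lborel)"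
  proof (rule integral_dominated_convergence[where w="\<lambda>x. 9 * (f x)\<^sup>2"])
    show "AE x in lborel. (\<lambda>i. (f x - s i x)\<^sup>2) \<longlonglongrightarrow> (f x - f x)\<^sup>2"
      by (intro AE_I2 tendsto_intros s)
    show "AE x in lborel. norm ((f x - s i x)\<^sup>2) \<le> 9 * (f x)\<^sup>2" for i
    proof (rule AE_I2)
      fix x
      have "\<bar>f x - s i x\<bar> \<le> 3 * \<bar>f x\<bar>" using s(3)[of i x] by simp
      then have "(f x - s i x)\<^sup>2 \<le> (3 * f x)\<^sup>2" by (subst abs_le_square_iff[symmetric]) (simp add: abs_mult)
      then show "norm ((f x - s i x)\<^sup>2) \<le> 9 * (f x)\<^sup>2" by (simp add: power_mult_distrib)
    qed
    show "(\<lambda>x. (f x - s i x)\<^sup>2) \<in> borel_measurable lborel" for i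
      using sqintD(2)[OF sqint_diff[OF f sq]] by (rule borel_measurable_integrable)
  qed (use sqintD(2)[OF f] in auto)
  then have "\<forall>\<^sub>F i in sequentially. dist (\<integral>x. (f x - s i x)\<^sup>2 \<partial>lborel) 0 < e"
    using e by (intro tendstoD) auto
  then obtain i where "dist (\<integral>x. (f x - s i x)\<^sup>2 \<partial>lborel) 0 < e" using eventually_happens by force
  then show "\<exists>h. sqint lborel h \<and> (transl_dist h \<longlongrightarrow> 0) (at 0) \<and> (\<integral>x. (f x - h x)\<^sup>2 \<partial>lborel) \<le> e"
    using sq[of i] transl_dist_simple[OF s(1) sq] by (intro exI[of _ "s i"]) auto
qed

section \<open>Partial derivatives and integration by parts\<close>

text \<open>
  Differentiability along the lines in one direction suffices for the integrations by parts below
  and spares a proof that mollifications are totally differentiable.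
\<close>

definition has_partial :: "'a::euclidean_space \<Rightarrow> ('a \<Rightarrow> real) \<Rightarrow> ('a \<Rightarrow> real) \<Rightarrow> bool" where
  "has_partial i W W' \<longleftrightarrow> (\<forall>x. ((\<lambda>t. W (x + t *\<^sub>R i)) has_real_derivative W' x) (at 0))"

lemma has_partialD_line:
  assumes "has_partial i W W'"
  shows "((\<lambda>t. W (x + t *\<^sub>R i)) has_real_derivative W' (x + t *\<^sub>R i)) (at t)"
proof -
  have "((\<lambda>s. W ((x + t *\<^sub>R i) + s *\<^sub>R i)) has_real_derivative W' (x + t *\<^sub>R i)) (at 0)"
    using assms by (simp add: has_partial_def)
  then have "((\<lambda>s. W (x + (s + t) *\<^sub>R i)) has_real_derivative W' (x + t *\<^sub>R i)) (at 0)"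
    by (simp add: algebra_simps)
  then show ?thesis
    using DERIV_shift[of "\<lambda>t. W (x + t *\<^sub>R i)" "W' (x + t *\<^sub>R i)" 0 t] by simp
qed

lemma has_partial_lipschitz:
  assumes "has_partial i W W'" "\<And>x. \<bar>W' x\<bar> \<le> B"
  shows "\<bar>W (x + h *\<^sub>R i) - W x\<bar> \<le> B * \<bar>h\<bar>"
proof -
  have "norm (W (x + h *\<^sub>R i) - W (x + 0 *\<^sub>R i)) \<le> B * norm (h - 0)"
    by (rule field_differentiable_bound[where S=UNIV and f="\<lambda>t. W (x + t *\<^sub>R i)" and f'="\<lambda>t. W' (x + t *\<^sub>R i)"])
       (use assms(2) has_partialD_line[OF assms(1)] in auto)
  then show ?thesis by simp
qed

lemma has_partial_quotient_tendsto:
  assumes "has_partial i W W'" "X \<longlonglongrightarrow> 0" "\<And>k. X k \<noteq> 0"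
  shows "(\<lambda>k. (W (x + X k *\<^sub>R i) - W x) / X k) \<longlonglongrightarrow> W' x"
proof -
  have "(\<lambda>h. (W (x + h *\<^sub>R i) - W x) / h) \<midarrow>0\<rightarrow> W' x"
    using assms(1) unfolding has_partial_def DERIV_def by simp
  then show ?thesis
    using assms(2,3) unfolding tendsto_at_iff_sequentially by (auto simp: comp_def)
qed

lemma Ck_fun_has_partial:
  assumes "Ck_fun (Suc k) W"
  shows "has_partial i W (\<lambda>x. frechet_derivative W (at x) i)"
  unfolding has_partial_def
proof
  fix x
  let ?D = "frechet_derivative W (at x)"
  have D: "(W has_derivative ?D) (at (x + 0 *\<^sub>R i))" using Ck_fun_SucD(1)[OF assms, of x] by simp
  have "((\<lambda>t. W (x + t *\<^sub>R i)) has_derivative (\<lambda>t. ?D (t *\<^sub>R i))) (at 0)"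
    by (rule has_derivative_compose[where f="\<lambda>t. x + t *\<^sub>R i" and g=W, OF _ D]) (auto intro!: derivative_eq_intros)
  moreover have "?D (t *\<^sub>R i) = ?D i * t" for t
    using has_derivative_linear[OF D] by (simp add: linear_scale)
  ultimately show "((\<lambda>t. W (x + t *\<^sub>R i)) has_real_derivative ?D i) (at 0)"
    by (simp add: has_field_derivative_def)
qed

lemma has_partial_mult:
  assumes "has_partial i V V'" "has_partial i W W'"
  shows "has_partial i (\<lambda>x. V x * W x) (\<lambda>x. V' x * W x + W' x * V x)"
  unfolding has_partial_def
proof
  fix x
  show "((\<lambda>t. V (x + t *\<^sub>R i) * W (x + t *\<^sub>R i)) has_real_derivative V' x * W x + W' x * V x) (at 0)"
    using DERIV_mult[of "\<lambda>t. V (x + t *\<^sub>R i)" "V' x" 0 UNIV "\<lambda>t. W (x + t *\<^sub>R i)" "W' x"] assms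
    by (simp add: has_partial_def)
qed

lemma has_partial_compose:
  assumes "\<And>s. (F has_real_derivative F' s) (at s)" "has_partial i W W'"
  shows "has_partial i (\<lambda>x. F (W x)) (\<lambda>x. F' (W x) * W' x)"
  unfolding has_partial_def
proof
  fix x
  show "((\<lambda>t. F (W (x + t *\<^sub>R i))) has_real_derivative F' (W x) * W' x) (at 0)"
    using DERIV_chain2[of F "F' (W x)" "\<lambda>t. W (x + t *\<^sub>R i)" 0 "W' x" UNIV] assms
    by (simp add: has_partial_def)
qed

lemma compact_subset_cball:
  fixes K :: "'a::euclidean_space set"
  assumes "compact K" obtains R where "R > 0" "K \<subseteq> cball 0 R"
proof -
  obtain b where b: "b > 0" "\<forall>x\<in>K. norm x \<le> b"
    using compact_imp_bounded[OF assms] unfolding bounded_pos by blast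
  show ?thesis by (rule that[OF b(1)]) (use b(2) in auto)
qed

lemma integrable_indicator_cball: "integrable lborel (\<lambda>x. c * indicator (cball (a::'a::euclidean_space) r) x :: real)"
  using emeasure_bounded_finite[of "cball a r"] by (auto simp: less_top)

text \<open>
  The integrals of the difference quotients vanish by translation invariance, and the bound on the
  derivative dominates the quotients.
\<close>

lemma integral_partial_eq_0:
  fixes W W' :: "'a::euclidean_space \<Rightarrow> real"
  assumes W: "has_partial i W W'" and B: "\<And>x. \<bar>W' x\<bar> \<le> B"
    and i[simp]: "integrable lborel W" and [measurable]: "W' \<in> borel_measurable borel"
    and K: "compact K" "\<And>x. x \<notin> K \<Longrightarrow> W x = 0"
  shows "(\<integral>x. W' x \<partial>lborel) = 0"
proof -
  define X where "X k = 1 / real (Suc k)" for k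
  have X: "X \<longlonglongrightarrow> 0" "X k \<noteq> 0" "\<bar>X k\<bar> \<le> 1" for k
    using LIMSEQ_inverse_real_of_nat by (auto simp: X_def[abs_def] inverse_eq_divide)
  have [measurable]: "W \<in> borel_measurable borel" using borel_measurable_integrable[OF i] by simp
  obtain R where R: "R > 0" "K \<subseteq> cball 0 R" using compact_subset_cball[OF K(1)] by blast
  have B0: "B \<ge> 0" using B[of 0] by linarith
  let ?q = "\<lambda>k x. (W (x + X k *\<^sub>R i) - W x) / X k"
  have "(\<lambda>k. \<integral>x. ?q k x \<partial>lborel) \<longlonglongrightarrow> (\<integral>x. W' x \<partial>lborel)"
  proof (rule integral_dominated_convergence[where w="\<lambda>x. B * indicator (cball 0 (R + norm i)) x"])
    show "AE x in lborel. (\<lambda>k. ?q k x) \<longlonglongrightarrow> W' x"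
      by (intro AE_I2 has_partial_quotient_tendsto[OF W] X)
    show "AE x in lborel. norm (?q k x) \<le> B * indicator (cball 0 (R + norm i)) x" for k
    proof (rule AE_I2)
      fix x
      show "norm (?q k x) \<le> B * indicator (cball 0 (R + norm i)) x"
      proof (cases "x \<in> cball 0 (R + norm i)")
        case True
        then show ?thesis
          using has_partial_lipschitz[OF W B, of x "X k"] X(2)[of k] by (simp add: field_simps)
      next
        case False
        have "norm (X k *\<^sub>R i) \<le> norm i" using X(3)[of k] by (simp add: mult_left_le_one_le)
        moreover have "norm x \<le> norm (x + X k *\<^sub>R i) + norm (X k *\<^sub>R i)"
          using norm_triangle_ineq4[of "x + X k *\<^sub>R i" "X k *\<^sub>R i"] by simp
        moreover have "norm x > R + norm i" using False by simp
        moreover have "norm y \<le> R" if "y \<in> K" for y using R(2) that by auto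
        ultimately have "x + X k *\<^sub>R i \<notin> K" "x \<notin> K"
          using norm_ge_zero[of i] by (meson add_mono le_less_trans less_le_not_le order_trans, smt (verit))
        then show ?thesis using K(2) False by simp
      qed
    qed
    show "integrable lborel (\<lambda>x. B * indicator (cball 0 (R + norm i)) x)"
      by (rule integrable_indicator_cball)
  qed auto
  moreover have "(\<integral>x. ?q k x \<partial>lborel) = 0" for k
    using lborel_translate[of W "X k *\<^sub>R i"] by simp
  ultimately have "(\<lambda>k::nat. 0) \<longlonglongrightarrow> (\<integral>x. W' x \<partial>lborel)" by (simp only:)
  then show ?thesis unfolding LIMSEQ_const_iff by simp
qed

section \<open>Mollification\<close>

definition mollify :: "('a::euclidean_space \<Rightarrow> real) \<Rightarrow> ('a \<Rightarrow> real) \<Rightarrow> 'a \<Rightarrow> real" where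
  "mollify \<rho> f x = (\<integral>z. f (x - z) * \<rho> z \<partial>lborel)"

lemma continuous_compact_support_sqint:
  fixes \<phi> :: "'a::euclidean_space \<Rightarrow> real"
  assumes c: "continuous_on UNIV \<phi>" and K: "compact K" "\<And>x. x \<notin> K \<Longrightarrow> \<phi> x = 0"
  shows "\<phi> \<in> borel_measurable borel" "integrable lborel \<phi>" "sqint lborel \<phi>"
proof -
  show m[measurable]: "\<phi> \<in> borel_measurable borel" by (rule borel_measurable_continuous_onI[OF c])
  obtain B where B: "B > 0" "\<And>x. norm (\<phi> x) \<le> B"
    using continuous_compact_support_bounded[OF c K] by blast
  obtain R where R: "R > 0" "K \<subseteq> cball 0 R" using compact_subset_cball[OF K(1)] by blast
  have z: "x \<notin> cball 0 R \<Longrightarrow> \<phi> x = 0" for x using R K by blast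
  show "integrable lborel \<phi>"
  proof (rule Bochner_Integration.integrable_bound[OF integrable_indicator_cball[of B 0 R]])
    show "AE x in lborel. norm (\<phi> x) \<le> norm (B * indicator (cball 0 R) x)"
      using B z by (intro AE_I2) (auto simp: indicator_def)
  qed simp
  have "integrable lborel (\<lambda>x. (\<phi> x)\<^sup>2)"
  proof (rule Bochner_Integration.integrable_bound[OF integrable_indicator_cball[of "B\<^sup>2" 0 R]])
    have "(\<phi> x)\<^sup>2 \<le> B\<^sup>2" for x using B(2)[of x] B(1) by (simp add: abs_le_square_iff[symmetric])
    then show "AE x in lborel. norm ((\<phi> x)\<^sup>2) \<le> norm (B\<^sup>2 * indicator (cball 0 R) x)"
      using z by (intro AE_I2) (auto simp: indicator_def)
  qed simp
  then show "sqint lborel \<phi>" by (simp add: sqint_def)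
qed

lemma lborel_reflect:
  fixes f :: "'a::euclidean_space \<Rightarrow> real"
  assumes [measurable]: "f \<in> borel_measurable borel"
  shows "integrable lborel (\<lambda>z. f (x - z)) \<longleftrightarrow> integrable lborel f"
    and "(\<integral>z. f (x - z) \<partial>lborel) = (\<integral>y. f y \<partial>lborel)"
proof -
  have "distr lborel borel (\<lambda>z. x - z) = (lborel :: 'a measure)"
    using lborel_affine[of "-1" x] by (simp add: density_1)
  moreover have "integrable (distr lborel borel (\<lambda>z. x - z)) f \<longleftrightarrow> integrable lborel (\<lambda>z. f (x - z))"
    by (subst integrable_distr_eq) auto
  moreover have "(\<integral>y. f y \<partial>(distr lborel borel (\<lambda>z. x - z))) = (\<integral>z. f (x - z) \<partial>lborel)"
    by (subst integral_distr) auto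
  ultimately show "integrable lborel (\<lambda>z. f (x - z)) \<longleftrightarrow> integrable lborel f"
    "(\<integral>z. f (x - z) \<partial>lborel) = (\<integral>y. f y \<partial>lborel)" by simp_all
qed

lemma sqint_reflect:
  fixes f :: "'a::euclidean_space \<Rightarrow> real"
  assumes f: "sqint lborel f"
  shows "sqint lborel (\<lambda>z. f (x - z))" "(\<integral>z. (f (x - z))\<^sup>2 \<partial>lborel) = (\<integral>x. (f x)\<^sup>2 \<partial>lborel)"
proof -
  have [measurable]: "f \<in> borel_measurable borel" using sqintD(1)[OF f] by simp
  show "sqint lborel (\<lambda>z. f (x - z))" "(\<integral>z. (f (x - z))\<^sup>2 \<partial>lborel) = (\<integral>x. (f x)\<^sup>2 \<partial>lborel)"
    using lborel_reflect[of "\<lambda>x. (f x)\<^sup>2" x] sqintD(2)[OF f] by (auto simp: sqint_def)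
qed

lemma mollify_alt:
  fixes f :: "'a::euclidean_space \<Rightarrow> real"
  assumes [measurable]: "f \<in> borel_measurable borel" "\<rho> \<in> borel_measurable borel"
  shows "mollify \<rho> f x = (\<integral>y. f y * \<rho> (x - y) \<partial>lborel)"
  using lborel_reflect(2)[of "\<lambda>y. f y * \<rho> (x - y)" x] by (simp add: mollify_def)

lemma mollify_measurable:
  fixes f :: "'a::euclidean_space \<Rightarrow> real"
  assumes [measurable]: "f \<in> borel_measurable borel" "\<rho> \<in> borel_measurable borel"
  shows "mollify \<rho> f \<in> borel_measurable borel"
  unfolding mollify_def[abs_def] by measurable

lemma mollify_bound:
  assumes f: "sqint lborel f" and r: "sqint lborel \<rho>"
  shows "\<bar>mollify \<rho> f x\<bar> \<le> sqrt (\<integral>x. (f x)\<^sup>2 \<partial>lborel) * sqrt (\<integral>x. (\<rho> x)\<^sup>2 \<partial>lborel)"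
  using Cauchy_Schwarz_integral[OF sqint_reflect(1)[OF f] r, of x] sqint_reflect(2)[OF f, of x]
  by (simp add: mollify_def)

text \<open>
  The difference quotients of the kernel are bounded by the mean value theorem and live on a common
  ball, so that the limit passes under the integral.
\<close>

lemma mollify_partial:
  fixes f :: "'a::euclidean_space \<Rightarrow> real"
  assumes f: "sqint lborel f" and P: "has_partial i \<rho> \<rho>'"
    and c: "continuous_on UNIV \<rho>" "continuous_on UNIV \<rho>'"
    and K: "compact K" "\<And>x. x \<notin> K \<Longrightarrow> \<rho> x = 0" "\<And>x. x \<notin> K \<Longrightarrow> \<rho>' x = 0"
  shows "has_partial i (mollify \<rho> f) (mollify \<rho>' f)"
  unfolding has_partial_def DERIV_def tendsto_at_iff_sequentially
proof (intro allI impI)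
  fix x :: 'a and X :: "nat \<Rightarrow> real" assume X0: "\<forall>k. X k \<in> UNIV - {0}" and X: "X \<longlonglongrightarrow> 0"
  have [measurable]: "f \<in> borel_measurable borel" using sqintD(1)[OF f] by simp
  note r = continuous_compact_support_sqint[OF c(1) K(1,2)] and r' = continuous_compact_support_sqint[OF c(2) K(1,3)]
  note [measurable] = r(1) r'(1)
  obtain B where B: "B > 0" "\<And>x. norm (\<rho>' x) \<le> B"
    using continuous_compact_support_bounded[OF c(2) K(1,3)] by blast
  obtain R where R: "R > 0" "K \<subseteq> cball 0 R" using compact_subset_cball[OF K(1)] by blast
  obtain M where M: "M > 0" "\<And>k. norm (X k) \<le> M" using convergent_imp_Bseq[of X] X
      by (auto simp: convergent_def Bseq_def)
  let ?C = "cball x (R + M * norm i)"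
  let ?q = "\<lambda>k y. f y * ((\<rho> ((x - y) + X k *\<^sub>R i) - \<rho> (x - y)) / X k)"
  have ir: "integrable lborel (\<lambda>y. f y * \<rho> (x' - y))" for x'
    by (rule sqint_mult_integrable[OF f sqint_reflect(1)[OF r(3)]])
  have "(\<lambda>k. \<integral>y. ?q k y \<partial>lborel) \<longlonglongrightarrow> (\<integral>y. f y * \<rho>' (x - y) \<partial>lborel)"
  proof (rule integral_dominated_convergence[where w="\<lambda>y. \<bar>f y\<bar> * (B * indicator ?C y)"])
    show "integrable lborel (\<lambda>y. \<bar>f y\<bar> * (B * indicator ?C y))"
      using emeasure_bounded_finite[of ?C]
      by (intro sqint_mult_integrable sqint_abs f sqint_indicator) auto
    show "AE y in lborel. (\<lambda>k. ?q k y) \<longlonglongrightarrow> f y * \<rho>' (x - y)"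
      using X0 by (intro AE_I2 tendsto_mult_left has_partial_quotient_tendsto[OF P] X) auto
    show "AE y in lborel. norm (?q k y) \<le> \<bar>f y\<bar> * (B * indicator ?C y)" for k
    proof (rule AE_I2)
      fix y
      have "\<bar>(\<rho> ((x - y) + X k *\<^sub>R i) - \<rho> (x - y)) / X k\<bar> \<le> B * indicator ?C y"
      proof (cases "y \<in> ?C")
        case True
        then show ?thesis
          using has_partial_lipschitz[OF P, of B "x - y" "X k"] B(2) X0 by (simp add: field_simps)
      next
        case False
        have 1: "norm (X k *\<^sub>R i) \<le> M * norm i" using M(2)[of k] by (simp add: mult_right_mono)
        have 2: "norm (x - y) \<le> norm ((x - y) + X k *\<^sub>R i) + norm (X k *\<^sub>R i)"
          using norm_triangle_ineq4[of "(x - y) + X k *\<^sub>R i" "X k *\<^sub>R i"] by simp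
        have 3: "norm (x - y) > R + M * norm i" using False by (simp add: dist_norm)
        have "(x - y) + X k *\<^sub>R i \<notin> K" using 1 2 3 R(2) by force
        moreover have "0 \<le> M * norm i" using M(1) by simp
        then have "x - y \<notin> K" using 3 R(2) by force
        ultimately show ?thesis using K(2) False by simp
      qed
      then show "norm (?q k y) \<le> \<bar>f y\<bar> * (B * indicator ?C y)"
        unfolding real_norm_def abs_mult[of "f y"] by (intro mult_left_mono) auto
    qed
  qed auto
  moreover have "(\<integral>y. ?q k y \<partial>lborel) = (mollify \<rho> f (x + (0 + X k) *\<^sub>R i) - mollify \<rho> f (x + 0 *\<^sub>R i)) / X k" for k
  proof -
    have "?q k y = (f y * \<rho> ((x + X k *\<^sub>R i) - y) - f y * \<rho> (x - y)) / X k" for y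
      by (simp add: algebra_simps diff_divide_distrib)
    then have "(\<integral>y. ?q k y \<partial>lborel) = (\<integral>y. (f y * \<rho> ((x + X k *\<^sub>R i) - y) - f y * \<rho> (x - y)) / X k \<partial>lborel)"
      by (simp only:)
    also have "\<dots> = (\<integral>y. f y * \<rho> ((x + X k *\<^sub>R i) - y) - f y * \<rho> (x - y) \<partial>lborel) / X k"
      by (rule integral_divide_zero)
    also have "\<dots> = ((\<integral>y. f y * \<rho> ((x + X k *\<^sub>R i) - y) \<partial>lborel) - (\<integral>y. f y * \<rho> (x - y) \<partial>lborel)) / X k"
      by (simp only: Bochner_Integration.integral_diff[OF ir ir])
    finally have "(\<integral>y. ?q k y \<partial>lborel) = \<dots>" .
    then show ?thesis by (simp add: mollify_alt)
  qed
  ultimately have "(\<lambda>k. (mollify \<rho> f (x + (0 + X k) *\<^sub>R i) - mollify \<rho> f (x + 0 *\<^sub>R i)) / X k) \<longlonglongrightarrow> (\<integral>y. f y *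
      \<rho>' (x - y) \<partial>lborel)"
    by (simp only:)
  moreover have "mollify \<rho>' f x = (\<integral>y. f y * \<rho>' (x - y) \<partial>lborel)"
    by (rule mollify_alt) measurable
  ultimately show "((\<lambda>h. (mollify \<rho> f (x + (0 + h) *\<^sub>R i) - mollify \<rho> f (x + 0 *\<^sub>R i)) / h) \<circ> X) \<longlonglongrightarrow> mollify \<rho>' f x"
    by (simp only: comp_def)
qed

definition mollifier :: "real \<Rightarrow> ('a::euclidean_space \<Rightarrow> real) \<Rightarrow> bool" where
  "mollifier \<delta> \<rho> \<longleftrightarrow> (\<forall>k. Ck_fun k \<rho>) \<and> (\<forall>x. \<rho> x \<ge> 0) \<and> (\<forall>x. x \<notin> cball 0 \<delta> \<longrightarrow> \<rho> x = 0) \<and>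
     (\<integral>x. \<rho> x \<partial>lborel) = 1"

lemma mollifier_exists:
  assumes "\<delta> > 0"
  shows "\<exists>\<rho>. mollifier \<delta> (\<rho> :: 'a::euclidean_space \<Rightarrow> real)"
proof -
  obtain a b :: 'a where ab: "cbox a b \<subseteq> ball 0 \<delta>" "0 \<in> box a b" "\<forall>i\<in>Basis. a \<bullet> i < b \<bullet> i"
    by (rule open_contains_cbox[of "ball (0 :: 'a) \<delta>" 0]) (use assms in auto)
  let ?b = "box_bump a b 1"
  have z: "?b x = 0" if "x \<notin> cbox a b" for x
    using that box_subset_cbox box_bump_zero by blast
  have i: "integrable lborel ?b"
    by (rule continuous_compact_support_sqint(2)[OF Ck_fun_continuous[OF Ck_fun_box_bump[of 0]] compact_cbox z])
  have "(\<integral>x. ?b x \<partial>lborel) \<noteq> 0"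
  proof
    assume "(\<integral>x. ?b x \<partial>lborel) = 0"
    then have "AE x in lborel. ?b x = 0"
      using i by (subst (asm) integral_nonneg_eq_0_iff_AE) (auto simp: box_bump_nonneg)
    then have "AE x in lborel. x \<notin> box a b"
    proof eventually_elim
      case (elim x)
      then show ?case using box_bump_pos[of x a b 1] by auto
    qed
    then have "box a b \<in> null_sets lborel" by (subst AE_iff_null_sets) auto
    then have "emeasure lborel (box a b) = 0" by auto
    moreover have "emeasure lborel (box a b) > 0"
      using ab(3) by (subst emeasure_lborel_box_eq) (auto simp: inner_diff_left intro!: prod_pos less_imp_le)
    ultimately show False by simp
  qed
  moreover have "(\<integral>x. ?b x \<partial>lborel) \<ge> 0" by (intro Bochner_Integration.integral_nonneg box_bump_nonneg)
  ultimately have p: "(\<integral>x. ?b x \<partial>lborel) > 0" by simp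
  have "mollifier \<delta> (\<lambda>x. ?b x * (1 / (\<integral>x. ?b x \<partial>lborel)))"
    unfolding mollifier_def
  proof (intro conjI allI impI)
    show "Ck_fun k (\<lambda>x. ?b x * (1 / (\<integral>x. ?b x \<partial>lborel)))" for k
      by (intro Ck_fun_mult Ck_fun_box_bump Ck_fun_const)
    show "0 \<le> ?b x * (1 / (\<integral>x. ?b x \<partial>lborel))" for x
      using p box_bump_nonneg[of a b 1 x] by simp
    show "?b x * (1 / (\<integral>x. ?b x \<partial>lborel)) = 0" if "x \<notin> cball 0 \<delta>" for x
    proof -
      have "x \<notin> cbox a b" using that ab(1) by force
      then show ?thesis using z by simp
    qed
    show "(\<integral>x. ?b x * (1 / (\<integral>x. ?b x \<partial>lborel)) \<partial>lborel) = 1"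
      using p by simp
  qed
  then show ?thesis by blast
qed

lemma mollifier_sqint:
  assumes "mollifier \<delta> \<rho>"
  shows "\<rho> \<in> borel_measurable borel" "integrable lborel \<rho>" "sqint lborel \<rho>" "continuous_on UNIV \<rho>"
proof -
  show c: "continuous_on UNIV \<rho>" using assms Ck_fun_continuous unfolding mollifier_def by blast
  have z: "\<And>x. x \<notin> cball 0 \<delta> \<Longrightarrow> \<rho> x = 0" using assms unfolding mollifier_def by blast
  show "\<rho> \<in> borel_measurable borel" "integrable lborel \<rho>" "sqint lborel \<rho>"
    using continuous_compact_support_sqint[OF c compact_cball z] by blast+
qed

text \<open>
  Jensen's inequality for the probability density \<open>\<rho>\<close>, in the form of the Cauchy-Schwarz inequality
  with \<open>\<rho> = sqrt \<rho> * sqrt \<rho>\<close>.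
\<close>

lemma mollify_deviation:
  fixes f :: "'a::euclidean_space \<Rightarrow> real"
  assumes f: "sqint lborel f" and m: "mollifier \<delta> \<rho>"
  shows "ennreal ((mollify \<rho> f x - f x)\<^sup>2) \<le> (\<integral>\<^sup>+z. ennreal ((f (x - z) - f x)\<^sup>2) * ennreal (\<rho> z) \<partial>lborel)"
proof -
  have [measurable]: "f \<in> borel_measurable borel" using sqintD(1)[OF f] by simp
  note r = mollifier_sqint[OF m]
  note [measurable] = r(1)
  have nn: "\<And>z. \<rho> z \<ge> 0" and one: "(\<integral>z. \<rho> z \<partial>lborel) = 1" using m by (auto simp: mollifier_def)
  have i1: "integrable lborel (\<lambda>z. f (x - z) * \<rho> z)"
    by (rule sqint_mult_integrable[OF sqint_reflect(1)[OF f] r(3)])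
  have "mollify \<rho> f x - f x = (\<integral>z. f (x - z) * \<rho> z \<partial>lborel) - (\<integral>z. f x * \<rho> z \<partial>lborel)"
    by (simp add: mollify_def one)
  also have "\<dots> = (\<integral>z. (f (x - z) - f x) * \<rho> z \<partial>lborel)"
    using i1 r(2) by (simp add: left_diff_distrib)
  finally have eq: "mollify \<rho> f x - f x = (\<integral>z. (f (x - z) - f x) * \<rho> z \<partial>lborel)" .
  have "integrable lborel (\<lambda>z. (f (x - z) - f x) * \<rho> z)"
    using i1 r(2) by (simp add: left_diff_distrib)
  then have "ennreal \<bar>mollify \<rho> f x - f x\<bar> \<le> (\<integral>\<^sup>+z. ennreal \<bar>(f (x - z) - f x) * \<rho> z\<bar> \<partial>lborel)"
    unfolding eq using integral_norm_bound_ennreal by fastforce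
  also have "\<dots> = (\<integral>\<^sup>+z. (ennreal (\<bar>f (x - z) - f x\<bar> * sqrt (\<rho> z))) * ennreal (sqrt (\<rho> z)) \<partial>lborel)"
  proof (rule nn_integral_cong)
    fix z
    have "\<bar>(f (x - z) - f x) * \<rho> z\<bar> = (\<bar>f (x - z) - f x\<bar> * sqrt (\<rho> z)) * sqrt (\<rho> z)"
      using nn[of z] by (simp add: abs_mult mult.assoc)
    then show "ennreal \<bar>(f (x - z) - f x) * \<rho> z\<bar> = ennreal (\<bar>f (x - z) - f x\<bar> * sqrt (\<rho> z)) * ennreal (sqrt (\<rho> z))"
      using nn[of z] by (simp add: ennreal_mult)
  qed
  finally have le: "ennreal \<bar>mollify \<rho> f x - f x\<bar> \<le> \<dots>" .
  have "ennreal ((mollify \<rho> f x - f x)\<^sup>2) = (ennreal \<bar>mollify \<rho> f x - f x\<bar>)\<^sup>2"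
    by (simp add: ennreal_power)
  also have "\<dots> \<le> (\<integral>\<^sup>+z. (ennreal (\<bar>f (x - z) - f x\<bar> * sqrt (\<rho> z))) * ennreal (sqrt (\<rho> z)) \<partial>lborel)\<^sup>2"
    by (intro power_mono le) auto
  also have "\<dots> \<le> (\<integral>\<^sup>+z. (ennreal (\<bar>f (x - z) - f x\<bar> * sqrt (\<rho> z)))\<^sup>2 \<partial>lborel) *
      (\<integral>\<^sup>+z. (ennreal (sqrt (\<rho> z)))\<^sup>2 \<partial>lborel)"
    by (rule Cauchy_Schwarz_nn_integral) auto
  also have "(\<lambda>z. (ennreal (sqrt (\<rho> z)))\<^sup>2) = (\<lambda>z. ennreal (\<rho> z))"
    using nn by (auto simp: ennreal_power)
  also have "(\<integral>\<^sup>+z. ennreal (\<rho> z) \<partial>lborel) = 1"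
    using r(2) nn one by (subst nn_integral_eq_integral) auto
  also have "(\<lambda>z. (ennreal (\<bar>f (x - z) - f x\<bar> * sqrt (\<rho> z)))\<^sup>2) = (\<lambda>z. ennreal ((f (x - z) - f x)\<^sup>2) * ennreal (\<rho> z))"
    using nn by (auto simp: ennreal_power power_mult_distrib ennreal_mult)
  finally show ?thesis by simp
qed

text \<open>
  By Fubini's theorem the error is at most an average of \<open>transl_dist f z\<close> over \<open>norm z \<le> d\<close>.
\<close>

lemma mollify_L2:
  fixes f :: "'a::euclidean_space \<Rightarrow> real"
  assumes f: "sqint lborel f" and e: "e > 0"
  obtains \<delta> where "\<delta> > 0" "\<And>d \<rho>. d \<le> \<delta> \<Longrightarrow> mollifier d \<rho> \<Longrightarrow>
    sqint lborel (mollify \<rho> f) \<and> (\<integral>x. (mollify \<rho> f x - f x)\<^sup>2 \<partial>lborel) \<le> e"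
proof -
  have [measurable]: "f \<in> borel_measurable borel" using sqintD(1)[OF f] by simp
  have "\<forall>\<^sub>F z in at 0. dist (transl_dist f z) 0 < e"
    using transl_dist_tendsto[OF f] e by (intro tendstoD) auto
  then obtain d0 where d0: "d0 > 0" "\<And>z. z \<noteq> 0 \<Longrightarrow> norm z < d0 \<Longrightarrow> transl_dist f z < e"
    unfolding eventually_at by (auto simp: transl_dist_nonneg)
  have small: "transl_dist f z \<le> e" if "norm z < d0" for z
    using d0(2)[of z] that e by (cases "z = 0") (auto simp: transl_dist_def)
  show ?thesis
  proof (rule that[of "d0 / 2"])
    fix d and \<rho> :: "'a \<Rightarrow> real" assume d: "d \<le> d0 / 2" and m: "mollifier d \<rho>"
    note r = mollifier_sqint[OF m]
    note [measurable] = r(1) mollify_measurable[of f \<rho>]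
    have nn: "\<rho> z \<ge> 0" and z0: "z \<notin> cball 0 d \<Longrightarrow> \<rho> z = 0" and one: "(\<integral>z. \<rho> z \<partial>lborel) = 1" for z
      using m by (auto simp: mollifier_def)
    have "(\<integral>\<^sup>+x. ennreal ((mollify \<rho> f x - f x)\<^sup>2) \<partial>lborel) \<le>
        (\<integral>\<^sup>+x. \<integral>\<^sup>+z. ennreal ((f (x - z) - f x)\<^sup>2) * ennreal (\<rho> z) \<partial>lborel \<partial>lborel)"
      by (intro nn_integral_mono mollify_deviation[OF f m])
    also have "\<dots> = (\<integral>\<^sup>+z. \<integral>\<^sup>+x. ennreal ((f (x - z) - f x)\<^sup>2) * ennreal (\<rho> z) \<partial>lborel \<partial>lborel)"
      by (rule lborel_pair.Fubini'[symmetric]) measurable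
    also have "\<dots> \<le> (\<integral>\<^sup>+z. ennreal e * ennreal (\<rho> z) \<partial>lborel)"
    proof (rule nn_integral_mono)
      fix z
      have "(\<integral>\<^sup>+x. ennreal ((f (x - z) - f x)\<^sup>2) * ennreal (\<rho> z) \<partial>lborel) =
          (\<integral>\<^sup>+x. ennreal ((f (x - z) - f x)\<^sup>2) \<partial>lborel) * ennreal (\<rho> z)"
        by (rule nn_integral_multc) measurable
      also have "(\<integral>\<^sup>+x. ennreal ((f (x - z) - f x)\<^sup>2) \<partial>lborel) = ennreal (transl_dist f z)"
        unfolding transl_dist_def
        by (intro nn_integral_eq_integral sqintD(2) sqint_diff sqint_translate f) auto
      also have "ennreal (transl_dist f z) * ennreal (\<rho> z) \<le> ennreal e * ennreal (\<rho> z)"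
      proof (cases "norm z < d0")
        case True
        then show ?thesis by (intro mult_right_mono ennreal_leI small) auto
      next
        case False
        then have "\<rho> z = 0" using d d0(1) by (intro z0) auto
        then show ?thesis by simp
      qed
      finally show "(\<integral>\<^sup>+x. ennreal ((f (x - z) - f x)\<^sup>2) * ennreal (\<rho> z) \<partial>lborel) \<le> ennreal e * ennreal (\<rho> z)" .
    qed
    also have "\<dots> = ennreal e * (\<integral>\<^sup>+z. ennreal (\<rho> z) \<partial>lborel)"
      by (rule nn_integral_cmult) measurable
    also have "(\<integral>\<^sup>+z. ennreal (\<rho> z) \<partial>lborel) = 1"
      using r(2) nn one by (subst nn_integral_eq_integral) auto
    finally have le: "(\<integral>\<^sup>+x. ennreal ((mollify \<rho> f x - f x)\<^sup>2) \<partial>lborel) \<le> ennreal e" by simp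
    have i: "integrable lborel (\<lambda>x. (mollify \<rho> f x - f x)\<^sup>2)"
      by (rule integrableI_bounded) (use le in \<open>auto intro: le_less_trans\<close>)
    have "sqint lborel (\<lambda>x. (mollify \<rho> f x - f x) + f x)"
      by (intro sqint_add f) (use i in \<open>auto simp: sqint_def\<close>)
    moreover have "ennreal (\<integral>x. (mollify \<rho> f x - f x)\<^sup>2 \<partial>lborel) \<le> ennreal e"
      using le i by (subst (asm) nn_integral_eq_integral) auto
    ultimately show "sqint lborel (mollify \<rho> f) \<and> (\<integral>x. (mollify \<rho> f x - f x)\<^sup>2 \<partial>lborel) \<le> e"
      using e by simp
  qed (use d0 in simp)
qed

section \<open>The chain rule for weak derivatives\<close>

lemma nonpos_if_le_mult_sqrt:
  fixes I C :: real
  assumes le: "\<And>e. e > 0 \<Longrightarrow> I \<le> C * sqrt e"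
  shows "I \<le> 0"
proof (rule ccontr)
  assume "\<not> I \<le> 0"
  then have I: "I > 0" by simp
  then have C: "C > 0" using le[of 1] by simp
  have "I \<le> C * sqrt ((I / (2 * C))\<^sup>2)" by (rule le) (use I C in simp)
  also have "\<dots> = I / 2" using I C by simp
  finally show False using I by simp
qed

lemma integral_bound_Cauchy_Schwarz:
  assumes a: "sqint M a" and b: "sqint M b" and f: "f \<in> borel_measurable M"
    and c: "c \<ge> 0" and le: "\<And>x. \<bar>f x\<bar> \<le> c * (\<bar>a x\<bar> * \<bar>b x\<bar>)"
  shows "integrable M f" "\<bar>\<integral>x. f x \<partial>M\<bar> \<le> c * (sqrt (\<integral>x. (a x)\<^sup>2 \<partial>M) * sqrt (\<integral>x. (b x)\<^sup>2 \<partial>M))"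
proof -
  have i: "integrable M (\<lambda>x. c * (\<bar>a x\<bar> * \<bar>b x\<bar>))"
    using sqint_mult_integrable[OF sqint_abs[OF a] sqint_abs[OF b]] by simp
  show i2: "integrable M f"
    by (rule Bochner_Integration.integrable_bound[OF i f]) (use le c in \<open>auto simp: abs_mult\<close>)
  have "\<bar>\<integral>x. f x \<partial>M\<bar> \<le> (\<integral>x. \<bar>f x\<bar> \<partial>M)" by (rule integral_abs_bound)
  also have "\<dots> \<le> (\<integral>x. c * (\<bar>a x\<bar> * \<bar>b x\<bar>) \<partial>M)"
    by (intro integral_mono i le) (use i2 in auto)
  also have "\<dots> = c * (\<integral>x. \<bar>a x\<bar> * \<bar>b x\<bar> \<partial>M)" by simp
  also have "\<dots> \<le> c * (sqrt (\<integral>x. (a x)\<^sup>2 \<partial>M) * sqrt (\<integral>x. (b x)\<^sup>2 \<partial>M))"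
    using Cauchy_Schwarz_integral[OF sqint_abs[OF a] sqint_abs[OF b]] c by (intro mult_left_mono) simp_all
  finally show "\<bar>\<integral>x. f x \<partial>M\<bar> \<le> c * (sqrt (\<integral>x. (a x)\<^sup>2 \<partial>M) * sqrt (\<integral>x. (b x)\<^sup>2 \<partial>M))" .
qed

text \<open>
  For functions on the whole space that vanish outside \<open>\<Omega>\<close>, so that all integrals can be taken with
  respect to \<open>lborel\<close>.
\<close>

definition weak_partial :: "'a::euclidean_space set \<Rightarrow> 'a \<Rightarrow> ('a \<Rightarrow> real) \<Rightarrow> ('a \<Rightarrow> real) \<Rightarrow> bool" where
  "weak_partial \<Omega> i u g \<longleftrightarrow> (\<forall>\<phi>. test_function \<Omega> \<phi> \<longrightarrow>
     (\<integral>x. u x * frechet_derivative \<phi> (at x) i \<partial>lborel) = - (\<integral>x. g x * \<phi> x \<partial>lborel))"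

lemma mollifier_partial:
  assumes m: "mollifier \<delta> \<rho>" and i: "i \<in> Basis"
  defines "\<rho>' \<equiv> \<lambda>x. frechet_derivative \<rho> (at x) i"
  shows "has_partial i \<rho> \<rho>'" "continuous_on UNIV \<rho>'" "\<And>x. x \<notin> cball 0 \<delta> \<Longrightarrow> \<rho>' x = 0" "sqint lborel \<rho>'"
proof -
  have C: "Ck_fun (Suc 0) \<rho>" using m by (simp add: mollifier_def del: Ck_fun.simps)
  show "has_partial i \<rho> \<rho>'" unfolding \<rho>'_def by (rule Ck_fun_has_partial[OF C])
  show c: "continuous_on UNIV \<rho>'" using Ck_fun_SucD(2)[OF C i] by (simp add: \<rho>'_def)
  show z: "\<rho>' x = 0" if "x \<notin> cball 0 \<delta>" for x
    unfolding \<rho>'_def using m that by (intro frechet_derivative_zero_outside[of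
        "cball 0 \<delta>"]) (auto simp: mollifier_def)
  show "sqint lborel \<rho>'" by (rule continuous_compact_support_sqint(3)[OF c compact_cball z])
qed

text \<open>The reflected kernel \<open>\<lambda>y. \<rho> (x - y)\<close> is a test function when its support fits into \<open>\<Omega>\<close>.\<close>

lemma mollify_weak_partial:
  fixes u g :: "'a::euclidean_space \<Rightarrow> real"
  assumes w: "weak_partial \<Omega> i u g" and m: "mollifier \<delta> \<rho>" and i: "i \<in> Basis"
    and [measurable]: "u \<in> borel_measurable borel" "g \<in> borel_measurable borel"
    and x: "cball x \<delta> \<subseteq> \<Omega>"
  shows "mollify (\<lambda>x. frechet_derivative \<rho> (at x) i) u x = mollify \<rho> g x"
proof -
  let ?\<rho>' = "\<lambda>x. frechet_derivative \<rho> (at x) i"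
  have C: "Ck_fun k \<rho>" for k using m by (simp add: mollifier_def)
  have D: "(\<rho> has_derivative frechet_derivative \<rho> (at y)) (at y)" for y using Ck_fun_SucD(1)[OF C[of "Suc 0"]] .
  note [measurable] = mollifier_sqint(1)[OF m]
  have [measurable]: "?\<rho>' \<in> borel_measurable borel"
    by (rule borel_measurable_continuous_onI[OF mollifier_partial(2)[OF m i]])
  let ?\<phi> = "\<lambda>y. \<rho> (x - y)"
  have "test_function \<Omega> ?\<phi>"
    unfolding test_function_def
  proof (intro conjI allI)
    show "Ck_fun k ?\<phi>" for k using Ck_fun_comp_scaleR[OF C[of k], of "-1" x] by simp
    have "?\<phi> y \<noteq> 0 \<longrightarrow> y \<in> cball x \<delta>" for y using m by (auto simp: mollifier_def dist_norm)
    then show "compactly_supported_in \<Omega> ?\<phi>"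
      by (intro compactly_supported_in_I[of _ "cball x \<delta>"] x) auto
  qed
  moreover have "frechet_derivative ?\<phi> (at y) i = - ?\<rho>' (x - y)" for y
  proof -
    have "(?\<phi> has_derivative (\<lambda>v. frechet_derivative \<rho> (at (x - y)) (- v))) (at y)"
      by (rule has_derivative_compose[OF _ D]) (auto intro!: derivative_eq_intros)
    then have "frechet_derivative ?\<phi> (at y) = (\<lambda>v. frechet_derivative \<rho> (at (x - y)) (- v))"
      using frechet_derivative_at by metis
    then show ?thesis using linear_neg[OF has_derivative_linear[OF D]] by simp
  qed
  moreover have "mollify ?\<rho>' u x = (\<integral>y. u y * ?\<rho>' (x - y) \<partial>lborel)"
    "mollify \<rho> g x = (\<integral>y. g y * \<rho> (x - y) \<partial>lborel)"
    by (intro mollify_alt; measurable)+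
  ultimately show ?thesis
    using w[unfolded weak_partial_def, rule_format, of ?\<phi>] by simp
qed

text \<open>
  For the mollification \<open>v\<close> of \<open>u\<close> the classical chain rule holds, and on \<open>K\<close> the derivative of \<open>v\<close>
  is the mollification of \<open>g\<close>. The three terms of the bound are the errors of replacing \<open>v\<close> by \<open>u\<close>
  in \<open>F\<close>, of replacing \<open>v\<close> by \<open>u\<close> in \<open>F'\<close>, and of replacing the mollification of \<open>g\<close> by \<open>g\<close>.
\<close>

lemma weak_chain_rule_estimate:
  fixes u g :: "'a::euclidean_space \<Rightarrow> real" and F F' :: "real \<Rightarrow> real"
  assumes \<Omega>: "open \<Omega>" and i: "i \<in> Basis" and u: "sqint lborel u" and g: "sqint lborel g"
      and weak: "weak_partial \<Omega> i u g"
    and F: "\<And>s. (F has_real_derivative F' s) (at s)" "\<And>s. \<bar>F s\<bar> \<le> N" "\<And>s. \<bar>F' s\<bar> \<le> M"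
        "\<And>s t. \<bar>F' s - F' t\<bar> \<le> \<Lambda> * \<bar>s - t\<bar>"
    and P: "has_partial i \<psi> \<psi>'" "continuous_on UNIV \<psi>" "continuous_on UNIV \<psi>'"
    and K: "compact K" "K \<subseteq> \<Omega>" "\<And>x. x \<notin> K \<Longrightarrow> \<psi> x = 0" "\<And>x. x \<notin> K \<Longrightarrow> \<psi>' x = 0"
    and B: "\<And>x. \<bar>\<psi> x\<bar> \<le> B"
    and m: "mollifier \<delta> \<rho>" and \<delta>: "\<And>x. x \<in> K \<Longrightarrow> cball x \<delta> \<subseteq> \<Omega>"
    and mu: "sqint lborel (mollify \<rho> u)" "(\<integral>x. (mollify \<rho> u x - u x)\<^sup>2 \<partial>lborel) \<le> e"
    and mg: "sqint lborel (mollify \<rho> g)" "(\<integral>x. (mollify \<rho> g x - g x)\<^sup>2 \<partial>lborel) \<le> e"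
  shows "\<bar>(\<integral>x. F (u x) * \<psi>' x \<partial>lborel) + (\<integral>x. F' (u x) * g x * \<psi> x \<partial>lborel)\<bar> \<le>
    (M * sqrt (\<integral>x. (\<psi>' x)\<^sup>2 \<partial>lborel) + \<Lambda> * B * sqrt (\<integral>x. (g x)\<^sup>2 \<partial>lborel) + M * sqrt (\<integral>x. (\<psi> x)\<^sup>2 \<partial>lborel)) * sqrt e"
proof -
  have [measurable]: "u \<in> borel_measurable borel" "g \<in> borel_measurable borel" using sqintD(1)[OF u] sqintD(1)[OF g]
      by auto
  note psi = continuous_compact_support_sqint[OF P(2) K(1,3)] and psi' =
      continuous_compact_support_sqint[OF P(3) K(1,4)]
  note [measurable] = psi(1) psi'(1)
  obtain B' where B': "B' > 0" "\<And>x. norm (\<psi>' x) \<le> B'"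
    using continuous_compact_support_bounded[OF P(3) K(1,4)] by blast
  have N0: "N \<ge> 0" using F(2)[of 0] by linarith
  have M0: "M \<ge> 0" using F(3)[of 0] by linarith
  have L0: "\<Lambda> \<ge> 0" using F(4)[of 1 0] by simp
  have B0: "B \<ge> 0" using B[of 0] by linarith
  have [measurable]: "F \<in> borel_measurable borel"
    using F(1) by (intro borel_measurable_continuous_onI) (auto intro!: DERIV_continuous continuous_at_imp_continuous_on)
  have "\<Lambda>-lipschitz_on UNIV F'" using F(4) L0 by (intro lipschitz_onI) (auto simp: dist_real_def)
  then have [measurable]: "F' \<in> borel_measurable borel"
    by (intro borel_measurable_continuous_onI lipschitz_on_continuous_on)
  define v v' w where "v = mollify \<rho> u" and "v' = mollify (\<lambda>x. frechet_derivative \<rho> (at x) i) u" and "w = mollify \<rho> g"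
  note mp = mollifier_partial[OF m i]
  note rho_meas = mollifier_sqint(1)[OF m] borel_measurable_continuous_onI[OF mp(2)]
  have [measurable]: "v \<in> borel_measurable borel" "v' \<in> borel_measurable borel" "w \<in> borel_measurable borel"
    using rho_meas by (auto simp: v_def v'_def w_def intro!: mollify_measurable)
  note mu = mu[folded v_def] and mg = mg[folded w_def]
  have Pv: "has_partial i v v'"
    unfolding v_def v'_def
    by (rule mollify_partial[OF u mp(1) mollifier_sqint(4)[OF m] mp(2) compact_cball[of 0 \<delta>] _ mp(3)])
       (use m in \<open>auto simp: mollifier_def\<close>)
  obtain V where V: "\<And>x. \<bar>v' x\<bar> \<le> V" unfolding v'_def using mollify_bound[OF u mp(4)] by blast
  have V0: "V \<ge> 0" using V[of 0] by linarith
  have vw: "v' x * \<psi> x = w x * \<psi> x" for x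
  proof (cases "x \<in> K")
    case True
    then show ?thesis using mollify_weak_partial[OF weak m i _ _ \<delta>[OF True]] by (simp add: v'_def w_def)
  qed (simp add: K)
  let ?W' = "\<lambda>x. (F' (v x) * v' x) * \<psi> x + \<psi>' x * F (v x)"
  have sF: "sqint lborel (\<lambda>x. F (v x) * indicator K x)"
  proof (rule sqint_le(1))
    show "sqint lborel (\<lambda>x. N * indicator K x)"
      using K(1) emeasure_compact_finite[OF K(1)] by (intro sqint_indicator) (auto simp: borel_compact less_top)
    show "(\<lambda>x. F (v x) * indicator K x) \<in> borel_measurable lborel"
      using borel_compact[OF K(1)] by measurable
    show "\<bar>F (v x) * indicator K x\<bar> \<le> \<bar>N * indicator K x\<bar>" for x
      using F(2)[of "v x"] N0 by (auto simp: indicator_def)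
  qed
  have Z: "(\<integral>x. ?W' x \<partial>lborel) = 0"
  proof (rule integral_partial_eq_0[OF has_partial_mult[OF has_partial_compose[OF F(1) Pv] P(1)]])
    show "\<bar>?W' x\<bar> \<le> M * V * B + B' * N" for x
    proof -
      have "\<bar>(F' (v x) * v' x) * \<psi> x\<bar> \<le> M * V * B"
        unfolding abs_mult by (intro mult_mono F(3) V B) (use M0 V0 in auto)
      moreover have "\<bar>\<psi>' x * F (v x)\<bar> \<le> B' * N"
        unfolding abs_mult using B'(2)[of x] B'(1) by (intro mult_mono F(2)) auto
      ultimately show ?thesis by linarith
    qed
    have "integrable lborel (\<lambda>x. (F (v x) * indicator K x) * \<psi> x)"
      by (rule sqint_mult_integrable[OF sF psi(3)])
    also have "(\<lambda>x. (F (v x) * indicator K x) * \<psi> x) = (\<lambda>x. F (v x) * \<psi> x)"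
      by (rule ext) (metis K(3) indicator_simps mult.right_neutral mult_zero_right)
    finally show "integrable lborel (\<lambda>x. F (v x) * \<psi> x)" .
    show "?W' \<in> borel_measurable borel" by measurable
    show "F (v x) * \<psi> x = 0" if "x \<notin> K" for x using K(3)[OF that] by simp
  qed (use K in auto)
  have su: "sqint lborel (\<lambda>x. v x - u x)" and sg: "sqint lborel (\<lambda>x. w x - g x)"
    by (intro sqint_diff mu mg u g)+
  let ?a = "\<lambda>x. (F (u x) - F (v x)) * \<psi>' x"
  let ?b = "\<lambda>x. (F' (u x) - F' (v x)) * g x * \<psi> x"
  let ?c = "\<lambda>x. F' (v x) * (g x - w x) * \<psi> x"
  have e0: "e \<ge> 0" using order_trans[OF _ mu(2)] by simp
  have a: "integrable lborel ?a" "\<bar>\<integral>x. ?a x \<partial>lborel\<bar> \<le> M * (sqrt e * sqrt (\<integral>x. (\<psi>' x)\<^sup>2 \<partial>lborel))"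
  proof -
    have le: "\<bar>?a x\<bar> \<le> M * (\<bar>v x - u x\<bar> * \<bar>\<psi>' x\<bar>)" for x
    proof -
      have "norm (F (u x) - F (v x)) \<le> M * norm (u x - v x)"
        by (rule field_differentiable_bound[where S=UNIV and f'=F']) (use F(1,3) in auto)
      then have "\<bar>F (u x) - F (v x)\<bar> \<le> M * \<bar>v x - u x\<bar>" by (simp add: abs_minus_commute)
      then show ?thesis unfolding abs_mult mult.assoc[symmetric] by (intro mult_right_mono) auto
    qed
    note c = integral_bound_Cauchy_Schwarz[OF su psi'(3) _ M0 le]
    show "integrable lborel ?a" by (rule c(1)) measurable
    have "\<bar>\<integral>x. ?a x \<partial>lborel\<bar> \<le> M * (sqrt (\<integral>x. (v x - u x)\<^sup>2 \<partial>lborel) * sqrt (\<integral>x. (\<psi>' x)\<^sup>2 \<partial>lborel))"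
      by (rule c(2)) measurable
    also have "\<dots> \<le> M * (sqrt e * sqrt (\<integral>x. (\<psi>' x)\<^sup>2 \<partial>lborel))"
      using mu(2) M0 by (intro mult_left_mono mult_right_mono) auto
    finally show "\<bar>\<integral>x. ?a x \<partial>lborel\<bar> \<le> M * (sqrt e * sqrt (\<integral>x. (\<psi>' x)\<^sup>2 \<partial>lborel))" .
  qed
  have b: "integrable lborel ?b" "\<bar>\<integral>x. ?b x \<partial>lborel\<bar> \<le> (\<Lambda> * B) * (sqrt e * sqrt (\<integral>x. (g x)\<^sup>2 \<partial>lborel))"
  proof -
    have le: "\<bar>?b x\<bar> \<le> (\<Lambda> * B) * (\<bar>v x - u x\<bar> * \<bar>g x\<bar>)" for x
    proof -
      have "\<bar>?b x\<bar> \<le> (\<Lambda> * \<bar>u x - v x\<bar>) * \<bar>g x\<bar> * B"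
        unfolding abs_mult by (intro mult_mono F(4) B) (use L0 in auto)
      then show ?thesis by (simp add: algebra_simps abs_minus_commute)
    qed
    have LB: "\<Lambda> * B \<ge> 0" using L0 B0 by simp
    note c = integral_bound_Cauchy_Schwarz[OF su g _ LB le]
    show "integrable lborel ?b" by (rule c(1)) measurable
    have "\<bar>\<integral>x. ?b x \<partial>lborel\<bar> \<le> (\<Lambda> * B) * (sqrt (\<integral>x. (v x - u x)\<^sup>2 \<partial>lborel) * sqrt (\<integral>x. (g x)\<^sup>2 \<partial>lborel))"
      by (rule c(2)) measurable
    also have "\<dots> \<le> (\<Lambda> * B) * (sqrt e * sqrt (\<integral>x. (g x)\<^sup>2 \<partial>lborel))"
      using mu(2) LB by (intro mult_left_mono mult_right_mono) auto
    finally show "\<bar>\<integral>x. ?b x \<partial>lborel\<bar> \<le> (\<Lambda> * B) * (sqrt e * sqrt (\<integral>x. (g x)\<^sup>2 \<partial>lborel))" .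
  qed
  have c: "integrable lborel ?c" "\<bar>\<integral>x. ?c x \<partial>lborel\<bar> \<le> M * (sqrt e * sqrt (\<integral>x. (\<psi> x)\<^sup>2 \<partial>lborel))"
  proof -
    have le: "\<bar>?c x\<bar> \<le> M * (\<bar>w x - g x\<bar> * \<bar>\<psi> x\<bar>)" for x
    proof -
      have "\<bar>?c x\<bar> \<le> M * \<bar>g x - w x\<bar> * \<bar>\<psi> x\<bar>"
        unfolding abs_mult by (intro mult_mono F(3)) (use M0 in auto)
      then show ?thesis by (simp add: algebra_simps abs_minus_commute)
    qed
    note c = integral_bound_Cauchy_Schwarz[OF sg psi(3) _ M0 le]
    show "integrable lborel ?c" by (rule c(1)) measurable
    have "\<bar>\<integral>x. ?c x \<partial>lborel\<bar> \<le> M * (sqrt (\<integral>x. (w x - g x)\<^sup>2 \<partial>lborel) * sqrt (\<integral>x. (\<psi> x)\<^sup>2 \<partial>lborel))"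
      by (rule c(2)) measurable
    also have "\<dots> \<le> M * (sqrt e * sqrt (\<integral>x. (\<psi> x)\<^sup>2 \<partial>lborel))"
      using mg(2) M0 by (intro mult_left_mono mult_right_mono) auto
    finally show "\<bar>\<integral>x. ?c x \<partial>lborel\<bar> \<le> M * (sqrt e * sqrt (\<integral>x. (\<psi> x)\<^sup>2 \<partial>lborel))" .
  qed
  have i1: "integrable lborel (\<lambda>x. F (v x) * \<psi>' x)"
  proof -
    have "integrable lborel (\<lambda>x. (F (v x) * indicator K x) * \<psi>' x)"
      by (rule sqint_mult_integrable[OF sF psi'(3)])
    also have "(\<lambda>x. (F (v x) * indicator K x) * \<psi>' x) = (\<lambda>x. F (v x) * \<psi>' x)"
      by (rule ext) (metis K(4) indicator_simps mult.right_neutral mult_zero_right)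
    finally show ?thesis .
  qed
  have i2: "integrable lborel (\<lambda>x. F' (v x) * w x * \<psi> x)"
  proof (rule integral_bound_Cauchy_Schwarz(1)[OF mg(1) psi(3) _ M0])
    show "\<bar>F' (v x) * w x * \<psi> x\<bar> \<le> M * (\<bar>w x\<bar> * \<bar>\<psi> x\<bar>)" for x
      unfolding abs_mult mult.assoc[symmetric] by (intro mult_right_mono F(3)) auto
  qed measurable
  have "0 = (\<integral>x. F (v x) * \<psi>' x + F' (v x) * w x * \<psi> x \<partial>lborel)"
  proof -
    have "?W' x = F (v x) * \<psi>' x + F' (v x) * w x * \<psi> x" for x
      using vw[of x] by (simp add: mult.assoc mult.commute[of "\<psi>' x"])
    then show ?thesis using Z by (simp only:)
  qed
  also have "\<dots> = (\<integral>x. F (v x) * \<psi>' x \<partial>lborel) + (\<integral>x. F' (v x) * w x * \<psi> x \<partial>lborel)"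
    using i1 i2 by simp
  finally have Z2: "(\<integral>x. F (v x) * \<psi>' x \<partial>lborel) + (\<integral>x. F' (v x) * w x * \<psi> x \<partial>lborel) = 0" by simp
  have "(\<integral>x. F (u x) * \<psi>' x \<partial>lborel) = (\<integral>x. ?a x + F (v x) * \<psi>' x \<partial>lborel)"
    by (simp add: algebra_simps)
  also have "\<dots> = (\<integral>x. ?a x \<partial>lborel) + (\<integral>x. F (v x) * \<psi>' x \<partial>lborel)"
    using a(1) i1 by (rule Bochner_Integration.integral_add)
  finally have e1: "(\<integral>x. F (u x) * \<psi>' x \<partial>lborel) = \<dots>" .
  have "(\<integral>x. F' (u x) * g x * \<psi> x \<partial>lborel) = (\<integral>x. ?b x + ?c x + F' (v x) * w x * \<psi> x \<partial>lborel)"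
    by (simp add: algebra_simps)
  also have "\<dots> = (\<integral>x. ?b x + ?c x \<partial>lborel) + (\<integral>x. F' (v x) * w x * \<psi> x \<partial>lborel)"
    using b(1) c(1) i2 by (intro Bochner_Integration.integral_add Bochner_Integration.integrable_add)
  also have "(\<integral>x. ?b x + ?c x \<partial>lborel) = (\<integral>x. ?b x \<partial>lborel) + (\<integral>x. ?c x \<partial>lborel)"
    using b(1) c(1) by (rule Bochner_Integration.integral_add)
  finally have e2: "(\<integral>x. F' (u x) * g x * \<psi> x \<partial>lborel) =
    (\<integral>x. ?b x \<partial>lborel) + (\<integral>x. ?c x \<partial>lborel) + (\<integral>x. F' (v x) * w x * \<psi> x \<partial>lborel)" .
  have "(\<integral>x. F (u x) * \<psi>' x \<partial>lborel) + (\<integral>x. F' (u x) * g x * \<psi> x \<partial>lborel) =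
      (\<integral>x. ?a x \<partial>lborel) + (\<integral>x. ?b x \<partial>lborel) + (\<integral>x. ?c x \<partial>lborel)"
    using e1 e2 Z2 by linarith
  then have "\<bar>(\<integral>x. F (u x) * \<psi>' x \<partial>lborel) + (\<integral>x. F' (u x) * g x * \<psi> x \<partial>lborel)\<bar> \<le>
      M * (sqrt e * sqrt (\<integral>x. (\<psi>' x)\<^sup>2 \<partial>lborel)) + (\<Lambda> * B) * (sqrt e * sqrt (\<integral>x. (g x)\<^sup>2 \<partial>lborel)) +
      M * (sqrt e * sqrt (\<integral>x. (\<psi> x)\<^sup>2 \<partial>lborel))"
    using a(2) b(2) c(2) by linarith
  then show ?thesis by (simp add: algebra_simps)
qed

lemma compact_cball_nbhd:
  fixes K :: "'a::euclidean_space set"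
  assumes "compact K" "open \<Omega>" "K \<subseteq> \<Omega>"
  obtains d where "d > 0" "\<And>x. x \<in> K \<Longrightarrow> cball x d \<subseteq> \<Omega>"
proof (cases "K = {} \<or> \<Omega> = UNIV")
  case True
  then show ?thesis using that[of 1] by auto
next
  case False
  have "setdist K (- \<Omega>) > 0"
    using assms False by (subst setdist_gt_0_compact_closed) (auto simp: closed_Compl)
  moreover have "cball x (setdist K (- \<Omega>) / 2) \<subseteq> \<Omega>" if "x \<in> K" for x
  proof
    fix y assume y: "y \<in> cball x (setdist K (- \<Omega>) / 2)"
    show "y \<in> \<Omega>"
    proof (rule ccontr)
      assume "y \<notin> \<Omega>"
      then have "setdist K (- \<Omega>) \<le> dist x y" using that by (intro setdist_le_dist) auto
      then show False using y calculation by simp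
    qed
  qed
  ultimately show ?thesis using that[of "setdist K (- \<Omega>) / 2"] by auto
qed

text \<open>
  Letting the radius of mollification tend to \<open>0\<close>. The function \<open>\<psi>\<close> need not be smooth: fields of
  class \<open>C\<^sup>1\<close> are the ones in the definition of the perimeter.
\<close>

lemma weak_chain_rule:
  fixes u g :: "'a::euclidean_space \<Rightarrow> real" and F F' :: "real \<Rightarrow> real"
  assumes \<Omega>: "open \<Omega>" and i: "i \<in> Basis" and u: "sqint lborel u" and g: "sqint lborel g" and w: "weak_partial \<Omega> i u g"
    and F: "\<And>s. (F has_real_derivative F' s) (at s)" "\<And>s. \<bar>F s\<bar> \<le> N" "\<And>s. \<bar>F' s\<bar> \<le> M"
        "\<And>s t. \<bar>F' s - F' t\<bar> \<le> \<Lambda> * \<bar>s - t\<bar>"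
    and P: "has_partial i \<psi> \<psi>'" "continuous_on UNIV \<psi>" "continuous_on UNIV \<psi>'"
    and K: "compact K" "K \<subseteq> \<Omega>" "\<And>x. x \<notin> K \<Longrightarrow> \<psi> x = 0" "\<And>x. x \<notin> K \<Longrightarrow> \<psi>' x = 0"
  shows "(\<integral>x. F (u x) * \<psi>' x \<partial>lborel) = - (\<integral>x. F' (u x) * g x * \<psi> x \<partial>lborel)"
proof -
  obtain B where B: "B > 0" "\<And>x. norm (\<psi> x) \<le> B"
    using continuous_compact_support_bounded[OF P(2) K(1,3)] by blast
  obtain d where d: "d > 0" "\<And>x. x \<in> K \<Longrightarrow> cball x d \<subseteq> \<Omega>" using compact_cball_nbhd[OF K(1) \<Omega> K(2)] by blast
  let ?I = "\<bar>(\<integral>x. F (u x) * \<psi>' x \<partial>lborel) + (\<integral>x. F' (u x) * g x * \<psi> x \<partial>lborel)\<bar>"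
  let ?C = "M * sqrt (\<integral>x. (\<psi>' x)\<^sup>2 \<partial>lborel) + \<Lambda> * B * sqrt (\<integral>x. (g x)\<^sup>2 \<partial>lborel) + M * sqrt (\<integral>x. (\<psi> x)\<^sup>2 \<partial>lborel)"
  have le: "?I \<le> ?C * sqrt e" if e: "e > 0" for e
  proof -
    obtain d1 where d1: "d1 > 0" "\<And>d \<rho>. d \<le> d1 \<Longrightarrow> mollifier d \<rho> \<Longrightarrow>
      sqint lborel (mollify \<rho> u) \<and> (\<integral>x. (mollify \<rho> u x - u x)\<^sup>2 \<partial>lborel) \<le> e"
      using mollify_L2[OF u e] by blast
    obtain d2 where d2: "d2 > 0" "\<And>d \<rho>. d \<le> d2 \<Longrightarrow> mollifier d \<rho> \<Longrightarrow>
      sqint lborel (mollify \<rho> g) \<and> (\<integral>x. (mollify \<rho> g x - g x)\<^sup>2 \<partial>lborel) \<le> e"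
      using mollify_L2[OF g e] by blast
    \<comment> \<open>Small enough for the balls around \<open>K\<close> and for both mean square errors.\<close>
    define \<delta> where "\<delta> = min d (min d1 d2)"
    have \<delta>: "\<delta> > 0" "\<delta> \<le> d" "\<delta> \<le> d1" "\<delta> \<le> d2" using d d1 d2 by (auto simp: \<delta>_def)
    obtain \<rho> :: "'a \<Rightarrow> real" where m: "mollifier \<delta> \<rho>" using mollifier_exists[OF \<delta>(1)] by blast
    show ?thesis
    proof (rule weak_chain_rule_estimate[OF \<Omega> i u g w F P K _ m])
      show "\<bar>\<psi> x\<bar> \<le> B" for x using B(2)[of x] by simp
      show "cball x \<delta> \<subseteq> \<Omega>" if "x \<in> K" for x using d(2)[OF that] \<delta>(2) by (meson order_trans subset_cball)
    qed (use d1(2)[OF \<delta>(3) m] d2(2)[OF \<delta>(4) m] in auto)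
  qed
  have "?I \<le> 0" by (rule nonpos_if_le_mult_sqrt[OF le])
  then show ?thesis by linarith
qed

section \<open>Perimeters of superlevel sets\<close>

text \<open>An antiderivative of \<open>max 0\<close>.\<close>

definition ramp_sq :: "real \<Rightarrow> real" where "ramp_sq s = (max 0 s)\<^sup>2 / 2"

lemma ramp_sq_deriv: "(ramp_sq has_real_derivative max 0 s) (at s)"
proof (cases "s = 0")
  case False
  show ?thesis
  proof (cases "s > 0")
    case True
    have *: "((\<lambda>s. s\<^sup>2 / 2) has_real_derivative max 0 s) (at s)"
      using True by (auto intro!: derivative_eq_intros)
    show ?thesis
      by (rule has_field_derivative_transform_within_open[OF *, of "{0<..}"])
         (use True in \<open>auto simp: ramp_sq_def\<close>)
  next
    case F: False
    have *: "((\<lambda>s. 0) has_real_derivative max 0 s) (at s)"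
      using F by auto
    show ?thesis
      by (rule has_field_derivative_transform_within_open[OF *, of "{..<0}"])
         (use F False in \<open>auto simp: ramp_sq_def\<close>)
  qed
next
  case [simp]: True
  have "((\<lambda>h. (ramp_sq (0 + h) - ramp_sq 0) / h) \<longlongrightarrow> 0) (at 0)"
  proof (rule Lim_null_comparison[where g="\<lambda>h. \<bar>h\<bar>"])
    show "\<forall>\<^sub>F h in at 0. norm ((ramp_sq (0 + h) - ramp_sq 0) / h) \<le> \<bar>h\<bar>"
      by (intro always_eventually) (auto simp: ramp_sq_def max_def power2_eq_square abs_mult)
    show "((\<lambda>h::real. \<bar>h\<bar>) \<longlongrightarrow> 0) (at 0)" by (intro tendsto_rabs_zero tendsto_ident_at)
  qed
  then show ?thesis unfolding has_field_derivative_iff by simp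
qed

text \<open>
  As a function of \<open>a\<close> this rises linearly from \<open>0\<close> to \<open>1\<close> on \<open>[0, \<eta>]\<close>, is \<open>1\<close> up to \<open>h - \<eta>\<close> and
  returns linearly to \<open>0\<close> at \<open>h\<close>.
\<close>

definition trapezoid :: "real \<Rightarrow> real \<Rightarrow> real \<Rightarrow> real" where
  "trapezoid h \<eta> a = (max 0 a - max 0 (a - \<eta>) - max 0 (a - h + \<eta>) + max 0 (a - h)) / \<eta>"

text \<open>The antiderivative of \<open>trapezoid h \<eta>\<close> that vanishes at \<open>0\<close>: a step of height \<open>h - \<eta>\<close>.\<close>

definition smoothed_step :: "real \<Rightarrow> real \<Rightarrow> real \<Rightarrow> real" where
  "smoothed_step h \<eta> a = (ramp_sq a - ramp_sq (a - \<eta>) - ramp_sq (a - h + \<eta>) + ramp_sq (a - h)) / \<eta>"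

lemma smoothed_step_deriv:
  assumes "\<eta> > 0"
  shows "((\<lambda>s. smoothed_step h \<eta> (s - t)) has_real_derivative trapezoid h \<eta> (s - t)) (at s)"
proof -
  have d: "((\<lambda>s. ramp_sq (s - c)) has_real_derivative max 0 (s - c)) (at s)" for c
  proof -
    have "((\<lambda>s. s - c) has_real_derivative 1) (at s)" by (auto intro!: derivative_eq_intros)
    from DERIV_chain2[OF ramp_sq_deriv this] show ?thesis by simp
  qed
  have "((\<lambda>s. (ramp_sq (s - t) - ramp_sq (s - (t + \<eta>)) - ramp_sq (s - (t + h - \<eta>)) + ramp_sq (s - (t +
      h))) / \<eta>) has_real_derivative
     (max 0 (s - t) - max 0 (s - (t + \<eta>)) - max 0 (s - (t + h - \<eta>)) + max 0 (s - (t + h))) / \<eta>) (at s)"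
    by (intro DERIV_cdivide DERIV_add DERIV_diff d)
  then show ?thesis
    by (simp add: smoothed_step_def trapezoid_def algebra_simps)
qed

lemma trapezoid_bounds:
  assumes "\<eta> > 0" "2 * \<eta> \<le> h"
  shows "0 \<le> trapezoid h \<eta> a" "trapezoid h \<eta> a \<le> 1" "a \<le> 0 \<or> h \<le> a \<Longrightarrow> trapezoid h \<eta> a = 0"
    "\<bar>trapezoid h \<eta> a - trapezoid h \<eta> b\<bar> \<le> (4 / \<eta>) * \<bar>a - b\<bar>"
proof -
  show "0 \<le> trapezoid h \<eta> a"
    unfolding trapezoid_def using assms by (intro divide_nonneg_pos) (auto simp: max_def)
  show "trapezoid h \<eta> a \<le> 1"
    unfolding trapezoid_def using assms by (subst pos_divide_le_eq) (auto simp: max_def)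
  show "a \<le> 0 \<or> h \<le> a \<Longrightarrow> trapezoid h \<eta> a = 0"
    using assms by (auto simp: trapezoid_def max_def)
  have l: "\<bar>max 0 a - max 0 b\<bar> \<le> \<bar>a - b\<bar>" "\<bar>max 0 (a - \<eta>) - max 0 (b - \<eta>)\<bar> \<le> \<bar>a - b\<bar>"
    "\<bar>max 0 (a - h + \<eta>) - max 0 (b - h + \<eta>)\<bar> \<le> \<bar>a - b\<bar>" "\<bar>max 0 (a - h) - max 0 (b - h)\<bar> \<le> \<bar>a - b\<bar>"
    by (auto simp: max_def)
  let ?N = "\<lambda>a. max 0 a - max 0 (a - \<eta>) - max 0 (a - h + \<eta>) + max 0 (a - h)"
  have aux: "\<bar>(p1 - p2 - p3 + p4) - (q1 - q2 - q3 + q4)\<bar> \<le> 4 * d"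
    if "\<bar>p1 - q1\<bar> \<le> d" "\<bar>p2 - q2\<bar> \<le> d" "\<bar>p3 - q3\<bar> \<le> d" "\<bar>p4 - q4\<bar> \<le> d" for p1 p2 p3 p4 q1 q2 q3 q4 d :: real
    using that by linarith
  have "\<bar>trapezoid h \<eta> a - trapezoid h \<eta> b\<bar> = \<bar>?N a - ?N b\<bar> / \<eta>"
    unfolding trapezoid_def diff_divide_distrib[symmetric] abs_divide using assms by simp
  also have "\<dots> \<le> 4 * \<bar>a - b\<bar> / \<eta>"
    using assms by (intro divide_right_mono aux[OF l]) simp
  finally show "\<bar>trapezoid h \<eta> a - trapezoid h \<eta> b\<bar> \<le> (4 / \<eta>) * \<bar>a - b\<bar>" by simp
qed

lemma smoothed_step_values:
  assumes "\<eta> > 0" "2 * \<eta> \<le> h"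
  shows "a \<le> 0 \<Longrightarrow> smoothed_step h \<eta> a = 0" "h \<le> a \<Longrightarrow> smoothed_step h \<eta> a = h - \<eta>"
    "0 \<le> smoothed_step h \<eta> a" "smoothed_step h \<eta> a \<le> h - \<eta>"
proof -
  show lo: "smoothed_step h \<eta> a = 0" if "a \<le> 0" for a
    using that assms by (auto simp: smoothed_step_def ramp_sq_def max_def)
  show hi: "smoothed_step h \<eta> a = h - \<eta>" if "h \<le> a" for a
  proof -
    have "ramp_sq a - ramp_sq (a - \<eta>) - ramp_sq (a - h + \<eta>) + ramp_sq (a - h) =
       (a\<^sup>2 - (a - \<eta>)\<^sup>2 - (a - h + \<eta>)\<^sup>2 + (a - h)\<^sup>2) / 2"
      using that assms by (simp add: ramp_sq_def max_def field_simps)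
    also have "\<dots> = \<eta> * (h - \<eta>)" by (simp add: power2_eq_square field_simps)
    finally show ?thesis using assms by (simp add: smoothed_step_def)
  qed
  have d: "(smoothed_step h \<eta> has_real_derivative trapezoid h \<eta> s) (at s)" for s
    using smoothed_step_deriv[OF assms(1), of h 0 s] by simp
  have mono: "smoothed_step h \<eta> x \<le> smoothed_step h \<eta> y" if "x \<le> y" for x y
    by (rule DERIV_nonneg_imp_nondecreasing[OF that]) (use d trapezoid_bounds(1)[OF assms] in blast)
  show "0 \<le> smoothed_step h \<eta> a"
    using mono[of "min 0 a" a] lo[of "min 0 a"] by simp
  show "smoothed_step h \<eta> a \<le> h - \<eta>"
    using mono[of a "max h a"] hi[of "max h a"] by simp
qed

text \<open>
  Borel representatives of a nonnegative Sobolev function and its gradient, extended by zero. Note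
  that the extension is in general no Sobolev function on the whole space: \<open>weak\<close> speaks of test
  functions supported in \<open>\<Omega>\<close>.
\<close>

locale sobolev_function =
  fixes \<Omega> :: "'a::euclidean_space set" and u :: "'a \<Rightarrow> real" and g :: "'a \<Rightarrow> 'a"
  assumes \<Omega>: "open \<Omega>" "bounded \<Omega>"
    and u: "sqint lborel u" and g[measurable]: "g \<in> borel_measurable borel"
        and g2: "integrable lborel (\<lambda>x. (norm (g x))\<^sup>2)"
    and weak: "\<And>i. i \<in> Basis \<Longrightarrow> weak_partial \<Omega> i u (\<lambda>x. g x \<bullet> i)"
    and out: "\<And>x. x \<notin> \<Omega> \<Longrightarrow> u x = 0" "\<And>x. x \<notin> \<Omega> \<Longrightarrow> g x = 0"
    and nonneg: "\<And>x. u x \<ge> 0"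
begin

lemma u_meas[measurable]: "u \<in> borel_measurable borel"
  using sqintD(1)[OF u] by simp

lemma \<Omega>_borel[measurable]: "\<Omega> \<in> sets borel" using \<Omega>(1) by simp

lemma finite_subset_\<Omega>: "A \<subseteq> \<Omega> \<Longrightarrow> emeasure lborel A < \<infinity>"
  using emeasure_bounded_finite[of A] bounded_subset[OF \<Omega>(2)] by blast

lemma norm_g_sqint: "sqint lborel (\<lambda>x. norm (g x))"
  using g2 by (simp add: sqint_def)

lemma g_component_sqint: "i \<in> Basis \<Longrightarrow> sqint lborel (\<lambda>x. g x \<bullet> i)"
  by (rule sqint_le(1)[OF norm_g_sqint]) (auto intro: Basis_le_norm)

lemma norm_g_integrable: "integrable lborel (\<lambda>x. norm (g x))"
proof -
  have "integrable lborel (\<lambda>x. norm (g x) * indicator \<Omega> x)"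
    using finite_subset_\<Omega>[of \<Omega>] sqint_indicator[of \<Omega> lborel 1]
    by (intro sqint_mult_integrable norm_g_sqint) auto
  also have "(\<lambda>x. norm (g x) * indicator \<Omega> x) = (\<lambda>x. norm (g x))"
    by (rule ext) (metis indicator_simps mult.right_neutral mult_zero_right norm_zero out(2))
  finally show ?thesis .
qed

text \<open>The mass of the gradient between levels.\<close>

definition slab :: "real set \<Rightarrow> real" where
  "slab A = (\<integral>x. indicator {x. u x \<in> A} x * norm (g x) \<partial>lborel)"

text \<open>
  Summing the chain rule for \<open>F \<circ> u\<close> over the components of \<open>\<phi>\<close> turns the left-hand side into the
  integral of \<open>- F' (u x) * (g x \<bullet> \<phi> x)\<close>, where \<open>F'\<close> is at most the indicator of \<open>A\<close>.
\<close>

lemma divergence_estimate: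
  fixes \<phi> :: "'a \<Rightarrow> 'a"
  assumes \<phi>: "Ck_fun 1 \<phi>" "compactly_supported_in \<Omega> \<phi>" "\<And>x. norm (\<phi> x) \<le> 1"
    and F: "\<And>s. (F has_real_derivative F' s) (at s)" "\<And>s. \<bar>F s\<bar> \<le> N" "\<And>s. 0 \<le> F' s" "\<And>s. F' s \<le> indicator A s"
      "\<And>s t. \<bar>F' s - F' t\<bar> \<le> \<Lambda> * \<bar>s - t\<bar>" and A[measurable]: "A \<in> sets borel"
  shows "(\<integral>x. F (u x) * divergence \<phi> x \<partial>lborel) \<le> slab A"
proof -
  obtain K where K: "compact K" "K \<subseteq> \<Omega>" "\<And>x. x \<notin> K \<Longrightarrow> \<phi> x = 0" using compactly_supported_inD[OF \<phi>(2)] by metis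
  let ?D = "\<lambda>i x. frechet_derivative \<phi> (at x) i \<bullet> i"
  have C: "Ck_fun (Suc 0) \<phi>" using \<phi>(1) by simp
  have F1: "\<bar>F' s\<bar> \<le> 1" for s using F(3,4)[of s] by (auto simp: indicator_def split: if_splits intro: order_trans)
  have "\<Lambda> \<ge> 0" using F(5)[of 1 0] by simp
  then have "\<Lambda>-lipschitz_on UNIV F'" using F(5) by (intro lipschitz_onI) (auto simp: dist_real_def)
  then have [measurable]: "F' \<in> borel_measurable borel"
    by (intro borel_measurable_continuous_onI lipschitz_on_continuous_on)
  have [measurable]: "F \<in> borel_measurable borel"
    using F(1) by (intro borel_measurable_continuous_onI) (auto intro!: DERIV_continuous continuous_at_imp_continuous_on)
  have c\<phi>: "continuous_on UNIV (\<lambda>x. \<phi> x \<bullet> i)" for i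
    using Ck_fun_continuous[OF \<phi>(1)] by (intro continuous_intros)
  have cD: "continuous_on UNIV (?D i)" if "i \<in> Basis" for i
    using Ck_fun_SucD(2)[OF C that] by (intro continuous_intros) simp
  have KD: "?D i x = 0" if "x \<notin> K" for x i
    using frechet_derivative_zero_outside[OF K(1,3) that] by simp
  have K\<phi>: "\<phi> x \<bullet> i = 0" if "x \<notin> K" for x i using K(3)[OF that] by simp
  have P: "has_partial i (\<lambda>x. \<phi> x \<bullet> i) (?D i)" for i
    unfolding has_partial_def
  proof
    fix x :: 'a
    have D: "(\<phi> has_derivative frechet_derivative \<phi> (at x)) (at (x + 0 *\<^sub>R i))" using Ck_fun_SucD(1)[OF C, of x]
        by simp
    have "((\<lambda>t. \<phi> (x + t *\<^sub>R i) \<bullet> i) has_derivative (\<lambda>t. frechet_derivative \<phi> (at x) (t *\<^sub>R i) \<bullet> i)) (at 0)"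
      by (intro has_derivative_inner_left has_derivative_compose[where f="\<lambda>t. x + t *\<^sub>R i" and g=\<phi>, OF _ D])
        (auto intro!: derivative_eq_intros)
    moreover have "frechet_derivative \<phi> (at x) (t *\<^sub>R i) \<bullet> i = (frechet_derivative \<phi> (at x) i \<bullet> i) * t" for t
      using has_derivative_linear[OF D] by (simp add: linear_scale)
    ultimately show "((\<lambda>t. \<phi> (x + t *\<^sub>R i) \<bullet> i) has_real_derivative frechet_derivative \<phi> (at x) i \<bullet> i) (at 0)"
      by (simp add: has_field_derivative_def)
  qed
  note q\<phi> = continuous_compact_support_sqint[OF c\<phi> K(1) K\<phi>] and qD = continuous_compact_support_sqint[OF cD K(1) KD]
  note [measurable] = q\<phi>(1)
  have chain: "(\<integral>x. F (u x) * ?D i x \<partial>lborel) = - (\<integral>x. F' (u x) * (g x \<bullet> i) * (\<phi> x \<bullet> i) \<partial>lborel)" if i: "i \<in> Basis"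
      for i
    by (rule weak_chain_rule[OF \<Omega>(1) i u g_component_sqint[OF i] weak[OF i] F(1,2) F1 F(5) P c\<phi> cD[OF i] K(1,2) K\<phi> KD])
  have iF: "integrable lborel (\<lambda>x. F (u x) * ?D i x)" if i: "i \<in> Basis" for i
  proof (rule Bochner_Integration.integrable_bound[OF integrable_mult_right[OF integrable_abs[OF qD(2)[OF i]], of N]])
    show "AE x in lborel. norm (F (u x) * ?D i x) \<le> norm (N * \<bar>?D i x\<bar>)"
    proof (rule AE_I2)
      fix x
      have "\<bar>F (u x) * ?D i x\<bar> \<le> N * \<bar>?D i x\<bar>" unfolding abs_mult by (intro mult_right_mono F) auto
      then show "norm (F (u x) * ?D i x) \<le> norm (N * \<bar>?D i x\<bar>)" by simp
    qed
  qed (use qD(1)[OF i] in measurable)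
  have ig: "integrable lborel (\<lambda>x. F' (u x) * (g x \<bullet> i) * (\<phi> x \<bullet> i))" if i: "i \<in> Basis" for i
  proof (rule Bochner_Integration.integrable_bound[OF norm_g_integrable])
    show "AE x in lborel. norm (F' (u x) * (g x \<bullet> i) * (\<phi> x \<bullet> i)) \<le> norm (norm (g x))"
    proof (rule AE_I2)
      fix x
      have "\<bar>\<phi> x \<bullet> i\<bar> \<le> 1" using Basis_le_norm[OF i, of "\<phi> x"] \<phi>(3)[of x] by linarith
      then have "\<bar>F' (u x)\<bar> * \<bar>g x \<bullet> i\<bar> * \<bar>\<phi> x \<bullet> i\<bar> \<le> 1 * norm (g x) * 1"
        by (intro mult_mono F1 Basis_le_norm i) auto
      then show "norm (F' (u x) * (g x \<bullet> i) * (\<phi> x \<bullet> i)) \<le> norm (norm (g x))" by (simp add: abs_mult)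
    qed
  qed measurable
  have "(\<integral>x. F (u x) * divergence \<phi> x \<partial>lborel) = (\<Sum>i\<in>Basis. \<integral>x. F (u x) * ?D i x \<partial>lborel)"
    unfolding divergence_def sum_distrib_left by (intro Bochner_Integration.integral_sum iF)
  also have "\<dots> = - (\<Sum>i\<in>Basis. \<integral>x. F' (u x) * (g x \<bullet> i) * (\<phi> x \<bullet> i) \<partial>lborel)"
    using chain by (simp add: sum_negf)
  also have "\<dots> = - (\<integral>x. (\<Sum>i\<in>Basis. F' (u x) * (g x \<bullet> i) * (\<phi> x \<bullet> i)) \<partial>lborel)"
    by (subst Bochner_Integration.integral_sum) (auto intro: ig)
  also have "\<dots> = (\<integral>x. - (\<Sum>i\<in>Basis. F' (u x) * (g x \<bullet> i) * (\<phi> x \<bullet> i)) \<partial>lborel)"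
    by simp
  also have "\<dots> \<le> (\<integral>x. indicator {x. u x \<in> A} x * norm (g x) \<partial>lborel)"
  proof (rule integral_mono)
    show "integrable lborel (\<lambda>x. - (\<Sum>i\<in>Basis. F' (u x) * (g x \<bullet> i) * (\<phi> x \<bullet> i)))"
      by (intro Bochner_Integration.integrable_minus Bochner_Integration.integrable_sum ig)
    show "integrable lborel (\<lambda>x. indicator {x. u x \<in> A} x * norm (g x))"
      using integrable_mult_indicator[OF _ norm_g_integrable, of "{x. u x \<in> A}"] by simp
    fix x
    have "- (\<Sum>i\<in>Basis. F' (u x) * (g x \<bullet> i) * (\<phi> x \<bullet> i)) = - (F' (u x) * (g x \<bullet> \<phi> x))"
      by (simp add: euclidean_inner[of "g x" "\<phi> x"] sum_distrib_left mult.assoc)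
    also have "\<dots> \<le> F' (u x) * (norm (g x) * norm (\<phi> x))"
      using Cauchy_Schwarz_ineq2[of "g x" "\<phi> x"] F(3)[of "u x"] mult_left_mono[of "- (g x \<bullet> \<phi> x)"
          "norm (g x) * norm (\<phi> x)" "F' (u x)"]
      by simp
    also have "\<dots> \<le> indicator A (u x) * (norm (g x) * 1)"
      by (intro mult_mono F \<phi>) auto
    finally show "- (\<Sum>i\<in>Basis. F' (u x) * (g x \<bullet> i) * (\<phi> x \<bullet> i)) \<le> indicator {x. u x \<in> A} x * norm (g x)"
      by (simp add: indicator_def)
  qed
  finally show ?thesis by (simp add: slab_def)
qed

text \<open>
  Take for \<open>F\<close> a smoothed step of height \<open>h - \<eta>\<close> over \<open>[t, t + h]\<close>. Then \<open>F \<circ> u\<close> differs from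
  \<open>(h - \<eta>)\<close> times the indicator of \<open>{u > t}\<close> only where \<open>t < u < t + h\<close>. Finally \<open>\<eta>\<close> tends to \<open>0\<close>.
\<close>

lemma superlevel_divergence_bound:
  fixes \<phi> :: "'a \<Rightarrow> 'a"
  assumes \<phi>: "Ck_fun 1 \<phi>" "compactly_supported_in \<Omega> \<phi>" "\<And>x. norm (\<phi> x) \<le> 1"
    and C: "\<And>x. \<bar>divergence \<phi> x\<bar> \<le> C" and dm[measurable]: "divergence \<phi> \<in> borel_measurable borel"
    and t: "t \<ge> 0" and h: "h > 0"
  shows "h * (\<integral>x. indicator {x. u x > t} x * divergence \<phi> x \<partial>lborel) \<le>
     slab {t<..t + h} + h * C * measure lborel {x. t < u x \<and> u x < t + h}"
proof -
  let ?E = "{x. u x > t}" and ?A = "{x. t < u x \<and> u x < t + h}"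
  let ?I = "\<integral>x. indicator ?E x * divergence \<phi> x \<partial>lborel"
  have C0: "C \<ge> 0" using C[of 0] by linarith
  have E: "?E \<subseteq> \<Omega>" using out(1) t by fastforce
  have A: "?A \<subseteq> \<Omega>" using E by auto
  have [measurable]: "?E \<in> sets borel" "?A \<in> sets borel" by measurable
  have fin: "emeasure lborel ?E < \<infinity>" "emeasure lborel ?A < \<infinity>"
    by (rule finite_subset_\<Omega>[OF E], rule finite_subset_\<Omega>[OF A])
  have iE: "integrable lborel (\<lambda>x. indicator ?E x * divergence \<phi> x)"
  proof (rule Bochner_Integration.integrable_bound)
    show "integrable lborel (\<lambda>x. C * indicator ?E x)" using fin by simp
    show "AE x in lborel. norm (indicator ?E x * divergence \<phi> x) \<le> norm (C * indicator ?E x)"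
      using C C0 by (intro AE_I2) (auto simp: indicator_def)
  qed measurable
  have *: "(h - \<eta>) * ?I \<le> slab {t<..t + h} + h * C * measure lborel ?A" if \<eta>: "\<eta> > 0" "2 * \<eta> \<le> h" for \<eta>
  proof -
    let ?F = "\<lambda>s. smoothed_step h \<eta> (s - t)" and ?F' = "\<lambda>s. trapezoid h \<eta> (s - t)"
    have [measurable]: "?F \<in> borel_measurable borel"
      using smoothed_step_deriv[OF \<eta>(1)]
      by (intro borel_measurable_continuous_onI) (auto intro!: DERIV_continuous continuous_at_imp_continuous_on)
    have 1: "(\<integral>x. ?F (u x) * divergence \<phi> x \<partial>lborel) \<le> slab {t<..t + h}"
    proof (rule divergence_estimate[OF \<phi>, where F = ?F and F' = ?F' and N = h and \<Lambda> = "4 / \<eta>"])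
      show "(?F has_real_derivative ?F' s) (at s)" for s by (rule smoothed_step_deriv[OF \<eta>(1)])
      show "\<bar>?F s\<bar> \<le> h" for s
        using smoothed_step_values(3,4)[OF \<eta>, of "s - t"] \<eta> by linarith
      show "0 \<le> ?F' s" for s by (rule trapezoid_bounds(1)[OF \<eta>])
      show "?F' s \<le> indicator {t<..t + h} s" for s
        using trapezoid_bounds(2,3)[OF \<eta>, of "s - t"] by (auto simp: indicator_def)
      show "\<bar>?F' s - ?F' r\<bar> \<le> 4 / \<eta> * \<bar>s - r\<bar>" for s r
        using trapezoid_bounds(4)[OF \<eta>, of "s - t" "r - t"] by simp
    qed simp
    let ?e = "\<lambda>x. ((h - \<eta>) * indicator ?E x - ?F (u x)) * divergence \<phi> x"
    have le: "\<bar>?e x\<bar> \<le> (h * C) * indicator ?A x" for x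
    proof (cases "x \<in> ?A")
      case True
      have "\<bar>(h - \<eta>) * indicator ?E x - ?F (u x)\<bar> \<le> h"
        using smoothed_step_values(3,4)[OF \<eta>, of "u x - t"] \<eta> True by simp
      then have "\<bar>?e x\<bar> \<le> h * C" unfolding abs_mult using h by (intro mult_mono C) auto
      then show ?thesis using True by simp
    next
      case False
      then have "(h - \<eta>) * indicator ?E x - ?F (u x) = 0"
        using smoothed_step_values(1,2)[OF \<eta>, of "u x - t"] by (cases "u x > t") auto
      then show ?thesis using False by simp
    qed
    have iA: "integrable lborel (\<lambda>x. (h * C) * indicator ?A x)" using fin by simp
    have ie: "integrable lborel ?e"
    proof (rule Bochner_Integration.integrable_bound[OF iA])
      show "AE x in lborel. norm (?e x) \<le> norm ((h * C) * indicator ?A x)"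
        using le h C0 by (intro AE_I2) (simp add: abs_mult)
    qed measurable
    have iF: "integrable lborel (\<lambda>x. ?F (u x) * divergence \<phi> x)"
    proof -
      have "integrable lborel (\<lambda>x. (h - \<eta>) * (indicator ?E x * divergence \<phi> x) - ?e x)"
        using iE ie by simp
      also have "(\<lambda>x. (h - \<eta>) * (indicator ?E x * divergence \<phi> x) - ?e x) = (\<lambda>x. ?F (u x) * divergence \<phi> x)"
        by (simp add: algebra_simps)
      finally show ?thesis .
    qed
    have eq: "?e x + ?F (u x) * divergence \<phi> x = (h - \<eta>) * (indicator ?E x * divergence \<phi> x)" for x
      by (simp add: algebra_simps)
    have "(h - \<eta>) * ?I = (\<integral>x. ?e x + ?F (u x) * divergence \<phi> x \<partial>lborel)"
      by (simp only: eq integral_mult_right_zero)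
    also have "\<dots> = (\<integral>x. ?e x \<partial>lborel) + (\<integral>x. ?F (u x) * divergence \<phi> x \<partial>lborel)"
      using ie iF by (rule Bochner_Integration.integral_add)
    also have "(\<integral>x. ?e x \<partial>lborel) \<le> (\<integral>x. (h * C) * indicator ?A x \<partial>lborel)"
    proof (rule integral_mono[OF ie iA])
      show "?e x \<le> (h * C) * indicator ?A x" for x using le[of x] by linarith
    qed
    also have "(\<integral>x. (h * C) * indicator ?A x \<partial>lborel) = h * C * measure lborel ?A" by simp
    finally show ?thesis using 1 by linarith
  qed
  have "(\<lambda>k. (h - h / 2 * inverse (real (Suc k))) * ?I) \<longlonglongrightarrow> (h - h / 2 * 0) * ?I"
    by (intro tendsto_intros LIMSEQ_inverse_real_of_nat)
  then have "(h - h / 2 * 0) * ?I \<le> slab {t<..t + h} + h * C * measure lborel ?A"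
  proof (rule LIMSEQ_le_const2, intro exI[of _ 0] allI impI)
    fix k
    show "(h - h / 2 * inverse (real (Suc k))) * ?I \<le> slab {t<..t + h} + h * C * measure lborel ?A"
    proof (rule *)
      show "0 < h / 2 * inverse (real (Suc k))" using h by simp
      have "inverse (real (Suc k)) \<le> 1" by (simp add: inverse_le_1_iff)
      then have "h * inverse (real (Suc k)) \<le> h * 1" using h by (intro mult_left_mono) auto
      then show "2 * (h / 2 * inverse (real (Suc k))) \<le> h" by simp
    qed
  qed
  then show ?thesis by simp
qed

text \<open>Continuity from above: the sets \<open>{t < u < t + h}\<close> decrease to the empty set.\<close>

lemma small_slices:
  assumes t: "t \<ge> 0" and e: "e > 0"
  shows "\<exists>h0>0. \<forall>h. 0 < h \<and> h < h0 \<longrightarrow> measure lborel {x. t < u x \<and> u x < t + h} \<le> e"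
proof -
  let ?A = "\<lambda>h. {x. t < u x \<and> u x < t + h}"
  have A: "?A h \<subseteq> \<Omega>" for h using out(1) t by fastforce
  have fin: "emeasure lborel (?A h) \<noteq> \<infinity>" for h using finite_subset_\<Omega>[OF A] by (simp add: less_top[symmetric])
  have m: "?A h \<in> sets lborel" for h by measurable
  let ?h = "\<lambda>k. inverse (real (Suc k))"
  have "(\<lambda>k. measure lborel (?A (?h k))) \<longlonglongrightarrow> measure lborel (\<Inter>k. ?A (?h k))"
  proof (rule Lim_measure_decseq)
    show "range (\<lambda>k. ?A (?h k)) \<subseteq> sets lborel" using m by auto
    show "decseq (\<lambda>k. ?A (?h k))"
      unfolding decseq_def
    proof (intro allI impI subsetI)
      fix i j :: nat and x assume ij: "i \<le> j" and x: "x \<in> ?A (?h j)"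
      have "?h j \<le> ?h i" using ij by (intro le_imp_inverse_le) auto
      then show "x \<in> ?A (?h i)" using x unfolding mem_Collect_eq by linarith
    qed
  qed (use fin in auto)
  also have "(\<Inter>k. ?A (?h k)) = {}"
  proof -
    have "\<exists>k. x \<notin> ?A (?h k)" for x
    proof (cases "u x > t")
      case True
      then obtain k where "?h k < u x - t" using reals_Archimedean[of "u x - t"] by auto
      then have "x \<notin> ?A (?h k)" unfolding mem_Collect_eq by linarith
      then show ?thesis by blast
    qed auto
    then show ?thesis by blast
  qed
  finally have "(\<lambda>k. measure lborel (?A (?h k))) \<longlonglongrightarrow> 0" by simp
  then have "\<forall>\<^sub>F k in sequentially. dist (measure lborel (?A (?h k))) 0 < e" using e by (rule tendstoD)
  then obtain k where k: "measure lborel (?A (?h k)) < e" using eventually_happens by force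
  show ?thesis
  proof (intro exI[of _ "?h k"] conjI allI impI)
    fix h assume h: "0 < h \<and> h < ?h k"
    have "measure lborel (?A h) \<le> measure lborel (?A (?h k))"
    proof (rule measure_mono_fmeasurable)
      show "?A h \<subseteq> ?A (?h k)"
      proof
        fix x assume "x \<in> ?A h"
        then show "x \<in> ?A (?h k)" using h unfolding mem_Collect_eq by linarith
      qed
      show "?A (?h k) \<in> fmeasurable lborel" using fin m by (auto intro!: fmeasurableI simp: less_top)
    qed (rule m)
    then show "measure lborel (?A h) \<le> e" using k by simp
  qed simp
qed

text \<open>
  A field \<open>\<phi>\<close> whose divergence integrates to more than \<open>K\<close> leaves room for the error term of
  \<open>superlevel_divergence_bound\<close>, which is \<open>h\<close> times a quantity tending to \<open>0\<close>.
\<close>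

lemma slab_ge_perimeter:
  assumes t: "t \<ge> 0" and K: "ereal K < perimeter \<Omega> {x. u x > t}"
  shows "\<exists>h0>0. \<forall>h. 0 < h \<and> h < h0 \<longrightarrow> K * h \<le> slab {t<..t + h}"
proof -
  let ?E = "{x. u x > t}"
  obtain \<phi> :: "'a \<Rightarrow> 'a" where \<phi>: "Ck_fun 1 \<phi>" "compactly_supported_in \<Omega> \<phi>" "\<And>x. norm (\<phi> x) \<le> 1"
    and K1: "K < integral\<^sup>L (lebesgue_on ?E) (divergence \<phi>)"
    using K unfolding perimeter_def less_SUP_iff by auto
  obtain K' where K': "compact K'" "K' \<subseteq> \<Omega>" "\<And>x. x \<notin> K' \<Longrightarrow> \<phi> x = 0" using compactly_supported_inD[OF \<phi>(2)] by metis
  have C1: "Ck_fun (Suc 0) \<phi>" using \<phi>(1) by simp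
  have c: "continuous_on UNIV (divergence \<phi>)"
    unfolding divergence_def[abs_def] using Ck_fun_SucD(2)[OF C1] by (intro continuous_intros) simp
  have z: "divergence \<phi> x = 0" if "x \<notin> K'" for x
    unfolding divergence_def using frechet_derivative_zero_outside[OF K'(1,3) that] by simp
  obtain C where C: "C > 0" "\<And>x. norm (divergence \<phi> x) \<le> C"
    using continuous_compact_support_bounded[OF c K'(1) z] by blast
  have dm[measurable]: "divergence \<phi> \<in> borel_measurable borel" by (rule borel_measurable_continuous_onI[OF c])
  define I where "I = (\<integral>x. indicator ?E x * divergence \<phi> x \<partial>lborel)"
  have Em: "?E \<in> sets borel" by measurable
  have "integral\<^sup>L (lebesgue_on ?E) (divergence \<phi>) = (\<integral>x. indicator ?E x *\<^sub>R divergence \<phi> x \<partial>lebesgue)"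
    using Em by (intro integral_restrict_space) auto
  also have "\<dots> = I" unfolding I_def by (simp add: integral_completion)
  finally have KI: "K < I" using K1 by simp
  then have "(I - K) / C > 0" using C(1) by simp
  then obtain h0 where h0: "h0 > 0" "\<And>h. 0 < h \<Longrightarrow> h < h0 \<Longrightarrow> measure lborel {x. t < u x \<and> u x < t + h} \<le> (I - K) / C"
    using small_slices[OF t] by metis
  show ?thesis
  proof (intro exI[of _ h0] conjI allI impI)
    fix h assume h: "0 < h \<and> h < h0"
    have "h * I \<le> slab {t<..t + h} + h * C * measure lborel {x. t < u x \<and> u x < t + h}"
      unfolding I_def by (rule superlevel_divergence_bound[OF \<phi> _ dm t]) (use C(2) h in auto)
    also have "h * C * measure lborel {x. t < u x \<and> u x < t + h} \<le> h * C * ((I - K) / C)"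
      using h C(1) h0(2)[of h] by (intro mult_left_mono) auto
    also have "\<dots> = h * (I - K)" using C(1) by simp
    finally show "K * h \<le> slab {t<..t + h}" by (simp add: algebra_simps)
  qed (rule h0)
qed

end

text \<open>
  Consider the supremum of the points up to which the inequality holds with the additional slope
  \<open>\<eta>\<close>. Jumps of the monotone function \<open>A\<close> only help to pass to the supremum, which is why \<open>A\<close> may be
  discontinuous while \<open>B\<close> may not.
\<close>

lemma dini_comparison:
  fixes A B :: "real \<Rightarrow> real"
  assumes ab: "a \<le> b" and A: "\<And>s t. a \<le> s \<Longrightarrow> s \<le> t \<Longrightarrow> t \<le> b \<Longrightarrow> A s \<le> A t" and B: "continuous_on {a..b} B"
    and D: "\<And>t \<eta>. a \<le> t \<Longrightarrow> t < b \<Longrightarrow> \<eta> > 0 \<Longrightarrow> \<exists>h0>0. \<forall>h. 0 < h \<and> h < h0 \<longrightarrow> B (t + h) - B t \<le> A (t + h) - A t + \<eta> * h"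
  shows "B b - B a \<le> A b - A a"
proof (rule field_le_epsilon)
  fix e :: real assume e: "e > 0"
  \<comment> \<open>The denominator is positive also for \<open>a = b\<close>.\<close>
  define \<eta> where "\<eta> = e / (b - a + 1)"
  have \<eta>: "\<eta> > 0" "\<eta> * (b - a) \<le> e" using e ab by (auto simp: \<eta>_def field_simps)
  define P where "P s \<longleftrightarrow> B s - B a \<le> A s - A a + \<eta> * (s - a)" for s
  define S where "S = {t \<in> {a..b}. \<forall>s\<in>{a..t}. P s}"
  have aS: "a \<in> S" using ab by (auto simp: S_def P_def)
  have bdd: "bdd_above S" by (auto simp: S_def bdd_above_def)
  define s where "s = Sup S"
  have "s \<le> b" unfolding s_def
  proof (rule cSup_least)
    show "S \<noteq> {}" using aS by blast
    show "x \<le> b" if "x \<in> S" for x using that unfolding S_def by simp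
  qed
  moreover have "a \<le> s" unfolding s_def by (rule cSup_upper[OF aS bdd])
  ultimately have s: "a \<le> s" "s \<le> b" by blast+
  have below: "P r" if r: "a \<le> r" "r < s" for r
  proof -
    have "S \<noteq> {}" using aS by blast
    then obtain t where t: "t \<in> S" "r < t"
      using r(2) bdd less_cSup_iff[of S r] unfolding s_def by blast
    then have "r \<in> {a..t}" using r by simp
    then show ?thesis using t(1) unfolding S_def by blast
  qed
  have Ps: "P s"
  proof (cases "s = a")
    case False
    then have sa: "a < s" using s by simp
    have "B s - B a \<le> A s - A a + \<eta> * (s - a)"
    proof (rule field_le_epsilon)
      fix d :: real assume d: "d > 0"
      have "s \<in> {a..b}" using s by simp
      from B[unfolded continuous_on_iff, rule_format, OF this d]
      obtain \<delta> where \<delta>: "\<delta> > 0" "\<And>r. r \<in> {a..b} \<Longrightarrow> dist r s < \<delta> \<Longrightarrow> dist (B r) (B s) < d"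
        by blast
      define r where "r = max a (s - \<delta> / 2)"
      have r: "a \<le> r" "r < s" "dist r s < \<delta>" using sa \<delta>(1) by (auto simp: r_def dist_real_def)
      have "B s < B r + d" using \<delta>(2)[of r] r s by (auto simp: dist_real_def)
      moreover have "A r \<le> A s" using A r s by simp
      moreover have "\<eta> * (r - a) \<le> \<eta> * (s - a)" using r \<eta>(1) by simp
      ultimately show "B s - B a \<le> A s - A a + \<eta> * (s - a) + d"
        using below[OF r(1,2)] by (simp add: P_def)
    qed
    then show ?thesis by (simp add: P_def)
  qed (simp add: P_def)
  have "s = b"
  proof (rule ccontr)
    assume "s \<noteq> b"
    then have sb: "s < b" using s by simp
    obtain h0 where h0: "h0 > 0" "\<And>h. 0 < h \<Longrightarrow> h < h0 \<Longrightarrow> B (s + h) - B s \<le> A (s + h) - A s + \<eta> * h"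
      using D[OF s(1) sb \<eta>(1)] by blast
    define t where "t = min b (s + h0 / 2)"
    have t: "s < t" "t \<le> b" "t - s < h0" using sb h0(1) by (auto simp: t_def min_def)
    have "t \<in> S"
      unfolding S_def
    proof (intro CollectI conjI ballI)
      show "t \<in> {a..b}" using t s by auto
      fix r assume r: "r \<in> {a..t}"
      consider "r < s" | "r = s" | "s < r" by linarith
      then show "P r"
      proof cases
        case 3
        then have "B (s + (r - s)) - B s \<le> A (s + (r - s)) - A s + \<eta> * (r - s)"
          using r t by (intro h0) auto
        then show ?thesis using Ps by (simp add: P_def algebra_simps)
      qed (use below Ps r in auto)
    qed
    then have "t \<le> s" unfolding s_def by (rule cSup_upper[OF _ bdd])
    then show False using t by simp
  qed
  then have "B b - B a \<le> A b - A a + \<eta> * (b - a)" using Ps by (simp add: P_def)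
  then show "B b - B a \<le> A b - A a + e" using \<eta>(2) by simp
qed

section \<open>Comparison of measures\<close>

lemma nn_integral_le_of_emeasure_le:
  assumes s: "sets N = sets M" and le: "\<And>A. A \<in> sets M \<Longrightarrow> emeasure M A \<le> emeasure N A"
    and f: "f \<in> borel_measurable M"
  shows "(\<integral>\<^sup>+x. f x \<partial>M) \<le> (\<integral>\<^sup>+x. f x \<partial>N)"
  using f
proof (induction f rule: borel_measurable_induct)
  case (cong f g)
  have "space N = space M" using s by (rule sets_eq_imp_space_eq)
  then show ?case using cong by (metis (no_types, lifting) nn_integral_cong)
next
  case (set A)
  then show ?case using le s by simp
next
  case (mult u c)
  moreover have "u \<in> borel_measurable N" using mult s by (simp cong: measurable_cong_sets)
  ultimately show ?case by (simp add: nn_integral_cmult mult_left_mono)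
next
  case (add u v)
  moreover have "u \<in> borel_measurable N" "v \<in> borel_measurable N" using add s by (simp_all cong: measurable_cong_sets)
  ultimately show ?case by (simp add: nn_integral_add add_mono)
next
  case (seq U)
  have m: "U i \<in> borel_measurable N" for i using seq(1)[of i] s by (simp cong: measurable_cong_sets)
  have "(\<integral>\<^sup>+x. (SUP i. U i x) \<partial>M) = (SUP i. \<integral>\<^sup>+x. U i x \<partial>M)"
    by (rule nn_integral_monotone_convergence_SUP[OF \<open>incseq U\<close>]) (use seq in auto)
  also have "\<dots> \<le> (SUP i. \<integral>\<^sup>+x. U i x \<partial>N)"
    by (rule SUP_mono) (use seq in blast)
  also have "\<dots> = (\<integral>\<^sup>+x. (SUP i. U i x) \<partial>N)"
    by (rule nn_integral_monotone_convergence_SUP[OF \<open>incseq U\<close>, symmetric]) (use m in auto)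
  finally show ?case by (simp add: image_comp)
qed

lemma intervals_exhaust_reals:
  "(\<Union>n. {- real n<..real n}) = UNIV" "incseq (\<lambda>n. {- real n<..real n})" "range (\<lambda>n. {- real n<..real n}) \<subseteq> sets borel"
proof -
  have "\<exists>n. x \<in> {- real n<..real n}" for x
  proof -
    obtain n where "\<bar>x\<bar> < real n" using reals_Archimedean2 by blast
    then show ?thesis by (intro exI[of _ n]) auto
  qed
  then show "(\<Union>n. {- real n<..real n}) = UNIV" by blast
qed (auto simp: incseq_def)

lemma emeasure_UNIV_le_of_intervals:
  fixes M N :: "real measure"
  assumes M: "sets M = sets borel" and N: "sets N = sets borel"
    and le: "\<And>a b. emeasure M {a<..b} \<le> emeasure N {a<..b}"
  shows "emeasure M UNIV \<le> emeasure N UNIV"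
proof (rule LIMSEQ_le)
  show "(\<lambda>n. emeasure M {- real n<..real n}) \<longlonglongrightarrow> emeasure M UNIV"
    using Lim_emeasure_incseq[of "\<lambda>n. {- real n<..real n}" M] intervals_exhaust_reals by (simp only: M)
  show "(\<lambda>n. emeasure N {- real n<..real n}) \<longlonglongrightarrow> emeasure N UNIV"
    using Lim_emeasure_incseq[of "\<lambda>n. {- real n<..real n}" N] intervals_exhaust_reals by (simp only: N)
qed (use le in blast)

text \<open>
  The hypothesis says that the difference of the two distribution functions is monotone. It thus
  defines a Stieltjes measure \<open>I\<close>, and \<open>M + I = N\<close> holds on intervals, hence on all Borel sets.
\<close>

lemma emeasure_le_of_intervals:
  fixes M N :: "real measure"
  assumes M: "finite_measure M" "sets M = sets borel" and N: "finite_measure N" "sets N = sets borel"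
    and le: "\<And>a b. a < b \<Longrightarrow> emeasure M {a<..b} \<le> emeasure N {a<..b}"
    and A: "A \<in> sets borel"
  shows "emeasure M A \<le> emeasure N A"
proof -
  interpret M: finite_measure M by (rule M)
  interpret N: finite_measure N by (rule N)
  have sp[simp]: "space M = UNIV" "space N = UNIV" using M(2) N(2) by (auto dest: sets_eq_imp_space_eq)
  note [simp] = M(2) N(2)
  have le': "measure M {a<..b} \<le> measure N {a<..b}" for a b
  proof (cases "a < b")
    case True
    from le[OF this] show ?thesis by (simp add: M.emeasure_eq_measure N.emeasure_eq_measure)
  qed simp
  define F where "F x = measure N {..x} - measure M {..x}" for x
  have split: "measure M {..b} = measure M {..a} + measure M {a<..b}"
      "measure N {..b} = measure N {..a} + measure N {a<..b}" if "a \<le> b" for a b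
  proof -
    have eq: "{..b} = {..a} \<union> {a<..b}" using that by auto
    show "measure M {..b} = measure M {..a} + measure M {a<..b}"
      unfolding eq by (rule M.finite_measure_Union) auto
    show "measure N {..b} = measure N {..a} + measure N {a<..b}"
      unfolding eq by (rule N.finite_measure_Union) auto
  qed
  have F: "F b - F a = measure N {a<..b} - measure M {a<..b}" if "a \<le> b" for a b
    using split[OF that] by (simp add: F_def)
  have mono: "F a \<le> F b" if "a \<le> b" for a b
    using F[OF that] le'[of a b] by linarith
  have rc: "continuous (at_right a) F" for a
  proof -
    have "(F \<longlongrightarrow> F a) (at_right a)"
    proof (rule tendsto_at_right_sequentially[of a "a + 1"])
      fix S :: "nat \<Rightarrow> real" assume S: "\<And>n. a < S n" "decseq S" "S \<longlonglongrightarrow> a"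
      have eq: "(\<Inter>n. {..S n}) = {..a}"
      proof (intro equalityI subsetI)
        fix x assume "x \<in> (\<Inter>n. {..S n})"
        then show "x \<in> {..a}" using LIMSEQ_le_const[OF S(3), of x] by auto
      qed (use S(1) less_imp_le order_trans in fastforce)
      have dec: "decseq (\<lambda>n. {..S n})"
        unfolding decseq_def using decseqD[OF S(2)] by auto
      have "(\<lambda>n. measure N {..S n}) \<longlonglongrightarrow> measure N (\<Inter>n. {..S n})"
        by (rule N.finite_Lim_measure_decseq[OF _ dec]) auto
      moreover have "(\<lambda>n. measure M {..S n}) \<longlonglongrightarrow> measure M (\<Inter>n. {..S n})"
        by (rule M.finite_Lim_measure_decseq[OF _ dec]) auto
      ultimately show "(\<lambda>n. F (S n)) \<longlonglongrightarrow> F a"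
        unfolding F_def eq by (rule tendsto_diff)
    qed simp
    then show ?thesis by (simp add: continuous_within)
  qed
  define I where "I = interval_measure F"
  have sI[simp]: "sets I = sets borel" "space I = UNIV" by (simp_all add: I_def)
  have eI: "emeasure I {a<..b} = ennreal (measure N {a<..b} - measure M {a<..b})" if "a \<le> b" for a b
    unfolding I_def F[OF that, symmetric] by (rule emeasure_interval_measure_Ioc[OF that mono rc])
  note U = intervals_exhaust_reals(1) and inc = intervals_exhaust_reals(2)
  have "emeasure I UNIV \<le> emeasure N UNIV"
  proof (rule emeasure_UNIV_le_of_intervals)
    show "emeasure I {a<..b} \<le> emeasure N {a<..b}" for a b
    proof (cases "a \<le> b")
      case True
      then show ?thesis
        unfolding N.emeasure_eq_measure by (subst eI) (auto intro!: ennreal_leI)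
    qed simp
  qed auto
  then have "emeasure I (space I) \<noteq> \<infinity>" using N.emeasure_finite[of UNIV] by (auto simp: top_unique)
  then interpret I: finite_measure I by (rule finite_measureI)
  have E: "measure I {a<..b} = measure N {a<..b} - measure M {a<..b}" for a b
  proof (cases "a \<le> b")
    case True
    then show ?thesis using eI[OF True] le'[of a b] by (simp add: I.emeasure_eq_measure)
  qed simp
  let ?P = "\<lambda>A. measure M A + measure I A = measure N A"
  have PU: "?P UNIV"
  proof (rule LIMSEQ_unique)
    have "(\<lambda>n. measure M {- real n<..real n} + measure I {- real n<..real n}) \<longlonglongrightarrow> measure M UNIV + measure I UNIV"
      by (rule tendsto_add[OF M.finite_Lim_measure_incseq[of
          "\<lambda>n. {- real n<..real n}", unfolded M(2) U, OF intervals_exhaust_reals(3) inc]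
        I.finite_Lim_measure_incseq[of "\<lambda>n. {- real n<..real n}", unfolded sI U, OF intervals_exhaust_reals(3) inc]])
    then show "(\<lambda>n. measure N {- real n<..real n}) \<longlonglongrightarrow> measure M UNIV + measure I UNIV"
      by (simp add: E)
    show "(\<lambda>n. measure N {- real n<..real n}) \<longlonglongrightarrow> measure N UNIV"
      by (rule N.finite_Lim_measure_incseq[of "\<lambda>n. {- real n<..real n}", unfolded N(2) U, OF intervals_exhaust_reals(3) inc])
  qed
  have "?P A"
  proof (rule sigma_sets_induct_disjoint[of "range (\<lambda>(a, b). {a <.. b::real})" UNIV A ?P])
    show "Int_stable (range (\<lambda>(a, b). {a <.. b::real}))" by (auto simp: Int_stable_def)
    show "A \<in> sigma_sets UNIV (range (\<lambda>(a, b). {a <.. b::real}))"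
      using A by (simp add: borel_sigma_sets_Ioc)
  next
    fix B assume "B \<in> range (\<lambda>(a, b). {a <.. b::real})"
    then show "?P B" by (auto simp: E)
  next
    fix B assume B: "B \<in> sigma_sets UNIV (range (\<lambda>(a, b). {a <.. b::real}))" "?P B"
    then have b: "B \<in> sets borel" by (simp add: borel_sigma_sets_Ioc)
    have "measure M (UNIV - B) = measure M UNIV - measure M B" "measure N (UNIV - B) = measure N UNIV - measure N B"
      "measure I (UNIV - B) = measure I UNIV - measure I B"
      using M.finite_measure_compl[of B] N.finite_measure_compl[of B] I.finite_measure_compl[of B] b by auto
    then show "?P (UNIV - B)" using B(2) PU by linarith
  next
    fix B :: "nat \<Rightarrow> real set" assume d: "disjoint_family B"
      and B: "range B \<subseteq> sigma_sets UNIV (range (\<lambda>(a, b). {a <.. b::real}))" and P: "\<And>i. ?P (B i)"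
    have b: "range B \<subseteq> sets borel" using B by (simp add: borel_sigma_sets_Ioc)
    have "(\<lambda>i. measure M (B i) + measure I (B i)) sums (measure M (\<Union>i. B i) + measure I (\<Union>i. B i))"
      using b d by (intro sums_add M.finite_measure_UNION I.finite_measure_UNION) auto
    moreover have "(\<lambda>i. measure N (B i)) sums measure N (\<Union>i. B i)"
      using b d by (intro N.finite_measure_UNION) auto
    ultimately show "?P (\<Union> (range B))" using P by (simp add: sums_unique2)
  qed auto
  then have "measure M A \<le> measure N A" using measure_nonneg[of I A] by linarith
  then show ?thesis by (simp add: M.emeasure_eq_measure N.emeasure_eq_measure)
qed

text \<open>
  The hypothesis bounds integration with respect to \<open>N\<close> as a functional on \<open>L\<^sup>2(M)\<close>. Indicators of
  null sets show that \<open>N\<close> is absolutely continuous. If \<open>H\<close> is its density and \<open>T\<close> a truncation of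
  \<open>H\<close>, then \<open>\<integral> T\<^sup>2 dM \<le> \<integral> T dN\<close>, and the hypothesis for \<open>\<theta> = T\<close> gives \<open>\<integral> T\<^sup>2 dM \<le> D\<close>; the truncation
  makes the integral finite, so that it can be cancelled.
\<close>

lemma density_of_square_bound:
  fixes M N :: "real measure"
  assumes M: "finite_measure M" "sets M = sets borel" and N: "sets N = sets borel" and D: "D \<ge> 0"
    and dual: "\<And>\<theta> :: real \<Rightarrow> ennreal. \<theta> \<in> borel_measurable borel \<Longrightarrow> (\<integral>\<^sup>+r. \<theta> r \<partial>N)\<^sup>2 \<le> (\<integral>\<^sup>+r. (\<theta> r)\<^sup>2 \<partial>M) * ennreal D"
  obtains h :: "real \<Rightarrow> real" where "h \<in> borel_measurable borel" "\<And>r. h r \<ge> 0"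
    "N = density M (\<lambda>r. ennreal (h r))" "(\<integral>\<^sup>+r. ennreal ((h r)\<^sup>2) \<partial>M) \<le> ennreal D"
proof -
  interpret M: finite_measure M by (rule M)
  have sp[simp]: "space M = UNIV" "space N = UNIV" using M(2) N by (auto dest: sets_eq_imp_space_eq)
  note [simp] = M(2) N
  have meas: "f \<in> borel_measurable M \<longleftrightarrow> f \<in> borel_measurable borel"
      "f \<in> borel_measurable N \<longleftrightarrow> f \<in> borel_measurable borel" for f :: "real \<Rightarrow> ennreal"
    by (simp_all cong: measurable_cong_sets)
  have "absolutely_continuous M N"
    unfolding absolutely_continuous_def
  proof
    fix A assume A: "A \<in> null_sets M"
    then have Ab: "A \<in> sets borel" by auto
    have "(\<integral>\<^sup>+r. indicator A r \<partial>N)\<^sup>2 \<le> (\<integral>\<^sup>+r. (indicator A r)\<^sup>2 \<partial>M) * ennreal D"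
      by (rule dual) (use Ab in simp)
    also have "(\<lambda>r. (indicator A r)\<^sup>2) = (indicator A :: real \<Rightarrow> ennreal)" by (auto simp: indicator_def)
    finally have "(emeasure N A)\<^sup>2 \<le> emeasure M A * ennreal D" using Ab by simp
    then have "emeasure N A = 0" using A by (simp add: null_setsD1)
    then show "A \<in> null_sets N" using Ab by auto
  qed
  then obtain H where H: "H \<in> borel_measurable M" "density M H = N"
    using M.Radon_Nikodym[of N] by auto
  have Hb[measurable]: "H \<in> borel_measurable borel" using H(1) by (simp add: meas)
  define T where "T k r = min (H r) (of_nat k)" for k :: nat and r
  have [measurable]: "T k \<in> borel_measurable borel" for k unfolding T_def by measurable
  have T: "(\<integral>\<^sup>+r. (T k r)\<^sup>2 \<partial>M) \<le> ennreal D" for k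
  proof -
    let ?X = "\<integral>\<^sup>+r. (T k r)\<^sup>2 \<partial>M"
    have "?X \<le> (\<integral>\<^sup>+r. (of_nat k)\<^sup>2 \<partial>M)"
      by (intro nn_integral_mono power_mono) (auto simp: T_def)
    also have "\<dots> < \<infinity>"
      using M.emeasure_finite[of UNIV] by (simp add: ennreal_mult_less_top less_top[symmetric] ennreal_of_nat_eq_real_of_nat power2_eq_square ennreal_mult_eq_top_iff)
    finally have fin: "?X < \<infinity>" .
    have "?X \<le> (\<integral>\<^sup>+r. H r * T k r \<partial>M)"
      by (intro nn_integral_mono) (auto simp: T_def power2_eq_square intro!: mult_right_mono)
    also have "\<dots> = (\<integral>\<^sup>+r. T k r \<partial>N)"
      unfolding H(2)[symmetric] by (subst nn_integral_density) (auto simp: meas)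
    finally have "?X\<^sup>2 \<le> (\<integral>\<^sup>+r. T k r \<partial>N)\<^sup>2" by (intro power_mono) auto
    also have "\<dots> \<le> ?X * ennreal D" by (rule dual) measurable
    finally have *: "?X * ?X \<le> ?X * ennreal D" by (simp add: power2_eq_square)
    show ?thesis
    proof (cases "?X = 0")
      case False
      obtain x where x: "?X = ennreal x" "x \<ge> 0" using fin by (cases ?X) auto
      then have "x > 0" using False by auto
      have "ennreal (x * x) \<le> ennreal (x * D)" using * x D by (simp add: ennreal_mult)
      then have "x * x \<le> x * D" using x D by (simp add: ennreal_le_iff)
      then show ?thesis using x \<open>x > 0\<close> by (simp add: ennreal_leI)
    qed simp
  qed
  have SUP: "(SUP k. (T k r)\<^sup>2) = (H r)\<^sup>2" for r
  proof (rule antisym)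
    show "(SUP k. (T k r)\<^sup>2) \<le> (H r)\<^sup>2" by (intro SUP_least power_mono) (auto simp: T_def)
    show "(H r)\<^sup>2 \<le> (SUP k. (T k r)\<^sup>2)"
    proof (cases "H r = top")
      case True
      have "(SUP k::nat. of_nat k :: ennreal) \<le> (SUP k. (T k r)\<^sup>2)"
      proof (rule SUP_mono)
        fix k :: nat
        have "k \<le> k * k" by (cases k) auto
        then have "(of_nat k :: ennreal) \<le> of_nat (k * k)" by (simp only: of_nat_le_iff)
        then show "\<exists>m\<in>UNIV. (of_nat k :: ennreal) \<le> (T m r)\<^sup>2"
          using True by (intro bexI[of _ k]) (auto simp: T_def power2_eq_square)
      qed
      then have "top \<le> (SUP k. (T k r)\<^sup>2)" by (simp only: ennreal_SUP_of_nat_eq_top)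
      then show ?thesis by (rule order_trans[OF top_greatest])
    next
      case False
      then obtain k where "H r < of_nat k" using ennreal_Ex_less_of_nat[of "H r"] by (auto simp: less_top)
      then have "(H r)\<^sup>2 = (T k r)\<^sup>2" by (simp add: T_def)
      also have "\<dots> \<le> (SUP k. (T k r)\<^sup>2)" by (rule SUP_upper) simp
      finally show ?thesis .
    qed
  qed
  have H2: "(\<integral>\<^sup>+r. (H r)\<^sup>2 \<partial>M) \<le> ennreal D"
  proof -
    have "(\<integral>\<^sup>+r. (H r)\<^sup>2 \<partial>M) = (\<integral>\<^sup>+r. (SUP k. (T k r)\<^sup>2) \<partial>M)" by (simp add: SUP)
    also have "\<dots> = (SUP k. \<integral>\<^sup>+r. (T k r)\<^sup>2 \<partial>M)"
    proof (rule nn_integral_monotone_convergence_SUP)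
      show "incseq (\<lambda>k r. (T k r)\<^sup>2)"
        by (auto simp: incseq_def le_fun_def T_def intro!: power_mono min.mono)
    qed (simp add: meas)
    also have "\<dots> \<le> ennreal D" by (intro SUP_least T)
    finally show ?thesis .
  qed
  have "AE r in M. (H r)\<^sup>2 \<noteq> \<infinity>"
    by (rule nn_integral_PInf_AE) (use H2 in \<open>auto simp: meas top_unique\<close>)
  then have fin: "AE r in M. H r = ennreal (enn2real (H r))"
  proof eventually_elim
    case (elim r)
    then have "H r \<noteq> top" by (auto simp: power2_eq_square ennreal_mult_top)
    then show ?case by (simp add: less_top)
  qed
  show ?thesis
  proof (rule that[of "\<lambda>r. enn2real (H r)"])
    show "N = density M (\<lambda>r. ennreal (enn2real (H r)))"
      unfolding H(2)[symmetric] by (rule density_cong) (use fin in \<open>auto simp: meas\<close>)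
    have "(\<integral>\<^sup>+r. ennreal ((enn2real (H r))\<^sup>2) \<partial>M) = (\<integral>\<^sup>+r. (H r)\<^sup>2 \<partial>M)"
    proof (rule nn_integral_cong_AE)
      show "AE r in M. ennreal ((enn2real (H r))\<^sup>2) = (H r)\<^sup>2"
        using fin
      proof eventually_elim
        case (elim r)
        have "ennreal ((enn2real (H r))\<^sup>2) = (ennreal (enn2real (H r)))\<^sup>2" by (simp add: ennreal_power)
        then show ?case using elim by simp
      qed
    qed
    then show "(\<integral>\<^sup>+r. ennreal ((enn2real (H r))\<^sup>2) \<partial>M) \<le> ennreal D" using H2 by simp
  qed auto
qed

section \<open>The coarea inequality\<close>

lemma emeasure_Ioc_finite: "emeasure lborel {a<..b::real} < \<infinity>"
  by (cases "a \<le> b") auto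

lemma integrable_indicator_Ioc: "integrable lborel (indicator {a<..b::real} :: real \<Rightarrow> real)"
  using emeasure_Ioc_finite[of a b] by simp

text \<open>The number \<open>R\<close> bounds the radius of the ball with the measure of \<open>{u > 0}\<close>.\<close>

locale isoperimetric_function = sobolev_function +
  fixes c R :: real
  assumes c: "c > 0" and R: "R \<ge> 0" and dim: "DIM('a) \<ge> 2"
    and iso: "\<And>t. t \<ge> 0 \<Longrightarrow> ereal (c * measure lborel {x \<in> \<Omega>. u x > t} powr (1 - 1 / real DIM('a))) \<le>
        perimeter \<Omega> {x. u x > t}"
    and lev0: "measure lborel {x \<in> \<Omega>. u x > 0} \<le> unit_ball_vol (real DIM('a)) * R ^ DIM('a)"
begin

text \<open>The distribution function of \<open>u\<close>.\<close>

definition lev :: "real \<Rightarrow> real" where "lev t = measure lborel {x \<in> \<Omega>. u x > t}"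

text \<open>
  The lower bound for the perimeter of \<open>{u > t}\<close>. Unlike the perimeter itself it is monotone in \<open>t\<close>,
  which makes its integrals easy to handle.
\<close>

definition flux :: "real \<Rightarrow> real" where "flux t = c * lev t powr (1 - 1 / real DIM('a))"

lemma emeasure_level: "emeasure lborel {x \<in> \<Omega>. u x > t} = ennreal (lev t)"
  unfolding lev_def using finite_subset_\<Omega>[of "{x \<in> \<Omega>. u x > t}"] by (intro emeasure_eq_ennreal_measure) auto

lemma lev_nonneg: "lev t \<ge> 0" by (simp add: lev_def)

lemma lev_antimono: "s \<le> t \<Longrightarrow> lev t \<le> lev s"
proof -
  assume "s \<le> t"
  then have "emeasure lborel {x \<in> \<Omega>. u x > t} \<le> emeasure lborel {x \<in> \<Omega>. u x > s}"
    by (intro emeasure_mono) auto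
  then show ?thesis by (simp add: emeasure_level lev_nonneg)
qed

lemma lev_measurable[measurable]: "lev \<in> borel_measurable borel"
proof -
  have "mono (\<lambda>t. - lev t)" by (intro monoI) (simp add: lev_antimono)
  then have "(\<lambda>t. - (- lev t)) \<in> borel_measurable borel" by (intro borel_measurable_uminus borel_measurable_mono)
  then show ?thesis by simp
qed

lemma flux_measurable[measurable]: "flux \<in> borel_measurable borel"
  unfolding flux_def[abs_def] by measurable

lemma flux_nonneg: "flux t \<ge> 0" using c by (simp add: flux_def)

lemma flux_antimono: "s \<le> t \<Longrightarrow> flux t \<le> flux s"
  unfolding flux_def using c dim by (intro mult_left_mono powr_mono2 lev_antimono lev_nonneg) auto

lemma flux_integrable: "integrable lborel (\<lambda>\<tau>. indicator {a<..b} \<tau> * flux \<tau>)"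
proof (rule Bochner_Integration.integrable_bound)
  show "integrable lborel (\<lambda>\<tau>. flux a * indicator {a<..b} \<tau>)"
    by (intro integrable_mult_right integrable_indicator_Ioc)
  show "AE \<tau> in lborel. norm (indicator {a<..b} \<tau> * flux \<tau>) \<le> norm (flux a * indicator {a<..b} \<tau>)"
    using flux_antimono[of a] flux_nonneg by (intro AE_I2) (auto simp: indicator_def)
qed measurable

lemma flux_integral_split:
  assumes "a \<le> s" "s \<le> t"
  shows "(\<integral>\<tau>. indicator {a<..t} \<tau> * flux \<tau> \<partial>lborel) =
     (\<integral>\<tau>. indicator {a<..s} \<tau> * flux \<tau> \<partial>lborel) + (\<integral>\<tau>. indicator {s<..t} \<tau> * flux \<tau> \<partial>lborel)"
proof -
  have "indicator {a<..t} \<tau> * flux \<tau> = indicator {a<..s} \<tau> * flux \<tau> + indicator {s<..t} \<tau> * flux \<tau>" for \<tau>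
    using assms by (auto simp: indicator_def)
  then show ?thesis by (simp add: flux_integrable)
qed

lemma flux_integral_bounds:
  assumes "s \<le> t"
  shows "0 \<le> (\<integral>\<tau>. indicator {s<..t} \<tau> * flux \<tau> \<partial>lborel)"
    "(\<integral>\<tau>. indicator {s<..t} \<tau> * flux \<tau> \<partial>lborel) \<le> flux s * (t - s)"
proof -
  show "0 \<le> (\<integral>\<tau>. indicator {s<..t} \<tau> * flux \<tau> \<partial>lborel)"
    by (intro Bochner_Integration.integral_nonneg) (simp add: flux_nonneg)
  have i: "integrable lborel (\<lambda>\<tau>. flux s * indicator {s<..t} \<tau>)"
    by (intro integrable_mult_right integrable_indicator_Ioc)
  have "(\<integral>\<tau>. indicator {s<..t} \<tau> * flux \<tau> \<partial>lborel) \<le> (\<integral>\<tau>. flux s * indicator {s<..t} \<tau> \<partial>lborel)"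
    by (rule integral_mono[OF flux_integrable i]) (use flux_antimono[of s] in \<open>auto simp: indicator_def\<close>)
  also have "\<dots> = flux s * (t - s)" using assms by simp
  finally show "(\<integral>\<tau>. indicator {s<..t} \<tau> * flux \<tau> \<partial>lborel) \<le> flux s * (t - s)" .
qed

lemma slab_integrable: "A \<in> sets borel \<Longrightarrow> integrable lborel (\<lambda>x. indicator {x. u x \<in> A} x * norm (g x))"
  using integrable_mult_indicator[OF _ norm_g_integrable, of "{x. u x \<in> A}"] by simp

lemma slab_split:
  assumes "a \<le> s" "s \<le> t"
  shows "slab {a<..t} = slab {a<..s} + slab {s<..t}"
proof -
  have "indicator {x. u x \<in> {a<..t}} x * norm (g x) =
      indicator {x. u x \<in> {a<..s}} x * norm (g x) + indicator {x. u x \<in> {s<..t}} x * norm (g x)" for x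
    using assms by (auto simp: indicator_def)
  then have "slab {a<..t} = (\<integral>x. indicator {x. u x \<in> {a<..s}} x * norm (g x) + indicator {x. u x \<in> {s<..t}} x *
      norm (g x) \<partial>lborel)"
    by (simp only: slab_def)
  also have "\<dots> = slab {a<..s} + slab {s<..t}"
    unfolding slab_def by (intro Bochner_Integration.integral_add slab_integrable) auto
  finally show ?thesis .
qed

lemma slab_nonneg: "slab A \<ge> 0" by (auto simp: slab_def intro!: Bochner_Integration.integral_nonneg)

text \<open>
  For small \<open>h\<close> the gradient mass of \<open>{t < u \<le> t + h}\<close> is at least \<open>(flux t - \<eta>) * h\<close>, while the
  integral of the antitone function \<open>flux\<close> over \<open>(t, t + h]\<close> is at most \<open>flux t * h\<close>; now
  \<open>dini_comparison\<close> applies.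
\<close>

lemma coarea_interval:
  assumes a: "0 \<le> a" and ab: "a \<le> b"
  shows "(\<integral>\<tau>. indicator {a<..b} \<tau> * flux \<tau> \<partial>lborel) \<le> slab {a<..b}"
proof -
  let ?B = "\<lambda>t. \<integral>\<tau>. indicator {a<..t} \<tau> * flux \<tau> \<partial>lborel"
  have "?B b - ?B a \<le> slab {a<..b} - slab {a<..a}"
  proof (rule dini_comparison[OF ab])
    fix s t assume st: "a \<le> s" "s \<le> t" "t \<le> b"
    show "slab {a<..s} \<le> slab {a<..t}"
      using slab_split[OF st(1,2)] slab_nonneg[of "{s<..t}"] by simp
  next
    have lip: "\<bar>?B t - ?B s\<bar> \<le> flux a * \<bar>t - s\<bar>" if "a \<le> s" "s \<le> t" for s t
    proof -
      have "?B t - ?B s = (\<integral>\<tau>. indicator {s<..t} \<tau> * flux \<tau> \<partial>lborel)"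
        using flux_integral_split[OF that] by simp
      moreover have "flux s * (t - s) \<le> flux a * (t - s)"
        using flux_antimono[OF that(1)] that by (intro mult_right_mono) auto
      ultimately show ?thesis using flux_integral_bounds[OF that(2)] that by simp
    qed
    have "(flux a)-lipschitz_on {a..b} ?B"
    proof (rule lipschitz_onI)
      fix s t assume "s \<in> {a..b}" "t \<in> {a..b}"
      then show "dist (?B s) (?B t) \<le> flux a * dist s t"
        using lip[of s t] lip[of t s] by (cases "s \<le> t") (auto simp: dist_real_def abs_minus_commute)
    qed (rule flux_nonneg)
    then show "continuous_on {a..b} ?B" by (rule lipschitz_on_continuous_on)
  next
    fix t \<eta> assume t: "a \<le> t" "t < b" and \<eta>: "(\<eta>::real) > 0"
    have "ereal (flux t - \<eta>) < ereal (flux t)" using \<eta> by simp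
    also have "\<dots> \<le> perimeter \<Omega> {x. u x > t}" using iso[of t] t a by (simp add: flux_def lev_def)
    finally obtain h0 where h0: "h0 > 0" "\<And>h. 0 < h \<Longrightarrow> h < h0 \<Longrightarrow> (flux t - \<eta>) * h \<le> slab {t<..t + h}"
      using slab_ge_perimeter[of t "flux t - \<eta>"] t a by auto
    show "\<exists>h0>0. \<forall>h. 0 < h \<and> h < h0 \<longrightarrow> ?B (t + h) - ?B t \<le> slab {a<..t + h} - slab {a<..t} + \<eta> * h"
    proof (intro exI[of _ h0] conjI allI impI h0(1))
      fix h assume h: "0 < h \<and> h < h0"
      have "?B (t + h) - ?B t \<le> flux t * h"
        using flux_integral_split[OF t(1), of "t + h"] flux_integral_bounds(2)[of t "t + h"] h by simp
      moreover have "slab {a<..t + h} - slab {a<..t} = slab {t<..t + h}"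
        using slab_split[OF t(1), of "t + h"] h by simp
      ultimately show "?B (t + h) - ?B t \<le> slab {a<..t + h} - slab {a<..t} + \<eta> * h"
        using h0(2)[of h] h by (simp add: algebra_simps)
    qed
  qed
  then show ?thesis by (simp add: slab_def)
qed

lemma nn_slab:
  assumes "A \<in> sets borel"
  shows "(\<integral>\<^sup>+x. indicator {x. u x \<in> A} x * ennreal (norm (g x)) \<partial>lborel) = ennreal (slab A)"
proof -
  have "(\<integral>\<^sup>+x. indicator {x. u x \<in> A} x * ennreal (norm (g x)) \<partial>lborel) =
      (\<integral>\<^sup>+x. ennreal (indicator {x. u x \<in> A} x * norm (g x)) \<partial>lborel)"
    by (intro nn_integral_cong) (auto simp: indicator_def)
  also have "\<dots> = ennreal (slab A)"
    unfolding slab_def using slab_integrable[OF assms] by (intro nn_integral_eq_integral) auto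
  finally show ?thesis .
qed

text \<open>
  Both sides integrate \<open>\<theta>\<close> with respect to a measure on the line, and \<open>coarea_interval\<close> compares the
  two measures on intervals.
\<close>

lemma coarea_inequality:
  fixes \<theta> :: "real \<Rightarrow> ennreal"
  assumes \<theta>[measurable]: "\<theta> \<in> borel_measurable borel"
  shows "(\<integral>\<^sup>+\<tau>. \<theta> \<tau> * (ennreal (flux \<tau>) * indicator {0<..} \<tau>) \<partial>lborel) \<le>
    (\<integral>\<^sup>+x. \<theta> (u x) * (ennreal (norm (g x)) * indicator {x. u x > 0} x) \<partial>lborel)"
proof -
  define M where "M = density lborel (\<lambda>\<tau>. ennreal (flux \<tau>) * indicator {0<..} \<tau>)"
  define N where "N = distr (density lborel (\<lambda>x. ennreal (norm (g x)) * indicator {x. u x > 0} x)) borel u"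
  have sM[simp]: "sets M = sets borel" "space M = UNIV" and sN[simp]: "sets N = sets borel" "space N = UNIV"
    by (simp_all add: M_def N_def)
  have M: "emeasure M A = (\<integral>\<^sup>+\<tau>. ennreal (flux \<tau>) * indicator {0<..} \<tau> * indicator A \<tau> \<partial>lborel)" if "A \<in> sets borel"
      for A
    using that unfolding M_def by (subst emeasure_density) auto
  have N: "emeasure N A = (\<integral>\<^sup>+x. ennreal (norm (g x)) * indicator {x. u x > 0} x * indicator {x. u x \<in> A} x \<partial>lborel)"
      if [measurable]: "A \<in> sets borel" for A
  proof -
    have "emeasure N A = emeasure (density lborel (\<lambda>x. ennreal (norm (g x)) * indicator {x. u x > 0} x)) (u -` A)"
      unfolding N_def by (subst emeasure_distr) auto
    also have "\<dots> = (\<integral>\<^sup>+x. ennreal (norm (g x)) * indicator {x. u x > 0} x * indicator (u -` A) x \<partial>lborel)"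
      using measurable_sets_borel[OF u_meas that] by (subst emeasure_density) auto
    finally show ?thesis by (simp add: vimage_def)
  qed
  have Npos: "emeasure N A = ennreal (slab (A \<inter> {0<..}))" if "A \<in> sets borel" for A
    unfolding N[OF that] nn_slab[OF sets.Int[OF that], of "{0<..}", simplified, symmetric]
    by (intro nn_integral_cong) (auto simp: indicator_def)
  have fN: "finite_measure N" by (rule finite_measureI) (simp add: Npos)
  have le: "emeasure M {a<..b} \<le> emeasure N {a<..b}" for a b
  proof (cases "max a 0 \<le> b")
    case True
    have "emeasure M {a<..b} = (\<integral>\<^sup>+\<tau>. ennreal (indicator {max a 0<..b} \<tau> * flux \<tau>) \<partial>lborel)"
      by (subst M) (auto intro!: nn_integral_cong simp: indicator_def)
    also have "\<dots> = ennreal (\<integral>\<tau>. indicator {max a 0<..b} \<tau> * flux \<tau> \<partial>lborel)"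
      by (intro nn_integral_eq_integral flux_integrable) (auto simp: flux_nonneg)
    also have "\<dots> \<le> ennreal (slab {max a 0<..b})"
      by (intro ennreal_leI coarea_interval True) simp
    also have "{max a 0<..b} = {a<..b} \<inter> {0<..}" by auto
    finally show ?thesis by (simp add: Npos)
  next
    case False
    then have z: "ennreal (flux \<tau>) * indicator {0<..} \<tau> * indicator {a<..b} \<tau> = 0" for \<tau>
      by (auto simp: indicator_def)
    have "emeasure M {a<..b} = 0" using M[of "{a<..b}"] by (simp only: z) simp
    then show ?thesis by simp
  qed
  have "emeasure M UNIV \<le> emeasure N UNIV"
    by (rule emeasure_UNIV_le_of_intervals[OF sM(1) sN(1) le])
  then have fM: "finite_measure M" by (intro finite_measureI) (auto simp: Npos top_unique)
  have "(\<integral>\<^sup>+\<tau>. \<theta> \<tau> \<partial>M) \<le> (\<integral>\<^sup>+\<tau>. \<theta> \<tau> \<partial>N)"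
  proof (rule nn_integral_le_of_emeasure_le)
    show "\<theta> \<in> borel_measurable M" using \<theta> by (simp cong: measurable_cong_sets)
  qed (auto intro!: emeasure_le_of_intervals fM fN le)
  also have "(\<integral>\<^sup>+\<tau>. \<theta> \<tau> \<partial>M) = (\<integral>\<^sup>+\<tau>. \<theta> \<tau> * (ennreal (flux \<tau>) * indicator {0<..} \<tau>) \<partial>lborel)"
    unfolding M_def by (subst nn_integral_density) (auto simp: mult.commute)
  also have "(\<integral>\<^sup>+\<tau>. \<theta> \<tau> \<partial>N) = (\<integral>\<^sup>+x. \<theta> (u x) * (ennreal (norm (g x)) * indicator {x. u x > 0} x) \<partial>lborel)"
    unfolding N_def by (subst nn_integral_distr, simp, simp, subst nn_integral_density) (auto simp: mult.commute)
  finally show ?thesis .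
qed

end

section \<open>Superlevel sets and balls of the same measure\<close>

text \<open>
  A countable dense subset of \<open>U\<close>, together with the largest and the least element of \<open>U\<close> as far as
  they exist.
\<close>

lemma countable_cofinal_coinitial:
  fixes U :: "real set"
  obtains D where "countable D" "D \<subseteq> U" "\<And>x. x \<in> U \<Longrightarrow> \<exists>a\<in>D. \<exists>b\<in>D. a \<le> x \<and> x \<le> b"
proof -
  obtain D where D: "countable D" "D \<subseteq> U" "U \<subseteq> closure D"
    using separable[of U] by blast
  define E where "E = D \<union> {x \<in> U. \<forall>y\<in>U. y \<le> x} \<union> {x \<in> U. \<forall>y\<in>U. x \<le> y}"
  have dense: "\<exists>d\<in>D. d \<in> V" if "open V" "x \<in> V" "x \<in> U" for V x
    using D(3) that by (metis closure_iff_nhds_not_empty IntE ex_in_conv order_refl subsetD)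
  show ?thesis
  proof (rule that[of E])
    have "{x \<in> U. \<forall>y\<in>U. y \<le> x} \<subseteq> {x}" if "x \<in> U" "\<forall>y\<in>U. y \<le> x" for x
      using that by (auto intro: antisym)
    then have "countable {x \<in> U. \<forall>y\<in>U. y \<le> x}"
      by (metis (no_types, lifting) countable_empty countable_insert countable_subset empty_Collect_eq mem_Collect_eq)
    moreover have "{x \<in> U. \<forall>y\<in>U. x \<le> y} \<subseteq> {x}" if "x \<in> U" "\<forall>y\<in>U. x \<le> y" for x
      using that by (auto intro: antisym)
    then have "countable {x \<in> U. \<forall>y\<in>U. x \<le> y}"
      by (metis (no_types, lifting) countable_empty countable_insert countable_subset empty_Collect_eq mem_Collect_eq)
    ultimately show "countable E" using D(1) by (simp add: E_def)
    show "E \<subseteq> U" using D(2) by (auto simp: E_def)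
    fix x assume x: "x \<in> U"
    have "\<exists>b\<in>E. x \<le> b"
    proof (cases "\<forall>y\<in>U. y \<le> x")
      case True
      then show ?thesis using x by (auto simp: E_def)
    next
      case False
      then obtain y where "y \<in> U" "x < y" by auto
      then have "\<exists>d\<in>D. d \<in> {x<..}" by (intro dense[of _ y]) auto
      then show ?thesis by (auto simp: E_def intro: less_imp_le)
    qed
    moreover have "\<exists>a\<in>E. a \<le> x"
    proof (cases "\<forall>y\<in>U. x \<le> y")
      case True
      then show ?thesis using x by (auto simp: E_def)
    next
      case False
      then obtain y where "y \<in> U" "y < x" by auto
      then have "\<exists>d\<in>D. d \<in> {..<x}" by (intro dense[of _ y]) auto
      then show ?thesis by (auto simp: E_def intro: less_imp_le)
    qed
    ultimately show "\<exists>a\<in>E. \<exists>b\<in>E. a \<le> x \<and> x \<le> b" by blast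
  qed
qed

context isoperimetric_function
begin

lemma vol_pos: "unit_ball_vol (real DIM('a)) > 0" by (rule unit_ball_vol_pos) simp

lemma vol_nonzero: "unit_ball_vol (real DIM('a)) \<noteq> 0"
  using vol_pos by linarith

text \<open>The radius of the ball with the measure of \<open>{u > t}\<close>.\<close>

definition rad :: "real \<Rightarrow> real" where "rad t = root DIM('a) (lev t / unit_ball_vol (real DIM('a)))"

lemma rad_nonneg: "rad t \<ge> 0"
  unfolding rad_def using lev_nonneg vol_pos by (simp add: divide_nonneg_pos)

lemma rad_power: "unit_ball_vol (real DIM('a)) * rad t ^ DIM('a) = lev t"
proof -
  have "rad t ^ DIM('a) = lev t / unit_ball_vol (real DIM('a))"
    unfolding rad_def using lev_nonneg vol_pos by (intro real_root_pow_pos2) (auto simp: divide_nonneg_pos)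
  then show ?thesis using vol_nonzero by simp
qed

lemma rad_antimono: "s \<le> t \<Longrightarrow> rad t \<le> rad s"
  unfolding rad_def using lev_antimono vol_pos by (simp add: divide_right_mono)

lemma rad_measurable[measurable]: "rad \<in> borel_measurable borel"
proof -
  have "mono (\<lambda>t. - rad t)" by (intro monoI) (simp add: rad_antimono)
  then have "(\<lambda>t. - (- rad t)) \<in> borel_measurable borel" by (intro borel_measurable_uminus borel_measurable_mono)
  then show ?thesis by simp
qed

lemma rad_le_iff: "r \<ge> 0 \<Longrightarrow> rad t \<le> r \<longleftrightarrow> lev t \<le> unit_ball_vol (real DIM('a)) * r ^ DIM('a)"
  unfolding rad_power[symmetric] using vol_pos rad_nonneg[of t] by simp

lemma rad_le_R: "t \<ge> 0 \<Longrightarrow> rad t \<le> R"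
  using rad_le_iff[OF R, of 0] lev0 rad_antimono[of 0 t] by (simp add: lev_def)

text \<open>
  The levels attained on sets of positive measure. There \<open>rad\<close> jumps, and the distribution of
  \<open>rad \<circ> u\<close> has atoms, which the distribution of \<open>norm\<close> has not. Being countable, these levels can
  be ignored in integrals over the level.
\<close>

definition atoms :: "real set" where "atoms = {t. emeasure lborel {x \<in> \<Omega>. u x = t} \<noteq> 0}"

lemma countable_atoms: "countable atoms"
proof -
  let ?M = "distr (density lborel (indicator \<Omega>)) borel u"
  have eq: "emeasure ?M {t} = emeasure lborel {x \<in> \<Omega>. u x = t}" for t
  proof -
    have m: "u -` {t} \<in> sets borel" using measurable_sets_borel[OF u_meas, of "{t}"] by simp
    have "emeasure ?M {t} = emeasure (density lborel (indicator \<Omega>)) (u -` {t})"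
      by (subst emeasure_distr) auto
    also have "\<dots> = (\<integral>\<^sup>+x. indicator \<Omega> x * indicator (u -` {t}) x \<partial>lborel)"
      by (rule emeasure_density) (use m in auto)
    also have "\<dots> = (\<integral>\<^sup>+x. indicator {x \<in> \<Omega>. u x = t} x \<partial>lborel)"
      by (rule nn_integral_cong) (auto simp: indicator_def)
    also have "\<dots> = emeasure lborel {x \<in> \<Omega>. u x = t}" by (rule nn_integral_indicator) simp
    finally show ?thesis .
  qed
  have "emeasure ?M UNIV = emeasure lborel \<Omega>"
    by (subst emeasure_distr) (auto simp: emeasure_density)
  then interpret finite_measure ?M
    using finite_subset_\<Omega>[of \<Omega>] by (intro finite_measureI) auto
  have "atoms = {t. measure ?M {t} \<noteq> 0}"
    unfolding atoms_def eq[symmetric] emeasure_eq_measure by simp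
  then show ?thesis using countable_support by simp
qed

lemma atoms_borel[measurable]: "atoms \<in> sets borel"
  using countable_atoms by (rule sets.countable[rotated]) simp

lemma slice_measure:
  assumes ab: "a \<le> b" and t: "a \<notin> atoms"
  shows "emeasure lborel {x \<in> \<Omega>. a \<le> u x \<and> u x \<le> b} = ennreal (lev a - lev b)"
proof -
  have sub: "A \<subseteq> \<Omega> \<Longrightarrow> emeasure lborel A \<noteq> \<infinity>" for A using finite_subset_\<Omega>[of A] by simp
  have "{x \<in> \<Omega>. a \<le> u x \<and> u x \<le> b} = {x \<in> \<Omega>. a < u x \<and> u x \<le> b} \<union> {x \<in> \<Omega>. u x = a}" using ab by auto
  moreover have "{x \<in> \<Omega>. u x = a} \<in> null_sets lborel"
    using t by (intro null_setsI) (auto simp: atoms_def)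
  ultimately have "emeasure lborel {x \<in> \<Omega>. a \<le> u x \<and> u x \<le> b} = emeasure lborel {x \<in> \<Omega>. a < u x \<and> u x \<le> b}"
    by (simp add: emeasure_Un_null_set)
  also have "{x \<in> \<Omega>. a < u x \<and> u x \<le> b} = {x \<in> \<Omega>. u x > a} - {x \<in> \<Omega>. u x > b}" by auto
  also have "emeasure lborel \<dots> = emeasure lborel {x \<in> \<Omega>. u x > a} - emeasure lborel {x \<in> \<Omega>. u x > b}"
    using ab by (intro emeasure_Diff sub) auto
  also have "\<dots> = ennreal (lev a - lev b)" by (simp add: emeasure_level ennreal_minus lev_nonneg)
  finally show ?thesis .
qed

text \<open>
  The levels \<open>t\<close> attained by \<open>u\<close> with \<open>s1 \<le> lev t \<le> s2\<close> are exhausted by intervals \<open>[a\<^sub>k, b\<^sub>k]\<close>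
  whose end points are such levels themselves, and \<open>{a\<^sub>k \<le> u \<le> b\<^sub>k}\<close> has measure
  \<open>lev a\<^sub>k - lev b\<^sub>k\<close>.
\<close>

lemma slice_bound:
  assumes s: "0 \<le> s1" "s1 \<le> s2"
  shows "emeasure lborel {x. 0 < u x \<and> u x \<notin> atoms \<and> s1 \<le> lev (u x) \<and> lev (u x) \<le> s2} \<le> ennreal (s2 - s1)"
proof -
  let ?Y = "{x. 0 < u x \<and> u x \<notin> atoms \<and> s1 \<le> lev (u x) \<and> lev (u x) \<le> s2}"
  obtain D where D: "countable D" "D \<subseteq> u ` ?Y" "\<And>x. x \<in> u ` ?Y \<Longrightarrow> \<exists>a\<in>D. \<exists>b\<in>D. a \<le> x \<and> x \<le> b"
    using countable_cofinal_coinitial[of "u ` ?Y"] by blast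
  show ?thesis
  proof (cases "D = {}")
    case True
    then have "?Y = {}" using D(3) by blast
    then show ?thesis by (simp only: emeasure_empty) simp
  next
    case False
    define d where "d = from_nat_into D"
    have d: "d k \<in> u ` ?Y" for k using from_nat_into[OF False, of k] D(2) by (auto simp: d_def)
    \<comment> \<open>The extreme levels among the first members of an enumeration of \<open>D\<close>.\<close>
    define a where "a k = Min (d ` {..k})" for k
    define b where "b k = Max (d ` {..k})" for k
    have ak: "a k \<in> u ` ?Y" and bk: "b k \<in> u ` ?Y" for k
    proof -
      have "a k \<in> d ` {..k}" unfolding a_def by (rule Min_in) auto
      then show "a k \<in> u ` ?Y" using d by auto
      have "b k \<in> d ` {..k}" unfolding b_def by (rule Max_in) auto
      then show "b k \<in> u ` ?Y" using d by auto
    qed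
    have ad: "a k \<le> d j" "d j \<le> b k" if "j \<le> k" for j k
      using that unfolding a_def b_def by (auto intro!: Min_le Max_ge)
    let ?A = "\<lambda>k. {x \<in> \<Omega>. a k \<le> u x \<and> u x \<le> b k}"
    have inc: "incseq ?A"
    proof -
      have "a k \<le> a j" "b j \<le> b k" if "j \<le> k" for j k
        using that unfolding a_def b_def by (auto intro!: Min_antimono Max_mono)
      then show ?thesis unfolding incseq_def by (auto intro: order_trans)
    qed
    have sub: "?Y \<subseteq> (\<Union>k. ?A k)"
    proof
      fix x assume x: "x \<in> ?Y"
      then obtain p q where pq: "p \<in> D" "q \<in> D" "p \<le> u x" "u x \<le> q" using D(3)[of "u x"] by auto
      obtain i j where ij: "d i = p" "d j = q"
        using pq(1,2) from_nat_into_surj[OF D(1)] unfolding d_def by metis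
      have "x \<in> \<Omega>" using x out(1)[of x] by fastforce
      then have "x \<in> ?A (max i j)"
        using ad(1)[of i "max i j"] ad(2)[of j "max i j"] pq ij by auto
      then show "x \<in> (\<Union>k. ?A k)" by blast
    qed
    have bound: "emeasure lborel (?A k) \<le> ennreal (s2 - s1)" for k
    proof -
      have "a k \<le> b k" using ad[of 0 k] by linarith
      moreover have "a k \<notin> atoms" using ak[of k] by auto
      ultimately have "emeasure lborel (?A k) = ennreal (lev (a k) - lev (b k))" by (rule slice_measure)
      also have "\<dots> \<le> ennreal (s2 - s1)"
        using ak[of k] bk[of k] by (intro ennreal_leI) auto
      finally show ?thesis .
    qed
    have "emeasure lborel ?Y \<le> emeasure lborel (\<Union>k. ?A k)"
      using sub by (intro emeasure_mono) auto
    also have "\<dots> = (SUP k. emeasure lborel (?A k))"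
      by (rule SUP_emeasure_incseq[symmetric]) (use inc in auto)
    also have "\<dots> \<le> ennreal (s2 - s1)" by (intro SUP_least bound)
    finally show ?thesis .
  qed
qed

text \<open>
  By \<open>slice_bound\<close> the set where \<open>a < rad (u x) \<le> b\<close> is at most as large as the spherical shell with
  the radii \<open>a\<close> and \<open>b\<close>.
\<close>

lemma radial_law:
  fixes \<theta> :: "real \<Rightarrow> ennreal"
  assumes \<theta>[measurable]: "\<theta> \<in> borel_measurable borel"
  shows "(\<integral>\<^sup>+x. \<theta> (rad (u x)) * indicator {x. 0 < u x \<and> u x \<notin> atoms} x \<partial>lborel) \<le>
    (\<integral>\<^sup>+x. \<theta> (norm x) * indicator (cball 0 R) x \<partial>(lborel :: 'a measure))"
proof -
  let ?Y = "{x. 0 < u x \<and> u x \<notin> atoms}"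
  have Y[measurable]: "?Y \<in> sets borel"
  proof -
    have "?Y = u -` ({0<..} - atoms)" by auto
    then show ?thesis using measurable_sets_borel[OF u_meas, of "{0<..} - atoms"] by simp
  qed
  define M where "M = distr (density lborel (indicator ?Y)) borel (\<lambda>x. rad (u x))"
  define N where "N = distr (density lborel (indicator (cball (0::'a) R))) borel norm"
  have sM[simp]: "sets M = sets borel" "space M = UNIV" and sN[simp]: "sets N = sets borel" "space N = UNIV"
    by (simp_all add: M_def N_def)
  have M: "emeasure M A = emeasure lborel {x \<in> ?Y. rad (u x) \<in> A}" if [measurable]: "A \<in> sets borel" for A
  proof -
    have m: "(\<lambda>x. rad (u x)) -` A \<in> sets borel" using measurable_sets_borel[of "\<lambda>x. rad (u x)" borel A] by simp
    have "emeasure M A = emeasure (density lborel (indicator ?Y)) ((\<lambda>x. rad (u x)) -` A)"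
      unfolding M_def by (subst emeasure_distr) auto
    also have "\<dots> = (\<integral>\<^sup>+x. indicator ?Y x * indicator ((\<lambda>x. rad (u x)) -` A) x \<partial>lborel)"
      by (rule emeasure_density) (use m Y in simp_all)
    also have "\<dots> = (\<integral>\<^sup>+x. indicator {x \<in> ?Y. rad (u x) \<in> A} x \<partial>lborel)"
      by (rule nn_integral_cong) (auto simp: indicator_def)
    also have "\<dots> = emeasure lborel {x \<in> ?Y. rad (u x) \<in> A}"
    proof (rule nn_integral_indicator)
      have "{x \<in> ?Y. rad (u x) \<in> A} = ?Y \<inter> (\<lambda>x. rad (u x)) -` A" by auto
      then show "{x \<in> ?Y. rad (u x) \<in> A} \<in> sets lborel" using Y m by simp
    qed
    finally show ?thesis .
  qed
  have N: "emeasure N A = emeasure lborel {x \<in> cball (0::'a) R. norm x \<in> A}" if [measurable]: "A \<in> sets borel" for A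
  proof -
    have m: "(norm :: 'a \<Rightarrow> real) -` A \<in> sets borel" using measurable_sets_borel[of "norm :: 'a \<Rightarrow> real" borel A]
        by simp
    have "emeasure N A = emeasure (density lborel (indicator (cball (0::'a) R))) (norm -` A)"
      unfolding N_def by (subst emeasure_distr) auto
    also have "\<dots> = (\<integral>\<^sup>+x. indicator (cball (0::'a) R) x * indicator (norm -` A) x \<partial>lborel)"
      by (rule emeasure_density) (use m in \<open>auto intro!: borel_measurable_indicator borel_closed\<close>)
    also have "\<dots> = (\<integral>\<^sup>+x. indicator {x \<in> cball (0::'a) R. norm x \<in> A} x \<partial>lborel)"
      by (rule nn_integral_cong) (auto simp: indicator_def)
    also have "\<dots> = emeasure lborel {x \<in> cball (0::'a) R. norm x \<in> A}"
      by (rule nn_integral_indicator) simp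
    finally show ?thesis .
  qed
  have Y\<Omega>: "?Y \<subseteq> \<Omega>" using out(1) by fastforce
  have fM: "finite_measure M"
    using finite_subset_\<Omega>[of "{x \<in> ?Y. rad (u x) \<in> UNIV}"] Y\<Omega> by (intro finite_measureI) (auto simp: M)
  have fN: "finite_measure N"
  proof (rule finite_measureI)
    have "{x \<in> cball (0::'a) R. norm x \<in> UNIV} = cball 0 R" by blast
    then have "emeasure N UNIV = emeasure lborel (cball (0::'a) R)"
        using N[OF sets.top[of borel, unfolded space_borel]] by (simp only:)
    then show "emeasure N (space N) \<noteq> \<infinity>"
      using emeasure_bounded_finite[of "cball (0::'a) R"] by (simp only: sN) simp
  qed
  have le: "emeasure M {a<..b} \<le> emeasure N {a<..b}" if ab: "a < b" for a b
  proof (cases "b < 0 \<or> R \<le> a")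
    case True
    have "\<not> (a < rad (u x) \<and> rad (u x) \<le> b)" if "0 < u x" for x
      using True rad_nonneg[of "u x"] rad_le_R[of "u x"] that by auto
    then have "{x \<in> ?Y. rad (u x) \<in> {a<..b}} = {}" by auto
    then show ?thesis using M[of "{a<..b}"] by (simp only: emeasure_empty) simp
  next
    case False
    define a' b' where "a' = max a 0" and "b' = min b R"
    have ab': "0 \<le> a'" "a' \<le> b'" "b' \<le> R" "0 \<le> b'" using False ab R by (auto simp: a'_def b'_def)
    have lev1: "unit_ball_vol (real DIM('a)) * a' ^ DIM('a) \<le> lev t" if "a < rad t" for t
    proof -
      have "a' \<le> rad t" using that rad_nonneg[of t] by (simp add: a'_def)
      then show ?thesis unfolding rad_power[symmetric] using ab' vol_pos by (intro mult_left_mono power_mono) auto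
    qed
    have "emeasure M {a<..b} \<le> emeasure lborel {x. 0 < u x \<and> u x \<notin> atoms \<and> unit_ball_vol (real DIM('a)) * a' ^ DIM('a) \<le>
        lev (u x) \<and> lev (u x) \<le> unit_ball_vol (real DIM('a)) * b' ^ DIM('a)}"
      unfolding M[OF greaterThanAtMost_borel]
    proof (rule emeasure_mono)
      show "{x \<in> ?Y. rad (u x) \<in> {a<..b}} \<subseteq> {x. 0 < u x \<and> u x \<notin> atoms \<and> unit_ball_vol (real DIM('a)) * a' ^ DIM('a) \<le>
          lev (u x) \<and> lev (u x) \<le> unit_ball_vol (real DIM('a)) * b' ^ DIM('a)}"
      proof
        fix x assume x: "x \<in> {x \<in> ?Y. rad (u x) \<in> {a<..b}}"
        then have "rad (u x) \<le> b'" using rad_le_R[of "u x"] by (auto simp: b'_def)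
        then show "x \<in> {x. 0 < u x \<and> u x \<notin> atoms \<and> unit_ball_vol (real DIM('a)) * a' ^ DIM('a) \<le> lev (u x) \<and> lev (u x) \<le>
            unit_ball_vol (real DIM('a)) * b' ^ DIM('a)}"
          using x lev1[of "u x"] rad_le_iff[OF ab'(4)] by auto
      qed
      have [measurable]: "{x \<in> space lborel. u x \<notin> atoms} \<in> sets lborel"
        using measurable_sets_borel[OF u_meas, of "- atoms"] by (simp add: vimage_def)
      show "{x. 0 < u x \<and> u x \<notin> atoms \<and> unit_ball_vol (real DIM('a)) * a' ^ DIM('a) \<le> lev (u x) \<and> lev (u x) \<le>
          unit_ball_vol (real DIM('a)) * b' ^ DIM('a)} \<in> sets lborel"
      proof -
        have "{x. 0 < u x \<and> u x \<notin> atoms \<and> unit_ball_vol (real DIM('a)) * a' ^ DIM('a) \<le> lev (u x) \<and> lev (u x) \<le>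
            unit_ball_vol (real DIM('a)) * b' ^ DIM('a)} =
          ?Y \<inter> {x. unit_ball_vol (real DIM('a)) * a' ^ DIM('a) \<le> lev (u x) \<and> lev (u x) \<le>
              unit_ball_vol (real DIM('a)) * b' ^ DIM('a)}" by auto
        also have "\<dots> \<in> sets lborel" by measurable
        finally show ?thesis .
      qed
    qed
    also have "\<dots> \<le> ennreal (unit_ball_vol (real DIM('a)) * b' ^ DIM('a) - unit_ball_vol (real DIM('a)) *
        a' ^ DIM('a))"
      using ab' vol_pos by (intro slice_bound mult_left_mono power_mono) auto
    also have "\<dots> = emeasure lborel (cball (0::'a) b') - emeasure lborel (cball (0::'a) a')"
      using ab' vol_pos by (simp add: emeasure_cball ennreal_minus)
    also have "\<dots> = emeasure lborel (cball (0::'a) b' - cball 0 a')"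
      using ab' emeasure_bounded_finite[of "cball (0::'a) a'"] by (intro emeasure_Diff[symmetric]) auto
    also have "\<dots> \<le> emeasure lborel {x \<in> cball (0::'a) R. norm x \<in> {a<..b}}"
      by (intro emeasure_mono) (auto simp: a'_def b'_def)
    finally show ?thesis by (simp add: N)
  qed
  have "(\<integral>\<^sup>+r. \<theta> r \<partial>M) \<le> (\<integral>\<^sup>+r. \<theta> r \<partial>N)"
  proof (rule nn_integral_le_of_emeasure_le)
    show "\<theta> \<in> borel_measurable M" using \<theta> by (simp cong: measurable_cong_sets)
  qed (auto intro!: emeasure_le_of_intervals fM fN le)
  also have "(\<integral>\<^sup>+r. \<theta> r \<partial>M) = (\<integral>\<^sup>+x. \<theta> (rad (u x)) * indicator ?Y x \<partial>lborel)"
    unfolding M_def by (subst nn_integral_distr, simp, simp, subst nn_integral_density) (auto simp: mult.commute intro!: borel_measurable_indicator borel_closed)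
  also have "(\<integral>\<^sup>+r. \<theta> r \<partial>N) = (\<integral>\<^sup>+x. \<theta> (norm x) * indicator (cball 0 R) x \<partial>(lborel :: 'a measure))"
    unfolding N_def by (subst nn_integral_distr, simp, simp, subst nn_integral_density) (auto simp: mult.commute intro!: borel_measurable_indicator borel_closed)
  finally show ?thesis .
qed

end

section \<open>Polar coordinates and the radial profile\<close>

text \<open>The image of \<open>lborel\<close> under the norm is determined by the measures of spherical shells.\<close>

lemma nn_integral_radial:
  fixes \<theta> :: "real \<Rightarrow> ennreal"
  assumes \<theta>[measurable]: "\<theta> \<in> borel_measurable borel"
  shows "(\<integral>\<^sup>+x. \<theta> (norm x) \<partial>(lborel :: 'a::euclidean_space measure)) =
    (\<integral>\<^sup>+r. \<theta> r * (ennreal (real DIM('a) * unit_ball_vol (real DIM('a)) * r ^ (DIM('a) - 1)) *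
        indicator {0<..} r) \<partial>lborel)"
proof -
  let ?n = "DIM('a)" and ?c = "unit_ball_vol (real DIM('a))"
  have c: "?c > 0" by (rule unit_ball_vol_pos) simp
  define M where "M = distr (lborel :: 'a measure) borel norm"
  define N where "N = density lborel (\<lambda>r. ennreal (real ?n * ?c * r ^ (?n - 1)) * indicator {0<..} r)"
  have M: "emeasure M A = emeasure lborel ((norm :: 'a \<Rightarrow> real) -` A)" if "A \<in> sets borel" for A
    using that unfolding M_def by (subst emeasure_distr) auto
  have N: "emeasure N A = (\<integral>\<^sup>+r. ennreal (real ?n * ?c * r ^ (?n - 1)) * indicator {0<..} r * indicator A r \<partial>lborel)"
      if "A \<in> sets borel" for A
    using that unfolding N_def by (subst emeasure_density) auto
  have eM: "emeasure M {a<..b} = (if b < 0 \<or> b < a then 0 else ennreal (?c * b ^ ?n - ?c * (max a 0) ^ ?n))"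
      for a b :: real
  proof (cases "b < 0 \<or> b < a")
    case True
    have "\<not> (a < norm x \<and> norm x \<le> b)" for x :: 'a
      using True norm_ge_zero[of x] by linarith
    then have "(norm :: 'a \<Rightarrow> real) -` {a<..b} = {}" by auto
    then show ?thesis using True by (simp add: M)
  next
    case False
    show ?thesis
    proof (cases "a < 0")
      case True
      have "(norm :: 'a \<Rightarrow> real) -` {a<..b} = cball 0 b" using True by (auto intro: less_le_trans[OF _ norm_ge_zero])
      then show ?thesis using True False by (simp add: M emeasure_cball)
    next
      case a: False
      have "(norm :: 'a \<Rightarrow> real) -` {a<..b} = cball 0 b - cball 0 a" by auto
      then have "emeasure M {a<..b} = emeasure lborel (cball (0::'a) b - cball 0 a)" by (simp add: M)
      also have "\<dots> = emeasure lborel (cball (0::'a) b) - emeasure lborel (cball (0::'a) a)"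
        using False emeasure_bounded_finite[of "cball (0::'a) a"] by (intro emeasure_Diff) auto
      also have "\<dots> = ennreal (?c * b ^ ?n - ?c * a ^ ?n)"
        using a False c by (simp add: emeasure_cball ennreal_minus)
      finally show ?thesis using a False by (simp add: max_def)
    qed
  qed
  have eN: "emeasure N {a<..b} = (if b < 0 \<or> b < a then 0 else ennreal (?c * b ^ ?n - ?c * (max a 0) ^ ?n))"
      for a b :: real
  proof (cases "b < 0 \<or> b < a")
    case True
    then have z: "ennreal (real ?n * ?c * r ^ (?n - 1)) * indicator {0<..} r * indicator {a<..b} r = 0" for r
      by (auto simp: indicator_def)
    have "emeasure N {a<..b} = 0" using N[of "{a<..b}"] by (simp only: z) simp
    then show ?thesis using True by simp
  next
    case False
    then have ab: "max a 0 \<le> b" by simp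
    have "emeasure N {a<..b} = (\<integral>\<^sup>+r. ennreal (real ?n * ?c * r ^ (?n - 1)) * indicator {max a 0..b} r \<partial>lborel)"
    proof (subst N, simp, rule nn_integral_cong_AE)
      have "AE r in lborel. r \<noteq> max a 0" by (rule AE_lborel_singleton)
      then show "AE r in lborel. ennreal (real ?n * ?c * r ^ (?n - 1)) * indicator {0<..} r * indicator {a<..b} r =
        ennreal (real ?n * ?c * r ^ (?n - 1)) * indicator {max a 0..b} r"
        by eventually_elim (auto simp: indicator_def)
    qed
    also have "\<dots> = ennreal (?c * b ^ ?n - ?c * (max a 0) ^ ?n)"
    proof (rule nn_integral_FTC_Icc)
      fix x assume "x \<in> {max a 0..b}"
      then show "0 \<le> real ?n * ?c * x ^ (?n - 1)" using c by auto
      show "((\<lambda>r. ?c * r ^ ?n) has_real_derivative real ?n * ?c * x ^ (?n - 1)) (at x)"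
        by (auto intro!: derivative_eq_intros)
    qed (use ab in auto)
    finally show ?thesis using False by simp
  qed
  have "M = N"
  proof (rule measure_eqI_generator_eq[where E="range (\<lambda>(a, b). {a <.. b::real})" and \<Omega>=UNIV and A="\<lambda>n. {- real n<..real n}"])
    show "Int_stable (range (\<lambda>(a, b). {a <.. b::real}))" by (auto simp: Int_stable_def)
    show "sets M = sigma_sets UNIV (range (\<lambda>(a, b). {a <.. b::real}))"
        "sets N = sigma_sets UNIV (range (\<lambda>(a, b). {a <.. b::real}))"
      unfolding M_def N_def by (simp_all add: borel_sigma_sets_Ioc)
    show "(\<Union>n. {- real n<..real n}) = UNIV" by (rule intervals_exhaust_reals(1))
  qed (auto simp: eM eN)
  have "(\<integral>\<^sup>+r. \<theta> r \<partial>M) = (\<integral>\<^sup>+r. \<theta> r \<partial>N)" unfolding \<open>M = N\<close> ..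
  also have "(\<integral>\<^sup>+r. \<theta> r \<partial>M) = (\<integral>\<^sup>+x. \<theta> (norm x) \<partial>(lborel :: 'a measure))"
    unfolding M_def by (subst nn_integral_distr) auto
  also have "(\<integral>\<^sup>+r. \<theta> r \<partial>N) = (\<integral>\<^sup>+r. \<theta> r * (ennreal (real ?n * ?c * r ^ (?n - 1)) * indicator {0<..} r) \<partial>lborel)"
    unfolding N_def by (subst nn_integral_density) (auto simp: mult.commute intro!: borel_measurable_indicator borel_closed)
  finally show ?thesis .
qed

text \<open>
  The isoperimetric constant of the \<open>n\<close>-dimensional space divided by the constant \<open>c\<close> of a relative
  isoperimetric inequality.
\<close>

definition symmetrization_ratio :: "real \<Rightarrow> real \<Rightarrow> real" where
  "symmetrization_ratio n c = n * unit_ball_vol n powr (1 / n) / c"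

context isoperimetric_function
begin

definition energy :: real where "energy = (\<integral>x. (norm (g x))\<^sup>2 \<partial>lborel)"

lemma flux_rad:
  assumes "rad t > 0"
  shows "flux t = (c * unit_ball_vol (real DIM('a)) powr (1 - 1 / real DIM('a))) * rad t ^ (DIM('a) - 1)"
proof -
  have "lev t powr (1 - 1 / real DIM('a)) = unit_ball_vol (real DIM('a)) powr (1 - 1 / real DIM('a)) *
      (rad t ^ DIM('a)) powr (1 - 1 / real DIM('a))"
    unfolding rad_power[symmetric] by (rule powr_mult)
  also have "(rad t ^ DIM('a)) powr (1 - 1 / real DIM('a)) = (rad t powr real DIM('a)) powr (1 - 1 / real DIM('a))"
    using assms by (simp add: powr_realpow)
  also have "\<dots> = rad t powr (real DIM('a) * (1 - 1 / real DIM('a)))" by (rule powr_powr)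
  also have "real DIM('a) * (1 - 1 / real DIM('a)) = real (DIM('a) - 1)"
    by (simp add: field_simps of_nat_diff)
  also have "rad t powr real (DIM('a) - 1) = rad t ^ (DIM('a) - 1)" using assms by (rule powr_realpow)
  finally show ?thesis by (simp add: flux_def)
qed

text \<open>
  The coarea inequality for \<open>\<theta> \<circ> rad\<close>, the Cauchy-Schwarz inequality, and \<open>radial_law\<close> for the
  factor \<open>\<integral> \<theta>(rad u)\<^sup>2 dx\<close>.
\<close>

lemma duality_estimate:
  fixes \<theta> :: "real \<Rightarrow> ennreal"
  assumes \<theta>[measurable]: "\<theta> \<in> borel_measurable borel"
  shows "(\<integral>\<^sup>+\<tau>. \<theta> (rad \<tau>) * (ennreal (flux \<tau>) * indicator {0<..} \<tau>) \<partial>lborel)\<^sup>2 \<le>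
    (\<integral>\<^sup>+x. (\<theta> (norm x))\<^sup>2 * indicator (cball 0 R) x \<partial>(lborel :: 'a measure)) * ennreal energy"
proof -
  let ?Y = "{x. 0 < u x \<and> u x \<notin> atoms}"
  have Y[measurable]: "?Y \<in> sets borel"
  proof -
    have "?Y = u -` ({0<..} - atoms)" by auto
    then show ?thesis using measurable_sets_borel[OF u_meas, of "{0<..} - atoms"] by simp
  qed
  have "(\<integral>\<^sup>+\<tau>. \<theta> (rad \<tau>) * (ennreal (flux \<tau>) * indicator {0<..} \<tau>) \<partial>lborel) =
      (\<integral>\<^sup>+\<tau>. (\<theta> (rad \<tau>) * indicator (- atoms) \<tau>) * (ennreal (flux \<tau>) * indicator {0<..} \<tau>) \<partial>lborel)"
  proof (rule nn_integral_cong_AE)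
    have "AE \<tau> in lborel. \<tau> \<notin> atoms" by (intro AE_not_in countable_imp_null_set_lborel countable_atoms)
    then show "AE \<tau> in lborel. \<theta> (rad \<tau>) * (ennreal (flux \<tau>) * indicator {0<..} \<tau>) =
      (\<theta> (rad \<tau>) * indicator (- atoms) \<tau>) * (ennreal (flux \<tau>) * indicator {0<..} \<tau>)"
      by eventually_elim simp
  qed
  also have "\<dots> \<le> (\<integral>\<^sup>+x. (\<theta> (rad (u x)) * indicator (- atoms) (u x)) * (ennreal (norm (g x)) *
      indicator {x. u x > 0} x) \<partial>lborel)"
    by (rule coarea_inequality) measurable
  also have "\<dots> = (\<integral>\<^sup>+x. (\<theta> (rad (u x)) * indicator ?Y x) * ennreal (norm (g x)) \<partial>lborel)"
    by (intro nn_integral_cong) (auto simp: indicator_def)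
  finally have "(\<integral>\<^sup>+\<tau>. \<theta> (rad \<tau>) * (ennreal (flux \<tau>) * indicator {0<..} \<tau>) \<partial>lborel)\<^sup>2 \<le>
     (\<integral>\<^sup>+x. (\<theta> (rad (u x)) * indicator ?Y x) * ennreal (norm (g x)) \<partial>lborel)\<^sup>2"
    by (rule power_mono) simp
  also have "\<dots> \<le> (\<integral>\<^sup>+x. (\<theta> (rad (u x)) * indicator ?Y x)\<^sup>2 \<partial>lborel) * (\<integral>\<^sup>+x. (ennreal (norm (g x)))\<^sup>2 \<partial>lborel)"
    by (rule Cauchy_Schwarz_nn_integral) measurable
  also have "(\<integral>\<^sup>+x. (ennreal (norm (g x)))\<^sup>2 \<partial>lborel) = ennreal energy"
    unfolding energy_def using g2 by (simp add: ennreal_power nn_integral_eq_integral)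
  also have "(\<integral>\<^sup>+x. (\<theta> (rad (u x)) * indicator ?Y x)\<^sup>2 \<partial>lborel) = (\<integral>\<^sup>+x. (\<theta> (rad (u x)))\<^sup>2 * indicator ?Y x \<partial>lborel)"
    by (intro nn_integral_cong) (auto simp: indicator_def)
  also have "(\<integral>\<^sup>+x. (\<theta> (rad (u x)))\<^sup>2 * indicator ?Y x \<partial>lborel) * ennreal energy \<le>
     (\<integral>\<^sup>+x. (\<theta> (norm x))\<^sup>2 * indicator (cball 0 R) x \<partial>(lborel :: 'a measure)) * ennreal energy"
    by (intro mult_right_mono radial_law[of "\<lambda>r. (\<theta> r)\<^sup>2"]) auto
  finally show ?thesis .
qed

lemma symmetrization_ratio_eq: "real DIM('a) * unit_ball_vol (real DIM('a)) / (c *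
    unit_ball_vol (real DIM('a)) powr (1 - 1 / real DIM('a))) = symmetrization_ratio (real DIM('a)) c"
proof -
  have "unit_ball_vol (real DIM('a)) powr (1 / real DIM('a)) *
      unit_ball_vol (real DIM('a)) powr (1 - 1 / real DIM('a)) = unit_ball_vol (real DIM('a))"
    using vol_pos by (simp add: powr_add[symmetric])
  then have "real DIM('a) * unit_ball_vol (real DIM('a)) / (c *
      unit_ball_vol (real DIM('a)) powr (1 - 1 / real DIM('a))) =
    real DIM('a) * (unit_ball_vol (real DIM('a)) powr (1 / real DIM('a)) *
        unit_ball_vol (real DIM('a)) powr (1 - 1 / real DIM('a))) /
      (c * unit_ball_vol (real DIM('a)) powr (1 - 1 / real DIM('a)))"
    by (simp only:)
  also have "\<dots> = symmetrization_ratio (real DIM('a)) c"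
    unfolding symmetrization_ratio_def using vol_nonzero by simp
  finally show ?thesis .
qed

text \<open>
  By duality the image of \<open>flux \<tau> d\<tau>\<close> under \<open>rad\<close> has a square integrable density \<open>h\<close> with respect
  to the distribution of \<open>norm\<close> on the ball. Integrating the function \<open>r \<mapsto> 1 / flux\<close>, expressed by
  the radius \<open>r\<close>, over \<open>(s, \<infinity>)\<close> on both sides removes the flux on the left; on the right the weight
  of polar coordinates cancels the power of \<open>r\<close> and leaves \<open>symmetrization_ratio\<close> times \<open>h\<close>.
\<close>

lemma profile_exists:
  obtains e :: "real \<Rightarrow> real" where "e \<in> borel_measurable borel" "\<And>r. e r \<ge> 0" "\<And>r. r \<notin> {0<..R} \<Longrightarrow> e r = 0"
    "(\<integral>\<^sup>+x. ennreal ((e (norm x))\<^sup>2) \<partial>(lborel :: 'a measure)) \<le>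
        ennreal ((symmetrization_ratio (real DIM('a)) c)\<^sup>2 * energy)"
    "\<And>s. s > 0 \<Longrightarrow> emeasure lborel {\<tau>. 0 < \<tau> \<and> s < rad \<tau>} = (\<integral>\<^sup>+r. ennreal (e r) * indicator {s<..} r \<partial>lborel)"
proof -
  define M where "M = distr (density lborel (indicator (cball (0::'a) R))) borel norm"
  define N where "N = distr (density lborel (\<lambda>\<tau>. ennreal (flux \<tau>) * indicator {0<..} \<tau>)) borel rad"
  have sM[simp]: "sets M = sets borel" "space M = UNIV" and sN[simp]: "sets N = sets borel" "space N = UNIV"
    by (simp_all add: M_def N_def)
  have M: "(\<integral>\<^sup>+r. \<theta> r \<partial>M) = (\<integral>\<^sup>+x. \<theta> (norm x) * indicator (cball 0 R) x \<partial>(lborel :: 'a measure))"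
    if [measurable]: "\<theta> \<in> borel_measurable borel" for \<theta>
    unfolding M_def by (subst nn_integral_distr, simp, simp, subst nn_integral_density) (auto simp: mult.commute intro!: borel_measurable_indicator borel_closed)
  have N: "(\<integral>\<^sup>+r. \<theta> r \<partial>N) = (\<integral>\<^sup>+\<tau>. \<theta> (rad \<tau>) * (ennreal (flux \<tau>) * indicator {0<..} \<tau>) \<partial>lborel)"
    if [measurable]: "\<theta> \<in> borel_measurable borel" for \<theta>
    unfolding N_def by (subst nn_integral_distr, simp, simp, subst nn_integral_density) (auto simp: mult.commute intro!: borel_measurable_indicator borel_closed)
  have "(\<integral>\<^sup>+r. 1 \<partial>M) < \<infinity>"
    using emeasure_bounded_finite[of "cball (0::'a) R"] by (subst M) (auto simp: less_top)
  then have fM: "finite_measure M" by (intro finite_measureI) simp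
  have e0: "energy \<ge> 0" by (simp add: energy_def)
  obtain h where h[measurable]: "h \<in> borel_measurable borel" and h0: "\<And>r. h r \<ge> 0"
    and Nh: "N = density M (\<lambda>r. ennreal (h r))" and h2: "(\<integral>\<^sup>+r. ennreal ((h r)\<^sup>2) \<partial>M) \<le> ennreal energy"
  proof (rule density_of_square_bound[OF fM sM(1) sN(1) e0])
    show "(\<integral>\<^sup>+r. \<theta> r \<partial>N)\<^sup>2 \<le> (\<integral>\<^sup>+r. (\<theta> r)\<^sup>2 \<partial>M) * ennreal energy" if [measurable]: "\<theta> \<in> borel_measurable borel" for \<theta>
      using duality_estimate[OF that] by (simp add: M N)
  qed blast
  have r0: "symmetrization_ratio (real DIM('a)) c > 0" unfolding symmetrization_ratio_def using vol_nonzero c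
      by (intro divide_pos_pos mult_pos_pos) auto
  define e where "e r = symmetrization_ratio (real DIM('a)) c * h r * indicator {0<..R} r" for r
  have em[measurable]: "e \<in> borel_measurable borel" unfolding e_def by measurable
  let ?k = "c * unit_ball_vol (real DIM('a)) powr (1 - 1 / real DIM('a))"
  have k: "?k > 0" using c vol_nonzero by (intro mult_pos_pos) auto
  show ?thesis
  proof (rule that[OF em])
    show "e r \<ge> 0" for r using r0 h0 by (simp add: e_def)
    show "e r = 0" if "r \<notin> {0<..R}" for r using that by (simp add: e_def)
    have "(\<integral>\<^sup>+x. ennreal ((e (norm x))\<^sup>2) \<partial>(lborel :: 'a measure)) \<le>
        (\<integral>\<^sup>+x. ennreal ((symmetrization_ratio (real DIM('a)) c)\<^sup>2) * (ennreal ((h (norm x))\<^sup>2) *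
            indicator (cball 0 R) x) \<partial>(lborel :: 'a measure))"
      by (intro nn_integral_mono) (auto simp: e_def indicator_def power_mult_distrib ennreal_mult)
    also have "\<dots> = ennreal ((symmetrization_ratio (real DIM('a)) c)\<^sup>2) * (\<integral>\<^sup>+r. ennreal ((h r)\<^sup>2) \<partial>M)"
      by (subst nn_integral_cmult) (auto simp: M intro!: borel_measurable_times_ennreal borel_measurable_indicator borel_closed)
    also have "\<dots> \<le> ennreal ((symmetrization_ratio (real DIM('a)) c)\<^sup>2) * ennreal energy"
        by (intro mult_left_mono h2) auto
    finally show "(\<integral>\<^sup>+x. ennreal ((e (norm x))\<^sup>2) \<partial>(lborel :: 'a measure)) \<le>
        ennreal ((symmetrization_ratio (real DIM('a)) c)\<^sup>2 * energy)"
      using e0 by (simp add: ennreal_mult)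
    fix s :: real assume s: "s > 0"
    \<comment> \<open>The reciprocal of \<open>flux\<close> as a function of the radius, by \<open>flux_rad\<close>.\<close>
    define F where "F r = indicator {s<..} r * ennreal (1 / (?k * r ^ (DIM('a) - 1)))" for r :: real
    have Fm[measurable]: "F \<in> borel_measurable borel" unfolding F_def by measurable
    have "emeasure lborel {\<tau>. 0 < \<tau> \<and> s < rad \<tau>} = (\<integral>\<^sup>+\<tau>. indicator {\<tau>. 0 < \<tau> \<and> s < rad \<tau>} \<tau> \<partial>lborel)"
      by (rule nn_integral_indicator[symmetric]) simp
    also have "\<dots> = (\<integral>\<^sup>+\<tau>. F (rad \<tau>) * (ennreal (flux \<tau>) * indicator {0<..} \<tau>) \<partial>lborel)"
    proof (rule nn_integral_cong)
      fix \<tau>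
      show "indicator {\<tau>. 0 < \<tau> \<and> s < rad \<tau>} \<tau> = F (rad \<tau>) * (ennreal (flux \<tau>) * indicator {0<..} \<tau>)"
      proof (cases "0 < \<tau> \<and> s < rad \<tau>")
        case True
        then have p: "rad \<tau> > 0" using s by simp
        have "F (rad \<tau>) * (ennreal (flux \<tau>) * indicator {0<..} \<tau>) =
            ennreal (1 / (?k * rad \<tau> ^ (DIM('a) - 1))) * ennreal (?k * rad \<tau> ^ (DIM('a) - 1))"
          using True by (simp add: F_def flux_rad[OF p])
        also have "\<dots> = ennreal (1 / (?k * rad \<tau> ^ (DIM('a) - 1)) * (?k * rad \<tau> ^ (DIM('a) - 1)))"
          using p k by (intro ennreal_mult[symmetric]) auto
        also have "1 / (?k * rad \<tau> ^ (DIM('a) - 1)) * (?k * rad \<tau> ^ (DIM('a) - 1)) = 1"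
          using p k c vol_nonzero by simp
        finally show ?thesis using True by simp
      qed (auto simp: F_def)
    qed
    also have "\<dots> = (\<integral>\<^sup>+r. F r \<partial>N)" by (rule N[symmetric]) measurable
    also have "\<dots> = (\<integral>\<^sup>+r. ennreal (h r) * F r \<partial>M)"
      unfolding Nh by (rule nn_integral_density) (simp_all cong: measurable_cong_sets)
    also have "\<dots> = (\<integral>\<^sup>+x. (\<lambda>r. ennreal (h r) * F r * indicator {..R} r) (norm x) \<partial>(lborel :: 'a measure))"
      by (subst M) (auto intro!: nn_integral_cong simp: indicator_def)
    also have "\<dots> = (\<integral>\<^sup>+r. ennreal (h r) * F r * indicator {..R} r * (ennreal (real DIM('a) *
        unit_ball_vol (real DIM('a)) * r ^ (DIM('a) - 1)) * indicator {0<..} r) \<partial>lborel)"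
      by (rule nn_integral_radial) measurable
    also have "\<dots> = (\<integral>\<^sup>+r. ennreal (e r) * indicator {s<..} r \<partial>lborel)"
    proof (rule nn_integral_cong)
      fix r :: real
      show "ennreal (h r) * F r * indicator {..R} r * (ennreal (real DIM('a) * unit_ball_vol (real DIM('a)) *
          r ^ (DIM('a) - 1)) * indicator {0<..} r) = ennreal (e r) * indicator {s<..} r"
      proof (cases "s < r \<and> r \<le> R")
        case True
        then have p: "r > 0" using s by simp
        have "ennreal (h r) * F r * indicator {..R} r * (ennreal (real DIM('a) * unit_ball_vol (real DIM('a)) *
            r ^ (DIM('a) - 1)) * indicator {0<..} r) =
          ennreal (h r * (1 / (?k * r ^ (DIM('a) - 1))) * (real DIM('a) * unit_ball_vol (real DIM('a)) *
              r ^ (DIM('a) - 1)))"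
          using True p k h0[of r] vol_pos by (simp add: F_def ennreal_mult del: times_divide_eq_right divide_divide_eq_left)
        also have "h r * (1 / (?k * r ^ (DIM('a) - 1))) * (real DIM('a) * unit_ball_vol (real DIM('a)) *
            r ^ (DIM('a) - 1)) = (real DIM('a) * unit_ball_vol (real DIM('a)) / ?k) * h r"
          using p by (simp add: field_simps)
        also have "\<dots> = e r" unfolding symmetrization_ratio_eq using True p by (simp add: e_def)
        finally show ?thesis using True by simp
      qed (auto simp: F_def e_def)
    qed
    finally show "emeasure lborel {\<tau>. 0 < \<tau> \<and> s < rad \<tau>} = (\<integral>\<^sup>+r. ennreal (e r) * indicator {s<..} r \<partial>lborel)" .
  qed
qed

end

section \<open>Smooth radial functions\<close>

text \<open>
  The gradient is \<open>x\<close> times functions of the same form with larger \<open>j\<close>, which is why the power of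
  the norm is part of the statement. Near the origin everything vanishes.
\<close>

lemma Ck_fun_radial:
  fixes \<omega> :: "real \<Rightarrow> real"
  assumes "\<And>k. Ck_fun k \<omega>" "\<delta> > 0" "\<And>r. r < \<delta> \<Longrightarrow> \<omega> r = 0"
  shows "Ck_fun k (\<lambda>x::'a::euclidean_space. \<omega> (norm x) * inverse (norm x) ^ j)"
  using assms
proof (induction k arbitrary: \<omega> j)
  case 0
  have c: "continuous_on UNIV \<omega>" using 0(1)[of 0] by simp
  have "isCont (\<lambda>x::'a. \<omega> (norm x) * inverse (norm x) ^ j) x" for x
  proof (cases "norm x < \<delta>")
    case True
    have "\<forall>\<^sub>F y in nhds x. \<omega> (norm y) * inverse (norm y) ^ j = 0"
    proof (rule eventually_mono)
      have "open {y::'a. norm y < \<delta>}" by (intro open_Collect_less continuous_intros)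
      then show "\<forall>\<^sub>F y in nhds x. norm y < \<delta>" using True eventually_nhds_in_open[of "{y::'a. norm y < \<delta>}" x] by simp
    qed (use 0(3) in simp)
    then have "isCont (\<lambda>x::'a. \<omega> (norm x) * inverse (norm x) ^ j) x \<longleftrightarrow> isCont (\<lambda>x::'a. 0::real) x"
        by (rule isCont_cong)
    then show ?thesis by simp
  next
    case False
    then have "x \<noteq> 0" using 0(2) by auto
    then show ?thesis
      using continuous_on_eq_continuous_at[OF open_UNIV] c
      by (auto intro!: continuous_intros isCont_o2[of _ norm \<omega>])
  qed
  then show ?case by (simp add: continuous_at_imp_continuous_on)
next
  case (Suc k)
  let ?\<omega>' = "deriv \<omega>"
  have d: "(\<omega> has_real_derivative ?\<omega>' r) (at r)" for r
    using Ck_fun_real_SucD(1)[OF Suc.prems(1)[of "Suc 0"]] .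
  have C': "Ck_fun m ?\<omega>'" for m using Ck_fun_real_SucD(2)[OF Suc.prems(1)[of "Suc m"]] .
  have z': "?\<omega>' r = 0" if "r < \<delta>" for r
  proof -
    have "(\<omega> has_real_derivative 0) (at r)"
      by (rule has_field_derivative_transform_within_open[OF DERIV_const[of 0], of "{..<\<delta>}"])
         (use that Suc.prems(3) in auto)
    then show ?thesis by (rule DERIV_imp_deriv)
  qed
  let ?q = "\<lambda>x::'a. ?\<omega>' (norm x) * inverse (norm x) ^ (j + 1) + (- real j) * (\<omega> (norm x) * inverse (norm x) ^ (j +
      2))"
  show ?case
  proof (rule Ck_fun_SucI[where D="\<lambda>x v. ?q x * (x \<bullet> v)"])
    fix x :: 'a
    show "((\<lambda>x. \<omega> (norm x) * inverse (norm x) ^ j) has_derivative (\<lambda>v. ?q x * (x \<bullet> v))) (at x)"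
    proof (cases "norm x < \<delta>")
      case True
      have q: "?q x = 0" using z'[OF True] Suc.prems(3)[OF True] by simp
      have "((\<lambda>x::'a. 0::real) has_derivative (\<lambda>v. ?q x * (x \<bullet> v))) (at x)" unfolding q by simp
      then show ?thesis
      proof (rule has_derivative_transform_within_open[of _ _ _ _ "{y. norm y < \<delta>}"])
        show "open {y::'a. norm y < \<delta>}" by (intro open_Collect_less continuous_intros)
      qed (use True Suc.prems(3) in auto)
    next
      case False
      then have x: "x \<noteq> 0" using Suc.prems(2) by auto
      have i: "((\<lambda>r. inverse r ^ j) has_real_derivative - real j * inverse (norm x) ^ (j + 1)) (at (norm x))"
        using DERIV_power[OF DERIV_inverse[of "norm x" UNIV], of j] x by (cases j) (simp_all add: algebra_simps)
      have f: "((\<lambda>r. \<omega> r * inverse r ^ j) has_derivative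
          (\<lambda>t. (?\<omega>' (norm x) * inverse (norm x) ^ j + (- real j * inverse (norm x) ^ (j + 1)) * \<omega> (norm x)) *
              t)) (at (norm x))"
        using DERIV_mult[OF d[of "norm x"] i] unfolding has_field_derivative_def .
      have "((\<lambda>x. \<omega> (norm x) * inverse (norm x) ^ j) has_derivative
         (\<lambda>v. (?\<omega>' (norm x) * inverse (norm x) ^ j + (- real j * inverse (norm x) ^ (j + 1)) * \<omega> (norm x)) *
             (v \<bullet> sgn x))) (at x)"
        by (rule has_derivative_compose[OF has_derivative_norm[OF x] f])
      moreover have "(?\<omega>' (norm x) * inverse (norm x) ^ j + (- real j * inverse (norm x) ^ (j + 1)) * \<omega> (norm x)) *
          (v \<bullet> sgn x) = ?q x * (x \<bullet> v)" for v
        by (simp add: sgn_div_norm inner_commute algebra_simps divide_inverse)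
      ultimately show ?thesis by simp
    qed
  next
    fix i :: 'a
    show "Ck_fun k (\<lambda>x. ?q x * (x \<bullet> i))"
      by (intro Ck_fun_mult Ck_fun_add Ck_fun_inner_left Ck_fun_const Suc.IH C' z' Suc.prems)
  qed
qed

definition gradient :: "('a::euclidean_space \<Rightarrow> real) \<Rightarrow> 'a \<Rightarrow> 'a" where
  "gradient \<phi> x = (\<Sum>i\<in>Basis. frechet_derivative \<phi> (at x) i *\<^sub>R i)"

lemma gradient_inner: "i \<in> Basis \<Longrightarrow> gradient \<phi> x \<bullet> i = frechet_derivative \<phi> (at x) i"
  unfolding gradient_def by (subst inner_sum_left_Basis) auto

text \<open>
  The function is \<open>\<phi>(x) = \<integral>\<omega>\<close>, taken from \<open>norm x\<close> to \<open>R\<close>; it is constant near the origin and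
  vanishes for \<open>norm x > R'\<close>.
\<close>

lemma radial_test_function:
  fixes \<omega> :: "real \<Rightarrow> real"
  assumes C: "\<And>k. Ck_fun k \<omega>" and \<delta>: "0 < \<delta>" "R' < R" "0 < R'"
    and lo: "\<And>r. r < \<delta> \<Longrightarrow> \<omega> r = 0" and hi: "\<And>r. r > R' \<Longrightarrow> \<omega> r = 0"
  obtains \<phi> :: "'a::euclidean_space \<Rightarrow> real" where "test_function (ball 0 R) \<phi>"
    "\<And>x. gradient \<phi> x = - (\<omega> (norm x) / norm x) *\<^sub>R x"
    "\<And>x. norm x \<le> R \<Longrightarrow> \<phi> x = (\<integral>r. indicator {norm x..R} r * \<omega> r \<partial>lborel)"
proof -
  have c: "continuous_on S \<omega>" for S using C[of 0] continuous_on_subset by auto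
  \<comment> \<open>The left end point \<open>-1\<close> makes \<open>V\<close> differentiable at \<open>0\<close> as well.\<close>
  define V where "V t = integral {-1..t} \<omega>" for t
  have dV: "(V has_real_derivative \<omega> t) (at t)" if "t > -1" for t
  proof -
    have "((\<lambda>x. integral {-1..x} \<omega>) has_real_derivative \<omega> t) (at t within {-1..t+1})"
      using that by (intro integral_has_real_derivative c) auto
    then show ?thesis using that by (simp add: V_def[abs_def] at_within_Icc_at)
  qed
  have FTC: "(\<integral>r. indicator {a..b} r * \<omega> r \<partial>lborel) = V b - V a" if "-1 < a" "a \<le> b" for a b
  proof -
    have "(\<integral>r. \<omega> r * indicator {a..b} r \<partial>lborel) = V b - V a"
    proof (rule integral_FTC_Icc_real[OF that(2)])
      show "(V has_real_derivative \<omega> x) (at x)" if "a \<le> x" "x \<le> b" for x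
        using that \<open>-1 < a\<close> by (intro dV) auto
      show "isCont \<omega> x" for x using c continuous_on_eq_continuous_at[OF open_UNIV] by blast
    qed
    then show ?thesis by (simp add: mult.commute)
  qed
  have const_lo: "V a = V b" if "-1 < a" "a \<le> b" "b < \<delta>" for a b
  proof -
    have "(\<integral>r. indicator {a..b} r * \<omega> r \<partial>lborel) = (\<integral>r. 0 \<partial>(lborel :: real measure))"
      by (intro Bochner_Integration.integral_cong) (use that lo in \<open>auto simp: indicator_def\<close>)
    then show ?thesis using FTC[OF that(1,2)] by simp
  qed
  have const_hi: "V a = V b" if "R' < a" "a \<le> b" for a b
  proof -
    have "(\<integral>r. indicator {a..b} r * \<omega> r \<partial>lborel) = (\<integral>r. 0 \<partial>(lborel :: real measure))"
      by (intro Bochner_Integration.integral_cong) (use that hi in \<open>auto simp: indicator_def\<close>)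
    then show ?thesis using FTC[of a b] that \<delta> by simp
  qed
  define \<phi> where "\<phi> x = V R - V (norm x)" for x :: 'a
  have D: "(\<phi> has_derivative (\<lambda>v. - (\<omega> (norm x) * inverse (norm x) ^ 1) * (x \<bullet> v))) (at x)" for x
  proof (cases "norm x < \<delta>")
    case True
    have "((\<lambda>x::'a. V R - V 0) has_derivative (\<lambda>v. - (\<omega> (norm x) * inverse (norm x) ^ 1) * (x \<bullet> v))) (at x)"
      using lo[OF True] by simp
    then show ?thesis
    proof (rule has_derivative_transform_within_open[of _ _ _ _ "{y. norm y < \<delta>}"])
      show "open {y::'a. norm y < \<delta>}" by (intro open_Collect_less continuous_intros)
      show "V R - V 0 = \<phi> y" if "y \<in> {y. norm y < \<delta>}" for y
        using const_lo[of 0 "norm y"] that by (simp add: \<phi>_def)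
    qed (use True in auto)
  next
    case False
    then have x: "x \<noteq> 0" using \<delta> by auto
    have "(V has_derivative (\<lambda>t. \<omega> (norm x) * t)) (at (norm x))"
      using dV[of "norm x"] norm_ge_zero[of x] unfolding has_field_derivative_def by linarith
    from has_derivative_compose[OF has_derivative_norm[OF x] this]
    have "((\<lambda>x. V (norm x)) has_derivative (\<lambda>v. \<omega> (norm x) * (v \<bullet> sgn x))) (at x)" .
    then have "(\<phi> has_derivative (\<lambda>v. 0 - \<omega> (norm x) * (v \<bullet> sgn x))) (at x)"
      unfolding \<phi>_def[abs_def] by (intro has_derivative_diff has_derivative_const)
    moreover have "0 - \<omega> (norm x) * (v \<bullet> sgn x) = - (\<omega> (norm x) * inverse (norm x) ^ 1) * (x \<bullet> v)" for v
      by (simp add: sgn_div_norm inner_commute divide_inverse)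
    ultimately show ?thesis by (simp only:)
  qed
  have Ck: "Ck_fun (Suc k) \<phi>" for k
  proof (rule Ck_fun_SucI[OF D])
    fix i :: 'a
    have "Ck_fun k (\<lambda>x::'a. \<omega> (norm x) * inverse (norm x) ^ 1)"
      by (rule Ck_fun_radial[OF C \<delta>(1) lo])
    from Ck_fun_mult[OF Ck_fun_const[of k "-1"] this]
    have "Ck_fun k (\<lambda>x::'a. (-1) * (\<omega> (norm x) * inverse (norm x) ^ 1))" .
    from Ck_fun_mult[OF this Ck_fun_inner_left]
    have "Ck_fun k (\<lambda>x::'a. ((-1) * (\<omega> (norm x) * inverse (norm x) ^ 1)) * (x \<bullet> i))" .
    then show "Ck_fun k (\<lambda>x. - (\<omega> (norm x) * inverse (norm x) ^ 1) * (x \<bullet> i))" by simp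
  qed
  show ?thesis
  proof (rule that[of \<phi>])
    show "test_function (ball 0 R) \<phi>"
      unfolding test_function_def
    proof (intro conjI allI)
      show "Ck_fun k \<phi>" for k using Ck_fun_Suc_imp[OF Ck] .
      have "\<phi> x = 0" if "x \<notin> cball 0 R'" for x
      proof -
        have x: "R' < norm x" using that by simp
        show ?thesis
        proof (cases "norm x \<le> R")
          case True
          show ?thesis unfolding \<phi>_def const_hi[OF x True] by simp
        next
          case False
          then have "R \<le> norm x" by simp
          show ?thesis unfolding \<phi>_def const_hi[OF \<delta>(2) \<open>R \<le> norm x\<close>] by simp
        qed
      qed
      then have "{x. \<phi> x \<noteq> 0} \<subseteq> cball 0 R'" by blast
      then show "compactly_supported_in (ball 0 R) \<phi>"
        by (rule compactly_supported_in_I) (use \<delta> in auto)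
    qed
    show "gradient \<phi> x = - (\<omega> (norm x) / norm x) *\<^sub>R x" for x
    proof (rule euclidean_eqI)
      fix i :: 'a assume i: "i \<in> Basis"
      have "frechet_derivative \<phi> (at x) i = - (\<omega> (norm x) * inverse (norm x) ^ 1) * (x \<bullet> i)"
        unfolding frechet_derivative_at[OF D[of x], symmetric] ..
      then show "gradient \<phi> x \<bullet> i = - (\<omega> (norm x) / norm x) *\<^sub>R x \<bullet> i"
        using i by (simp add: gradient_inner divide_inverse)
    qed
    show "\<phi> x = (\<integral>r. indicator {norm x..R} r * \<omega> r \<partial>lborel)" if "norm x \<le> R" for x
      using FTC[of "norm x" R] that norm_ge_zero[of x] unfolding \<phi>_def by linarith
  qed
qed

lemma mollify_deriv:
  fixes f :: "real \<Rightarrow> real"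
  assumes f: "sqint lborel f" and \<rho>: "\<And>k. Ck_fun k \<rho>" "\<And>x. x \<notin> cball 0 d \<Longrightarrow> \<rho> x = 0"
  shows "(mollify \<rho> f has_real_derivative mollify (deriv \<rho>) f x) (at x) \<and> (\<forall>x. x \<notin> cball 0 d \<longrightarrow> deriv \<rho> x = 0)"
proof -
  have d: "(\<rho> has_real_derivative deriv \<rho> x) (at x)" for x
    by (rule Ck_fun_real_SucD(1)[OF \<rho>(1)[of "Suc 0"]])
  have z: "deriv \<rho> x = 0" if "x \<notin> cball 0 d" for x
  proof -
    have "(\<rho> has_real_derivative 0) (at x)"
      by (rule has_field_derivative_transform_within_open[OF DERIV_const[of 0], of "- cball 0 d"])
         (use that \<rho>(2) in \<open>auto simp: open_Compl\<close>)
    then show ?thesis by (rule DERIV_imp_deriv)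
  qed
  have P: "has_partial 1 \<rho> (deriv \<rho>)"
    unfolding has_partial_def using DERIV_shift[of \<rho> _ 0] d by (auto simp: add.commute)
  have "has_partial 1 (mollify \<rho> f) (mollify (deriv \<rho>) f)"
  proof (rule mollify_partial[OF f P _ _ compact_cball \<rho>(2) z])
    show "continuous_on UNIV \<rho>" using \<rho>(1)[of 0] by simp
    show "continuous_on UNIV (deriv \<rho>)" using Ck_fun_real_SucD(2)[OF \<rho>(1)[of "Suc 0"]] by simp
  qed
  then have "((\<lambda>t. mollify \<rho> f (x + t)) has_real_derivative mollify (deriv \<rho>) f x) (at 0)"
    by (simp add: has_partial_def)
  then have "((\<lambda>t. mollify \<rho> f (t + x)) has_real_derivative mollify (deriv \<rho>) f x) (at 0)"
    by (simp only: add.commute[of x])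
  then have "(mollify \<rho> f has_real_derivative mollify (deriv \<rho>) f x) (at x)"
    using DERIV_shift[of "mollify \<rho> f" "mollify (deriv \<rho>) f x" 0 x] by simp
  then show ?thesis using z by blast
qed

lemma Ck_fun_mollify:
  fixes f :: "real \<Rightarrow> real"
  assumes f: "sqint lborel f" and \<rho>: "\<And>k. Ck_fun k \<rho>" "\<And>x. x \<notin> cball 0 d \<Longrightarrow> \<rho> x = 0"
  shows "Ck_fun k (mollify \<rho> f)"
  using \<rho>
proof (induction k arbitrary: \<rho>)
  case 0
  show ?case using mollify_deriv[OF f 0] by (auto intro!: DERIV_continuous continuous_at_imp_continuous_on)
next
  case (Suc k)
  show ?case
  proof (rule Ck_fun_real_SucI)
    show "(mollify \<rho> f has_real_derivative mollify (deriv \<rho>) f x) (at x)" for x using mollify_deriv[OF f Suc.prems]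
        by blast
    show "Ck_fun k (mollify (deriv \<rho>) f)"
      using mollify_deriv[OF f Suc.prems] by (intro Suc.IH Ck_fun_real_SucD(2) Suc.prems) blast
  qed
qed

text \<open>Away from the origin the weight of polar coordinates is bounded below.\<close>

lemma radial_square_integral_tail:
  fixes e :: "real \<Rightarrow> real"
  assumes e[measurable]: "e \<in> borel_measurable borel"
    and fin: "(\<integral>\<^sup>+x. ennreal ((e (norm x))\<^sup>2) \<partial>(lborel :: 'a::euclidean_space measure)) < \<infinity>" and s: "s > 0"
  shows "sqint lborel (\<lambda>r. e r * indicator {s<..} r)"
proof -
  let ?n = "DIM('a)" and ?c = "unit_ball_vol (real DIM('a))"
  have c: "?c > 0" by (rule unit_ball_vol_pos) simp
  let ?m = "real ?n * ?c * s ^ (?n - 1)"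
  have m: "?m > 0" using c s by simp
  have "(\<integral>\<^sup>+r. ennreal ((e r * indicator {s<..} r)\<^sup>2) \<partial>lborel) * ennreal ?m =
      (\<integral>\<^sup>+r. ennreal ((e r * indicator {s<..} r)\<^sup>2) * ennreal ?m \<partial>lborel)"
    by (rule nn_integral_multc[symmetric]) measurable
  also have "\<dots> \<le> (\<integral>\<^sup>+r. ennreal ((e r)\<^sup>2) * (ennreal (real ?n * ?c * r ^ (?n - 1)) * indicator {0<..} r) \<partial>lborel)"
  proof (rule nn_integral_mono)
    fix r :: real
    show "ennreal ((e r * indicator {s<..} r)\<^sup>2) * ennreal ?m \<le>
        ennreal ((e r)\<^sup>2) * (ennreal (real ?n * ?c * r ^ (?n - 1)) * indicator {0<..} r)"
    proof (cases "r > s")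
      case True
      have "ennreal ?m \<le> ennreal (real ?n * ?c * r ^ (?n - 1))"
        using True s c by (intro ennreal_leI mult_left_mono power_mono) auto
      then show ?thesis using True s by (auto intro!: mult_left_mono)
    qed simp
  qed
  also have "\<dots> = (\<integral>\<^sup>+x. ennreal ((e (norm x))\<^sup>2) \<partial>(lborel :: 'a measure))"
    by (rule nn_integral_radial[symmetric]) measurable
  finally have *: "(\<integral>\<^sup>+r. ennreal ((e r * indicator {s<..} r)\<^sup>2) \<partial>lborel) * ennreal ?m < \<infinity>"
    using fin by (rule le_less_trans)
  have "(\<integral>\<^sup>+r. ennreal ((e r * indicator {s<..} r)\<^sup>2) \<partial>lborel) < \<infinity>"
  proof (rule ccontr)
    assume "\<not> ?thesis"
    then have "(\<integral>\<^sup>+r. ennreal ((e r * indicator {s<..} r)\<^sup>2) \<partial>lborel) = top" by (simp add: less_top[symmetric])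
    moreover have "ennreal ?m \<noteq> 0" using m by (simp only: ennreal_eq_0_iff not_le)
    then have "top * ennreal ?m = top" by (simp only: ennreal_top_mult if_False)
    ultimately show False using * by (simp only:) simp
  qed
  then have "integrable lborel (\<lambda>r. (e r * indicator {s<..} r)\<^sup>2)"
    by (intro integrableI_bounded) auto
  then show ?thesis by (simp add: sqint_def)
qed

lemma radial_tail_integrable:
  fixes e :: "real \<Rightarrow> real"
  assumes e[measurable]: "e \<in> borel_measurable borel"
    and fin: "(\<integral>\<^sup>+x. ennreal ((e (norm x))\<^sup>2) \<partial>(lborel :: 'a::euclidean_space measure)) < \<infinity>" and s: "s > 0"
  shows "integrable lborel (\<lambda>r. indicator {s<..R} r * e r)"
proof -
  have "sqint lborel (\<lambda>r. 1 * indicator {s<..R} r)"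
    using emeasure_Ioc_finite[of s R] by (intro sqint_indicator) (simp_all add: top.not_eq_extremum)
  then have "integrable lborel (\<lambda>r. (e r * indicator {s<..} r) * (1 * indicator {s<..R} r))"
    by (rule sqint_mult_integrable[OF radial_square_integral_tail[OF e fin s]])
  also have "(\<lambda>r. (e r * indicator {s<..} r) * (1 * indicator {s<..R} r)) = (\<lambda>r. indicator {s<..R} r * e r)"
    by (auto simp: indicator_def fun_eq_iff)
  finally show ?thesis .
qed

text \<open>
  Cut \<open>e\<close> off near the origin, at the cost of a small part of the square integral, and mollify the
  result \<open>f\<close> on the line. The cut keeps the mollification away from the origin, and on bounded sets
  the weight of polar coordinates is bounded above.
\<close>

lemma radial_smooth_approx:
  fixes e :: "real \<Rightarrow> real"
  assumes e[measurable]: "e \<in> borel_measurable borel" and supp: "\<And>r. r \<notin> {0<..R0} \<Longrightarrow> e r = 0"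
    and R: "0 \<le> R0" "R0 < R"
    and fin: "(\<integral>\<^sup>+x. ennreal ((e (norm x))\<^sup>2) \<partial>(lborel :: 'a::euclidean_space measure)) < \<infinity>" and \<eta>: "\<eta> > 0"
  obtains \<omega> \<delta> R' where "\<And>k. Ck_fun k \<omega>" "0 < \<delta>" "R' < R" "0 < R'" "\<And>r. r < \<delta> \<Longrightarrow> \<omega> r = 0" "\<And>r. r > R' \<Longrightarrow> \<omega> r = (0::real)"
    "(\<integral>\<^sup>+x. ennreal ((e (norm x) - \<omega> (norm x))\<^sup>2) \<partial>(lborel :: 'a measure)) \<le> ennreal \<eta>"
proof -
  let ?n = "DIM('a)" and ?c = "unit_ball_vol (real DIM('a))"
  have c: "?c > 0" by (rule unit_ball_vol_pos) simp
  have R0: "R > 0" using R by simp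
  let ?L = "lborel :: 'a measure"
  have cancel: "a / (4 * q) * q = a / 4" if "q > 0" for a q :: real using that by simp
  let ?f = "\<lambda>k x. ennreal ((e (norm x))\<^sup>2) * indicator {x. norm x \<le> inverse (real (Suc k))} x"
  have "(\<lambda>k. \<integral>\<^sup>+x. ?f k x \<partial>?L) \<longlonglongrightarrow> (\<integral>\<^sup>+x. 0 \<partial>?L)"
  proof (rule nn_integral_dominated_convergence[where w="\<lambda>x. ennreal ((e (norm x))\<^sup>2)"])
    show "AE x in ?L. (\<lambda>k. ?f k x) \<longlonglongrightarrow> 0"
    proof (rule AE_I2)
      fix x :: 'a
      show "(\<lambda>k. ?f k x) \<longlonglongrightarrow> 0"
      proof (cases "x = 0")
        case True
        then show ?thesis using supp[of 0] by simp
      next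
        case False
        then have "norm x > 0" by simp
        then have "\<forall>\<^sub>F k in sequentially. inverse (real (Suc k)) < norm x"
          using order_tendstoD(2)[OF LIMSEQ_inverse_real_of_nat] by blast
        then have "\<forall>\<^sub>F k in sequentially. ?f k x = 0" by eventually_elim simp
        then show ?thesis by (rule tendsto_eventually)
      qed
    qed
  qed (use fin in \<open>auto simp: indicator_def\<close>)
  then have "\<forall>\<^sub>F k in sequentially. (\<integral>\<^sup>+x. ?f k x \<partial>?L) < ennreal (\<eta> / 4)"
    using \<eta> by (intro order_tendstoD(2)) auto
  then obtain k where k: "(\<integral>\<^sup>+x. ?f k x \<partial>?L) < ennreal (\<eta> / 4)" using eventually_happens by force
  define s where "s = inverse (real (Suc k))"
  have s: "s > 0" by (simp add: s_def)
  define f where "f r = e r * indicator {s<..} r" for r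
  have f: "sqint lborel f" unfolding f_def[abs_def] by (rule radial_square_integral_tail[OF e fin s])
  have [measurable]: "f \<in> borel_measurable borel" unfolding f_def[abs_def] by measurable
  \<comment> \<open>The largest weight of polar coordinates on \<open>(0, R]\<close>; both \<open>f\<close> and its mollification vanish beyond \<open>R\<close>.\<close>
  let ?p = "real ?n * ?c * R ^ (?n - 1)"
  have p: "?p > 0" using c R0 by simp
  have "\<eta> / (4 * ?p) > 0" using \<eta> p by simp
  then obtain d1 where d1: "d1 > 0" "\<And>d \<rho>. d \<le> d1 \<Longrightarrow> mollifier d \<rho> \<Longrightarrow>
    sqint lborel (mollify \<rho> f) \<and> (\<integral>x. (mollify \<rho> f x - f x)\<^sup>2 \<partial>lborel) \<le> \<eta> / (4 * ?p)"
    using mollify_L2[OF f] by blast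
  define d where "d = min d1 (min (s / 2) ((R - R0) / 2))"
  have d: "d > 0" "d \<le> d1" "d \<le> s / 2" using d1(1) s R by (auto simp: d_def)
  have d4: "d \<le> (R - R0) / 2" unfolding d_def by (intro min.coboundedI2 min.cobounded2)
  obtain \<rho> :: "real \<Rightarrow> real" where m: "mollifier d \<rho>" using mollifier_exists[OF d(1)] by blast
  have \<rho>: "Ck_fun k \<rho>" "x \<notin> cball 0 d \<Longrightarrow> \<rho> x = 0" for k x using m by (auto simp: mollifier_def)
  define \<omega> where "\<omega> = mollify \<rho> f"
  have supp\<omega>: "\<omega> r = 0" if "r < s / 2 \<or> r > R0 + d" for r
  proof -
    have "f (r - z) * \<rho> z = 0" for z
    proof (cases "z \<in> cball 0 d")
      case True
      then have "r - z \<le> s \<or> r - z > R0" using that d(3) by auto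
      then have "f (r - z) = 0" using supp[of "r - z"] by (auto simp: f_def)
      then show ?thesis by simp
    qed (simp add: \<rho>)
    then show ?thesis unfolding \<omega>_def mollify_def by (simp only:) simp
  qed
  have \<omega>2: "sqint lborel \<omega>" "(\<integral>x. (\<omega> x - f x)\<^sup>2 \<partial>lborel) \<le> \<eta> / (4 * ?p)"
    unfolding \<omega>_def using d1(2)[OF d(2) m] by - (erule conjunct1, erule conjunct2)
  have [measurable]: "\<omega> \<in> borel_measurable borel" using sqintD(1)[OF \<omega>2(1)] by simp
  show ?thesis
  proof (rule that[of \<omega> "s / 2" "(R0 + R) / 2"])
    show "Ck_fun k \<omega>" for k unfolding \<omega>_def by (rule Ck_fun_mollify[OF f \<rho>])
    show "\<omega> r = 0" if "r < s / 2" for r using supp\<omega> that by blast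
    show "\<omega> r = 0" if "r > (R0 + R) / 2" for r
      using supp\<omega>[of r] that d4 by (simp add: field_simps)
    have 1: "(\<integral>\<^sup>+x. ennreal ((e (norm x) - f (norm x))\<^sup>2) \<partial>?L) \<le> ennreal (\<eta> / 4)"
    proof -
      have "(\<integral>\<^sup>+x. ennreal ((e (norm x) - f (norm x))\<^sup>2) \<partial>?L) = (\<integral>\<^sup>+x. ?f k x \<partial>?L)"
        by (intro nn_integral_cong) (auto simp: f_def s_def indicator_def)
      then show ?thesis using k by simp
    qed
    have 2: "(\<integral>\<^sup>+x. ennreal ((f (norm x) - \<omega> (norm x))\<^sup>2) \<partial>?L) \<le> ennreal (\<eta> / 4)"
    proof -
      have "(\<integral>\<^sup>+x. ennreal ((f (norm x) - \<omega> (norm x))\<^sup>2) \<partial>?L) =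
        (\<integral>\<^sup>+r. ennreal ((f r - \<omega> r)\<^sup>2) * (ennreal (real ?n * ?c * r ^ (?n - 1)) * indicator {0<..} r) \<partial>lborel)"
        by (rule nn_integral_radial[of "\<lambda>r. ennreal ((f r - \<omega> r)\<^sup>2)"]) measurable
      also have "\<dots> \<le> (\<integral>\<^sup>+r. ennreal ((f r - \<omega> r)\<^sup>2) * ennreal ?p \<partial>lborel)"
      proof (rule nn_integral_mono)
        fix r :: real
        show "ennreal ((f r - \<omega> r)\<^sup>2) * (ennreal (real ?n * ?c * r ^ (?n - 1)) * indicator {0<..} r) \<le>
            ennreal ((f r - \<omega> r)\<^sup>2) * ennreal ?p"
        proof (cases "0 < r \<and> r \<le> R")
          case True
          then have "ennreal (real ?n * ?c * r ^ (?n - 1)) \<le> ennreal ?p"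
            using c by (intro ennreal_leI mult_left_mono power_mono) auto
          then show ?thesis using True by (auto intro!: mult_left_mono)
        next
          case False
          show ?thesis
          proof (cases "r > R")
            case True
            have "f r = 0" "\<omega> r = 0"
              using True R supp[of r] supp\<omega>[of r] d4 by (auto simp: f_def field_simps)
            then show ?thesis by simp
          qed (use False in simp)
        qed
      qed
      also have "\<dots> = (\<integral>\<^sup>+r. ennreal ((f r - \<omega> r)\<^sup>2) \<partial>lborel) * ennreal ?p"
        by (rule nn_integral_multc) measurable
      also have "(\<integral>\<^sup>+r. ennreal ((f r - \<omega> r)\<^sup>2) \<partial>lborel) = ennreal (\<integral>r. (f r - \<omega> r)\<^sup>2 \<partial>lborel)"
        using sqintD(2)[OF sqint_diff[OF f \<omega>2(1)]] by (intro nn_integral_eq_integral) auto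
      also have "ennreal (\<integral>r. (f r - \<omega> r)\<^sup>2 \<partial>lborel) * ennreal ?p \<le> ennreal (\<eta> / (4 * ?p)) * ennreal ?p"
        using \<omega>2(2) by (intro mult_right_mono ennreal_leI) (simp_all add: power2_commute)
      also have "\<dots> = ennreal (\<eta> / (4 * ?p) * ?p)"
        using p \<eta> by (intro ennreal_mult[symmetric]) auto
      also have "\<eta> / (4 * ?p) * ?p = \<eta> / 4" by (rule cancel[OF p])
      finally show ?thesis .
    qed
    have "(\<integral>\<^sup>+x. ennreal ((e (norm x) - \<omega> (norm x))\<^sup>2) \<partial>?L) \<le>
      (\<integral>\<^sup>+x. ennreal 2 * ennreal ((e (norm x) - f (norm x))\<^sup>2) + ennreal 2 *
          ennreal ((f (norm x) - \<omega> (norm x))\<^sup>2) \<partial>?L)"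
    proof (rule nn_integral_mono)
      fix x :: 'a
      have "(e (norm x) - \<omega> (norm x))\<^sup>2 \<le> 2 * (e (norm x) - f (norm x))\<^sup>2 + 2 * (f (norm x) - \<omega> (norm x))\<^sup>2"
        using square_add_le[of "e (norm x) - f (norm x)" "f (norm x) - \<omega> (norm x)"] by simp
      then have "ennreal ((e (norm x) - \<omega> (norm x))\<^sup>2) \<le>
          ennreal (2 * (e (norm x) - f (norm x))\<^sup>2 + 2 * (f (norm x) - \<omega> (norm x))\<^sup>2)"
        by (rule ennreal_leI)
      also have "\<dots> = ennreal 2 * ennreal ((e (norm x) - f (norm x))\<^sup>2) + ennreal 2 *
          ennreal ((f (norm x) - \<omega> (norm x))\<^sup>2)"
        by (simp add: ennreal_plus ennreal_mult del: ennreal_numeral)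
      finally show "ennreal ((e (norm x) - \<omega> (norm x))\<^sup>2) \<le>
          ennreal 2 * ennreal ((e (norm x) - f (norm x))\<^sup>2) + ennreal 2 * ennreal ((f (norm x) - \<omega> (norm x))\<^sup>2)" .
    qed
    also have "\<dots> = ennreal 2 * (\<integral>\<^sup>+x. ennreal ((e (norm x) - f (norm x))\<^sup>2) \<partial>?L) + ennreal 2 *
        (\<integral>\<^sup>+x. ennreal ((f (norm x) - \<omega> (norm x))\<^sup>2) \<partial>?L)"
      by (simp add: nn_integral_add nn_integral_cmult)
    also have "\<dots> \<le> ennreal 2 * ennreal (\<eta> / 4) + ennreal 2 * ennreal (\<eta> / 4)"
      by (intro add_mono mult_left_mono 1 2) auto
    also have "\<dots> = ennreal (2 * (\<eta> / 4) + 2 * (\<eta> / 4))"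
    proof -
      have "ennreal 2 * ennreal (\<eta> / 4) = ennreal (2 * (\<eta> / 4))" using \<eta> by (intro ennreal_mult[symmetric]) auto
      then show ?thesis using \<eta> by (simp only:) (rule ennreal_plus[symmetric]; simp)
    qed
    finally show "(\<integral>\<^sup>+x. ennreal ((e (norm x) - \<omega> (norm x))\<^sup>2) \<partial>?L) \<le> ennreal \<eta>" by simp
  qed (use s R in auto)
qed

text \<open>
  Split \<open>d\<close> into the square root of the weight of polar coordinates times its inverse. By the
  Cauchy-Schwarz inequality it remains to integrate the reciprocal weight, first over \<open>norm x < r\<close>
  and then over \<open>r\<close>; the inner integral is \<open>r / n\<close>.
\<close>

lemma radial_poincare:
  fixes d :: "real \<Rightarrow> real"
  assumes d[measurable]: "d \<in> borel_measurable borel" and d0: "\<And>r. d r \<ge> 0" and R: "R > 0"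
  shows "(\<integral>\<^sup>+x. (\<integral>\<^sup>+r. ennreal (d r) * indicator {norm x<..R} r \<partial>lborel)\<^sup>2 \<partial>(lborel :: 'a::euclidean_space measure)) \<le>
    ennreal (R\<^sup>2) * (\<integral>\<^sup>+x. ennreal ((d (norm x))\<^sup>2) \<partial>(lborel :: 'a measure))"
proof -
  let ?n = "DIM('a)" and ?c = "unit_ball_vol (real DIM('a))"
  have c: "?c > 0" by (rule unit_ball_vol_pos) simp
  let ?L = "lborel :: 'a measure"
  let ?p = "\<lambda>r. real ?n * ?c * r ^ (?n - 1)"
  have p: "?p r > 0" if "r > 0" for r using c that by simp
  have cancel: "a * q * (1 / q) = a" if "q > 0" for a q :: real using that by simp
  have cancel_power: "1 / (N * C * q) * (C * (q * r)) = r / N" if "C > 0" "q > 0" for N C q r :: real using that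
      by simp
  let ?A = "\<integral>\<^sup>+x. ennreal ((d (norm x))\<^sup>2) \<partial>?L"
  have A: "?A = (\<integral>\<^sup>+r. ennreal ((d r)\<^sup>2) * (ennreal (?p r) * indicator {0<..} r) \<partial>lborel)"
    by (rule nn_integral_radial[of "\<lambda>r. ennreal ((d r)\<^sup>2)"]) measurable
  have inner: "(\<integral>\<^sup>+r. ennreal (d r) * indicator {norm x<..R} r \<partial>lborel)\<^sup>2 \<le>
      ?A * (\<integral>\<^sup>+r. ennreal (1 / ?p r) * indicator {norm x<..R} r \<partial>lborel)" for x :: 'a
  proof -
    have "(\<integral>\<^sup>+r. ennreal (d r) * indicator {norm x<..R} r \<partial>lborel) =
      (\<integral>\<^sup>+r. (ennreal (d r * sqrt (?p r)) * indicator {0<..} r) * (ennreal (1 / sqrt (?p r)) *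
          indicator {norm x<..R} r) \<partial>lborel)"
    proof (rule nn_integral_cong)
      fix r :: real
      show "ennreal (d r) * indicator {norm x<..R} r =
          (ennreal (d r * sqrt (?p r)) * indicator {0<..} r) * (ennreal (1 / sqrt (?p r)) * indicator {norm x<..R} r)"
      proof (cases "norm x < r \<and> r \<le> R")
        case True
        then have r: "r > 0" using norm_ge_zero[of x] by linarith
        have "ennreal (d r * sqrt (?p r)) * ennreal (1 / sqrt (?p r)) =
            ennreal (d r * sqrt (?p r) * (1 / sqrt (?p r)))"
          using p[OF r] d0[of r] by (intro ennreal_mult[symmetric]) auto
        also have "d r * sqrt (?p r) * (1 / sqrt (?p r)) = d r" by (rule cancel[OF real_sqrt_gt_zero[OF p[OF r]]])
        finally show ?thesis using True r by simp
      qed simp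
    qed
    then have "(\<integral>\<^sup>+r. ennreal (d r) * indicator {norm x<..R} r \<partial>lborel)\<^sup>2 \<le>
      (\<integral>\<^sup>+r. (ennreal (d r * sqrt (?p r)) * indicator {0<..} r)\<^sup>2 \<partial>lborel) * (\<integral>\<^sup>+r. (ennreal (1 / sqrt (?p r)) *
          indicator {norm x<..R} r)\<^sup>2 \<partial>lborel)"
      by (simp only:) (rule Cauchy_Schwarz_nn_integral; measurable)
    also have "(\<integral>\<^sup>+r. (ennreal (d r * sqrt (?p r)) * indicator {0<..} r)\<^sup>2 \<partial>lborel) = ?A"
      unfolding A
    proof (rule nn_integral_cong)
      fix r :: real
      show "(ennreal (d r * sqrt (?p r)) * indicator {0<..} r)\<^sup>2 =
          ennreal ((d r)\<^sup>2) * (ennreal (?p r) * indicator {0<..} r)"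
      proof (cases "r > 0")
        case True
        have "(ennreal (d r * sqrt (?p r)))\<^sup>2 = ennreal ((d r * sqrt (?p r))\<^sup>2)"
          using d0[of r] p[OF True] by (simp add: ennreal_power)
        also have "(d r * sqrt (?p r))\<^sup>2 = (d r)\<^sup>2 * ?p r"
          using p[OF True] by (simp add: power_mult_distrib)
        finally show ?thesis using True p[OF True] by (simp add: ennreal_mult)
      qed simp
    qed
    also have "(\<integral>\<^sup>+r. (ennreal (1 / sqrt (?p r)) * indicator {norm x<..R} r)\<^sup>2 \<partial>lborel) =
        (\<integral>\<^sup>+r. ennreal (1 / ?p r) * indicator {norm x<..R} r \<partial>lborel)"
    proof (rule nn_integral_cong)
      fix r :: real
      show "(ennreal (1 / sqrt (?p r)) * indicator {norm x<..R} r)\<^sup>2 = ennreal (1 / ?p r) * indicator {norm x<..R} r"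
      proof (cases "norm x < r \<and> r \<le> R")
        case True
        then have r: "r > 0" using norm_ge_zero[of x] by linarith
        have "(ennreal (1 / sqrt (?p r)))\<^sup>2 = ennreal ((1 / sqrt (?p r))\<^sup>2)"
          using p[OF r] by (simp add: ennreal_power)
        also have "(1 / sqrt (?p r))\<^sup>2 = 1 / ?p r" using p[OF r] by (simp add: power_divide)
        finally show ?thesis using True by simp
      qed simp
    qed
    finally show ?thesis .
  qed
  have "(\<integral>\<^sup>+x. (\<integral>\<^sup>+r. ennreal (d r) * indicator {norm x<..R} r \<partial>lborel)\<^sup>2 \<partial>?L) \<le>
    (\<integral>\<^sup>+x. ?A * (\<integral>\<^sup>+r. ennreal (1 / ?p r) * indicator {norm x<..R} r \<partial>lborel) \<partial>?L)"
    by (intro nn_integral_mono inner)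
  also have "\<dots> = ?A * (\<integral>\<^sup>+x. \<integral>\<^sup>+r. ennreal (1 / ?p r) * indicator {(x, r). norm x < r \<and> r \<le> R} (x, r) \<partial>lborel \<partial>?L)"
    by (subst nn_integral_cmult[symmetric]) (auto intro!: nn_integral_cong simp: indicator_def)
  finally have *: "(\<integral>\<^sup>+x. (\<integral>\<^sup>+r. ennreal (d r) * indicator {norm x<..R} r \<partial>lborel)\<^sup>2 \<partial>?L) \<le>
      ?A * (\<integral>\<^sup>+x. \<integral>\<^sup>+r. ennreal (1 / ?p r) * indicator {(x, r). norm x < r \<and> r \<le> R} (x, r) \<partial>lborel \<partial>?L)" .
  have "(\<integral>\<^sup>+x. \<integral>\<^sup>+r. ennreal (1 / ?p r) * indicator {(x, r). norm x < r \<and> r \<le> R} (x, r) \<partial>lborel \<partial>?L) =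
     (\<integral>\<^sup>+r. \<integral>\<^sup>+x. ennreal (1 / ?p r) * indicator {(x, r). norm x < r \<and> r \<le> R} (x, r) \<partial>?L \<partial>lborel)"
    by (rule lborel_pair.Fubini'[symmetric]) measurable
  also have "\<dots> \<le> (\<integral>\<^sup>+r. ennreal R * indicator {0..R} r \<partial>lborel)"
  proof (rule nn_integral_mono)
    fix r :: real
    show "(\<integral>\<^sup>+x. ennreal (1 / ?p r) * indicator {(x, r). norm x < r \<and> r \<le> R} (x, r) \<partial>?L) \<le>
        ennreal R * indicator {0..R} r"
    proof (cases "0 < r \<and> r \<le> R")
      case True
      then have r: "r > 0" by simp
      have "(\<integral>\<^sup>+x. ennreal (1 / ?p r) * indicator {(x, r). norm x < r \<and> r \<le> R} (x, r) \<partial>?L) =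
          (\<integral>\<^sup>+x. ennreal (1 / ?p r) * indicator (ball 0 r) x \<partial>?L)"
        using True by (intro nn_integral_cong) (auto simp: indicator_def)
      also have "\<dots> = ennreal (1 / ?p r) * emeasure ?L (ball 0 r)" by (rule nn_integral_cmult_indicator) simp
      also have "\<dots> = ennreal (1 / ?p r) * ennreal (?c * r ^ ?n)" using r by (simp add: emeasure_ball)
      also have "\<dots> = ennreal (1 / ?p r * (?c * r ^ ?n))" using p[OF r] c r by (intro ennreal_mult[symmetric]) auto
      also have "1 / ?p r * (?c * r ^ ?n) = r / real ?n"
          unfolding power_minus_mult[OF DIM_positive, symmetric] by (rule cancel_power) (use r c in auto)
      also have "ennreal (r / real ?n) \<le> ennreal R"
      proof (rule ennreal_leI)
        have "1 \<le> real ?n" by (simp add: Suc_leI)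
        then have "r / real ?n \<le> r / 1" using r by (intro divide_left_mono) auto
        then show "r / real ?n \<le> R" using True by simp
      qed
      finally show ?thesis using True by simp
    next
      case False
      have z: "indicator {(x, r). norm x < r \<and> r \<le> R} (x, r) = (0 :: ennreal)" for x :: 'a
        using False le_less_trans[OF norm_ge_zero, of x r] by (auto simp: indicator_def)
      show ?thesis by (simp only: z) simp
    qed
  qed
  also have "\<dots> = ennreal R * ennreal R" using R by (subst nn_integral_cmult_indicator) auto
  also have "\<dots> = ennreal (R\<^sup>2)" using R by (simp add: power2_eq_square ennreal_mult)
  finally have "?A * (\<integral>\<^sup>+x. \<integral>\<^sup>+r. ennreal (1 / ?p r) * indicator {(x, r). norm x < r \<and> r \<le> R} (x, r) \<partial>lborel \<partial>?L) \<le>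
      ?A * ennreal (R\<^sup>2)"
    by (rule mult_left_mono) simp
  from order_trans[OF * this] show ?thesis by (simp only: mult.commute[of ?A])
qed

section \<open>The closure of the test functions\<close>

lemma integral_lebesgue_on_eq_lborel:
  fixes f :: "'a::euclidean_space \<Rightarrow> real"
  assumes \<Omega>: "\<Omega> \<in> sets borel" and f: "f \<in> borel_measurable borel" "\<And>x. x \<notin> \<Omega> \<Longrightarrow> f x = 0"
  shows "(\<integral>x. f x \<partial>lebesgue_on \<Omega>) = (\<integral>x. f x \<partial>lborel)"
    and "integrable (lebesgue_on \<Omega>) f \<longleftrightarrow> integrable lborel f"
proof -
  have eq: "(\<lambda>x. indicator \<Omega> x *\<^sub>R f x) = f" using f(2) by (force simp: indicator_def)
  have \<Omega>': "\<Omega> \<inter> space lebesgue \<in> sets lebesgue" using \<Omega> by simp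
  have "(\<integral>x. f x \<partial>lebesgue_on \<Omega>) = (\<integral>x. f x \<partial>lebesgue)"
    using integral_restrict_space[OF \<Omega>', of f] by (simp only: eq)
  also have "\<dots> = (\<integral>x. f x \<partial>lborel)" using f(1) by (intro integral_completion) simp
  finally show "(\<integral>x. f x \<partial>lebesgue_on \<Omega>) = (\<integral>x. f x \<partial>lborel)" .
  have "integrable (lebesgue_on \<Omega>) f \<longleftrightarrow> integrable lebesgue f"
    using integrable_restrict_space[OF \<Omega>', of f] by (simp only: eq)
  also have "\<dots> \<longleftrightarrow> integrable lborel f" using f(1) by (intro integrable_completion) simp
  finally show "integrable (lebesgue_on \<Omega>) f \<longleftrightarrow> integrable lborel f" .
qed

lemma integral_lebesgue_on_AE:
  fixes f h :: "'a::euclidean_space \<Rightarrow> real"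
  assumes \<Omega>: "\<Omega> \<in> sets lebesgue" and f: "f \<in> borel_measurable (lebesgue_on \<Omega>)"
      and AE: "AE x in lebesgue_on \<Omega>. h x = f x"
  shows "h \<in> borel_measurable (lebesgue_on \<Omega>)" "(\<integral>x. h x \<partial>lebesgue_on \<Omega>) = (\<integral>x. f x \<partial>lebesgue_on \<Omega>)"
proof -
  have i: "\<Omega> \<inter> space lebesgue \<in> sets lebesgue" using \<Omega> by simp
  have "(\<lambda>x. indicator \<Omega> x *\<^sub>R f x) \<in> borel_measurable lebesgue"
    using f borel_measurable_restrict_space_iff[OF i, of f] by simp
  moreover have "AE x in lebesgue. indicator \<Omega> x *\<^sub>R f x = indicator \<Omega> x *\<^sub>R h x"
    using AE unfolding AE_restrict_space_iff[OF i] by eventually_elim (auto simp: indicator_def)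
  ultimately have "(\<lambda>x. indicator \<Omega> x *\<^sub>R h x) \<in> borel_measurable lebesgue"
    by (rule borel_measurable_AE)
  then show h: "h \<in> borel_measurable (lebesgue_on \<Omega>)"
    using borel_measurable_restrict_space_iff[OF i, of h] by simp
  show "(\<integral>x. h x \<partial>lebesgue_on \<Omega>) = (\<integral>x. f x \<partial>lebesgue_on \<Omega>)"
    by (rule integral_cong_AE[OF h f AE])
qed

lemma locally_integrable_on_cong:
  assumes "\<And>x. x \<in> \<Omega> \<Longrightarrow> f x = f' x"
  shows "locally_integrable_on f \<Omega> \<longleftrightarrow> locally_integrable_on f' \<Omega>"
proof -
  have "(\<lambda>x. indicator K x *\<^sub>R f x) = (\<lambda>x. indicator K x *\<^sub>R f' x)" if "K \<subseteq> \<Omega>" for K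
    using assms that by (force simp: indicator_def)
  then show ?thesis unfolding locally_integrable_on_def set_integrable_def by (metis (no_types, lifting))
qed

lemma has_weak_gradient_cong:
  assumes "\<And>x. x \<in> \<Omega> \<Longrightarrow> u x = v x" "\<And>x. x \<in> \<Omega> \<Longrightarrow> g x = h x"
  shows "has_weak_gradient \<Omega> u g \<longleftrightarrow> has_weak_gradient \<Omega> v h"
proof -
  have i: "integral\<^sup>L (lebesgue_on \<Omega>) (\<lambda>x. u x * d x) = integral\<^sup>L (lebesgue_on \<Omega>) (\<lambda>x. v x * d x)"
    "integral\<^sup>L (lebesgue_on \<Omega>) (\<lambda>x. (g x \<bullet> i) * d x) = integral\<^sup>L (lebesgue_on \<Omega>) (\<lambda>x. (h x \<bullet> i) * d x)"
        for d :: "'a \<Rightarrow> real" and i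
    using assms by (auto intro!: Bochner_Integration.integral_cong)
  have "locally_integrable_on u \<Omega> = locally_integrable_on v \<Omega>" by (rule locally_integrable_on_cong) (rule assms(1))
  moreover have "locally_integrable_on g \<Omega> = locally_integrable_on h \<Omega>"
      by (rule locally_integrable_on_cong) (rule assms(2))
  ultimately show ?thesis unfolding has_weak_gradient_def i by (simp only:)
qed

lemma sqint_bounded_integrable:
  fixes f :: "'a::euclidean_space \<Rightarrow> real"
  assumes f: "sqint lborel f" and \<Omega>: "bounded \<Omega>" "\<Omega> \<in> sets borel"
  shows "integrable lborel (\<lambda>x. indicator \<Omega> x * f x)"
proof -
  have "sqint lborel (\<lambda>x. 1 * indicator \<Omega> x)"
    using emeasure_bounded_finite[OF \<Omega>(1)] \<Omega>(2) by (intro sqint_indicator) auto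
  from sqint_mult_integrable[OF this f] show ?thesis by simp
qed

lemma locally_integrable_of_integrable_norm:
  fixes f :: "'a::euclidean_space \<Rightarrow> 'b::euclidean_space"
  assumes f: "f \<in> borel_measurable borel" and n: "sqint lborel (\<lambda>x. norm (f x))"
  shows "locally_integrable_on f \<Omega>"
  unfolding locally_integrable_on_def set_integrable_def
proof (intro allI impI)
  fix K assume K: "compact K \<and> K \<subseteq> \<Omega>"
  have Kb: "K \<in> sets borel" using K by (simp add: borel_compact)
  have "integrable lborel (\<lambda>x. indicator K x * norm (f x))"
    using K Kb by (intro sqint_bounded_integrable[OF n]) (auto dest: compact_imp_bounded)
  then have "integrable lborel (\<lambda>x. indicator K x *\<^sub>R f x)"
    by (rule Bochner_Integration.integrable_bound) (use f Kb in auto)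
  then show "integrable lebesgue (\<lambda>x. indicator K x *\<^sub>R f x)"
    using f Kb by (subst integrable_completion) auto
qed

lemma gradient_measurable:
  assumes "Ck_fun (Suc k) \<phi>"
  shows "gradient \<phi> \<in> borel_measurable borel"
proof -
  have "continuous_on UNIV (gradient \<phi>)"
    unfolding gradient_def[abs_def] using Ck_fun_continuous[OF Ck_fun_SucD(2)[OF assms]] by (intro continuous_intros)
  then show ?thesis by (rule borel_measurable_continuous_onI)
qed

lemma test_function_facts:
  fixes \<phi> :: "'a::euclidean_space \<Rightarrow> real"
  assumes t: "test_function \<Omega> \<phi>"
  shows "sqint lborel \<phi>" "sqint lborel (\<lambda>x. norm (gradient \<phi> x))" "gradient \<phi> \<in> borel_measurable borel"
    "\<And>i. i \<in> Basis \<Longrightarrow> sqint lborel (\<lambda>x. frechet_derivative \<phi> (at x) i)"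
    "\<And>x. x \<notin> \<Omega> \<Longrightarrow> \<phi> x = 0" "\<And>x. x \<notin> \<Omega> \<Longrightarrow> gradient \<phi> x = 0"
proof -
  obtain K where K: "compact K" "K \<subseteq> \<Omega>" "\<And>x. x \<notin> K \<Longrightarrow> \<phi> x = 0"
    using t compactly_supported_inD unfolding test_function_def by metis
  have C: "Ck_fun k \<phi>" for k using t by (simp add: test_function_def)
  have z: "frechet_derivative \<phi> (at x) i = 0" if "x \<notin> K" for x i
    by (rule frechet_derivative_zero_outside[OF K(1,3) that])
  have zg: "gradient \<phi> x = 0" if "x \<notin> K" for x unfolding gradient_def using z[OF that] by simp
  show "sqint lborel \<phi>" by (rule continuous_compact_support_sqint(3)[OF Ck_fun_continuous[OF C[of 0]] K(1,3)])
  show s: "sqint lborel (\<lambda>x. frechet_derivative \<phi> (at x) i)" if "i \<in> Basis" for i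
    by (rule continuous_compact_support_sqint(3)[OF Ck_fun_continuous[OF Ck_fun_SucD(2)[OF C[of
        "Suc 0"] that]] K(1) z])
  show "gradient \<phi> \<in> borel_measurable borel" by (rule gradient_measurable[OF C[of "Suc 0"]])
  have c: "continuous_on UNIV (\<lambda>x. norm (gradient \<phi> x))"
    unfolding gradient_def[abs_def] using Ck_fun_continuous[OF Ck_fun_SucD(2)[OF C[of "Suc 0"]]]
        by (intro continuous_intros)
  show "sqint lborel (\<lambda>x. norm (gradient \<phi> x))"
    by (rule continuous_compact_support_sqint(3)[OF c K(1)]) (simp add: zg)
  show "\<phi> x = 0" if "x \<notin> \<Omega>" for x using K that by blast
  show "gradient \<phi> x = 0" if "x \<notin> \<Omega>" for x using zg K that by blast
qed

lemma test_function_parts: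
  fixes \<phi> \<zeta> :: "'a::euclidean_space \<Rightarrow> real"
  assumes \<phi>: "test_function \<Omega> \<phi>" and \<zeta>: "test_function \<Omega> \<zeta>" and i: "i \<in> Basis"
  shows "(\<integral>x. \<phi> x * frechet_derivative \<zeta> (at x) i \<partial>lborel) = - (\<integral>x. frechet_derivative \<phi> (at x) i * \<zeta> x \<partial>lborel)"
proof -
  obtain K B where K: "compact K" "\<And>x. x \<notin> K \<Longrightarrow> \<phi> x = 0" and B: "B > 0" "\<And>x. \<bar>\<phi> x\<bar> \<le> B"
      "\<And>x i. i \<in> Basis \<Longrightarrow> \<bar>frechet_derivative \<phi> (at x) i\<bar> \<le> B"
    using test_functionD[OF \<phi>] by metis
  obtain B' where B': "B' > 0" "\<And>x. \<bar>\<zeta> x\<bar> \<le> B'" "\<And>x i. i \<in> Basis \<Longrightarrow> \<bar>frechet_derivative \<zeta> (at x) i\<bar> \<le> B'"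
    using test_functionD[OF \<zeta>] by metis
  have C: "Ck_fun (Suc 0) \<phi>" "Ck_fun (Suc 0) \<zeta>" using \<phi> \<zeta> by (auto simp: test_function_def simp del: Ck_fun.simps)
  note f = test_function_facts[OF \<phi>] and f' = test_function_facts[OF \<zeta>]
  let ?W' = "\<lambda>x. frechet_derivative \<phi> (at x) i * \<zeta> x + frechet_derivative \<zeta> (at x) i * \<phi> x"
  have i1: "integrable lborel (\<lambda>x. frechet_derivative \<phi> (at x) i * \<zeta> x)"
    by (rule sqint_mult_integrable[OF f(4)[OF i] f'(1)])
  have i2: "integrable lborel (\<lambda>x. frechet_derivative \<zeta> (at x) i * \<phi> x)"
    by (rule sqint_mult_integrable[OF f'(4)[OF i] f(1)])
  have "(\<integral>x. ?W' x \<partial>lborel) = 0"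
  proof (rule integral_partial_eq_0[OF has_partial_mult[OF Ck_fun_has_partial[OF C(1)] Ck_fun_has_partial[OF C(2)]]])
    show "\<bar>?W' x\<bar> \<le> B * B' + B' * B" for x
    proof -
      have "\<bar>frechet_derivative \<phi> (at x) i * \<zeta> x\<bar> \<le> B * B'" "\<bar>frechet_derivative \<zeta> (at x) i * \<phi> x\<bar> \<le> B' * B"
        unfolding abs_mult using B B' i by (auto intro!: mult_mono)
      then show ?thesis by linarith
    qed
    show "integrable lborel (\<lambda>x. \<phi> x * \<zeta> x)" by (rule sqint_mult_integrable[OF f(1) f'(1)])
    have "?W' \<in> borel_measurable lborel"
      using borel_measurable_integrable[OF i1] borel_measurable_integrable[OF i2] by (rule borel_measurable_add)
    then show "?W' \<in> borel_measurable borel" by simp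
  qed (use K in auto)
  then have "(\<integral>x. frechet_derivative \<phi> (at x) i * \<zeta> x \<partial>lborel) + (\<integral>x. frechet_derivative \<zeta> (at x) i * \<phi> x \<partial>lborel) =
      0"
    using i1 i2 by simp
  then show ?thesis by (simp add: mult.commute)
qed

text \<open>
  The test functions pass integration by parts on to the limit, so \<open>G\<close> is the weak gradient of \<open>w\<close>.
  By uniqueness it computes the Dirichlet integrals, also those of the differences \<open>v - \<phi>\<close>. The
  functions \<open>v\<close> and \<open>w\<close> agree on \<open>\<Omega>\<close> only, as \<open>v\<close> may be arbitrary outside.
\<close>

lemma H12_0_by_approximation:
  fixes v w :: "'a::euclidean_space \<Rightarrow> real" and G :: "'a \<Rightarrow> 'a"
  assumes \<Omega>: "open \<Omega>" "bounded \<Omega>"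
    and w: "sqint lborel w" "\<And>x. x \<notin> \<Omega> \<Longrightarrow> w x = 0" "\<And>x. x \<in> \<Omega> \<Longrightarrow> v x = w x"
    and G[measurable]: "G \<in> borel_measurable borel" and G2: "sqint lborel (\<lambda>x. norm (G x))" "\<And>x. x \<notin> \<Omega> \<Longrightarrow> G x = 0"
    and approx: "\<And>\<eta>. \<eta> > 0 \<Longrightarrow> \<exists>\<phi>. test_function \<Omega> \<phi> \<and> (\<integral>x. (w x - \<phi> x)\<^sup>2 \<partial>lborel) \<le> \<eta> \<and>
        (\<integral>x. (norm (G x - gradient \<phi> x))\<^sup>2 \<partial>lborel) \<le> \<eta>"
  shows "v \<in> H12_0 \<Omega>" "dirichlet_integral \<Omega> v = (\<integral>x. (norm (G x))\<^sup>2 \<partial>lborel)"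
proof -
  have \<Omega>b: "\<Omega> \<in> sets borel" using \<Omega>(1) by simp
  have wm[measurable]: "w \<in> borel_measurable borel" using sqintD(1)[OF w(1)] by simp
  have sG: "sqint lborel (\<lambda>x. G x \<bullet> i)" if "i \<in> Basis" for i
    by (rule sqint_le(1)[OF G2(1)]) (use Basis_le_norm[OF that] in auto)
  have parts: "(\<integral>x. w x * frechet_derivative \<zeta> (at x) i \<partial>lborel) = - (\<integral>x. (G x \<bullet> i) * \<zeta> x \<partial>lborel)"
    if \<zeta>: "test_function \<Omega> \<zeta>" and i: "i \<in> Basis" for \<zeta> i
  proof -
    note z = test_function_facts[OF \<zeta>]
    let ?D = "\<lambda>\<phi> x. frechet_derivative \<phi> (at x) i"
    let ?I = "\<bar>(\<integral>x. w x * ?D \<zeta> x \<partial>lborel) + (\<integral>x. (G x \<bullet> i) * \<zeta> x \<partial>lborel)\<bar>"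
    let ?C = "sqrt (\<integral>x. (?D \<zeta> x)\<^sup>2 \<partial>lborel) + sqrt (\<integral>x. (\<zeta> x)\<^sup>2 \<partial>lborel)"
    have bound: "?I \<le> ?C * sqrt \<eta>" if \<eta>: "\<eta> > 0" for \<eta>
    proof -
      obtain \<phi> where \<phi>: "test_function \<Omega> \<phi>" "(\<integral>x. (w x - \<phi> x)\<^sup>2 \<partial>lborel) \<le> \<eta>"
          "(\<integral>x. (norm (G x - gradient \<phi> x))\<^sup>2 \<partial>lborel) \<le> \<eta>"
        using approx[OF \<eta>] by blast
      note p = test_function_facts[OF \<phi>(1)]
      have sd: "sqint lborel (\<lambda>x. w x - \<phi> x)" by (rule sqint_diff[OF w(1) p(1)])
      have sGd: "sqint lborel (\<lambda>x. G x \<bullet> i - ?D \<phi> x)" by (rule sqint_diff[OF sG[OF i] p(4)[OF i]])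
      have sN: "sqint lborel (\<lambda>x. norm (G x - gradient \<phi> x))"
      proof (rule sqint_le(1)[OF sqint_add[OF G2(1) p(2)]])
        show "(\<lambda>x. norm (G x - gradient \<phi> x)) \<in> borel_measurable lborel" using p(3) by measurable
        show "\<bar>norm (G x - gradient \<phi> x)\<bar> \<le> \<bar>norm (G x) + norm (gradient \<phi> x)\<bar>" for x
          using norm_triangle_ineq4[of "G x" "gradient \<phi> x"] by simp
      qed
      have "(\<integral>x. (G x \<bullet> i - ?D \<phi> x)\<^sup>2 \<partial>lborel) \<le> (\<integral>x. (norm (G x - gradient \<phi> x))\<^sup>2 \<partial>lborel)"
      proof (rule sqint_le(2)[OF sN sqintD(1)[OF sGd]])
        show "\<bar>G x \<bullet> i - ?D \<phi> x\<bar> \<le> \<bar>norm (G x - gradient \<phi> x)\<bar>" for x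
          using Basis_le_norm[OF i, of "G x - gradient \<phi> x"] i by (simp add: inner_diff_left gradient_inner)
      qed
      then have dG: "(\<integral>x. (G x \<bullet> i - ?D \<phi> x)\<^sup>2 \<partial>lborel) \<le> \<eta>" using \<phi>(3) by linarith
      have m1: "(\<integral>x. w x * ?D \<zeta> x \<partial>lborel) = (\<integral>x. (w x - \<phi> x) * ?D \<zeta> x \<partial>lborel) + (\<integral>x. \<phi> x * ?D \<zeta> x \<partial>lborel)"
        using sqint_mult_integrable[OF w(1) z(4)[OF i]] sqint_mult_integrable[OF p(1) z(4)[OF i]]
        by (simp add: left_diff_distrib)
      have m2: "(\<integral>x. (G x \<bullet> i) * \<zeta> x \<partial>lborel) = (\<integral>x. (G x \<bullet> i - ?D \<phi> x) * \<zeta> x \<partial>lborel) + (\<integral>x. ?D \<phi> x * \<zeta> x \<partial>lborel)"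
        using sqint_mult_integrable[OF sG[OF i] z(1)] sqint_mult_integrable[OF p(4)[OF i] z(1)]
        by (simp add: left_diff_distrib)
      have "?I \<le> \<bar>\<integral>x. (w x - \<phi> x) * ?D \<zeta> x \<partial>lborel\<bar> + \<bar>\<integral>x. (G x \<bullet> i - ?D \<phi> x) * \<zeta> x \<partial>lborel\<bar>"
        unfolding m1 m2 using test_function_parts[OF \<phi>(1) \<zeta> i] by linarith
      also have "\<dots> \<le> sqrt (\<integral>x. (w x - \<phi> x)\<^sup>2 \<partial>lborel) * sqrt (\<integral>x. (?D \<zeta> x)\<^sup>2 \<partial>lborel) +
          sqrt (\<integral>x. (G x \<bullet> i - ?D \<phi> x)\<^sup>2 \<partial>lborel) * sqrt (\<integral>x. (\<zeta> x)\<^sup>2 \<partial>lborel)"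
        by (intro add_mono Cauchy_Schwarz_integral sd sGd z(1) z(4)[OF i])
      also have "\<dots> \<le> sqrt \<eta> * sqrt (\<integral>x. (?D \<zeta> x)\<^sup>2 \<partial>lborel) + sqrt \<eta> * sqrt (\<integral>x. (\<zeta> x)\<^sup>2 \<partial>lborel)"
        using \<phi>(2) dG by (intro add_mono mult_right_mono real_sqrt_le_mono) auto
      finally show ?thesis by (simp add: algebra_simps)
    qed
    have "?I \<le> 0" by (rule nonpos_if_le_mult_sqrt[OF bound])
    then show ?thesis by linarith
  qed
  have wg: "has_weak_gradient \<Omega> (\<lambda>x. w x - \<phi> x) (\<lambda>x. G x - gradient \<phi> x)" if \<phi>: "test_function \<Omega> \<phi> \<or> \<phi> = (\<lambda>_. 0)"
      for \<phi>
  proof -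
    have p: "sqint lborel \<phi>" "sqint lborel (\<lambda>x. norm (gradient \<phi> x))" "gradient \<phi> \<in> borel_measurable borel"
      "\<And>i. i \<in> Basis \<Longrightarrow> sqint lborel (\<lambda>x. frechet_derivative \<phi> (at x) i)"
      "\<And>x. x \<notin> \<Omega> \<Longrightarrow> \<phi> x = 0" "\<And>x. x \<notin> \<Omega> \<Longrightarrow> gradient \<phi> x = 0"
      and pp: "\<And>\<zeta> i. test_function \<Omega> \<zeta> \<Longrightarrow> i \<in> Basis \<Longrightarrow> (\<integral>x. \<phi> x * frechet_derivative \<zeta> (at x) i \<partial>lborel) =
          - (\<integral>x. frechet_derivative \<phi> (at x) i * \<zeta> x \<partial>lborel)"
      using \<phi> test_function_facts[of \<Omega> \<phi>] test_function_parts[of \<Omega> \<phi>]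
      by (auto simp: sqint_def gradient_def[abs_def] frechet_derivative_const)
    have pm[measurable]: "\<phi> \<in> borel_measurable borel" "gradient \<phi> \<in> borel_measurable borel"
        using sqintD(1)[OF p(1)] p(3) by auto
    have sd: "sqint lborel (\<lambda>x. w x - \<phi> x)" by (rule sqint_diff[OF w(1) p(1)])
    have sN: "sqint lborel (\<lambda>x. norm (G x - gradient \<phi> x))"
    proof (rule sqint_le(1)[OF sqint_add[OF G2(1) p(2)]])
      show "(\<lambda>x. norm (G x - gradient \<phi> x)) \<in> borel_measurable lborel" by measurable
      show "\<bar>norm (G x - gradient \<phi> x)\<bar> \<le> \<bar>norm (G x) + norm (gradient \<phi> x)\<bar>" for x
        using norm_triangle_ineq4[of "G x" "gradient \<phi> x"] by simp
    qed
    show ?thesis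
      unfolding has_weak_gradient_def
    proof (intro conjI allI impI ballI)
      show "locally_integrable_on (\<lambda>x. w x - \<phi> x) \<Omega>"
        by (rule locally_integrable_of_integrable_norm) (use sqint_abs[OF sd] in auto)
      show "locally_integrable_on (\<lambda>x. G x - gradient \<phi> x) \<Omega>"
        by (rule locally_integrable_of_integrable_norm[OF _ sN]) measurable
      fix \<zeta> and i :: 'a assume \<zeta>: "test_function \<Omega> \<zeta>" and i: "i \<in> Basis"
      note z = test_function_facts[OF \<zeta>]
      have zm[measurable]: "\<zeta> \<in> borel_measurable borel" "(\<lambda>x. frechet_derivative \<zeta> (at x) i) \<in> borel_measurable borel"
        using sqintD(1)[OF z(1)] sqintD(1)[OF z(4)[OF i]] by auto
      have "(\<integral>x. (w x - \<phi> x) * frechet_derivative \<zeta> (at x) i \<partial>lebesgue_on \<Omega>) =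
          (\<integral>x. (w x - \<phi> x) * frechet_derivative \<zeta> (at x) i \<partial>lborel)"
        by (rule integral_lebesgue_on_eq_lborel(1)[OF \<Omega>b]) (use w(2) p(5) in auto)
      also have "\<dots> = (\<integral>x. w x * frechet_derivative \<zeta> (at x) i \<partial>lborel) - (\<integral>x. \<phi> x *
          frechet_derivative \<zeta> (at x) i \<partial>lborel)"
        using sqint_mult_integrable[OF w(1) z(4)[OF i]] sqint_mult_integrable[OF p(1) z(4)[OF i]]
        by (simp add: left_diff_distrib)
      also have "\<dots> = - (\<integral>x. (G x \<bullet> i) * \<zeta> x \<partial>lborel) + (\<integral>x. frechet_derivative \<phi> (at x) i * \<zeta> x \<partial>lborel)"
        using parts[OF \<zeta> i] pp[OF \<zeta> i] by simp
      also have "\<dots> = - (\<integral>x. (G x \<bullet> i - frechet_derivative \<phi> (at x) i) * \<zeta> x \<partial>lborel)"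
        using sqint_mult_integrable[OF sG[OF i] z(1)] sqint_mult_integrable[OF p(4)[OF i] z(1)]
        by (simp add: left_diff_distrib)
      also have "(\<integral>x. (G x \<bullet> i - frechet_derivative \<phi> (at x) i) * \<zeta> x \<partial>lborel) =
          (\<integral>x. ((G x - gradient \<phi> x) \<bullet> i) * \<zeta> x \<partial>lborel)"
        using i by (simp add: inner_diff_left gradient_inner)
      also have "\<dots> = (\<integral>x. ((G x - gradient \<phi> x) \<bullet> i) * \<zeta> x \<partial>lebesgue_on \<Omega>)"
        by (rule integral_lebesgue_on_eq_lborel(1)[OF \<Omega>b, symmetric]) (use G2(2) p(6) in auto)
      finally show "(\<integral>x. (w x - \<phi> x) * frechet_derivative \<zeta> (at x) i \<partial>lebesgue_on \<Omega>) =
          - (\<integral>x. ((G x - gradient \<phi> x) \<bullet> i) * \<zeta> x \<partial>lebesgue_on \<Omega>)" .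
    qed
  qed
  have dir: "dirichlet_integral \<Omega> (\<lambda>x. v x - \<phi> x) = (\<integral>x. (norm (G x - gradient \<phi> x))\<^sup>2 \<partial>lborel)"
    if \<phi>: "test_function \<Omega> \<phi> \<or> \<phi> = (\<lambda>_. 0)" for \<phi>
  proof -
    have pm[measurable]: "gradient \<phi> \<in> borel_measurable borel" and po: "\<And>x. x \<notin> \<Omega> \<Longrightarrow> gradient \<phi> x = 0"
      using \<phi> test_function_facts[of \<Omega> \<phi>] by (auto simp: gradient_def[abs_def] frechet_derivative_const)
    have "has_weak_gradient \<Omega> (\<lambda>x. v x - \<phi> x) (\<lambda>x. G x - gradient \<phi> x)"
      using wg[OF \<phi>] by (subst has_weak_gradient_cong[where v="\<lambda>x. w x - \<phi> x"]) (auto simp: w(3))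
    note AE = weak_gradient_AE[OF \<Omega>(1) this]
    have m: "(\<lambda>x. (norm (G x - gradient \<phi> x))\<^sup>2) \<in> borel_measurable borel" by measurable
    have ml: "(\<lambda>x. (norm (G x - gradient \<phi> x))\<^sup>2) \<in> borel_measurable (lebesgue_on \<Omega>)"
      using m by (intro measurable_restrict_space1 measurable_completion) simp
    have "dirichlet_integral \<Omega> (\<lambda>x. v x - \<phi> x) = (\<integral>x. (norm (G x - gradient \<phi> x))\<^sup>2 \<partial>lebesgue_on \<Omega>)"
      unfolding dirichlet_integral_def
    proof (rule integral_lebesgue_on_AE(2)[OF _ ml])
      show "\<Omega> \<in> sets lebesgue" using \<Omega>b by simp
      show "AE x in lebesgue_on \<Omega>. (norm (weak_gradient \<Omega> (\<lambda>x. v x - \<phi> x) x))\<^sup>2 = (norm (G x - gradient \<phi> x))\<^sup>2"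
        using AE by eventually_elim simp
    qed
    also have "\<dots> = (\<integral>x. (norm (G x - gradient \<phi> x))\<^sup>2 \<partial>lborel)"
      by (rule integral_lebesgue_on_eq_lborel(1)[OF \<Omega>b m]) (simp add: G2(2) po)
    finally show ?thesis .
  qed
  have g0: "gradient (\<lambda>_. 0 :: real) = (\<lambda>_::'a. 0)" by (simp add: gradient_def[abs_def] frechet_derivative_const)
  show "dirichlet_integral \<Omega> v = (\<integral>x. (norm (G x))\<^sup>2 \<partial>lborel)"
    using dir[of "\<lambda>_. 0"] by (simp add: g0)
  show "v \<in> H12_0 \<Omega>"
    unfolding H12_0_def
  proof (intro CollectI conjI allI impI)
    show "v \<in> H12 \<Omega>"
      unfolding H12_def L2_on_def
    proof (intro CollectI conjI exI[of _ G])
      have wl: "w \<in> borel_measurable (lebesgue_on \<Omega>)"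
        by (intro measurable_restrict_space1 measurable_completion) simp
      then show "v \<in> borel_measurable (lebesgue_on \<Omega>)"
        by (subst measurable_cong[where g=w]) (auto simp: w(3))
      have "integrable (lebesgue_on \<Omega>) (\<lambda>x. (w x)\<^sup>2)"
        by (subst integral_lebesgue_on_eq_lborel(2)[OF \<Omega>b]) (use w(2) sqintD(2)[OF w(1)] in auto)
      then show "integrable (lebesgue_on \<Omega>) (\<lambda>x. (norm (v x))\<^sup>2)"
        by (subst Bochner_Integration.integrable_cong[where g="\<lambda>x. (w x)\<^sup>2"]) (auto simp: w(3))
      show "G \<in> borel_measurable (lebesgue_on \<Omega>)"
        by (intro measurable_restrict_space1 measurable_completion) simp
      show "integrable (lebesgue_on \<Omega>) (\<lambda>x. (norm (G x))\<^sup>2)"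
        by (subst integral_lebesgue_on_eq_lborel(2)[OF \<Omega>b]) (use G2(2) sqintD(2)[OF G2(1)] in auto)
      show "has_weak_gradient \<Omega> v G"
        using wg[of "\<lambda>_. 0"] by (subst has_weak_gradient_cong[where v=w and h=G]) (auto simp: w(3) g0)
    qed
    fix e :: real assume e: "e > 0"
    then have "e\<^sup>2 / 4 > 0" by simp
    then obtain \<phi> where \<phi>: "test_function \<Omega> \<phi>" "(\<integral>x. (w x - \<phi> x)\<^sup>2 \<partial>lborel) \<le> e\<^sup>2 / 4"
        "(\<integral>x. (norm (G x - gradient \<phi> x))\<^sup>2 \<partial>lborel) \<le> e\<^sup>2 / 4"
      using approx by blast
    have pm[measurable]: "\<phi> \<in> borel_measurable borel" using sqintD(1)[OF test_function_facts(1)[OF \<phi>(1)]] by simp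
    have "(\<integral>x. (v x - \<phi> x)\<^sup>2 \<partial>lebesgue_on \<Omega>) = (\<integral>x. (w x - \<phi> x)\<^sup>2 \<partial>lebesgue_on \<Omega>)"
      by (intro Bochner_Integration.integral_cong) (auto simp: w(3))
    also have "\<dots> = (\<integral>x. (w x - \<phi> x)\<^sup>2 \<partial>lborel)"
      by (rule integral_lebesgue_on_eq_lborel(1)[OF \<Omega>b]) (use w(2) test_function_facts(5)[OF \<phi>(1)] in auto)
    finally have "H12_norm \<Omega> (\<lambda>x. v x - \<phi> x) \<le> sqrt (e\<^sup>2 / 4 + e\<^sup>2 / 4)"
      unfolding H12_norm_def using dir[of \<phi>] \<phi> by (intro real_sqrt_le_mono) simp
    also have "\<dots> < sqrt (e\<^sup>2)" using e by (intro real_sqrt_less_mono) simp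
    finally show "\<exists>\<phi>. test_function \<Omega> \<phi> \<and> H12_norm \<Omega> (\<lambda>x. v x - \<phi> x) < e"
      using \<phi>(1) e by (intro exI[of _ \<phi>]) simp
  qed
qed

lemma integral_le_of_nn_integral_le:
  fixes f :: "'b \<Rightarrow> real"
  assumes f: "f \<in> borel_measurable M" "\<And>x. f x \<ge> 0" and le: "(\<integral>\<^sup>+x. ennreal (f x) \<partial>M) \<le> ennreal b" and b: "b \<ge> 0"
  shows "integrable M f" "(\<integral>x. f x \<partial>M) \<le> b"
proof -
  show i: "integrable M f"
    by (rule integrableI_bounded) (use f le in \<open>auto intro: le_less_trans\<close>)
  have "ennreal (\<integral>x. f x \<partial>M) = (\<integral>\<^sup>+x. ennreal (f x) \<partial>M)"
    by (rule nn_integral_eq_integral[symmetric]) (use i f in auto)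
  then have "ennreal (\<integral>x. f x \<partial>M) \<le> ennreal b" using le by (simp only:)
  then show "(\<integral>x. f x \<partial>M) \<le> b" using ennreal_le_iff[OF b] by blast
qed

text \<open>
  The approximating profiles \<open>\<omega>\<close> yield test functions with gradient \<open>- \<omega>(|x|) x / |x|\<close>; the
  gradients converge by choice of \<open>\<omega>\<close> and the functions by \<open>radial_poincare\<close>. The origin is excluded
  in the formula for \<open>v\<close> because the integral may diverge there.
\<close>

lemma radial_function_in_H12_0:
  fixes e :: "real \<Rightarrow> real" and v :: "'a::euclidean_space \<Rightarrow> real"
  assumes e[measurable]: "e \<in> borel_measurable borel" and supp: "\<And>r. r \<notin> {0<..R0} \<Longrightarrow> e r = 0"
    and R: "0 \<le> R0" "R0 < R"
    and fin: "(\<integral>\<^sup>+x. ennreal ((e (norm x))\<^sup>2) \<partial>(lborel :: 'a measure)) < \<infinity>"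
    and v: "\<And>x. x \<in> ball 0 R \<Longrightarrow> x \<noteq> 0 \<Longrightarrow> v x = (\<integral>r. indicator {norm x<..R} r * e r \<partial>lborel)"
  shows "v \<in> H12_0 (ball 0 R)" "dirichlet_integral (ball 0 R) v = (\<integral>x. (e (norm x))\<^sup>2 \<partial>(lborel :: 'a measure))"
proof -
  let ?L = "lborel :: 'a measure"
  have R0: "R > 0" using R by simp
  define W where "W x = (\<integral>r. indicator {norm x<..R} r * e r \<partial>lborel)" for x :: 'a
  have [measurable]: "W \<in> borel_measurable borel"
  proof -
    have "(\<lambda>x::'a. \<integral>r. indicator {(x, r). norm x < r \<and> r \<le> R} (x, r) * e r \<partial>lborel) \<in> borel_measurable borel"
      by measurable
    also have "(\<lambda>x::'a. \<integral>r. indicator {(x, r). norm x < r \<and> r \<le> R} (x, r) * e r \<partial>lborel) = W"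
      unfolding W_def by (intro ext Bochner_Integration.integral_cong) (auto simp: indicator_def)
    finally show ?thesis .
  qed
  define w where "w x = (if x \<in> ball 0 R then (if x \<in> {0} then v 0 else W x) else 0)" for x
  have wm[measurable]: "w \<in> borel_measurable borel" unfolding w_def by (intro measurable_If_set) auto
  have w0: "w x = 0" if "x \<notin> ball 0 R" for x using that by (simp add: w_def)
  have vw: "v x = w x" if "x \<in> ball 0 R" for x using that v[OF that] by (auto simp: w_def W_def)
  define G where "G x = - (e (norm x) / norm x) *\<^sub>R x" for x :: 'a
  have Gm[measurable]: "G \<in> borel_measurable borel" unfolding G_def by measurable
  have nG: "norm (G x) = \<bar>e (norm x)\<bar>" for x
    using supp[of 0] by (cases "x = 0") (auto simp: G_def)
  have sG: "sqint lborel (\<lambda>x. norm (G x))"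
  proof -
    have "integrable lborel (\<lambda>x::'a. (e (norm x))\<^sup>2)"
      by (rule integrableI_bounded) (use fin in auto)
    then show ?thesis by (simp add: sqint_def nG)
  qed
  have G0: "G x = 0" if "x \<notin> ball 0 R" for x
    using that supp[of "norm x"] R by (simp add: G_def)
  have approx: "\<exists>\<phi>. test_function (ball 0 R) \<phi> \<and> (\<integral>\<^sup>+x. ennreal ((w x - \<phi> x)\<^sup>2) \<partial>lborel) \<le> ennreal \<eta> \<and>
      (\<integral>\<^sup>+x. ennreal ((norm (G x - gradient \<phi> x))\<^sup>2) \<partial>lborel) \<le> ennreal \<eta>" if \<eta>: "\<eta> > 0" for \<eta>
  proof -
    define \<eta>' where "\<eta>' = \<eta> / (1 + R\<^sup>2)"
    have RR: "1 + R\<^sup>2 > 0" by (simp add: add_pos_nonneg)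
    have \<eta>': "\<eta>' > 0" "R\<^sup>2 * \<eta>' \<le> \<eta>" "\<eta>' \<le> \<eta>"
      using \<eta> RR by (auto simp: \<eta>'_def field_simps)
    obtain \<omega> \<delta> R' where \<omega>: "\<And>k. Ck_fun k \<omega>" "0 < \<delta>" "R' < R" "0 < R'" "\<And>r. r < \<delta> \<Longrightarrow> \<omega> r = 0"
        "\<And>r. r > R' \<Longrightarrow> \<omega> r = (0::real)"
      and \<omega>2: "(\<integral>\<^sup>+x. ennreal ((e (norm x) - \<omega> (norm x))\<^sup>2) \<partial>?L) \<le> ennreal \<eta>'"
      using radial_smooth_approx[OF e supp R fin \<eta>'(1)] by blast
    obtain \<phi> :: "'a \<Rightarrow> real" where \<phi>: "test_function (ball 0 R) \<phi>" "\<And>x. gradient \<phi> x = - (\<omega> (norm x) / norm x) *\<^sub>R x"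
      "\<And>x. norm x \<le> R \<Longrightarrow> \<phi> x = (\<integral>r. indicator {norm x..R} r * \<omega> r \<partial>lborel)"
      using radial_test_function[OF \<omega>(1-6)] by blast
    have z\<omega>: "\<omega> x = 0" if "x \<notin> {\<delta>..R'}" for x using that \<omega>(5,6)[of x] by auto
    note s\<omega> = continuous_compact_support_sqint[OF Ck_fun_continuous[OF \<omega>(1)[of 0]] compact_Icc z\<omega>]
    have [measurable]: "\<omega> \<in> borel_measurable borel" by (rule s\<omega>(1))
    have "(\<integral>\<^sup>+x. ennreal ((norm (G x - gradient \<phi> x))\<^sup>2) \<partial>lborel) = (\<integral>\<^sup>+x. ennreal ((e (norm x) - \<omega> (norm x))\<^sup>2) \<partial>?L)"
    proof (rule nn_integral_cong)
      fix x :: 'a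
      show "ennreal ((norm (G x - gradient \<phi> x))\<^sup>2) = ennreal ((e (norm x) - \<omega> (norm x))\<^sup>2)"
      proof (cases "x = 0")
        case True
        then show ?thesis using supp[of 0] \<omega>(5)[OF \<omega>(2)] \<omega>(5)[of 0] \<omega>(2) by (simp add: G_def \<phi>(2))
      next
        case False
        have "G x - gradient \<phi> x = - ((e (norm x) - \<omega> (norm x)) / norm x) *\<^sub>R x"
          by (simp add: G_def \<phi>(2) diff_divide_distrib scaleR_left_diff_distrib algebra_simps)
        then have "norm (G x - gradient \<phi> x) = \<bar>e (norm x) - \<omega> (norm x)\<bar>" using False by simp
        then show ?thesis by simp
      qed
    qed
    then have 2: "(\<integral>\<^sup>+x. ennreal ((norm (G x - gradient \<phi> x))\<^sup>2) \<partial>lborel) \<le> ennreal \<eta>"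
      using \<omega>2 \<eta>'(3) by (simp add: order_trans ennreal_leI)
    let ?d = "\<lambda>r. \<bar>e r - \<omega> r\<bar>"
    have "(\<integral>\<^sup>+x. ennreal ((w x - \<phi> x)\<^sup>2) \<partial>lborel) \<le>
        (\<integral>\<^sup>+x. (\<integral>\<^sup>+r. ennreal (?d r) * indicator {norm x<..R} r \<partial>lborel)\<^sup>2 \<partial>?L)"
    proof (rule nn_integral_mono_AE)
      have "AE x in ?L. x \<noteq> 0" by (rule AE_lborel_singleton)
      then show "AE x in ?L. ennreal ((w x - \<phi> x)\<^sup>2) \<le> (\<integral>\<^sup>+r. ennreal (?d r) * indicator {norm x<..R} r \<partial>lborel)\<^sup>2"
      proof eventually_elim
        case (elim x)
        show ?case
        proof (cases "x \<in> ball 0 R")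
          case False
          then show ?thesis using w0[OF False] test_function_facts(5)[OF \<phi>(1) False] by simp
        next
          case True
          have x: "norm x > 0" "norm x \<le> R" using elim True by auto
          have ie: "integrable lborel (\<lambda>r. indicator {norm x<..R} r * e r)"
            by (rule radial_tail_integrable[OF e fin x(1)])
          have i\<omega>: "integrable lborel (\<lambda>r. indicator {norm x<..R} r * \<omega> r)"
            using integrable_mult_indicator[OF _ s\<omega>(2), of "{norm x<..R}"] by simp
          have "\<phi> x = (\<integral>r. indicator {norm x<..R} r * \<omega> r \<partial>lborel)"
            unfolding \<phi>(3)[OF x(2)]
          proof (rule integral_cong_AE)
            have "AE r in lborel. r \<noteq> norm x" by (rule AE_lborel_singleton)
            then show "AE r in lborel. indicator {norm x..R} r * \<omega> r = indicator {norm x<..R} r * \<omega> r"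
              by eventually_elim (auto simp: indicator_def)
          qed measurable
          then have eq: "w x - \<phi> x = (\<integral>r. indicator {norm x<..R} r * (e r - \<omega> r) \<partial>lborel)"
            using True elim ie i\<omega> by (simp add: w_def W_def right_diff_distrib)
          have id: "integrable lborel (\<lambda>r. indicator {norm x<..R} r * (e r - \<omega> r))"
            using ie i\<omega> by (simp add: right_diff_distrib)
          have "ennreal \<bar>w x - \<phi> x\<bar> \<le> (\<integral>\<^sup>+r. ennreal \<bar>indicator {norm x<..R} r * (e r - \<omega> r)\<bar> \<partial>lborel)"
            unfolding eq using integral_norm_bound_ennreal[OF id] by simp
          also have "\<dots> = (\<integral>\<^sup>+r. ennreal (?d r) * indicator {norm x<..R} r \<partial>lborel)"
            by (intro nn_integral_cong) (auto simp: indicator_def)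
          finally have le: "ennreal \<bar>w x - \<phi> x\<bar> \<le> \<dots>" .
          have "ennreal ((w x - \<phi> x)\<^sup>2) = (ennreal \<bar>w x - \<phi> x\<bar>)\<^sup>2" by (simp add: ennreal_power)
          also have "\<dots> \<le> (\<integral>\<^sup>+r. ennreal (?d r) * indicator {norm x<..R} r \<partial>lborel)\<^sup>2"
            by (rule power_mono[OF le]) simp
          finally show ?thesis .
        qed
      qed
    qed
    also have "\<dots> \<le> ennreal (R\<^sup>2) * (\<integral>\<^sup>+x. ennreal ((?d (norm x))\<^sup>2) \<partial>?L)"
      by (rule radial_poincare[OF _ _ R0]) auto
    also have "\<dots> = ennreal (R\<^sup>2) * (\<integral>\<^sup>+x. ennreal ((e (norm x) - \<omega> (norm x))\<^sup>2) \<partial>?L)" by simp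
    also have "\<dots> \<le> ennreal (R\<^sup>2) * ennreal \<eta>'" by (intro mult_left_mono \<omega>2) simp
    also have "\<dots> = ennreal (R\<^sup>2 * \<eta>')" using \<eta>'(1) by (intro ennreal_mult[symmetric]) auto
    also have "\<dots> \<le> ennreal \<eta>" by (rule ennreal_leI[OF \<eta>'(2)])
    finally show ?thesis using \<phi>(1) 2 by blast
  qed
  have sw: "sqint lborel w"
  proof -
    obtain \<phi> where \<phi>: "test_function (ball 0 R) \<phi>" "(\<integral>\<^sup>+x. ennreal ((w x - \<phi> x)\<^sup>2) \<partial>lborel) \<le> ennreal 1"
      using approx[of 1] by auto
    have p: "sqint lborel \<phi>" by (rule test_function_facts(1)[OF \<phi>(1)])
    have [measurable]: "\<phi> \<in> borel_measurable borel" using sqintD(1)[OF p] by simp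
    have "integrable lborel (\<lambda>x. (w x - \<phi> x)\<^sup>2)"
      by (rule integral_le_of_nn_integral_le(1)[OF _ _ \<phi>(2)]) auto
    then have "sqint lborel (\<lambda>x. w x - \<phi> x)" by (simp add: sqint_def)
    from sqint_add[OF this p] show ?thesis by simp
  qed
  have approx': "\<exists>\<phi>. test_function (ball 0 R) \<phi> \<and> (\<integral>x. (w x - \<phi> x)\<^sup>2 \<partial>lborel) \<le> \<eta> \<and>
      (\<integral>x. (norm (G x - gradient \<phi> x))\<^sup>2 \<partial>lborel) \<le> \<eta>"
    if \<eta>: "\<eta> > 0" for \<eta>
  proof -
    obtain \<phi> where \<phi>: "test_function (ball 0 R) \<phi>" "(\<integral>\<^sup>+x. ennreal ((w x - \<phi> x)\<^sup>2) \<partial>lborel) \<le> ennreal \<eta>"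
      "(\<integral>\<^sup>+x. ennreal ((norm (G x - gradient \<phi> x))\<^sup>2) \<partial>lborel) \<le> ennreal \<eta>"
      using approx[OF \<eta>] by blast
    have [measurable]: "\<phi> \<in> borel_measurable borel" "gradient \<phi> \<in> borel_measurable borel"
      using sqintD(1)[OF test_function_facts(1)[OF \<phi>(1)]] test_function_facts(3)[OF \<phi>(1)] by auto
    have "(\<integral>x. (w x - \<phi> x)\<^sup>2 \<partial>lborel) \<le> \<eta>"
      by (rule integral_le_of_nn_integral_le(2)[OF _ _ \<phi>(2)]) (use \<eta> in auto)
    moreover have "(\<integral>x. (norm (G x - gradient \<phi> x))\<^sup>2 \<partial>lborel) \<le> \<eta>"
      by (rule integral_le_of_nn_integral_le(2)[OF _ _ \<phi>(3)]) (use \<eta> in auto)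
    ultimately show ?thesis using \<phi>(1) by blast
  qed
  note H = H12_0_by_approximation[OF open_ball bounded_ball sw w0 vw Gm sG G0 approx']
  show "v \<in> H12_0 (ball 0 R)" by (rule H(1))
  have "dirichlet_integral (ball 0 R) v = (\<integral>x. (norm (G x))\<^sup>2 \<partial>lborel)" by (rule H(2))
  then show "dirichlet_integral (ball 0 R) v = (\<integral>x. (e (norm x))\<^sup>2 \<partial>(lborel :: 'a measure))" by (simp add: nG)
qed

section \<open>The Schwarz symmetrization\<close>

lemma borel_version_real:
  fixes f :: "'a::euclidean_space \<Rightarrow> real"
  assumes \<Omega>: "\<Omega> \<in> sets borel" and f: "f \<in> borel_measurable (lebesgue_on \<Omega>)"
  obtains f' where "f' \<in> borel_measurable borel" "\<And>x. x \<notin> \<Omega> \<Longrightarrow> f' x = 0" "AE x in lebesgue_on \<Omega>. f x = f' x"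
proof -
  have i: "\<Omega> \<inter> space lebesgue \<in> sets lebesgue" using \<Omega> by simp
  have "(\<lambda>x. indicator \<Omega> x *\<^sub>R f x) \<in> borel_measurable lebesgue"
    using f borel_measurable_restrict_space_iff[OF i, of f] by simp
  then obtain h where h: "h \<in> borel_measurable lborel" "AE x in lborel. indicator \<Omega> x *\<^sub>R f x = h x"
    using completion_ex_borel_measurable_real[of "\<lambda>x. indicator \<Omega> x *\<^sub>R f x" lborel] by blast
  have AE: "AE x in lebesgue. indicator \<Omega> x *\<^sub>R f x = h x" by (rule AE_completion[OF h(2)])
  show ?thesis
  proof (rule that[of "\<lambda>x. indicator \<Omega> x * h x"])
    show "(\<lambda>x. indicator \<Omega> x * h x) \<in> borel_measurable borel" using h(1) \<Omega> by simp
    show "AE x in lebesgue_on \<Omega>. f x = indicator \<Omega> x * h x"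
      unfolding AE_restrict_space_iff[OF i] using AE by eventually_elim (auto simp: indicator_def)
  qed simp
qed

lemma borel_version:
  fixes f :: "'a::euclidean_space \<Rightarrow> 'b::euclidean_space"
  assumes \<Omega>: "\<Omega> \<in> sets borel" and f: "f \<in> borel_measurable (lebesgue_on \<Omega>)"
  obtains f' where "f' \<in> borel_measurable borel" "\<And>x. x \<notin> \<Omega> \<Longrightarrow> f' x = 0" "AE x in lebesgue_on \<Omega>. f x = f' x"
proof -
  have "\<exists>h. h \<in> borel_measurable borel \<and> (\<forall>x. x \<notin> \<Omega> \<longrightarrow> h x = 0) \<and> (AE x in lebesgue_on \<Omega>. f x \<bullet> i = h x)" for i
  proof -
    have "(\<lambda>x. f x \<bullet> i) \<in> borel_measurable (lebesgue_on \<Omega>)" using f by measurable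
    then show ?thesis using borel_version_real[OF \<Omega>, of "\<lambda>x. f x \<bullet> i"] by blast
  qed
  then have "\<forall>i. \<exists>h. h \<in> borel_measurable borel \<and> (\<forall>x. x \<notin> \<Omega> \<longrightarrow> h x = 0) \<and> (AE x in lebesgue_on \<Omega>. f x \<bullet> i = h x)"
    by (rule allI)
  from choice[OF this] obtain h where
    "\<forall>i. h i \<in> borel_measurable borel \<and> (\<forall>x. x \<notin> \<Omega> \<longrightarrow> h i x = 0) \<and> (AE x in lebesgue_on \<Omega>. f x \<bullet> i = h i x)"
    by (elim exE)
  then have h: "\<And>i. h i \<in> borel_measurable borel" "\<And>i x. x \<notin> \<Omega> \<Longrightarrow> h i x = 0"
      "\<And>i. AE x in lebesgue_on \<Omega>. f x \<bullet> i = h i x"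
    by simp_all
  show ?thesis
  proof (rule that[of "\<lambda>x. \<Sum>i\<in>Basis. h i x *\<^sub>R i"])
    show "(\<lambda>x. \<Sum>i\<in>Basis. h i x *\<^sub>R i) \<in> borel_measurable borel" using h(1) by measurable
    show "(\<Sum>i\<in>Basis. h i x *\<^sub>R i) = 0" if "x \<notin> \<Omega>" for x using h(2)[OF that] by simp
    have "AE x in lebesgue_on \<Omega>. \<forall>i\<in>Basis. f x \<bullet> i = h i x"
      using h(3) by (intro AE_finite_allI) auto
    then show "AE x in lebesgue_on \<Omega>. f x = (\<Sum>i\<in>Basis. h i x *\<^sub>R i)"
    proof eventually_elim
      case (elim x)
      have "f x = (\<Sum>i\<in>Basis. (f x \<bullet> i) *\<^sub>R i)" by (rule euclidean_representation[symmetric])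
      then show ?case using elim by simp
    qed
  qed
qed

text \<open>
  The union in the definition of the support may be taken over countably many open sets, by the
  Lindelof property.
\<close>

lemma nonzero_in_ae_support:
  fixes u :: "'a::euclidean_space \<Rightarrow> real"
  assumes \<Omega>: "open \<Omega>"
  shows "ae_support \<Omega> u \<in> sets borel" "AE x in lebesgue. x \<in> \<Omega> \<longrightarrow> u x \<noteq> 0 \<longrightarrow> x \<in> ae_support \<Omega> u"
proof -
  let ?F = "{U. open U \<and> U \<subseteq> \<Omega> \<and> (AE x in lebesgue_on U. u x = 0)}"
  have "open (\<Union>?F)" by (intro open_Union) auto
  then show "ae_support \<Omega> u \<in> sets borel" using \<Omega> by (simp add: ae_support_def)
  obtain F where F: "F \<subseteq> ?F" "countable F" "\<Union>F = \<Union>?F"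
    using Lindelof[of ?F] by blast
  have "AE x in lebesgue. \<forall>U\<in>F. x \<in> U \<longrightarrow> u x = 0"
  proof (subst AE_ball_countable[OF F(2)], intro ballI)
    fix U assume "U \<in> F"
    then have U: "open U" "AE x in lebesgue_on U. u x = 0" using F(1) by auto
    have i: "U \<inter> space lebesgue \<in> sets lebesgue" using U(1) by simp
    show "AE x in lebesgue. x \<in> U \<longrightarrow> u x = 0" using U(2) unfolding AE_restrict_space_iff[OF i] .
  qed
  then show "AE x in lebesgue. x \<in> \<Omega> \<longrightarrow> u x \<noteq> 0 \<longrightarrow> x \<in> ae_support \<Omega> u"
  proof eventually_elim
    case (elim x)
    then have "x \<notin> \<Union>?F" if "u x \<noteq> 0" using that F(3) by blast
    then show ?case by (auto simp: ae_support_def)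
  qed
qed

context isoperimetric_function
begin

text \<open>
  As \<open>rad\<close> is antitone, \<open>{\<tau>. 0 < \<tau> \<and> r < rad \<tau>}\<close> is an interval with left end point \<open>0\<close>. Its length
  \<open>I\<close> is the infimum of the levels \<open>t \<ge> 0\<close> with \<open>rad t \<le> r\<close>.
\<close>

lemma rearrangement_value:
  assumes r: "r > 0" and I: "emeasure lborel {\<tau>. 0 < \<tau> \<and> r < rad \<tau>} = ennreal I" "I \<ge> 0"
    and F: "\<And>t. F t \<le> unit_ball_vol (real DIM('a)) * r ^ DIM('a) \<longleftrightarrow> 0 \<le> t \<and> lev t \<le>
        unit_ball_vol (real DIM('a)) * r ^ DIM('a)"
  shows "Inf {ereal t | t. F t \<le> unit_ball_vol (real DIM('a)) * r ^ DIM('a)} = ereal I"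
proof -
  let ?T = "{\<tau>. 0 < \<tau> \<and> r < rad \<tau>}"
  let ?A = "{ereal t | t. F t \<le> unit_ball_vol (real DIM('a)) * r ^ DIM('a)}"
  have A: "F t \<le> unit_ball_vol (real DIM('a)) * r ^ DIM('a) \<longleftrightarrow> 0 \<le> t \<and> rad t \<le> r" for t
    using F[of t] rad_le_iff[of r t] r by simp
  have Tm: "?T \<in> sets lborel" by measurable
  have T_le: "\<tau> \<le> I" if "\<tau> \<in> ?T" for \<tau>
  proof -
    have "{0<..\<tau>} \<subseteq> ?T"
    proof
      fix s assume s: "s \<in> {0<..\<tau>}"
      then have "rad \<tau> \<le> rad s" by (intro rad_antimono) auto
      then show "s \<in> ?T" using that s by auto
    qed
    then have "emeasure lborel {0<..\<tau>} \<le> emeasure lborel ?T" by (rule emeasure_mono[OF _ Tm])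
    then have "ennreal \<tau> \<le> ennreal I" using that I by simp
    then show ?thesis using I(2) by (simp add: ennreal_le_iff)
  qed
  show ?thesis
  proof (rule antisym)
    show "ereal I \<le> Inf ?A"
    proof (rule Inf_greatest)
      fix y assume "y \<in> ?A"
      then obtain t where t: "y = ereal t" "0 \<le> t" "rad t \<le> r" using A by auto
      have "?T \<subseteq> {0<..t}"
      proof
        fix s assume s: "s \<in> ?T"
        show "s \<in> {0<..t}"
        proof (rule ccontr)
          assume "s \<notin> {0<..t}"
          then have "t \<le> s" using s by auto
          then have "rad s \<le> rad t" by (rule rad_antimono)
          then show False using s t by auto
        qed
      qed
      then have "emeasure lborel ?T \<le> emeasure lborel {0<..t}" by (intro emeasure_mono) auto
      then have "ennreal I \<le> ennreal t" using t(2) I by simp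
      then show "ereal I \<le> y" using t(1,2) by (simp add: ennreal_le_iff)
    qed
    show "Inf ?A \<le> ereal I"
    proof (rule ereal_le_epsilon2)
      fix e :: real assume e: "0 < e"
      have "I + e \<notin> ?T" using T_le[of "I + e"] e by auto
      then have "F (I + e) \<le> unit_ball_vol (real DIM('a)) * r ^ DIM('a)" using A[of "I + e"] e I(2) by auto
      then have "Inf ?A \<le> ereal (I + e)" by (intro Inf_lower) auto
      then show "Inf ?A \<le> ereal I + ereal e" by simp
    qed
  qed
qed

end

lemma ereal_le_of_mult_le:
  assumes "Q > 0" "ereal b \<le> ereal Q * P"
  shows "ereal (b / Q) \<le> P"
proof (cases P)
  case (real r)
  then have "b \<le> Q * r" using assms(2) by simp
  then show ?thesis using assms(1) real by (simp add: field_simps)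
qed (use assms in auto)

theorem theorem1p2:
  fixes \<Omega> :: "'a::euclidean_space set" and u :: "'a \<Rightarrow> real" and Q \<epsilon> \<alpha> L n :: real
  assumes "DIM('a) \<ge> 2" and n: "n = real DIM('a)"
    and "bounded_lipschitz_domain \<Omega>"
    and "Q > 0"
    and "\<And>E. E \<in> sets lebesgue \<Longrightarrow> E \<subseteq> \<Omega> \<Longrightarrow>
           ereal Q * perimeter \<Omega> E
             \<ge> ereal (min (measure lebesgue E) (measure lebesgue (\<Omega> - E)) powr (1 - 1 / n))"
    and "u \<in> H12 \<Omega>"
    and "AE x in lebesgue_on \<Omega>. u x \<ge> 0"
    and "\<epsilon> > 0"
    and "measure lebesgue (ae_support \<Omega> u) = measure lebesgue \<Omega> - \<epsilon>"
    and \<alpha>: "\<alpha> = (if \<epsilon> \<le> measure lebesgue \<Omega> / 2 then \<epsilon> / (measure lebesgue \<Omega> - \<epsilon>) else 1)"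
    and L: "L = Q * n * unit_ball_vol n powr (1 / n) / \<alpha> powr (1 - 1 / n)"
  shows "schwarz_symmetrization \<Omega> u \<in> H12_0 (symmetrized_domain \<Omega>) \<and>
         dirichlet_integral (symmetrized_domain \<Omega>) (schwarz_symmetrization \<Omega> u)
           \<le> L\<^sup>2 * dirichlet_integral \<Omega> u"
proof -
  have \<Omega>: "open \<Omega>" "bounded \<Omega>" "\<Omega> \<noteq> {}" using assms(3) by (auto simp: bounded_lipschitz_domain_def)
  have \<Omega>b: "\<Omega> \<in> sets borel" using \<Omega>(1) by simp
  have \<Omega>l: "\<Omega> \<in> sets lebesgue" using \<Omega>b by simp
  have i: "\<Omega> \<inter> space lebesgue \<in> sets lebesgue" using \<Omega>b by simp
  let ?m = "measure lebesgue \<Omega>" and ?v = "unit_ball_vol (real DIM('a))"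
  have v: "?v > 0" by (rule unit_ball_vol_pos) simp
  then have v0: "?v \<noteq> 0" by linarith
  have fm: "A \<in> fmeasurable lebesgue" if "A \<in> sets lebesgue" "A \<subseteq> \<Omega>" for A
    using that bounded_subset[OF \<Omega>(2)] by (intro bounded_set_imp_lmeasurable) auto
  obtain g where u2: "u \<in> borel_measurable (lebesgue_on \<Omega>)" "integrable (lebesgue_on \<Omega>) (\<lambda>x. (u x)\<^sup>2)"
    and g2: "g \<in> borel_measurable (lebesgue_on \<Omega>)" "integrable (lebesgue_on \<Omega>) (\<lambda>x. (norm (g x))\<^sup>2)"
    and wg: "has_weak_gradient \<Omega> u g"
    using assms(6) unfolding H12_def L2_on_def by auto
  obtain u1 where u1: "u1 \<in> borel_measurable borel" "\<And>x. x \<notin> \<Omega> \<Longrightarrow> u1 x = 0" "AE x in lebesgue_on \<Omega>. u x = u1 x"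
    using borel_version_real[OF \<Omega>b u2(1)] by blast
  \<comment> \<open>Borel representatives that vanish outside \<open>\<Omega>\<close>; the function is made nonnegative everywhere.\<close>
  define u0 where "u0 x = max 0 (u1 x)" for x
  have u0m[measurable]: "u0 \<in> borel_measurable borel" using u1(1) unfolding u0_def by measurable
  have u0z: "u0 x = 0" if "x \<notin> \<Omega>" for x using u1(2)[OF that] by (simp add: u0_def)
  have u0nn: "u0 x \<ge> 0" for x by (simp add: u0_def)
  have uu0: "AE x in lebesgue_on \<Omega>. u x = u0 x"
    using u1(3) assms(7) by eventually_elim (simp add: u0_def)
  obtain g0 where g0m[measurable]: "g0 \<in> borel_measurable borel" and g0z: "\<And>x. x \<notin> \<Omega> \<Longrightarrow> g0 x = 0"
      and gg0: "AE x in lebesgue_on \<Omega>. g x = g0 x"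
    using borel_version[OF \<Omega>b g2(1)] by blast
  have restr: "h \<in> borel_measurable borel \<Longrightarrow> h \<in> borel_measurable (lebesgue_on \<Omega>)" for h :: "'a \<Rightarrow> real"
    by (intro measurable_restrict_space1 measurable_completion) simp
  have su0: "sqint lborel u0"
  proof -
    have "integrable (lebesgue_on \<Omega>) (\<lambda>x. (u0 x)\<^sup>2)"
      by (rule integrable_cong_AE_imp[OF u2(2)]) (use uu0 in \<open>auto intro!: restr\<close>)
    then have "integrable lborel (\<lambda>x. (u0 x)\<^sup>2)"
      by (subst (asm) integral_lebesgue_on_eq_lborel(2)[OF \<Omega>b]) (use u0z in auto)
    then show ?thesis by (simp add: sqint_def)
  qed
  have ig0: "integrable lborel (\<lambda>x. (norm (g0 x))\<^sup>2)"
  proof -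
    have "integrable (lebesgue_on \<Omega>) (\<lambda>x. (norm (g0 x))\<^sup>2)"
      by (rule integrable_cong_AE_imp[OF g2(2)]) (use gg0 in \<open>auto intro!: restr\<close>)
    then show ?thesis
      by (subst (asm) integral_lebesgue_on_eq_lborel(2)[OF \<Omega>b]) (use g0z in auto)
  qed
  have weak: "weak_partial \<Omega> i u0 (\<lambda>x. g0 x \<bullet> i)" if i: "i \<in> Basis" for i
    unfolding weak_partial_def
  proof (intro allI impI)
    fix \<phi> assume \<phi>: "test_function \<Omega> \<phi>"
    note p = test_function_facts[OF \<phi>]
    have [measurable]: "\<phi> \<in> borel_measurable borel" "(\<lambda>x. frechet_derivative \<phi> (at x) i) \<in> borel_measurable borel"
      using sqintD(1)[OF p(1)] sqintD(1)[OF p(4)[OF i]] by auto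
    have "(\<integral>x. u0 x * frechet_derivative \<phi> (at x) i \<partial>lborel) =
        (\<integral>x. u0 x * frechet_derivative \<phi> (at x) i \<partial>lebesgue_on \<Omega>)"
      by (rule integral_lebesgue_on_eq_lborel(1)[OF \<Omega>b, symmetric]) (use u0z in auto)
    also have "\<dots> = (\<integral>x. u x * frechet_derivative \<phi> (at x) i \<partial>lebesgue_on \<Omega>)"
      by (rule integral_lebesgue_on_AE(2)[OF \<Omega>l _, symmetric]) (use uu0 in \<open>auto intro!: restr\<close>)
    also have "\<dots> = - (\<integral>x. (g x \<bullet> i) * \<phi> x \<partial>lebesgue_on \<Omega>)"
      using wg \<phi> i unfolding has_weak_gradient_def by blast
    also have "(\<integral>x. (g x \<bullet> i) * \<phi> x \<partial>lebesgue_on \<Omega>) = (\<integral>x. (g0 x \<bullet> i) * \<phi> x \<partial>lebesgue_on \<Omega>)"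
      by (rule integral_lebesgue_on_AE(2)[OF \<Omega>l]) (use gg0 in \<open>auto intro!: restr\<close>)
    also have "\<dots> = (\<integral>x. (g0 x \<bullet> i) * \<phi> x \<partial>lborel)"
      by (rule integral_lebesgue_on_eq_lborel(1)[OF \<Omega>b]) (use g0z in auto)
    finally show "(\<integral>x. u0 x * frechet_derivative \<phi> (at x) i \<partial>lborel) = - (\<integral>x. (g0 x \<bullet> i) * \<phi> x \<partial>lborel)" .
  qed
  have uu0': "AE x in lebesgue. x \<in> \<Omega> \<longrightarrow> u x = u0 x" using uu0 unfolding AE_restrict_space_iff[OF i] .
  have dist: "distribution_function \<Omega> u t = measure lborel {x \<in> \<Omega>. u0 x > t}" for t
  proof -
    have m0: "{x \<in> \<Omega>. u0 x > t} \<in> sets borel" using \<Omega>b by measurable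
    have "{x \<in> space (lebesgue_on \<Omega>). u x > t} \<in> sets (lebesgue_on \<Omega>)" using u2(1) by measurable
    then have mu: "{x \<in> \<Omega>. u x > t} \<in> sets lebesgue"
      using sets_restrict_space_iff[OF i] by (simp add: space_restrict_space)
    have "distribution_function \<Omega> u t = measure lebesgue {x \<in> \<Omega>. u0 x > t}"
      unfolding distribution_function_def
    proof (rule measure_eq_AE)
      show "AE x in lebesgue. x \<in> {x \<in> \<Omega>. u x > t} \<longleftrightarrow> x \<in> {x \<in> \<Omega>. u0 x > t}"
        using uu0' by eventually_elim auto
    qed (use mu m0 in auto)
    then show ?thesis using m0 by simp
  qed
  have S: "measure lebesgue (ae_support \<Omega> u) = ?m - \<epsilon>" by (rule assms(9))
  have me: "?m - \<epsilon> \<ge> 0" unfolding S[symmetric] by simp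
  have level_le: "measure lborel {x \<in> \<Omega>. u0 x > t} \<le> ?m - \<epsilon>" if t: "t \<ge> 0" for t
  proof -
    have m0: "{x \<in> \<Omega>. u0 x > t} \<in> sets borel" using \<Omega>b by measurable
    have sb: "ae_support \<Omega> u \<in> sets borel" by (rule nonzero_in_ae_support(1)[OF \<Omega>(1)])
    have "emeasure lebesgue {x \<in> \<Omega>. u0 x > t} \<le> emeasure lebesgue (ae_support \<Omega> u)"
    proof (rule emeasure_mono_AE)
      show "AE x in lebesgue. x \<in> {x \<in> \<Omega>. u0 x > t} \<longrightarrow> x \<in> ae_support \<Omega> u"
        using nonzero_in_ae_support(2)[OF \<Omega>(1), of u] uu0' by eventually_elim (use t in auto)
    qed (use sb in simp)
    moreover have "ae_support \<Omega> u \<in> fmeasurable lebesgue"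
      by (rule fm) (use sb in \<open>auto simp: ae_support_def\<close>)
    ultimately have "measure lebesgue {x \<in> \<Omega>. u0 x > t} \<le> measure lebesgue (ae_support \<Omega> u)"
      unfolding measure_def by (intro enn2real_mono) (auto simp: fmeasurable_def)
    then show ?thesis using m0 S by simp
  qed
  have mpos: "?m > 0"
  proof -
    obtain x r where "r > 0" "ball x r \<subseteq> \<Omega>" using \<Omega>(1,3) by (metis all_not_in_conv open_contains_ball)
    then have "measure lebesgue (ball x r) \<le> ?m" using fm[OF \<Omega>l] by (intro measure_mono_fmeasurable) auto
    moreover have "measure lebesgue (ball x r) > 0" using content_ball_pos[OF \<open>r > 0\<close>, of x] by simp
    ultimately show ?thesis by linarith
  qed
  have \<alpha>0: "\<alpha> > 0" using \<alpha> assms(8) me mpos by (auto simp: field_simps)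
  define p where "p = 1 - 1 / real DIM('a)"
  have p0: "p \<ge> 0" using assms(1) by (simp add: p_def)
  define c where "c = \<alpha> powr p / Q"
  have c0: "c > 0" using \<alpha>0 assms(4) by (simp add: c_def)
  have iso: "ereal (c * measure lborel {x \<in> \<Omega>. u0 x > t} powr p) \<le> perimeter \<Omega> {x. u0 x > t}" if t: "t \<ge> 0" for t
  proof -
    have E: "{x. u0 x > t} = {x \<in> \<Omega>. u0 x > t}" using u0z t by force
    have m0: "{x \<in> \<Omega>. u0 x > t} \<in> sets borel" using \<Omega>b by measurable
    let ?x = "measure lborel {x \<in> \<Omega>. u0 x > t}"
    have x: "measure lebesgue {x \<in> \<Omega>. u0 x > t} = ?x" using m0 by simp
    have dx: "measure lebesgue (\<Omega> - {x \<in> \<Omega>. u0 x > t}) = ?m - ?x"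
      unfolding x[symmetric] using fm[OF \<Omega>l] fm[of "{x \<in> \<Omega>. u0 x > t}"] m0
      by (intro measurable_measure_Diff) auto
    \<comment> \<open>If \<open>\<epsilon> \<le> |\<Omega>| / 2\<close>, then \<open>\<alpha> \<le> 1\<close> and \<open>\<alpha> * ?x \<le> \<alpha> * (?m - \<epsilon>) = \<epsilon> \<le> ?m - ?x\<close>. Otherwise \<open>?x\<close> is
      at most half of \<open>?m\<close>.\<close>
    have min: "\<alpha> * ?x \<le> min ?x (?m - ?x)"
    proof -
      have le: "?x \<le> ?m - \<epsilon>" by (rule level_le[OF t])
      have x0: "?x \<ge> 0" by simp
      show ?thesis
      proof (cases "\<epsilon> \<le> ?m / 2")
        case True
        then have a: "\<alpha> = \<epsilon> / (?m - \<epsilon>)" and pos: "?m - \<epsilon> > 0" using \<alpha> mpos by auto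
        have a1: "\<alpha> \<le> 1" using a pos True by simp
        have "\<alpha> * ?x \<le> ?x" using mult_right_mono[OF a1 x0] by simp
        moreover have "\<alpha> * ?x \<le> \<alpha> * (?m - \<epsilon>)" using le \<alpha>0 by (intro mult_left_mono) auto
        moreover have "\<alpha> * (?m - \<epsilon>) = \<epsilon>" using a pos by simp
        ultimately show ?thesis using le by simp
      next
        case False
        then have "\<alpha> = 1" using \<alpha> by simp
        then show ?thesis using le False by simp
      qed
    qed
    have "ereal ((\<alpha> * ?x) powr p) \<le> ereal (min ?x (?m - ?x) powr p)"
      using min \<alpha>0 p0 by (simp add: powr_mono2)
    also have "\<dots> \<le> ereal Q * perimeter \<Omega> {x \<in> \<Omega>. u0 x > t}"
      using assms(5)[of "{x \<in> \<Omega>. u0 x > t}"] m0 unfolding x dx n p_def by auto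
    finally have "ereal ((\<alpha> * ?x) powr p / Q) \<le> perimeter \<Omega> {x \<in> \<Omega>. u0 x > t}"
      by (rule ereal_le_of_mult_le[OF assms(4)])
    moreover have "(\<alpha> * ?x) powr p / Q = c * ?x powr p"
      using \<alpha>0 by (simp add: c_def powr_mult)
    ultimately show ?thesis by (simp add: E)
  qed
  \<comment> \<open>The radius of the ball with measure \<open>|\<Omega>| - \<epsilon>\<close>.\<close>
  define R0 where "R0 = root DIM('a) ((?m - \<epsilon>) / ?v)"
  have R0: "R0 \<ge> 0" "?v * R0 ^ DIM('a) = ?m - \<epsilon>"
  proof -
    have q: "(?m - \<epsilon>) / ?v \<ge> 0" using me v by simp
    show "R0 \<ge> 0" unfolding R0_def using q by simp
    have "R0 ^ DIM('a) = (?m - \<epsilon>) / ?v" unfolding R0_def using q by (intro real_root_pow_pos2) auto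
    then show "?v * R0 ^ DIM('a) = ?m - \<epsilon>" using v0 by simp
  qed
  interpret isoperimetric_function \<Omega> u0 g0 c R0
  proof unfold_locales
    show "measure lborel {x \<in> \<Omega>. u0 x > 0} \<le> unit_ball_vol (real DIM('a)) * R0 ^ DIM('a)"
      using level_le[of 0] R0(2) by simp
    show "ereal (c * measure lborel {x \<in> \<Omega>. u0 x > t} powr (1 - 1 / real DIM('a))) \<le> perimeter \<Omega> {x. u0 x > t}" if
        "t \<ge> 0" for t
      using iso[OF that] by (simp add: p_def)
  qed (use \<Omega> su0 ig0 weak u0z g0z u0nn c0 R0 assms(1) in auto)
  obtain e where e: "e \<in> borel_measurable borel" "\<And>r. e r \<ge> 0" "\<And>r. r \<notin> {0<..R0} \<Longrightarrow> e r = 0"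
    "(\<integral>\<^sup>+x. ennreal ((e (norm x))\<^sup>2) \<partial>(lborel :: 'a measure)) \<le>
        ennreal ((symmetrization_ratio (real DIM('a)) c)\<^sup>2 * energy)"
    "\<And>s. s > 0 \<Longrightarrow> emeasure lborel {\<tau>. 0 < \<tau> \<and> s < rad \<tau>} = (\<integral>\<^sup>+r. ennreal (e r) * indicator {s<..} r \<partial>lborel)"
    using profile_exists by blast
  have en0: "energy \<ge> 0" by (simp add: energy_def)
  have fin: "(\<integral>\<^sup>+x. ennreal ((e (norm x))\<^sup>2) \<partial>(lborel :: 'a measure)) < \<infinity>"
    using e(4) by (rule le_less_trans) simp
  have ratioL: "symmetrization_ratio (real DIM('a)) c = L"
    unfolding symmetrization_ratio_def L c_def n p_def using assms(4) by (simp add: field_simps)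
  define R1 where "R1 = (?m / ?v) powr (1 / real DIM('a))"
  have dom: "symmetrized_domain \<Omega> = ball 0 R1" by (simp add: symmetrized_domain_def R1_def)
  have R1: "R1 > 0" "?v * R1 ^ DIM('a) = ?m"
  proof -
    have q: "?m / ?v > 0" using mpos v by simp
    show R1: "R1 > 0" using mpos v0 by (simp add: R1_def)
    have "R1 ^ DIM('a) = R1 powr real DIM('a)" by (rule powr_realpow[OF R1, symmetric])
    also have "\<dots> = (?m / ?v) powr (1 / real DIM('a) * real DIM('a))" unfolding R1_def by (rule powr_powr)
    also have "1 / real DIM('a) * real DIM('a) = 1" by simp
    also have "(?m / ?v) powr 1 = ?m / ?v" using q by (intro powr_one) auto
    finally have "R1 ^ DIM('a) = ?m / ?v" .
    then show "?v * R1 ^ DIM('a) = ?m" using v0 by simp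
  qed
  have R01: "R0 < R1"
  proof (rule power_less_imp_less_base[of R0 "DIM('a)" R1])
    have "?v * R0 ^ DIM('a) < ?v * R1 ^ DIM('a)" using R0(2) R1(2) assms(8) by simp
    then show "R0 ^ DIM('a) < R1 ^ DIM('a)" using v by simp
  qed (use R1 in simp)
  have schwarz: "schwarz_symmetrization \<Omega> u x = (\<integral>r. indicator {norm x<..R1} r * e r \<partial>lborel)" if x: "x \<in> ball 0 R1"
      "x \<noteq> 0" for x
  proof -
    let ?r = "norm x"
    have r: "?r > 0" "?r < R1" using x by auto
    let ?I = "\<integral>r. indicator {?r<..R1} r * e r \<partial>lborel"
    have I0: "?I \<ge> 0" by (intro Bochner_Integration.integral_nonneg) (simp add: e(2))
    have "(\<integral>\<^sup>+\<rho>. ennreal (e \<rho>) * indicator {?r<..} \<rho> \<partial>lborel) = (\<integral>\<^sup>+\<rho>. ennreal (indicator {?r<..R1} \<rho> * e \<rho>) \<partial>lborel)"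
      using e(3) R01 by (intro nn_integral_cong) (auto simp: indicator_def)
    also have "\<dots> = ennreal ?I"
      by (rule nn_integral_eq_integral[OF radial_tail_integrable[OF e(1) fin r(1)]]) (simp add: e(2))
    finally have I: "emeasure lborel {\<tau>. 0 < \<tau> \<and> ?r < rad \<tau>} = ennreal ?I" using e(5)[OF r(1)] by simp
    \<comment> \<open>Negative levels do not enter the infimum: there the distribution function is \<open>|\<Omega>|\<close>, which exceeds
      the measure of the ball of radius \<open>?r\<close>.\<close>
    have F: "distribution_function \<Omega> u t \<le> ?v * ?r ^ DIM('a) \<longleftrightarrow> 0 \<le> t \<and> lev t \<le> ?v * ?r ^ DIM('a)" for t
    proof (cases "t \<ge> 0")
      case True
      then show ?thesis by (simp add: dist lev_def)
    next
      case False
      have "{x \<in> \<Omega>. u0 x > t} = \<Omega>" using False u0nn by (auto simp: not_le intro: less_le_trans[of t 0])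
      then have "distribution_function \<Omega> u t = ?m" using \<Omega>b by (simp add: dist)
      moreover have "?v * ?r ^ DIM('a) < ?v * R1 ^ DIM('a)"
        using r v by (intro mult_strict_left_mono power_strict_mono) auto
      ultimately show ?thesis using False R1(2) by simp
    qed
    have "decreasing_rearrangement \<Omega> u (?v * ?r ^ DIM('a)) = ereal ?I"
      unfolding decreasing_rearrangement_def by (rule rearrangement_value[OF r(1) I I0 F])
    then show ?thesis by (simp add: schwarz_symmetrization_def)
  qed
  note H = radial_function_in_H12_0[OF e(1) e(3) R0(1) R01 fin schwarz]
  have dir_u: "dirichlet_integral \<Omega> u = energy"
  proof -
    have AE: "AE x in lebesgue_on \<Omega>. (norm (weak_gradient \<Omega> u x))\<^sup>2 = (norm (g0 x))\<^sup>2"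
      using weak_gradient_AE[OF \<Omega>(1) wg] gg0 by eventually_elim simp
    have "dirichlet_integral \<Omega> u = (\<integral>x. (norm (g0 x))\<^sup>2 \<partial>lebesgue_on \<Omega>)"
      unfolding dirichlet_integral_def by (rule integral_lebesgue_on_AE(2)[OF \<Omega>l _ AE]) (auto intro!: restr)
    also have "\<dots> = energy" unfolding energy_def
      by (rule integral_lebesgue_on_eq_lborel(1)[OF \<Omega>b]) (use g0z in auto)
    finally show ?thesis .
  qed
  have "(\<integral>x. (e (norm x))\<^sup>2 \<partial>(lborel :: 'a measure)) \<le> (symmetrization_ratio (real DIM('a)) c)\<^sup>2 * energy"
    by (rule integral_le_of_nn_integral_le(2)[OF _ _ e(4)]) (use e(1) en0 in auto)
  then show ?thesis using H by (simp add: dom dir_u ratioL)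
qed

end
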